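(* Let $D$ be a ring with one, let $M,L,N$ be left $D$-modules, and let $\eta^M_L\in\mathrm{Ext}^1_D(M,L)$ and $\eta^L_N\in\mathrm{Ext}^1_D(L,N)$. If $\mathrm{ExtMod}(\eta^M_L,\eta^L_N)$ is non-empty, then it is a principal homogeneous space for the abelian group $$\mathrm{Ext}^1(\eta^M_L,\eta^L_N):=\mathrm{Ext}^1_D(M,N)\big/\big(\mathrm{Hom}_D(M,L)\circ\eta^L_N+\eta^M_L\circ\mathrm{Hom}_D(L,N)\big),$$ and hence $$\mathrm{ExtMod}(\eta^M_L,\eta^L_N)\;\cong\;\big((\pi^{G_1})_*\big)^{-1}(\eta^M_L)\big/\big(\eta^M_L\circ\mathrm{Hom}_D(L,N)\big)\;\cong\;\big((\iota_{G_0})^*\big)^{-1}(\eta^L_N)\big/\big(\mathrm{Hom}_D(M,L)\circ\eta^L_N\big).$$ The group $\mathrm{Ext}^1(\eta^M_L,\eta^L_N)$ is called the first extension group of $1$-cocycles.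
   Context: All modules are left $D$-modules. Elements of $\mathrm{Ext}^1_D(A,B)$ ($1$-cocycles) correspond, by the Yoneda equivalence, to congruence classes of short exact sequences $0\leftarrow A\leftarrow G\leftarrow B\leftarrow 0$. Compositions and Yoneda products are written from left to right. For $\varphi\in\mathrm{Hom}_D(M,L)$, $\varphi\circ\eta^L_N\in\mathrm{Ext}^1_D(M,N)$ is the pullback of $\eta^L_N$ along $\varphi$; for $\lambda\in\mathrm{Hom}_D(L,N)$, $\eta^M_L\circ\lambda\in\mathrm{Ext}^1_D(M,N)$ is the pushout of $\eta^M_L$ along $\lambda$. Put $\mathrm{Hom}_D(M,L)\circ\eta^L_N=\{\varphi\circ\eta^L_N\mid\varphi\in\mathrm{Hom}_D(M,L)\}$ and $\eta^M_L\circ\mathrm{Hom}_D(L,N)=\{\eta^M_L\circ\lambda\mid\lambda\in\mathrm{Hom}_D(L,N)\}$. A $2$-extension module is a module $E$ together with a chain of submodules $E=E_0\geq E_1\geq E_2\geq E_3=0$. $\mathrm{ExtMod}(\eta^M_L,\eta^L_N)$ denotes the set of all $2$-extension modules $E$, with subfactors $E_0/E_1$, $E_1/E_2$, $E_2$ the prescribed modules $M$, $L$, $N$, such that $\eta^M_L$ corresponds to $0\leftarrow E_0/E_1\leftarrow E_0/E_2\leftarrow E_1/E_2\leftarrow 0$ and $\eta^L_N$ corresponds to $0\leftarrow E_1/E_2\leftarrow E_1\leftarrow E_2\leftarrow 0$, modulo the following equivalence: $E\approx E'$ if there exists an isomorphism $\alpha:E\to E'$ that induces isomorphisms from $E_i$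 onto $E'_i$ for all $i$. Fix short exact sequences $0\leftarrow M\xleftarrow{\pi^{G_0}}G_0\xleftarrow{\iota_{G_0}}L\leftarrow 0$ corresponding to $\eta^M_L$ and $0\leftarrow L\xleftarrow{\pi^{G_1}}G_1\xleftarrow{\iota_{G_1}}N\leftarrow 0$ corresponding to $\eta^L_N$. They induce maps $(\pi^{G_1})_*:\mathrm{Ext}^1_D(M,G_1)\to\mathrm{Ext}^1_D(M,L)$, $(\iota_{G_1})_*:\mathrm{Ext}^1_D(M,N)\to\mathrm{Ext}^1_D(M,G_1)$, $(\iota_{G_0})^*:\mathrm{Ext}^1_D(G_0,N)\to\mathrm{Ext}^1_D(L,N)$ and $(\pi^{G_0})^*:\mathrm{Ext}^1_D(M,N)\to\mathrm{Ext}^1_D(G_0,N)$. The group $\mathrm{Ext}^1_D(M,N)$ acts on the fiber $((\pi^{G_1})_* )^{-1}(\eta^M_L)$ by $(\eta,\eta^M_{G_1})\mapsto(\iota_{G_1})_*(\eta)+\eta^M_{G_1}$, and on the fiber $((\iota_{G_0})^* )^{-1}(\eta^L_N)$ by $(\eta,\eta^{G_0}_N)\mapsto(\pi^{G_0})^*(\eta)+\eta^{G_0}_N$; the quotients of the fibers in the claim are by these actions restricted to the indicated subgroups. The action on $\mathrm{ExtMod}(\eta^M_L,\eta^L_N)$ comes from the following action of $\mathrm{Ext}^1_D(M,N)$: if $E$ is presented by a block upper triangular relation matrix with diagonal blocks fixed relation matrices of $M,L,N$, with matrices representing $\eta^M_L,\eta^L_N$ on the secondary diagonal and with upper right block $\eta$,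 then a class in $\mathrm{Ext}^1_D(M,N)$ represented by a matrix $\tilde\eta^M_N$ acts by $\eta\mapsto\eta+\tilde\eta^M_N$. A principal homogeneous space for a group is a non-empty set on which the group acts freely and transitively. No statement is made about a natural group structure (a naturally distinguished element) on $\mathrm{ExtMod}(\eta^M_L,\eta^L_N)$.
   Formalization: Equivalence of 2-extension modules is taken to be a filtered isomorphism inducing the identity on the prescribed subfactors M, L, N; with arbitrary filtered isomorphisms the claim fails, e.g. L = 0, M = N = Z/3 (2 classes, but the group has 3 elements). *)

theory Defs
  imports "HOL-Algebra.Module" "HOL-Algebra.AbelCoset" "HOL-Algebra.Group_Action"
begin

section \<open>Left modules over a not necessarily commutative ring\<close>

text \<open>
  The library locale \<^locale>\<open>module\<close> requires a commutative ring.  The axioms below are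
  literally the same, over a ring with one.  The fields \<open>mult\<close> and \<open>one\<close> of the record
  \<open>module\<close> play no role.
\<close>

locale left_module = R?: ring R + M?: abelian_group M
  for R :: "('d, 'z) ring_scheme" (structure) and M :: "('d, 'a, 'y) module_scheme" (structure) +
  assumes smult_closed [simp, intro]:
      "\<lbrakk>a \<in> carrier R; x \<in> carrier M\<rbrakk> \<Longrightarrow> a \<odot>\<^bsub>M\<^esub> x \<in> carrier M"
    and smult_l_distr:
      "\<lbrakk>a \<in> carrier R; b \<in> carrier R; x \<in> carrier M\<rbrakk> \<Longrightarrow>
        (a \<oplus> b) \<odot>\<^bsub>M\<^esub> x = a \<odot>\<^bsub>M\<^esub> x \<oplus>\<^bsub>M\<^esub> b \<odot>\<^bsub>M\<^esub> x"
    and smult_r_distr: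
      "\<lbrakk>a \<in> carrier R; x \<in> carrier M; y \<in> carrier M\<rbrakk> \<Longrightarrow>
        a \<odot>\<^bsub>M\<^esub> (x \<oplus>\<^bsub>M\<^esub> y) = a \<odot>\<^bsub>M\<^esub> x \<oplus>\<^bsub>M\<^esub> a \<odot>\<^bsub>M\<^esub> y"
    and smult_assoc1:
      "\<lbrakk>a \<in> carrier R; b \<in> carrier R; x \<in> carrier M\<rbrakk> \<Longrightarrow>
        (a \<otimes> b) \<odot>\<^bsub>M\<^esub> x = a \<odot>\<^bsub>M\<^esub> (b \<odot>\<^bsub>M\<^esub> x)"
    and smult_one [simp]:
      "x \<in> carrier M \<Longrightarrow> \<one> \<odot>\<^bsub>M\<^esub> x = x"

definition mod_hom :: "('d, 'z) ring_scheme \<Rightarrow> ('d, 'a) module \<Rightarrow> ('d, 'b) module \<Rightarrow> ('a \<Rightarrow> 'b) set"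
  where "mod_hom D A B = {f \<in> carrier A \<rightarrow> carrier B.
    (\<forall>x\<in>carrier A. \<forall>y\<in>carrier A. f (x \<oplus>\<^bsub>A\<^esub> y) = f x \<oplus>\<^bsub>B\<^esub> f y) \<and>
    (\<forall>d\<in>carrier D. \<forall>x\<in>carrier A. f (d \<odot>\<^bsub>A\<^esub> x) = d \<odot>\<^bsub>B\<^esub> f x)}"

definition mod_iso :: "('d, 'z) ring_scheme \<Rightarrow> ('d, 'a) module \<Rightarrow> ('d, 'b) module \<Rightarrow> ('a \<Rightarrow> 'b) set"
  where "mod_iso D A B = {f \<in> mod_hom D A B. bij_betw f (carrier A) (carrier B)}"

definition prod_mod :: "('d, 'a) module \<Rightarrow> ('d, 'b) module \<Rightarrow> ('d, 'a \<times> 'b) module"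
  where "prod_mod A B =
    \<lparr>carrier = carrier A \<times> carrier B, mult = undefined, one = undefined,
     zero = (\<zero>\<^bsub>A\<^esub>, \<zero>\<^bsub>B\<^esub>),
     add = \<lambda>x y. (fst x \<oplus>\<^bsub>A\<^esub> fst y, snd x \<oplus>\<^bsub>B\<^esub> snd y),
     smult = \<lambda>d x. (d \<odot>\<^bsub>A\<^esub> fst x, d \<odot>\<^bsub>B\<^esub> snd x)\<rparr>"

definition quot_mod :: "('d, 'a) module \<Rightarrow> 'a set \<Rightarrow> ('d, 'a set) module"
  where "quot_mod A H =
    \<lparr>carrier = a_rcosets\<^bsub>A\<^esub> H, mult = undefined, one = undefined,
     zero = H,
     add = set_add A,
     smult = \<lambda>d C. (\<Union>c\<in>C. H +>\<^bsub>A\<^esub> (d \<odot>\<^bsub>A\<^esub> c))\<rparr>"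


section \<open>Short exact sequences and the group Ext1\<close>

text \<open>A value of the following type is a diagram \<open>A \<leftarrow> G \<leftarrow> B\<close>, where \<open>G\<close> has elements of type \<open>'g\<close>.\<close>

record ('d, 'a, 'b, 'g) ses =
  mid :: "('d, 'g) module"
  inc :: "'b \<Rightarrow> 'g"
  prj :: "'g \<Rightarrow> 'a"

definition short_exact ::
  "('d, 'z) ring_scheme \<Rightarrow> ('d, 'a) module \<Rightarrow> ('d, 'b) module \<Rightarrow> ('d, 'a, 'b, 'g) ses \<Rightarrow> bool"
  where "short_exact D A B S \<longleftrightarrow>
    left_module D A \<and> left_module D B \<and> left_module D (mid S) \<and>
    inc S \<in> mod_hom D B (mid S) \<and> prj S \<in> mod_hom D (mid S) A \<and>
    inj_on (inc S) (carrier B) \<and>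
    prj S ` carrier (mid S) = carrier A \<and>
    inc S ` carrier B = a_kernel (mid S) A (prj S)"

text \<open>Congruence of extensions; the middle modules may live on different types.\<close>

definition ses_cong ::
  "('d, 'z) ring_scheme \<Rightarrow> ('d, 'a) module \<Rightarrow> ('d, 'b) module
    \<Rightarrow> ('d, 'a, 'b, 'g) ses \<Rightarrow> ('d, 'a, 'b, 'h) ses \<Rightarrow> bool"
  where "ses_cong D A B S T \<longleftrightarrow>
    (\<exists>\<alpha>\<in>mod_iso D (mid S) (mid T).
      (\<forall>b\<in>carrier B. \<alpha> (inc S b) = inc T b) \<and>
      (\<forall>g\<in>carrier (mid S). prj T (\<alpha> g) = prj S g))"

text \<open>
  The congruence class of an extension \<open>S\<close> of \<open>A\<close> by \<open>B\<close>.  Members of a class have their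
  middle module on the type \<open>'a \<times> 'b\<close>.  This loses nothing: every extension of \<open>A\<close> by \<open>B\<close>,
  whatever the type of its middle module, is in bijection with \<open>carrier A \<times> carrier B\<close> and hence
  congruent to one on \<open>'a \<times> 'b\<close> (see \<open>ext_class_nonempty\<close> below).
\<close>

definition ext_class ::
  "('d, 'z) ring_scheme \<Rightarrow> ('d, 'a) module \<Rightarrow> ('d, 'b) module
    \<Rightarrow> ('d, 'a, 'b, 'g) ses \<Rightarrow> ('d, 'a, 'b, 'a \<times> 'b) ses set"
  where "ext_class D A B S = {T. short_exact D A B T \<and> ses_cong D A B S T}"

lemma left_module_transport:
  fixes G :: "('d, 'g) module" and C :: "'h set"
  assumes G: "left_module D G" and h: "bij_betw h (carrier G) C"
  obtains G' where "left_module D G'" "carrier G' = C" "h \<in> mod_iso D G G'"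
proof -
  interpret G: left_module D G by (rule G)
  define k where "k = inv_into (carrier G) h"
  have kh: "k (h x) = x" if "x \<in> carrier G" for x
    using h that by (simp add: k_def bij_betw_inv_into_left)
  have hC: "h x \<in> C" if "x \<in> carrier G" for x
    using h that by (rule bij_betwE[THEN bspec])
  have C: "\<exists>x\<in>carrier G. y = h x" if "y \<in> C" for y
    using h that by (auto simp: bij_betw_def)
  define G' :: "('d, 'h) module" where
    "G' = \<lparr>carrier = C, mult = undefined, one = undefined, zero = h \<zero>\<^bsub>G\<^esub>,
           add = \<lambda>x y. h (k x \<oplus>\<^bsub>G\<^esub> k y), smult = \<lambda>d x. h (d \<odot>\<^bsub>G\<^esub> k x)\<rparr>"
  have "abelian_group G'"
  proof (rule abelian_groupI)
    fix x assume "x \<in> carrier G'"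
    then obtain u where u: "u \<in> carrier G" "x = h u" using C by (auto simp: G'_def)
    then have "h (\<ominus>\<^bsub>G\<^esub> u) \<in> carrier G'" "h (\<ominus>\<^bsub>G\<^esub> u) \<oplus>\<^bsub>G'\<^esub> x = \<zero>\<^bsub>G'\<^esub>"
      by (auto simp: G'_def hC kh G.l_neg)
    then show "\<exists>y\<in>carrier G'. y \<oplus>\<^bsub>G'\<^esub> x = \<zero>\<^bsub>G'\<^esub>" by blast
  qed (auto simp: G'_def hC kh G.a_ac dest!: C)
  then have "left_module D G'"
    by (intro left_module.intro left_module_axioms.intro G.R.ring_axioms)
       (auto simp: G'_def hC kh G.smult_l_distr G.smult_r_distr G.smult_assoc1 dest!: C)
  moreover have "h \<in> mod_iso D G G'"
    using h by (auto simp: mod_iso_def mod_hom_def G'_def hC kh)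
  ultimately show ?thesis using that by (simp add: G'_def)
qed

lemma ext_class_nonempty:
  fixes S :: "('d, 'a, 'b, 'g) ses"
  assumes S: "short_exact D A B S"
  shows "ext_class D A B S \<noteq> {}"
proof -
  let ?G = "mid S" and ?i = "inc S" and ?p = "prj S"
  interpret A: left_module D A using S by (simp add: short_exact_def)
  interpret B: left_module D B using S by (simp add: short_exact_def)
  interpret G: left_module D ?G using S by (simp add: short_exact_def)
  have p_add: "?p (x \<oplus>\<^bsub>?G\<^esub> y) = ?p x \<oplus>\<^bsub>A\<^esub> ?p y" if "x \<in> carrier ?G" "y \<in> carrier ?G" for x y
    using S that by (auto simp: short_exact_def mod_hom_def)
  have p_in: "?p x \<in> carrier A" if "x \<in> carrier ?G" for x
    using S that by (auto simp: short_exact_def mod_hom_def)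
  have i_in: "?i b \<in> carrier ?G" if "b \<in> carrier B" for b
    using S that by (auto simp: short_exact_def mod_hom_def)
  have inj: "inj_on ?i (carrier B)" and surj: "?p ` carrier ?G = carrier A"
    and ker: "?i ` carrier B = {x \<in> carrier ?G. ?p x = \<zero>\<^bsub>A\<^esub>}"
    using S by (auto simp: short_exact_def a_kernel_def kernel_def)
  define s where "s = inv_into (carrier ?G) ?p"
  have s: "s a \<in> carrier ?G" "?p (s a) = a" if "a \<in> carrier A" for a
    using that surj by (simp_all add: s_def inv_into_into f_inv_into_f)
  define k where "k = (\<lambda>(a, b). s a \<oplus>\<^bsub>?G\<^esub> ?i b)"
  have p_i: "?p (?i b) = \<zero>\<^bsub>A\<^esub>" if "b \<in> carrier B" for b
    using ker that by blast
  have "bij_betw k (carrier A \<times> carrier B) (carrier ?G)"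
  proof (rule bij_betw_imageI)
    show "inj_on k (carrier A \<times> carrier B)"
    proof (rule inj_onI, clarsimp simp: k_def)
      fix a b a' b'
      assume ab: "a \<in> carrier A" "b \<in> carrier B" "a' \<in> carrier A" "b' \<in> carrier B"
        and eq: "s a \<oplus>\<^bsub>?G\<^esub> ?i b = s a' \<oplus>\<^bsub>?G\<^esub> ?i b'"
      have "?p (s a \<oplus>\<^bsub>?G\<^esub> ?i b) = a" "?p (s a' \<oplus>\<^bsub>?G\<^esub> ?i b') = a'"
        using ab by (simp_all add: p_add s i_in p_i)
      then have "a = a'" using eq by simp
      moreover from this eq ab have "?i b = ?i b'" by (simp add: s i_in)
      ultimately show "a = a' \<and> b = b'" using inj ab by (simp add: inj_on_eq_iff)
    qed
    show "k ` (carrier A \<times> carrier B) = carrier ?G"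
    proof (intro equalityI subsetI)
      fix g assume g: "g \<in> carrier ?G"
      let ?a = "?p g" and ?x = "\<ominus>\<^bsub>?G\<^esub> s (?p g) \<oplus>\<^bsub>?G\<^esub> g"
      have sg: "s ?a \<in> carrier ?G" "?p (s ?a) = ?a" using g by (simp_all add: s p_in)
      have "?a \<oplus>\<^bsub>A\<^esub> ?p ?x = ?p (s ?a \<oplus>\<^bsub>?G\<^esub> ?x)" using sg g by (simp add: p_add)
      also have "s ?a \<oplus>\<^bsub>?G\<^esub> ?x = g" using sg g by (simp add: G.r_neg2)
      finally have "?p ?x = \<zero>\<^bsub>A\<^esub>" using sg g p_in by simp
      moreover have "?x \<in> carrier ?G" using sg g by simp
      ultimately obtain b where b: "b \<in> carrier B" "?x = ?i b" using ker by blast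
      then have "g = k (?a, b)" using sg g by (simp add: k_def G.r_neg2 flip: b(2))
      then show "g \<in> k ` (carrier A \<times> carrier B)" using b g p_in by blast
    qed (auto simp: k_def s i_in)
  qed
  then obtain h where h: "bij_betw h (carrier ?G) (carrier A \<times> carrier B)"
    using bij_betw_inv by blast
  obtain G' where G': "left_module D G'" "carrier G' = carrier A \<times> carrier B"
    and hi: "h \<in> mod_iso D ?G G'"
    using left_module_transport[OF G.left_module_axioms h] by metis
  define j where "j = inv_into (carrier ?G) h"
  have jh: "j (h x) = x" if "x \<in> carrier ?G" for x
    using h that by (simp add: j_def bij_betw_inv_into_left)
  have hG: "h x \<in> carrier G'" if "x \<in> carrier ?G" for x
    using hi that by (auto simp: mod_iso_def mod_hom_def)
  have G'h: "carrier G' = h ` carrier ?G" using hi by (auto simp: mod_iso_def bij_betw_def)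
  have h_add: "h x \<oplus>\<^bsub>G'\<^esub> h y = h (x \<oplus>\<^bsub>?G\<^esub> y)" if "x \<in> carrier ?G" "y \<in> carrier ?G" for x y
    using hi that by (auto simp: mod_iso_def mod_hom_def)
  have h_smult: "d \<odot>\<^bsub>G'\<^esub> h x = h (d \<odot>\<^bsub>?G\<^esub> x)" if "d \<in> carrier D" "x \<in> carrier ?G" for d x
    using hi that by (auto simp: mod_iso_def mod_hom_def)
  have p_smult: "?p (d \<odot>\<^bsub>?G\<^esub> x) = d \<odot>\<^bsub>A\<^esub> ?p x" if "d \<in> carrier D" "x \<in> carrier ?G" for d x
    using S that by (auto simp: short_exact_def mod_hom_def)
  define T where "T = \<lparr>mid = G', inc = h \<circ> ?i, prj = ?p \<circ> j\<rparr>"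
  have "h \<circ> ?i \<in> mod_hom D B G'"
    using S by (auto simp: short_exact_def mod_hom_def hG h_add h_smult Pi_iff)
  moreover have "?p \<circ> j \<in> mod_hom D G' A"
    by (auto simp: mod_hom_def G'h h_add h_smult jh p_in p_add p_smult)
  moreover have "inj_on (h \<circ> ?i) (carrier B)"
    by (rule comp_inj_on[OF inj], rule inj_on_subset[of h "carrier ?G"])
       (use h i_in in \<open>auto simp: bij_betw_def\<close>)
  moreover have "(?p \<circ> j) ` carrier G' = carrier A"
    using surj by (simp add: G'h image_comp jh flip: surj cong: image_cong_simp)
  moreover have "(h \<circ> ?i) ` carrier B = a_kernel G' A (?p \<circ> j)"
    unfolding image_comp[symmetric] ker by (auto simp: a_kernel_def kernel_def G'h jh)
  ultimately have "short_exact D A B T"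
    using G'(1) by (simp add: short_exact_def T_def A.left_module_axioms B.left_module_axioms)
  moreover have "ses_cong D A B S T"
    unfolding ses_cong_def T_def using hi by (intro bexI[of _ h]) (auto simp: jh)
  ultimately show ?thesis unfolding ext_class_def by blast
qed

definition split_ses :: "('d, 'a) module \<Rightarrow> ('d, 'b) module \<Rightarrow> ('d, 'a, 'b, 'a \<times> 'b) ses"
  where "split_ses A B = \<lparr>mid = prod_mod A B, inc = (\<lambda>b. (\<zero>\<^bsub>A\<^esub>, b)), prj = fst\<rparr>"

text \<open>Baer sum: the fibre product of \<open>S\<close> and \<open>T\<close> over \<open>A\<close>, modulo the antidiagonal copy of \<open>B\<close>.\<close>

definition baer_sum ::
  "('d, 'b) module \<Rightarrow> ('d, 'a, 'b, 'g) ses \<Rightarrow> ('d, 'a, 'b, 'h) ses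
    \<Rightarrow> ('d, 'a, 'b, ('g \<times> 'h) set) ses"
  where "baer_sum B S T =
    (let P = prod_mod (mid S) (mid T)
               \<lparr>carrier := {(g, h). g \<in> carrier (mid S) \<and> h \<in> carrier (mid T) \<and> prj S g = prj T h}\<rparr>;
         H = (\<lambda>b. (inc S b, \<ominus>\<^bsub>mid T\<^esub> inc T b)) ` carrier B
     in \<lparr>mid = quot_mod P H,
         inc = (\<lambda>b. H +>\<^bsub>P\<^esub> (inc S b, \<zero>\<^bsub>mid T\<^esub>)),
         prj = (\<lambda>C. the_elem ((\<lambda>(g, h). prj S g) ` C))\<rparr>)"

text \<open>
  The abelian group \<open>Ext1 D A B\<close>, written with the monoid record of HOL-Algebra, that is,
  multiplicatively.
\<close>

definition Ext1 ::
  "('d, 'z) ring_scheme \<Rightarrow> ('d, 'a) module \<Rightarrow> ('d, 'b) module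
    \<Rightarrow> ('d, 'a, 'b, 'a \<times> 'b) ses set monoid"
  where "Ext1 D A B =
    \<lparr>carrier = ext_class D A B ` {S :: ('d, 'a, 'b, 'a \<times> 'b) ses. short_exact D A B S},
     mult = \<lambda>c c'. (\<Union>S\<in>c. \<Union>T\<in>c'. ext_class D A B (baer_sum B S T)),
     one = ext_class D A B (split_ses A B)\<rparr>"


section \<open>Yoneda products with homomorphisms\<close>

text \<open>Pullback of an extension \<open>S\<close> of \<open>A\<close> along \<open>\<phi> : A' \<rightarrow> A\<close>.\<close>

definition pullback_ses ::
  "('d, 'p) module \<Rightarrow> ('p \<Rightarrow> 'a) \<Rightarrow> ('d, 'a, 'b, 'g) ses \<Rightarrow> ('d, 'p, 'b, 'p \<times> 'g) ses"
  where "pullback_ses A' \<phi> S =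
    \<lparr>mid = prod_mod A' (mid S)
             \<lparr>carrier := {(a, g). a \<in> carrier A' \<and> g \<in> carrier (mid S) \<and> \<phi> a = prj S g}\<rparr>,
     inc = (\<lambda>b. (\<zero>\<^bsub>A'\<^esub>, inc S b)),
     prj = fst\<rparr>"

text \<open>Pushout of an extension \<open>S\<close> by \<open>B\<close> along \<open>\<psi> : B \<rightarrow> B'\<close>.\<close>

definition pushout_ses ::
  "('d, 'b) module \<Rightarrow> ('d, 'q) module \<Rightarrow> ('b \<Rightarrow> 'q) \<Rightarrow> ('d, 'a, 'b, 'g) ses
    \<Rightarrow> ('d, 'a, 'q, ('q \<times> 'g) set) ses"
  where "pushout_ses B B' \<psi> S =
    (let P = prod_mod B' (mid S);
         H = (\<lambda>b. (\<psi> b, \<ominus>\<^bsub>mid S\<^esub> inc S b)) ` carrier B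
     in \<lparr>mid = quot_mod P H,
         inc = (\<lambda>b'. H +>\<^bsub>P\<^esub> (b', \<zero>\<^bsub>mid S\<^esub>)),
         prj = (\<lambda>C. the_elem ((\<lambda>(b', g). prj S g) ` C))\<rparr>)"

text \<open>
  The induced operations on classes: \<open>ext_pullback D A' B \<phi> c\<close> is \<open>\<phi> \<circ> c = \<phi>\<^sup>* c\<close> and
  \<open>ext_pushout D A B B' \<psi> c\<close> is \<open>c \<circ> \<psi> = \<psi>\<^sub>* c\<close> (compositions from left to right).
\<close>

definition ext_pullback ::
  "('d, 'z) ring_scheme \<Rightarrow> ('d, 'p) module \<Rightarrow> ('d, 'b) module \<Rightarrow> ('p \<Rightarrow> 'a)
    \<Rightarrow> ('d, 'a, 'b, 'a \<times> 'b) ses set \<Rightarrow> ('d, 'p, 'b, 'p \<times> 'b) ses set"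
  where "ext_pullback D A' B \<phi> c = (\<Union>S\<in>c. ext_class D A' B (pullback_ses A' \<phi> S))"

definition ext_pushout ::
  "('d, 'z) ring_scheme \<Rightarrow> ('d, 'a) module \<Rightarrow> ('d, 'b) module \<Rightarrow> ('d, 'q) module \<Rightarrow> ('b \<Rightarrow> 'q)
    \<Rightarrow> ('d, 'a, 'b, 'a \<times> 'b) ses set \<Rightarrow> ('d, 'a, 'q, 'a \<times> 'q) ses set"
  where "ext_pushout D A B B' \<psi> c = (\<Union>S\<in>c. ext_class D A B' (pushout_ses B B' \<psi> S))"

definition Hom_ext ::
  "('d, 'z) ring_scheme \<Rightarrow> ('d, 'm) module \<Rightarrow> ('d, 'l) module \<Rightarrow> ('d, 'n) module
    \<Rightarrow> ('d, 'l, 'n, 'l \<times> 'n) ses set \<Rightarrow> ('d, 'm, 'n, 'm \<times> 'n) ses set set"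
  where "Hom_ext D M L N \<eta>LN = {ext_pullback D M N \<phi> \<eta>LN | \<phi>. \<phi> \<in> mod_hom D M L}"

definition ext_Hom ::
  "('d, 'z) ring_scheme \<Rightarrow> ('d, 'm) module \<Rightarrow> ('d, 'l) module \<Rightarrow> ('d, 'n) module
    \<Rightarrow> ('d, 'm, 'l, 'm \<times> 'l) ses set \<Rightarrow> ('d, 'm, 'n, 'm \<times> 'n) ses set set"
  where "ext_Hom D M L N \<eta>ML = {ext_pushout D M L N \<psi> \<eta>ML | \<psi>. \<psi> \<in> mod_hom D L N}"

text \<open>The first extension group of the 1-cocycles \<open>\<eta>ML\<close> and \<open>\<eta>LN\<close>.\<close>

definition Ext1_cocycles ::
  "('d, 'z) ring_scheme \<Rightarrow> ('d, 'm) module \<Rightarrow> ('d, 'l) module \<Rightarrow> ('d, 'n) module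
    \<Rightarrow> ('d, 'm, 'l, 'm \<times> 'l) ses set \<Rightarrow> ('d, 'l, 'n, 'l \<times> 'n) ses set
    \<Rightarrow> ('d, 'm, 'n, 'm \<times> 'n) ses set set monoid"
  where "Ext1_cocycles D M L N \<eta>ML \<eta>LN =
    Ext1 D M N Mod (Hom_ext D M L N \<eta>LN <#>\<^bsub>Ext1 D M N\<^esub> ext_Hom D M L N \<eta>ML)"


section \<open>2-extension modules\<close>

text \<open>
  A module \<open>E\<close> with submodules \<open>E \<ge> E1 \<ge> E2 \<ge> 0\<close>, together with the identifications
  \<open>isoM : E/E1 \<rightarrow> M\<close>, \<open>isoL : E1/E2 \<rightarrow> L\<close>, \<open>isoN : E2 \<rightarrow> N\<close> of its subfactors with the prescribed
  modules.
\<close>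

record ('d, 'm, 'l, 'n, 'e) ext2 =
  E0 :: "('d, 'e) module"
  E1 :: "'e set"
  E2 :: "'e set"
  isoM :: "'e set \<Rightarrow> 'm"
  isoL :: "'e set \<Rightarrow> 'l"
  isoN :: "'e \<Rightarrow> 'n"

definition two_extension ::
  "('d, 'z) ring_scheme \<Rightarrow> ('d, 'm) module \<Rightarrow> ('d, 'l) module \<Rightarrow> ('d, 'n) module
    \<Rightarrow> ('d, 'm, 'l, 'n, 'e) ext2 \<Rightarrow> bool"
  where "two_extension D M L N E \<longleftrightarrow>
    left_module D M \<and> left_module D L \<and> left_module D N \<and> left_module D (E0 E) \<and>
    submodule (E1 E) D (E0 E) \<and> submodule (E2 E) D (E0 E) \<and> E2 E \<subseteq> E1 E \<and>
    isoM E \<in> mod_iso D (quot_mod (E0 E) (E1 E)) M \<and>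
    isoL E \<in> mod_iso D (quot_mod (E0 E\<lparr>carrier := E1 E\<rparr>) (E2 E)) L \<and>
    isoN E \<in> mod_iso D (E0 E\<lparr>carrier := E2 E\<rparr>) N"

text \<open>The sequence \<open>M = E/E1 \<leftarrow> E/E2 \<leftarrow> E1/E2 = L\<close>; the coset of \<open>E1\<close> induced by a coset
  \<open>C\<close> of \<open>E2\<close> is \<open>E1 + C\<close>.\<close>

definition upper_ses :: "('d, 'm, 'l, 'n, 'e) ext2 \<Rightarrow> ('d, 'm, 'l, 'e set) ses"
  where "upper_ses E =
    \<lparr>mid = quot_mod (E0 E) (E2 E),
     inc = inv_into (carrier (quot_mod (E0 E\<lparr>carrier := E1 E\<rparr>) (E2 E))) (isoL E),
     prj = (\<lambda>C. isoM E (E1 E <+>\<^bsub>E0 E\<^esub> C))\<rparr>"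

text \<open>The sequence \<open>L = E1/E2 \<leftarrow> E1 \<leftarrow> E2 = N\<close>.\<close>

definition lower_ses :: "('d, 'm, 'l, 'n, 'e) ext2 \<Rightarrow> ('d, 'l, 'n, 'e) ses"
  where "lower_ses E =
    \<lparr>mid = E0 E\<lparr>carrier := E1 E\<rparr>,
     inc = inv_into (E2 E) (isoN E),
     prj = (\<lambda>e. isoL E (E2 E +>\<^bsub>E0 E\<^esub> e))\<rparr>"

text \<open>
  Equivalence of 2-extension modules: an isomorphism of filtered modules compatible with the
  identifications of the subfactors.  Without this compatibility (that is, up to automorphisms of
  \<open>M\<close>, \<open>L\<close>, \<open>N\<close>) already for \<open>L = 0\<close> one would not get the set of Yoneda classes: for
  \<open>M = N = \<int>/3\<close> there are only two filtered modules up to isomorphism, but three classes.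
\<close>

definition ext2_equiv ::
  "('d, 'z) ring_scheme \<Rightarrow> ('d, 'm, 'l, 'n, 'e) ext2 \<Rightarrow> ('d, 'm, 'l, 'n, 'f) ext2 \<Rightarrow> bool"
  where "ext2_equiv D E F \<longleftrightarrow>
    (\<exists>\<alpha>\<in>mod_iso D (E0 E) (E0 F). \<alpha> ` E1 E = E1 F \<and> \<alpha> ` E2 E = E2 F \<and>
      (\<forall>e\<in>carrier (E0 E). isoM F (E1 F +>\<^bsub>E0 F\<^esub> \<alpha> e) = isoM E (E1 E +>\<^bsub>E0 E\<^esub> e)) \<and>
      (\<forall>e\<in>E1 E. isoL F (E2 F +>\<^bsub>E0 F\<^esub> \<alpha> e) = isoL E (E2 E +>\<^bsub>E0 E\<^esub> e)) \<and>
      (\<forall>e\<in>E2 E. isoN F (\<alpha> e) = isoN E e))"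

text \<open>As for \<open>ext_class\<close>, it suffices to consider modules on the type \<open>'m \<times> 'l \<times> 'n\<close>:
  a 2-extension module is in bijection with \<open>carrier M \<times> carrier L \<times> carrier N\<close>.\<close>

definition ext2_class ::
  "('d, 'z) ring_scheme \<Rightarrow> ('d, 'm) module \<Rightarrow> ('d, 'l) module \<Rightarrow> ('d, 'n) module
    \<Rightarrow> ('d, 'm, 'l, 'n, 'e) ext2 \<Rightarrow> ('d, 'm, 'l, 'n, 'm \<times> 'l \<times> 'n) ext2 set"
  where "ext2_class D M L N E = {F. two_extension D M L N F \<and> ext2_equiv D E F}"

definition ExtMod ::
  "('d, 'z) ring_scheme \<Rightarrow> ('d, 'm) module \<Rightarrow> ('d, 'l) module \<Rightarrow> ('d, 'n) module
    \<Rightarrow> ('d, 'm, 'l, 'm \<times> 'l) ses set \<Rightarrow> ('d, 'l, 'n, 'l \<times> 'n) ses set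
    \<Rightarrow> ('d, 'm, 'l, 'n, 'm \<times> 'l \<times> 'n) ext2 set set"
  where "ExtMod D M L N \<eta>ML \<eta>LN =
    ext2_class D M L N ` {E :: ('d, 'm, 'l, 'n, 'm \<times> 'l \<times> 'n) ext2. two_extension D M L N E \<and>
      ext_class D M L (upper_ses E) = \<eta>ML \<and> ext_class D L N (lower_ses E) = \<eta>LN}"


section \<open>Relation matrices\<close>

text \<open>
  \<open>gen\<close> is a family of generators indexed by \<open>cols\<close>; the rows of the row-finite matrix \<open>ent\<close>
  generate all relations.  The index sets may be infinite, so every module has such a presentation.
\<close>

record ('d, 'm, 'x, 'r) presentation =
  cols :: "'x set"
  rows :: "'r set"
  ent :: "'r \<Rightarrow> 'x \<Rightarrow> 'd"
  gen :: "'x \<Rightarrow> 'm"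

definition row_vectors :: "('d, 'z) ring_scheme \<Rightarrow> 'x set \<Rightarrow> ('x \<Rightarrow> 'd) set"
  where "row_vectors D X = {a \<in> X \<rightarrow> carrier D. finite {x \<in> X. a x \<noteq> \<zero>\<^bsub>D\<^esub>}}"

definition lincomb ::
  "('d, 'z) ring_scheme \<Rightarrow> ('d, 'm) module \<Rightarrow> 'x set \<Rightarrow> ('x \<Rightarrow> 'd) \<Rightarrow> ('x \<Rightarrow> 'm) \<Rightarrow> 'm"
  where "lincomb D M X a g = (\<Oplus>\<^bsub>M\<^esub>x\<in>{x \<in> X. a x \<noteq> \<zero>\<^bsub>D\<^esub>}. a x \<odot>\<^bsub>M\<^esub> g x)"

definition row_times_matrix ::
  "('d, 'z) ring_scheme \<Rightarrow> 'r set \<Rightarrow> ('r \<Rightarrow> 'd) \<Rightarrow> ('r \<Rightarrow> 'x \<Rightarrow> 'd) \<Rightarrow> 'x \<Rightarrow> 'd"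
  where "row_times_matrix D R c A x = (\<Oplus>\<^bsub>D\<^esub>r\<in>{r \<in> R. c r \<noteq> \<zero>\<^bsub>D\<^esub>}. c r \<otimes>\<^bsub>D\<^esub> A r x)"

definition presents ::
  "('d, 'z) ring_scheme \<Rightarrow> ('d, 'm) module \<Rightarrow> ('d, 'm, 'x, 'r) presentation \<Rightarrow> bool"
  where "presents D M P \<longleftrightarrow>
    gen P \<in> cols P \<rightarrow> carrier M \<and>
    ent P \<in> rows P \<rightarrow> row_vectors D (cols P) \<and>
    (\<forall>m\<in>carrier M. \<exists>a\<in>row_vectors D (cols P). lincomb D M (cols P) a (gen P) = m) \<and>
    (\<forall>a\<in>row_vectors D (cols P). lincomb D M (cols P) a (gen P) = \<zero>\<^bsub>M\<^esub> \<longleftrightarrow>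
      (\<exists>c\<in>row_vectors D (rows P). \<forall>x\<in>cols P. a x = row_times_matrix D (rows P) c (ent P) x))"

text \<open>The block matrix with rows \<open>(A, B)\<close> and \<open>(0, C)\<close>.\<close>

definition block_upper ::
  "('d, 'z) ring_scheme \<Rightarrow> ('r \<Rightarrow> 'x \<Rightarrow> 'd) \<Rightarrow> ('r \<Rightarrow> 'y \<Rightarrow> 'd) \<Rightarrow> ('s \<Rightarrow> 'y \<Rightarrow> 'd)
    \<Rightarrow> 'r + 's \<Rightarrow> 'x + 'y \<Rightarrow> 'd"
  where "block_upper D A B C =
    case_sum (\<lambda>r. case_sum (A r) (B r)) (\<lambda>s. case_sum (\<lambda>_. \<zero>\<^bsub>D\<^esub>) (C s))"

text \<open>
  The extension \<open>S\<close> of \<open>M\<close> by \<open>N\<close> is presented by the relation matrix with rows \<open>(PM, \<eta>)\<close> and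
  \<open>(0, PN)\<close>: this is the sense in which the matrix \<open>\<eta>\<close> represents the class of \<open>S\<close>.
\<close>

definition ses_presented ::
  "('d, 'z) ring_scheme \<Rightarrow> ('d, 'm, 'xm, 'rm) presentation \<Rightarrow> ('d, 'n, 'xn, 'rn) presentation
    \<Rightarrow> ('d, 'm, 'n, 'g) ses \<Rightarrow> ('rm \<Rightarrow> 'xn \<Rightarrow> 'd) \<Rightarrow> bool"
  where "ses_presented D PM PN S \<eta> \<longleftrightarrow>
    (\<exists>e. presents D (mid S)
           \<lparr>cols = cols PM <+> cols PN, rows = rows PM <+> rows PN,
            ent = block_upper D (ent PM) \<eta> (ent PN), gen = e\<rparr> \<and>
         (\<forall>x\<in>cols PM. prj S (e (Inl x)) = gen PM x) \<and>
         (\<forall>z\<in>cols PN. e (Inr z) = inc S (gen PN z)))"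

text \<open>
  The 2-extension module \<open>E\<close> is presented by the relation matrix with rows \<open>(PM, \<beta>, \<eta>)\<close>,
  \<open>(0, PL, \<gamma>)\<close> and \<open>(0, 0, PN)\<close>, compatibly with the filtration.  In particular \<open>\<beta>\<close> and \<open>\<gamma>\<close>
  then represent the classes of \<open>upper_ses E\<close> and \<open>lower_ses E\<close>.
\<close>

definition ext2_presented ::
  "('d, 'z) ring_scheme \<Rightarrow> ('d, 'm, 'xm, 'rm) presentation \<Rightarrow> ('d, 'l, 'xl, 'rl) presentation
    \<Rightarrow> ('d, 'n, 'xn, 'rn) presentation \<Rightarrow> ('d, 'm, 'l, 'n, 'e) ext2
    \<Rightarrow> ('rm \<Rightarrow> 'xl \<Rightarrow> 'd) \<Rightarrow> ('rl \<Rightarrow> 'xn \<Rightarrow> 'd) \<Rightarrow> ('rm \<Rightarrow> 'xn \<Rightarrow> 'd) \<Rightarrow> bool"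
  where "ext2_presented D PM PL PN E \<beta> \<gamma> \<eta> \<longleftrightarrow>
    (\<exists>e. presents D (E0 E)
           \<lparr>cols = cols PM <+> (cols PL <+> cols PN), rows = rows PM <+> (rows PL <+> rows PN),
            ent = block_upper D (ent PM) (\<lambda>r. case_sum (\<beta> r) (\<eta> r))
                    (block_upper D (ent PL) \<gamma> (ent PN)),
            gen = e\<rparr> \<and>
         (\<forall>x\<in>cols PM. isoM E (E1 E +>\<^bsub>E0 E\<^esub> e (Inl x)) = gen PM x) \<and>
         (\<forall>y\<in>cols PL. e (Inr (Inl y)) \<in> E1 E \<and> isoL E (E2 E +>\<^bsub>E0 E\<^esub> e (Inr (Inl y))) = gen PL y) \<and>
         (\<forall>z\<in>cols PN. e (Inr (Inr z)) \<in> E2 E \<and> isoN E (e (Inr (Inr z))) = gen PN z))"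


section \<open>Actions\<close>

text \<open>
  The action of a class \<open>\<xi>\<close> in \<open>Ext1 D M N\<close> on a class \<open>x\<close> of 2-extension modules, given by
  \<open>\<eta> \<mapsto> \<eta> + \<eta>'\<close> in the upper right block, with \<open>\<eta>'\<close> representing \<open>\<xi>\<close>.
\<close>

definition ExtMod_act ::
  "('d, 'z) ring_scheme \<Rightarrow> ('d, 'm) module \<Rightarrow> ('d, 'l) module \<Rightarrow> ('d, 'n) module
    \<Rightarrow> ('d, 'm, 'xm, 'rm) presentation \<Rightarrow> ('d, 'l, 'xl, 'rl) presentation
    \<Rightarrow> ('d, 'n, 'xn, 'rn) presentation \<Rightarrow> ('d, 'm, 'n, 'm \<times> 'n) ses set
    \<Rightarrow> ('d, 'm, 'l, 'n, 'm \<times> 'l \<times> 'n) ext2 set \<Rightarrow> ('d, 'm, 'l, 'n, 'm \<times> 'l \<times> 'n) ext2 set"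
  where "ExtMod_act D M L N PM PL PN \<xi> x =
    {F. two_extension D M L N F \<and>
      (\<exists>E\<in>x. \<exists>S\<in>\<xi>. \<exists>\<beta> \<gamma> \<eta> \<eta>'.
        ext2_presented D PM PL PN E \<beta> \<gamma> \<eta> \<and> ses_presented D PM PN S \<eta>' \<and>
        ext2_presented D PM PL PN F \<beta> \<gamma> (\<lambda>r z. \<eta> r z \<oplus>\<^bsub>D\<^esub> \<eta>' r z))}"

text \<open>The action of a factor group induced by an action \<open>\<phi>\<close> on \<open>X\<close> in which the subgroup acts
  trivially.\<close>

definition quotient_action :: "('g \<Rightarrow> 'x \<Rightarrow> 'x) \<Rightarrow> 'x set \<Rightarrow> 'g set \<Rightarrow> 'x \<Rightarrow> 'x"
  where "quotient_action \<phi> X C = (\<lambda>x\<in>X. the_elem ((\<lambda>g. \<phi> g x) ` C))"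

definition principal_homogeneous_space ::
  "('g, 'z) monoid_scheme \<Rightarrow> 'x set \<Rightarrow> ('g \<Rightarrow> 'x \<Rightarrow> 'x) \<Rightarrow> bool"
  where "principal_homogeneous_space G X \<phi> \<longleftrightarrow>
    X \<noteq> {} \<and> transitive_action G X \<phi> \<and> (\<forall>x\<in>X. stabilizer G \<phi> x = {\<one>\<^bsub>G\<^esub>})"

text \<open>Isomorphism of sets with an action of (the elements of) \<open>G\<close>.\<close>

definition equivariant_iso ::
  "('g, 'z) monoid_scheme \<Rightarrow> 'x set \<Rightarrow> ('g \<Rightarrow> 'x \<Rightarrow> 'x) \<Rightarrow> 'y set \<Rightarrow> ('g \<Rightarrow> 'y \<Rightarrow> 'y) \<Rightarrow> bool"
  where "equivariant_iso G X \<phi> Y \<psi> \<longleftrightarrow>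
    (\<exists>f. bij_betw f X Y \<and> (\<forall>g\<in>carrier G. \<forall>x\<in>X. f (\<phi> g x) = \<psi> g (f x)))"

text \<open>
  For \<open>S1\<close> a sequence \<open>L \<leftarrow> G1 \<leftarrow> N\<close>: the fibre over \<open>\<eta>ML\<close> of \<open>Ext1 D M G1 \<rightarrow> Ext1 D M L\<close>, and
  the action of \<open>Ext1 D M N\<close> on it.
\<close>

definition fibre_push ::
  "('d, 'z) ring_scheme \<Rightarrow> ('d, 'm) module \<Rightarrow> ('d, 'l) module \<Rightarrow> ('d, 'l, 'n, 'g) ses
    \<Rightarrow> ('d, 'm, 'l, 'm \<times> 'l) ses set \<Rightarrow> ('d, 'm, 'g, 'm \<times> 'g) ses set set"
  where "fibre_push D M L S1 \<eta>ML =
    {c \<in> carrier (Ext1 D M (mid S1)). ext_pushout D M (mid S1) L (prj S1) c = \<eta>ML}"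

definition fibre_push_act ::
  "('d, 'z) ring_scheme \<Rightarrow> ('d, 'm) module \<Rightarrow> ('d, 'n) module \<Rightarrow> ('d, 'l, 'n, 'g) ses
    \<Rightarrow> ('d, 'm, 'n, 'm \<times> 'n) ses set \<Rightarrow> ('d, 'm, 'g, 'm \<times> 'g) ses set
    \<Rightarrow> ('d, 'm, 'g, 'm \<times> 'g) ses set"
  where "fibre_push_act D M N S1 \<xi> c =
    ext_pushout D M N (mid S1) (inc S1) \<xi> \<otimes>\<^bsub>Ext1 D M (mid S1)\<^esub> c"

text \<open>
  For \<open>S0\<close> a sequence \<open>M \<leftarrow> G0 \<leftarrow> L\<close>: the fibre over \<open>\<eta>LN\<close> of \<open>Ext1 D G0 N \<rightarrow> Ext1 D L N\<close>, and
  the action of \<open>Ext1 D M N\<close> on it.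
\<close>

definition fibre_pull ::
  "('d, 'z) ring_scheme \<Rightarrow> ('d, 'l) module \<Rightarrow> ('d, 'n) module \<Rightarrow> ('d, 'm, 'l, 'g) ses
    \<Rightarrow> ('d, 'l, 'n, 'l \<times> 'n) ses set \<Rightarrow> ('d, 'g, 'n, 'g \<times> 'n) ses set set"
  where "fibre_pull D L N S0 \<eta>LN =
    {c \<in> carrier (Ext1 D (mid S0) N). ext_pullback D L N (inc S0) c = \<eta>LN}"

definition fibre_pull_act ::
  "('d, 'z) ring_scheme \<Rightarrow> ('d, 'n) module \<Rightarrow> ('d, 'm, 'l, 'g) ses
    \<Rightarrow> ('d, 'm, 'n, 'm \<times> 'n) ses set \<Rightarrow> ('d, 'g, 'n, 'g \<times> 'n) ses set
    \<Rightarrow> ('d, 'g, 'n, 'g \<times> 'n) ses set"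
  where "fibre_pull_act D N S0 \<xi> c =
    ext_pullback D (mid S0) N (prj S0) \<xi> \<otimes>\<^bsub>Ext1 D (mid S0) N\<^esub> c"

end

theory Submission
  imports Defs
begin

text \<open>
  A set-theoretic section \<open>s\<close> of an extension of \<open>A\<close> by \<open>B\<close> yields the cocycle \<open>h\<close> with
  \<open>d s(a) + s(a') = s(d a + a') + h(d, a, a')\<close>, which determines the congruence class of the
  extension up to coboundaries; pushout, pullback and Baer sum become composition with a
  homomorphism and pointwise addition.  Sections of both \<open>E/E2\<close> over \<open>M\<close> and \<open>E1\<close> over \<open>L\<close>
  describe a 2-extension module by a triple \<open>(\<beta>, \<gamma>, \<eta>)\<close>, where \<open>\<beta>\<close> and \<open>\<gamma>\<close> can be fixed in
  advance.  A class in \<open>Ext1 D M N\<close> with cocycle \<open>\<sigma>\<close> acts by \<open>\<eta> \<mapsto> \<eta> + \<sigma>\<close>, and the remaining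
  choice of the sections changes \<open>\<eta>\<close> by coboundaries and by \<open>\<gamma> \<circ> \<phi> + \<psi> \<circ> \<beta>\<close> with \<open>\<phi>\<close> in
  \<open>Hom(M, L)\<close> and \<open>\<psi>\<close> in \<open>Hom(L, N)\<close>.  So \<open>Ext1 D M N\<close> acts transitively on \<open>ExtMod\<close> with
  stabilizer \<open>Hom_ext + ext_Hom\<close>.  By exactness of the long exact sequences it acts transitively
  on the two fibres with stabilizers \<open>Hom_ext\<close> and \<open>ext_Hom\<close>.  Hence the three sets of the
  theorem are transitive with the same stabilizer, and therefore isomorphic.
\<close>

section \<open>Modules and homomorphisms\<close>

text \<open>No cocycle identity is ever written down: a function counts as a cocycle when a section
  of some extension produces it. Closure properties are therefore proved by building modules, and
  one construction (\<open>quot_ses\<close>) serves Baer sums, pushouts and \<open>E/E2\<close>.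
  Sections are not normalised, hence the recurring corrections by the value of a section at zero.
  The component \<eta> of a triple need not be a cocycle; differences of two such \<eta> with the
  same \<beta> and \<gamma> are. For fixed \<beta> and \<gamma> the admissible \<eta> are the same
  for \<open>ExtMod\<close> and for the fibre in \<open>Ext1 D M (mid S1)\<close>; only the
  identifications among them differ. The fibre in \<open>Ext1 D (mid S0) N\<close> is treated on its
  own, since its cocycles live on \<open>mid S0\<close>. The main obstacle is the action, whose
  definition by relation matrices involves many choices. A map from the fibre product of E and S
  over M to F shows that adding cocycles adds matrices, and matrices determine a 2-extension module
  up to equivalence.\<close>

context left_module
begin

lemma smult_l_null [simp]: "x \<in> carrier M \<Longrightarrow> \<zero> \<odot>\<^bsub>M\<^esub> x = \<zero>\<^bsub>M\<^esub>"
  using smult_l_distr[of \<zero> \<zero> x] M.add.r_cancel_one' by auto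

lemma smult_r_null [simp]: "a \<in> carrier R \<Longrightarrow> a \<odot>\<^bsub>M\<^esub> \<zero>\<^bsub>M\<^esub> = \<zero>\<^bsub>M\<^esub>"
  using smult_r_distr[of a "\<zero>\<^bsub>M\<^esub>" "\<zero>\<^bsub>M\<^esub>"] M.add.r_cancel_one' by auto

lemma smult_minus_one [simp]: "x \<in> carrier M \<Longrightarrow> (\<ominus> \<one>) \<odot>\<^bsub>M\<^esub> x = \<ominus>\<^bsub>M\<^esub> x"
  using smult_l_distr[of "\<ominus> \<one>" \<one> x] by (simp add: R.l_neg M.minus_equality)

end

text \<open>The single operation d x + y carries the whole module structure: d = 1 gives addition
  and y = 0 scalar multiplication. Linearity of a map and closure of a subset thus become one
  condition each.\<close>

definition axpy :: "('d, 'a) module \<Rightarrow> 'd \<Rightarrow> 'a \<Rightarrow> 'a \<Rightarrow> 'a"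
  where "axpy A d x y = d \<odot>\<^bsub>A\<^esub> x \<oplus>\<^bsub>A\<^esub> y"

locale lmod = left_module D A for D :: "('d, 'z) ring_scheme" and A :: "('d, 'a) module"
begin

lemma axpy_closed [simp, intro]:
  "\<lbrakk>d \<in> carrier D; x \<in> carrier A; y \<in> carrier A\<rbrakk> \<Longrightarrow> axpy A d x y \<in> carrier A"
  by (simp add: axpy_def)

lemma axpy_add:
  "\<lbrakk>d \<in> carrier D; x \<in> carrier A; y \<in> carrier A; x' \<in> carrier A; y' \<in> carrier A\<rbrakk> \<Longrightarrow>
    axpy A d (x \<oplus>\<^bsub>A\<^esub> x') (y \<oplus>\<^bsub>A\<^esub> y') = axpy A d x y \<oplus>\<^bsub>A\<^esub> axpy A d x' y'"
  by (simp add: axpy_def smult_r_distr M.a_ac)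

lemma axpy_zero [simp]: "d \<in> carrier D \<Longrightarrow> axpy A d \<zero>\<^bsub>A\<^esub> \<zero>\<^bsub>A\<^esub> = \<zero>\<^bsub>A\<^esub>"
  by (simp add: axpy_def)

lemma axpy_one [simp]: "x \<in> carrier A \<Longrightarrow> axpy A \<one>\<^bsub>D\<^esub> x y = x \<oplus>\<^bsub>A\<^esub> y"
  by (simp add: axpy_def)

lemma axpy_minus:
  assumes "d \<in> carrier D" "x \<in> carrier A" "y \<in> carrier A"
  shows "axpy A d (\<ominus>\<^bsub>A\<^esub> x) (\<ominus>\<^bsub>A\<^esub> y) = \<ominus>\<^bsub>A\<^esub> axpy A d x y"
proof -
  have "axpy A d (\<ominus>\<^bsub>A\<^esub> x) (\<ominus>\<^bsub>A\<^esub> y) \<oplus>\<^bsub>A\<^esub> axpy A d x y = \<zero>\<^bsub>A\<^esub>"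
    using assms axpy_add[of d "\<ominus>\<^bsub>A\<^esub> x" "\<ominus>\<^bsub>A\<^esub> y" x y] by (simp add: M.l_neg)
  then show ?thesis using assms by (simp add: M.minus_equality)
qed

lemma minus_axpy: "x \<in> carrier A \<Longrightarrow> \<ominus>\<^bsub>A\<^esub> x = axpy A (\<ominus>\<^bsub>D\<^esub> \<one>\<^bsub>D\<^esub>) x \<zero>\<^bsub>A\<^esub>"
  by (simp add: axpy_def)

text \<open>Zero comes from (-1) c + c for any element c of the nonempty set; scalar multiples then
  come from y = 0, and negatives from them.\<close>

lemma closed_subset:
  assumes "C \<subseteq> carrier A" "C \<noteq> {}"
    and C: "\<And>d x y. \<lbrakk>d \<in> carrier D; x \<in> C; y \<in> C\<rbrakk> \<Longrightarrow> axpy A d x y \<in> C"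
  shows submodule_of_closed_subset: "submodule C D A"
    and left_module_of_closed_subset: "left_module D (A\<lparr>carrier := C\<rparr>)"
proof -
  have in_A: "x \<in> carrier A" if "x \<in> C" for x using that assms(1) by blast
  have add: "x \<oplus>\<^bsub>A\<^esub> y \<in> C" if "x \<in> C" "y \<in> C" for x y
    using C[of "\<one>\<^bsub>D\<^esub>" x y] that by (simp add: in_A)
  obtain c where c: "c \<in> C" using assms(2) by blast
  have z: "\<zero>\<^bsub>A\<^esub> \<in> C"
    using C[of "\<ominus>\<^bsub>D\<^esub> \<one>\<^bsub>D\<^esub>" c c] c by (simp add: axpy_def in_A M.l_neg)
  have smult: "d \<odot>\<^bsub>A\<^esub> x \<in> C" if "d \<in> carrier D" "x \<in> C" for d x
    using C[of d x "\<zero>\<^bsub>A\<^esub>"] that z by (simp add: axpy_def in_A)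
  have neg: "\<ominus>\<^bsub>A\<^esub> x \<in> C" if "x \<in> C" for x
    using smult[of "\<ominus>\<^bsub>D\<^esub> \<one>\<^bsub>D\<^esub>" x] that by (simp add: in_A)
  show "submodule C D A"
    using assms(1) add z smult neg
    by (intro submodule.intro subgroup.intro submodule_axioms.intro)
       (simp_all flip: a_inv_def)
  have "abelian_group (A\<lparr>carrier := C\<rparr>)"
  proof (rule abelian_groupI)
    fix x assume "x \<in> carrier (A\<lparr>carrier := C\<rparr>)"
    then show "\<exists>y\<in>carrier (A\<lparr>carrier := C\<rparr>). y \<oplus>\<^bsub>A\<lparr>carrier := C\<rparr>\<^esub> x = \<zero>\<^bsub>A\<lparr>carrier := C\<rparr>\<^esub>"
      using neg by (auto intro!: bexI[of _ "\<ominus>\<^bsub>A\<^esub> x"] simp: M.l_neg in_A)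
  qed (auto simp: add z M.a_ac in_A)
  then show "left_module D (A\<lparr>carrier := C\<rparr>)"
    by (intro left_module.intro left_module_axioms.intro R.ring_axioms)
       (auto simp: in_A smult smult_l_distr smult_r_distr smult_assoc1)
qed

end

lemma lmodI: "left_module D A \<Longrightarrow> lmod D A"
  by (simp add: lmod_def)

lemma axpy_carrier_update [simp]: "axpy (A\<lparr>carrier := C\<rparr>) = axpy A"
  by (simp add: axpy_def fun_eq_iff)

lemma submodule_axpy:
  assumes "left_module D A" "submodule C D A" "d \<in> carrier D" "x \<in> C" "y \<in> C"
  shows "axpy A d x y \<in> C"
proof -
  interpret A: left_module D A by fact
  interpret submodule C D A by fact
  show ?thesis using assms(3-) m_closed[of "d \<odot>\<^bsub>A\<^esub> x" y] by (simp add: axpy_def smult_closed)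
qed

lemma mod_hom_closed: "\<lbrakk>f \<in> mod_hom D A B; x \<in> carrier A\<rbrakk> \<Longrightarrow> f x \<in> carrier B"
  by (auto simp: mod_hom_def)

lemma mod_hom_add:
  "\<lbrakk>f \<in> mod_hom D A B; x \<in> carrier A; y \<in> carrier A\<rbrakk> \<Longrightarrow> f (x \<oplus>\<^bsub>A\<^esub> y) = f x \<oplus>\<^bsub>B\<^esub> f y"
  by (auto simp: mod_hom_def)

lemma mod_hom_smult:
  "\<lbrakk>f \<in> mod_hom D A B; d \<in> carrier D; x \<in> carrier A\<rbrakk> \<Longrightarrow> f (d \<odot>\<^bsub>A\<^esub> x) = d \<odot>\<^bsub>B\<^esub> f x"
  by (auto simp: mod_hom_def)

lemma mod_hom_axpy:
  assumes "f \<in> mod_hom D A B" "left_module D A" "d \<in> carrier D" "x \<in> carrier A" "y \<in> carrier A"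
  shows "f (axpy A d x y) = axpy B d (f x) (f y)"
proof -
  interpret A: left_module D A by fact
  show ?thesis using assms by (simp add: axpy_def mod_hom_add mod_hom_smult)
qed

lemma mod_hom_zero:
  assumes "f \<in> mod_hom D A B" "left_module D A" "left_module D B"
  shows "f \<zero>\<^bsub>A\<^esub> = \<zero>\<^bsub>B\<^esub>"
proof -
  interpret A: left_module D A by fact
  interpret B: left_module D B by fact
  show ?thesis using mod_hom_smult[of f D A B "\<zero>\<^bsub>D\<^esub>" "\<zero>\<^bsub>A\<^esub>"] assms by (simp add: mod_hom_closed)
qed

text \<open>Preservation of zero has to be settled before the scalar law, which is the instance y =
  0 of the hypothesis. It follows from additivity (d = 1), since f(0) = f(0) + f(0).\<close>

lemma mod_homI:
  assumes "left_module D A" "left_module D B"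
    and closed: "\<And>x. x \<in> carrier A \<Longrightarrow> f x \<in> carrier B"
    and f: "\<And>d x y. \<lbrakk>d \<in> carrier D; x \<in> carrier A; y \<in> carrier A\<rbrakk> \<Longrightarrow>
      f (axpy A d x y) = axpy B d (f x) (f y)"
  shows "f \<in> mod_hom D A B"
proof -
  interpret A: left_module D A by fact
  interpret B: left_module D B by fact
  have add: "f (x \<oplus>\<^bsub>A\<^esub> y) = f x \<oplus>\<^bsub>B\<^esub> f y" if "x \<in> carrier A" "y \<in> carrier A" for x y
    using f[of "\<one>\<^bsub>D\<^esub>" x y] that by (simp add: axpy_def closed)
  have zero: "f \<zero>\<^bsub>A\<^esub> = \<zero>\<^bsub>B\<^esub>"
    using add[of "\<zero>\<^bsub>A\<^esub>" "\<zero>\<^bsub>A\<^esub>"] closed[of "\<zero>\<^bsub>A\<^esub>"] B.M.add.r_cancel_one' by auto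
  have "f (d \<odot>\<^bsub>A\<^esub> x) = d \<odot>\<^bsub>B\<^esub> f x" if "d \<in> carrier D" "x \<in> carrier A" for d x
    using f[of d x "\<zero>\<^bsub>A\<^esub>"] that zero by (simp add: axpy_def closed)
  then show ?thesis using add closed by (auto simp: mod_hom_def)
qed

lemma mod_hom_compose:
  assumes "f \<in> mod_hom D A B" "g \<in> mod_hom D B C"
  shows "(\<lambda>x. g (f x)) \<in> mod_hom D A C"
  using assms by (auto simp: mod_hom_def Pi_iff)

lemma mod_hom_minus:
  assumes f: "f \<in> mod_hom D A B" and A: "left_module D A" and B: "left_module D B"
  shows "(\<lambda>x. \<ominus>\<^bsub>B\<^esub> f x) \<in> mod_hom D A B"
proof -
  interpret A: lmod D A using A by (rule lmodI)
  interpret B: lmod D B using B by (rule lmodI)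
  show ?thesis
    by (rule mod_homI[OF A B]) (use f A in \<open>auto simp: mod_hom_closed mod_hom_axpy B.axpy_minus\<close>)
qed

lemma mod_iso_inv:
  assumes f: "f \<in> mod_iso D A B" and A: "left_module D A" and B: "left_module D B"
  shows "inv_into (carrier A) f \<in> mod_iso D B A"
proof -
  interpret A: lmod D A using A by (rule lmodI)
  interpret B: lmod D B using B by (rule lmodI)
  let ?g = "inv_into (carrier A) f"
  have bij: "bij_betw f (carrier A) (carrier B)" and hom: "f \<in> mod_hom D A B"
    using f by (auto simp: mod_iso_def)
  have gf: "?g (f x) = x" if "x \<in> carrier A" for x
    using bij that by (rule bij_betw_inv_into_left)
  have fg: "f (?g y) = y" if "y \<in> carrier B" for y
    using bij that by (rule bij_betw_inv_into_right)
  have gc: "?g y \<in> carrier A" if "y \<in> carrier B" for y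
    using bij_betw_inv_into[OF bij] that by (auto simp: bij_betw_def)
  have "?g \<in> mod_hom D B A"
  proof (rule mod_homI[OF B A gc])
    fix d x y assume *: "d \<in> carrier D" "x \<in> carrier B" "y \<in> carrier B"
    have "axpy B d x y = f (axpy A d (?g x) (?g y))"
      using * by (simp add: mod_hom_axpy[OF hom A] gc fg)
    then show "?g (axpy B d x y) = axpy A d (?g x) (?g y)"
      using * by (simp add: gf gc)
  qed
  then show ?thesis using bij_betw_inv_into[OF bij] by (simp add: mod_iso_def)
qed

lemma prod_mod_simps [simp]:
  "carrier (prod_mod A B) = carrier A \<times> carrier B"
  "\<zero>\<^bsub>prod_mod A B\<^esub> = (\<zero>\<^bsub>A\<^esub>, \<zero>\<^bsub>B\<^esub>)"
  "(x, y) \<oplus>\<^bsub>prod_mod A B\<^esub> (x', y') = (x \<oplus>\<^bsub>A\<^esub> x', y \<oplus>\<^bsub>B\<^esub> y')"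
  "d \<odot>\<^bsub>prod_mod A B\<^esub> (x, y) = (d \<odot>\<^bsub>A\<^esub> x, d \<odot>\<^bsub>B\<^esub> y)"
  "axpy (prod_mod A B) d (x, y) (x', y') = (axpy A d x x', axpy B d y y')"
  by (simp_all add: prod_mod_def axpy_def)

lemma left_module_prod_mod:
  assumes "left_module D A" "left_module D B"
  shows "left_module D (prod_mod A B)"
proof -
  interpret A: left_module D A by fact
  interpret B: left_module D B by fact
  have "abelian_group (prod_mod A B)"
  proof (rule abelian_groupI)
    fix x assume "x \<in> carrier (prod_mod A B)"
    then show "\<exists>y\<in>carrier (prod_mod A B). y \<oplus>\<^bsub>prod_mod A B\<^esub> x = \<zero>\<^bsub>prod_mod A B\<^esub>"
      by (intro bexI[of _ "(\<ominus>\<^bsub>A\<^esub> fst x, \<ominus>\<^bsub>B\<^esub> snd x)"]) (auto simp: A.M.l_neg B.M.l_neg)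
  qed (auto simp: A.M.a_ac B.M.a_ac)
  then show ?thesis
    by (intro left_module.intro left_module_axioms.intro A.R.ring_axioms)
       (auto simp: A.smult_l_distr A.smult_r_distr A.smult_assoc1
                   B.smult_l_distr B.smult_r_distr B.smult_assoc1)
qed

section \<open>Quotient modules\<close>

lemma a_r_coset_carrier_update [simp]: "H +>\<^bsub>A\<lparr>carrier := C\<rparr>\<^esub> x = H +>\<^bsub>A\<^esub> x"
  by (simp add: a_r_coset_def r_coset_def)

lemma mem_a_r_coset: "c \<in> H +>\<^bsub>A\<^esub> x \<longleftrightarrow> (\<exists>h\<in>H. c = h \<oplus>\<^bsub>A\<^esub> x)"
  unfolding a_r_coset_def r_coset_def by simp

locale quotient_module = lmod D A for D :: "('d, 'z) ring_scheme" and A :: "('d, 'a) module" +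
  fixes H :: "'a set"
  assumes sub: "submodule H D A"
begin

sublocale sub: submodule H D A by (rule sub)

sublocale additive_subgroup H A
  by (rule additive_subgroup.intro) unfold_locales

sublocale abelian_subgroup H A
  by (rule abelian_subgroupI3) unfold_locales

lemma coset_eq_iff:
  assumes "x \<in> carrier A" "y \<in> carrier A"
  shows "H +>\<^bsub>A\<^esub> x = H +>\<^bsub>A\<^esub> y \<longleftrightarrow> x \<ominus>\<^bsub>A\<^esub> y \<in> H"
proof -
  have "x \<ominus>\<^bsub>A\<^esub> y \<in> H \<longleftrightarrow> x \<in> H +>\<^bsub>A\<^esub> y"
    using a_rcos_module[of y x] assms by (simp add: a_minus_def)
  then show ?thesis using assms a_repr_independence'[of x y] a_rcos_self[of x] by metis
qed

lemma carrier_quot: "carrier (quot_mod A H) = (\<lambda>x. H +>\<^bsub>A\<^esub> x) ` carrier A"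
  by (auto simp: quot_mod_def A_RCOSETS_def RCOSETS_def a_r_coset_def)

lemma zero_quot: "\<zero>\<^bsub>quot_mod A H\<^esub> = H +>\<^bsub>A\<^esub> \<zero>\<^bsub>A\<^esub>"
  by (simp add: quot_mod_def a_coset_add_zero a_subset)

lemma add_quot:
  "\<lbrakk>x \<in> carrier A; y \<in> carrier A\<rbrakk> \<Longrightarrow>
    (H +>\<^bsub>A\<^esub> x) \<oplus>\<^bsub>quot_mod A H\<^esub> (H +>\<^bsub>A\<^esub> y) = H +>\<^bsub>A\<^esub> (x \<oplus>\<^bsub>A\<^esub> y)"
  by (simp add: quot_mod_def a_rcos_sum)

text \<open>\<open>quot_mod\<close> takes the union of the cosets of d c over all representatives c.
  A representative is h + x with h in H, and d h lies in H again, so all these cosets coincide and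
  the union is one coset.\<close>

lemma smult_quot:
  assumes d: "d \<in> carrier D" and x: "x \<in> carrier A"
  shows "d \<odot>\<^bsub>quot_mod A H\<^esub> (H +>\<^bsub>A\<^esub> x) = H +>\<^bsub>A\<^esub> (d \<odot>\<^bsub>A\<^esub> x)"
proof -
  have "H +>\<^bsub>A\<^esub> (d \<odot>\<^bsub>A\<^esub> c) = H +>\<^bsub>A\<^esub> (d \<odot>\<^bsub>A\<^esub> x)" if c: "c \<in> H +>\<^bsub>A\<^esub> x" for c
  proof -
    obtain h where h: "h \<in> H" and c_eq: "c = h \<oplus>\<^bsub>A\<^esub> x" using mem_a_r_coset[THEN iffD1, OF c] by blast
    have hA: "h \<in> carrier A" using h by (rule a_Hcarr)
    have dh: "d \<odot>\<^bsub>A\<^esub> h \<in> H" using d h by (rule sub.smult_closed)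
    have "d \<odot>\<^bsub>A\<^esub> c = d \<odot>\<^bsub>A\<^esub> h \<oplus>\<^bsub>A\<^esub> d \<odot>\<^bsub>A\<^esub> x"
      unfolding c_eq using d hA x by (rule smult_r_distr)
    then have "d \<odot>\<^bsub>A\<^esub> c \<in> H +>\<^bsub>A\<^esub> (d \<odot>\<^bsub>A\<^esub> x)"
      by (intro mem_a_r_coset[THEN iffD2] bexI[OF _ dh])
    then show ?thesis
      by (rule a_repr_independence'[symmetric]) (use d x a_subgroup in simp_all)
  qed
  moreover have "x \<in> H +>\<^bsub>A\<^esub> x" using x by (rule a_rcos_self)
  ultimately have "(\<Union>c\<in>H +>\<^bsub>A\<^esub> x. H +>\<^bsub>A\<^esub> (d \<odot>\<^bsub>A\<^esub> c)) = H +>\<^bsub>A\<^esub> (d \<odot>\<^bsub>A\<^esub> x)" by blast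
  then show ?thesis by (simp add: quot_mod_def)
qed

lemma axpy_quot:
  "\<lbrakk>d \<in> carrier D; x \<in> carrier A; y \<in> carrier A\<rbrakk> \<Longrightarrow>
    axpy (quot_mod A H) d (H +>\<^bsub>A\<^esub> x) (H +>\<^bsub>A\<^esub> y) = H +>\<^bsub>A\<^esub> axpy A d x y"
  by (simp add: axpy_def add_quot smult_quot)

lemma left_module_quot: "left_module D (quot_mod A H)"
proof -
  have "abelian_group (quot_mod A H)"
  proof (rule abelian_groupI)
    fix C assume "C \<in> carrier (quot_mod A H)"
    then obtain x where "x \<in> carrier A" "C = H +>\<^bsub>A\<^esub> x" by (auto simp: carrier_quot)
    then show "\<exists>y\<in>carrier (quot_mod A H). y \<oplus>\<^bsub>quot_mod A H\<^esub> C = \<zero>\<^bsub>quot_mod A H\<^esub>"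
      by (intro bexI[of _ "H +>\<^bsub>A\<^esub> (\<ominus>\<^bsub>A\<^esub> x)"]) (auto simp: add_quot carrier_quot zero_quot M.l_neg)
  qed (auto simp: carrier_quot add_quot zero_quot M.a_ac)
  then show ?thesis
    by (intro left_module.intro left_module_axioms.intro R.ring_axioms)
       (auto simp: carrier_quot add_quot smult_quot smult_l_distr smult_r_distr smult_assoc1)
qed

end

section \<open>Short exact sequences and their cocycles\<close>

locale exact_seq =
  fixes D :: "('d, 'z) ring_scheme" and A :: "('d, 'a) module" and B :: "('d, 'b) module"
    and S :: "('d, 'a, 'b, 'g) ses"
  assumes exact: "short_exact D A B S"
begin

sublocale A: lmod D A using exact by (simp add: short_exact_def lmodI)
sublocale B: lmod D B using exact by (simp add: short_exact_def lmodI)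
sublocale G: lmod D "mid S" using exact by (simp add: short_exact_def lmodI)

lemma inc_hom: "inc S \<in> mod_hom D B (mid S)" and prj_hom: "prj S \<in> mod_hom D (mid S) A"
  using exact by (simp_all add: short_exact_def)

lemma inc_closed [simp]: "b \<in> carrier B \<Longrightarrow> inc S b \<in> carrier (mid S)"
  using inc_hom by (rule mod_hom_closed)

lemma prj_closed [simp]: "x \<in> carrier (mid S) \<Longrightarrow> prj S x \<in> carrier A"
  using prj_hom by (rule mod_hom_closed)

lemma inc_add [simp]:
  "\<lbrakk>b \<in> carrier B; b' \<in> carrier B\<rbrakk> \<Longrightarrow> inc S (b \<oplus>\<^bsub>B\<^esub> b') = inc S b \<oplus>\<^bsub>mid S\<^esub> inc S b'"
  using inc_hom by (rule mod_hom_add)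

lemma prj_add [simp]:
  "\<lbrakk>x \<in> carrier (mid S); y \<in> carrier (mid S)\<rbrakk> \<Longrightarrow>
    prj S (x \<oplus>\<^bsub>mid S\<^esub> y) = prj S x \<oplus>\<^bsub>A\<^esub> prj S y"
  using prj_hom by (rule mod_hom_add)

lemma inc_axpy [simp]:
  "\<lbrakk>d \<in> carrier D; b \<in> carrier B; b' \<in> carrier B\<rbrakk> \<Longrightarrow>
    inc S (axpy B d b b') = axpy (mid S) d (inc S b) (inc S b')"
  using inc_hom B.left_module_axioms by (rule mod_hom_axpy)

lemma prj_axpy [simp]:
  "\<lbrakk>d \<in> carrier D; x \<in> carrier (mid S); y \<in> carrier (mid S)\<rbrakk> \<Longrightarrow>
    prj S (axpy (mid S) d x y) = axpy A d (prj S x) (prj S y)"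
  using prj_hom G.left_module_axioms by (rule mod_hom_axpy)

lemma inc_zero [simp]: "inc S \<zero>\<^bsub>B\<^esub> = \<zero>\<^bsub>mid S\<^esub>"
  using inc_hom B.left_module_axioms G.left_module_axioms by (rule mod_hom_zero)

lemma prj_zero [simp]: "prj S \<zero>\<^bsub>mid S\<^esub> = \<zero>\<^bsub>A\<^esub>"
  using prj_hom G.left_module_axioms A.left_module_axioms by (rule mod_hom_zero)

lemma inc_eq_iff [simp]:
  "\<lbrakk>b \<in> carrier B; b' \<in> carrier B\<rbrakk> \<Longrightarrow> inc S b = inc S b' \<longleftrightarrow> b = b'"
  using exact by (auto simp: short_exact_def inj_on_eq_iff)

lemma prj_surj: "prj S ` carrier (mid S) = carrier A"
  using exact by (simp add: short_exact_def)

lemma inc_image: "inc S ` carrier B = {x \<in> carrier (mid S). prj S x = \<zero>\<^bsub>A\<^esub>}"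
  using exact by (simp add: short_exact_def a_kernel_def kernel_def)

lemma prj_inc [simp]: "b \<in> carrier B \<Longrightarrow> prj S (inc S b) = \<zero>\<^bsub>A\<^esub>"
  using inc_image by blast

lemma kernelE:
  assumes "x \<in> carrier (mid S)" "prj S x = \<zero>\<^bsub>A\<^esub>"
  obtains b where "b \<in> carrier B" "x = inc S b"
  using assms inc_image by blast

text \<open>The element -y + x lies in the kernel of \<open>prj S\<close>, hence in the image of
  \<open>inc S\<close>. Cochains with values in B are obtained later by choice from the bounded
  existential form \<open>diff_ex\<close>.\<close>

lemma diffE:
  assumes "x \<in> carrier (mid S)" "y \<in> carrier (mid S)" "prj S x = prj S y"
  obtains b where "b \<in> carrier B" "x = y \<oplus>\<^bsub>mid S\<^esub> inc S b"
proof -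
  let ?z = "\<ominus>\<^bsub>mid S\<^esub> y \<oplus>\<^bsub>mid S\<^esub> x"
  have "prj S (\<ominus>\<^bsub>mid S\<^esub> y) \<oplus>\<^bsub>A\<^esub> prj S y = \<zero>\<^bsub>A\<^esub>"
    using assms(2) by (simp add: G.M.l_neg flip: prj_add)
  then have "prj S ?z = \<zero>\<^bsub>A\<^esub>" using assms by simp
  then obtain b where b: "b \<in> carrier B" "?z = inc S b"
    using assms(1,2) kernelE[of ?z] by (metis G.M.add.inv_closed G.M.a_closed)
  have "y \<oplus>\<^bsub>mid S\<^esub> inc S b = x" using assms(1,2) by (simp add: G.M.r_neg2 flip: b(2))
  then show ?thesis using that[of b] b(1) by simp
qed

lemma diff_ex:
  "\<lbrakk>x \<in> carrier (mid S); y \<in> carrier (mid S); prj S x = prj S y\<rbrakk> \<Longrightarrow>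
    \<exists>b\<in>carrier B. x = y \<oplus>\<^bsub>mid S\<^esub> inc S b"
  by (rule diffE) blast+

end

lemma short_exactI:
  assumes "left_module D A" "left_module D B" "left_module D (mid S)"
    and "inc S \<in> mod_hom D B (mid S)" "prj S \<in> mod_hom D (mid S) A"
    and "\<And>b b'. \<lbrakk>b \<in> carrier B; b' \<in> carrier B; inc S b = inc S b'\<rbrakk> \<Longrightarrow> b = b'"
    and "\<And>a. a \<in> carrier A \<Longrightarrow> \<exists>x\<in>carrier (mid S). prj S x = a"
    and "\<And>b. b \<in> carrier B \<Longrightarrow> prj S (inc S b) = \<zero>\<^bsub>A\<^esub>"
    and "\<And>x. \<lbrakk>x \<in> carrier (mid S); prj S x = \<zero>\<^bsub>A\<^esub>\<rbrakk> \<Longrightarrow> \<exists>b\<in>carrier B. x = inc S b"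
  shows "short_exact D A B S"
proof -
  have "prj S ` carrier (mid S) = carrier A"
    using assms(5,7) by (auto simp: mod_hom_closed)
  moreover have "inc S ` carrier B = a_kernel (mid S) A (prj S)"
    using assms(4,8,9) by (auto simp: a_kernel_def kernel_def mod_hom_closed)
  ultimately show ?thesis
    using assms(1-6) by (simp add: short_exact_def inj_on_def)
qed

text \<open>
  \<open>s\<close> is a set-theoretic section of \<open>S\<close> and \<open>h\<close> measures its failure to be linear.  Recording only
  the operation \<open>d a + a'\<close> replaces the usual two factor sets (for addition and for scalar
  multiplication) by one function.
\<close>

definition ses_section ::
  "('d, 'z) ring_scheme \<Rightarrow> ('d, 'a) module \<Rightarrow> ('d, 'b) module \<Rightarrow> ('d, 'a, 'b, 'g) ses
    \<Rightarrow> ('a \<Rightarrow> 'g) \<Rightarrow> ('d \<Rightarrow> 'a \<Rightarrow> 'a \<Rightarrow> 'b) \<Rightarrow> bool"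
  where "ses_section D A B S s h \<longleftrightarrow>
    (\<forall>a\<in>carrier A. s a \<in> carrier (mid S) \<and> prj S (s a) = a) \<and>
    (\<forall>d\<in>carrier D. \<forall>a\<in>carrier A. \<forall>a'\<in>carrier A. h d a a' \<in> carrier B \<and>
      axpy (mid S) d (s a) (s a') = s (axpy A d a a') \<oplus>\<^bsub>mid S\<^esub> inc S (h d a a'))"

text \<open>No identity is imposed on h; the factor-set conditions are implied by h coming from a
  section of a module.\<close>

definition has_cocycle ::
  "('d, 'z) ring_scheme \<Rightarrow> ('d, 'a) module \<Rightarrow> ('d, 'b) module \<Rightarrow> ('d, 'a, 'b, 'g) ses
    \<Rightarrow> ('d \<Rightarrow> 'a \<Rightarrow> 'a \<Rightarrow> 'b) \<Rightarrow> bool"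
  where "has_cocycle D A B S h \<longleftrightarrow> short_exact D A B S \<and> (\<exists>s. ses_section D A B S s h)"

text \<open>The difference h' - h is the coboundary d x(a) + x(a') - x(d a + a') of the cochain x.
  It is written without subtraction, the form in which a comparison of two sections delivers
  it.\<close>

definition cohomologous ::
  "('d, 'z) ring_scheme \<Rightarrow> ('d, 'a) module \<Rightarrow> ('d, 'b) module
    \<Rightarrow> ('d \<Rightarrow> 'a \<Rightarrow> 'a \<Rightarrow> 'b) \<Rightarrow> ('d \<Rightarrow> 'a \<Rightarrow> 'a \<Rightarrow> 'b) \<Rightarrow> bool"
  where "cohomologous D A B h h' \<longleftrightarrow> (\<exists>x. (\<forall>a\<in>carrier A. x a \<in> carrier B) \<and>
    (\<forall>d\<in>carrier D. \<forall>a\<in>carrier A. \<forall>a'\<in>carrier A.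
      h' d a a' \<oplus>\<^bsub>B\<^esub> x (axpy A d a a') = h d a a' \<oplus>\<^bsub>B\<^esub> axpy B d (x a) (x a')))"

lemma ses_sectionD:
  assumes "ses_section D A B S s h" "a \<in> carrier A"
  shows "s a \<in> carrier (mid S)" "prj S (s a) = a"
  using assms by (auto simp: ses_section_def)

lemma ses_section_cocycle:
  assumes "ses_section D A B S s h" "d \<in> carrier D" "a \<in> carrier A" "a' \<in> carrier A"
  shows "h d a a' \<in> carrier B"
    and "axpy (mid S) d (s a) (s a') = s (axpy A d a a') \<oplus>\<^bsub>mid S\<^esub> inc S (h d a a')"
  using assms by (auto simp: ses_section_def)

lemma ses_sectionI:
  assumes "\<And>a. a \<in> carrier A \<Longrightarrow> s a \<in> carrier (mid S)"
    and "\<And>a. a \<in> carrier A \<Longrightarrow> prj S (s a) = a"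
    and "\<And>d a a'. \<lbrakk>d \<in> carrier D; a \<in> carrier A; a' \<in> carrier A\<rbrakk> \<Longrightarrow> h d a a' \<in> carrier B"
    and "\<And>d a a'. \<lbrakk>d \<in> carrier D; a \<in> carrier A; a' \<in> carrier A\<rbrakk> \<Longrightarrow>
      axpy (mid S) d (s a) (s a') = s (axpy A d a a') \<oplus>\<^bsub>mid S\<^esub> inc S (h d a a')"
  shows "ses_section D A B S s h"
  using assms by (simp add: ses_section_def)

lemma has_cocycleI: "\<lbrakk>short_exact D A B S; ses_section D A B S s h\<rbrakk> \<Longrightarrow> has_cocycle D A B S h"
  by (auto simp: has_cocycle_def)

lemma cohomologousI:
  assumes "\<And>a. a \<in> carrier A \<Longrightarrow> x a \<in> carrier B"
    and "\<And>d a a'. \<lbrakk>d \<in> carrier D; a \<in> carrier A; a' \<in> carrier A\<rbrakk> \<Longrightarrow>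
      h' d a a' \<oplus>\<^bsub>B\<^esub> x (axpy A d a a') = h d a a' \<oplus>\<^bsub>B\<^esub> axpy B d (x a) (x a')"
  shows "cohomologous D A B h h'"
  using assms unfolding cohomologous_def by (intro exI[of _ x]) simp

lemma cohomologousE:
  assumes "cohomologous D A B h h'"
  obtains x where "\<forall>a\<in>carrier A. x a \<in> carrier B"
    and "\<forall>d\<in>carrier D. \<forall>a\<in>carrier A. \<forall>a'\<in>carrier A.
      h' d a a' \<oplus>\<^bsub>B\<^esub> x (axpy A d a a') = h d a a' \<oplus>\<^bsub>B\<^esub> axpy B d (x a) (x a')"
  using assms unfolding cohomologous_def by blast

lemma cohomologous_cong:
  assumes "\<And>d a a'. \<lbrakk>d \<in> carrier D; a \<in> carrier A; a' \<in> carrier A\<rbrakk> \<Longrightarrow> h d a a' = g d a a'"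
    and "\<And>d a a'. \<lbrakk>d \<in> carrier D; a \<in> carrier A; a' \<in> carrier A\<rbrakk> \<Longrightarrow> h' d a a' = g' d a a'"
  shows "cohomologous D A B h h' \<longleftrightarrow> cohomologous D A B g g'"
  using assms by (simp add: cohomologous_def)

text \<open>Cochains are total functions in HOL, but only their values on the carriers are meant;
  congruence rules of this kind take the place of extensionality.\<close>

lemma has_cocycle_cong:
  assumes "\<And>d a a'. \<lbrakk>d \<in> carrier D; a \<in> carrier A; a' \<in> carrier A\<rbrakk> \<Longrightarrow> h d a a' = h' d a a'"
  shows "has_cocycle D A B S h \<longleftrightarrow> has_cocycle D A B S h'"
  using assms by (simp add: has_cocycle_def ses_section_def)

lemma has_cocycle_exact: "has_cocycle D A B S h \<Longrightarrow> short_exact D A B S"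
  by (simp add: has_cocycle_def)

lemma has_cocycle_closed:
  "\<lbrakk>has_cocycle D A B S h; d \<in> carrier D; a \<in> carrier A; a' \<in> carrier A\<rbrakk> \<Longrightarrow> h d a a' \<in> carrier B"
  by (auto simp: has_cocycle_def ses_section_def)

context exact_seq
begin

text \<open>Any right inverse s of \<open>prj S\<close> will do: as \<open>prj S\<close> is linear,
  d s(a) + s(a') and s(d a + a') both project to d a + a', so they differ by an element of B. The
  value s(0) may be nonzero.\<close>

lemma ex_section: "\<exists>s h. ses_section D A B S s h"
proof -
  define s where "s = inv_into (carrier (mid S)) (prj S)"
  have s: "s a \<in> carrier (mid S)" "prj S (s a) = a" if "a \<in> carrier A" for a
    using that by (simp_all add: s_def inv_into_into f_inv_into_f flip: prj_surj)
  have "\<exists>b\<in>carrier B. axpy (mid S) d (s a) (s a') = s (axpy A d a a') \<oplus>\<^bsub>mid S\<^esub> inc S b"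
    if "d \<in> carrier D" "a \<in> carrier A" "a' \<in> carrier A" for d a a'
    using that s by (intro diff_ex) simp_all
  then obtain h where "h d a a' \<in> carrier B \<and>
      axpy (mid S) d (s a) (s a') = s (axpy A d a a') \<oplus>\<^bsub>mid S\<^esub> inc S (h d a a')"
    if "d \<in> carrier D" "a \<in> carrier A" "a' \<in> carrier A" for d a a'
    by metis
  then show ?thesis using s unfolding ses_section_def by blast
qed

lemma ex_cocycle: "\<exists>h. has_cocycle D A B S h"
  using ex_section exact by (auto simp: has_cocycle_def)

lemma section_add_closed:
  "\<lbrakk>ses_section D A B S s h; a \<in> carrier A; b \<in> carrier B\<rbrakk> \<Longrightarrow>
    s a \<oplus>\<^bsub>mid S\<^esub> inc S b \<in> carrier (mid S)"
  by (simp add: ses_sectionD)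

lemma prj_section_add:
  "\<lbrakk>ses_section D A B S s h; a \<in> carrier A; b \<in> carrier B\<rbrakk> \<Longrightarrow>
    prj S (s a \<oplus>\<^bsub>mid S\<^esub> inc S b) = a"
  by (simp add: ses_sectionD)

text \<open>In the coordinates (a, b) of s(a) + b, the operation of the middle module is d (a, b) +
  (a', b') = (d a + a', h(d, a, a') + d b + b'): the classical twisted structure on A x B given by a
  factor set.\<close>

lemma axpy_section:
  assumes s: "ses_section D A B S s h"
    and "d \<in> carrier D" "a \<in> carrier A" "b \<in> carrier B" "a' \<in> carrier A" "b' \<in> carrier B"
  shows "axpy (mid S) d (s a \<oplus>\<^bsub>mid S\<^esub> inc S b) (s a' \<oplus>\<^bsub>mid S\<^esub> inc S b') =
    s (axpy A d a a') \<oplus>\<^bsub>mid S\<^esub> inc S (h d a a' \<oplus>\<^bsub>B\<^esub> axpy B d b b')"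
  using assms(2-) by (simp add: G.axpy_add ses_sectionD[OF s] ses_section_cocycle[OF s] G.M.a_assoc)

lemma sectionE:
  assumes s: "ses_section D A B S s h" and x: "x \<in> carrier (mid S)"
  obtains b where "b \<in> carrier B" "x = s (prj S x) \<oplus>\<^bsub>mid S\<^esub> inc S b"
  using x by (rule diffE[of x "s (prj S x)"]) (simp_all add: ses_sectionD[OF s] x)

lemma section_eq_iff:
  assumes s: "ses_section D A B S s h"
    and "a \<in> carrier A" "b \<in> carrier B" "a' \<in> carrier A" "b' \<in> carrier B"
  shows "s a \<oplus>\<^bsub>mid S\<^esub> inc S b = s a' \<oplus>\<^bsub>mid S\<^esub> inc S b' \<longleftrightarrow> a = a' \<and> b = b'"
proof
  assume eq: "s a \<oplus>\<^bsub>mid S\<^esub> inc S b = s a' \<oplus>\<^bsub>mid S\<^esub> inc S b'"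
  then have "a = a'" using assms(2-) prj_section_add[OF s] by metis
  then show "a = a' \<and> b = b'" using eq assms(2-) by (simp add: ses_sectionD[OF s])
qed simp

lemma section_change:
  assumes s: "ses_section D A B S s h"
    and x: "\<And>a. a \<in> carrier A \<Longrightarrow> x a \<in> carrier B"
    and h'_closed: "\<And>d a a'. \<lbrakk>d \<in> carrier D; a \<in> carrier A; a' \<in> carrier A\<rbrakk> \<Longrightarrow> h' d a a' \<in> carrier B"
    and h': "\<And>d a a'. \<lbrakk>d \<in> carrier D; a \<in> carrier A; a' \<in> carrier A\<rbrakk> \<Longrightarrow>
      h' d a a' \<oplus>\<^bsub>B\<^esub> x (axpy A d a a') = h d a a' \<oplus>\<^bsub>B\<^esub> axpy B d (x a) (x a')"
  shows "ses_section D A B S (\<lambda>a. s a \<oplus>\<^bsub>mid S\<^esub> inc S (x a)) h'"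
proof (rule ses_sectionI)
  fix d a a' assume *: "d \<in> carrier D" "a \<in> carrier A" "a' \<in> carrier A"
  have "axpy (mid S) d (s a \<oplus>\<^bsub>mid S\<^esub> inc S (x a)) (s a' \<oplus>\<^bsub>mid S\<^esub> inc S (x a')) =
      s (axpy A d a a') \<oplus>\<^bsub>mid S\<^esub> inc S (h' d a a' \<oplus>\<^bsub>B\<^esub> x (axpy A d a a'))"
    using * by (simp only: axpy_section[OF s] x h')
  also have "\<dots> = s (axpy A d a a') \<oplus>\<^bsub>mid S\<^esub> inc S (x (axpy A d a a')) \<oplus>\<^bsub>mid S\<^esub> inc S (h' d a a')"
    using * by (simp add: x h'_closed ses_sectionD[OF s] G.M.a_ac)
  finally show "axpy (mid S) d (s a \<oplus>\<^bsub>mid S\<^esub> inc S (x a)) (s a' \<oplus>\<^bsub>mid S\<^esub> inc S (x a')) = \<dots>" .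
qed (simp_all add: x h'_closed ses_sectionD[OF s])

text \<open>The function x itself is kept in the conclusion, not only the cohomology relation: for h
  = h' the last equation says that x is linear, which is how homomorphisms from L to N enter
  later.\<close>

lemma sections_differ:
  assumes s: "ses_section D A B S s h" and s': "ses_section D A B S s' h'"
  obtains x where "\<forall>a\<in>carrier A. x a \<in> carrier B"
    and "\<forall>a\<in>carrier A. s' a = s a \<oplus>\<^bsub>mid S\<^esub> inc S (x a)"
    and "\<forall>d\<in>carrier D. \<forall>a\<in>carrier A. \<forall>a'\<in>carrier A.
      h' d a a' \<oplus>\<^bsub>B\<^esub> x (axpy A d a a') = h d a a' \<oplus>\<^bsub>B\<^esub> axpy B d (x a) (x a')"
proof -
  have "\<forall>a\<in>carrier A. \<exists>b\<in>carrier B. s' a = s a \<oplus>\<^bsub>mid S\<^esub> inc S b"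
    by (intro ballI diff_ex) (simp_all add: ses_sectionD[OF s] ses_sectionD[OF s'])
  then obtain x where x: "\<forall>a\<in>carrier A. x a \<in> carrier B"
    and s'_eq: "\<forall>a\<in>carrier A. s' a = s a \<oplus>\<^bsub>mid S\<^esub> inc S (x a)" by metis
  show ?thesis
  proof (rule that[OF x s'_eq], intro ballI)
    fix d a a' assume *: "d \<in> carrier D" "a \<in> carrier A" "a' \<in> carrier A"
    note h = ses_section_cocycle[OF s *] and h' = ses_section_cocycle[OF s' *]
    have "s (axpy A d a a') \<oplus>\<^bsub>mid S\<^esub> inc S (h d a a' \<oplus>\<^bsub>B\<^esub> axpy B d (x a) (x a')) =
        axpy (mid S) d (s' a) (s' a')"
      using * x by (simp only: axpy_section[OF s] s'_eq)
    also have "\<dots> = s (axpy A d a a') \<oplus>\<^bsub>mid S\<^esub> inc S (h' d a a' \<oplus>\<^bsub>B\<^esub> x (axpy A d a a'))"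
      using * h' x by (simp add: s'_eq ses_sectionD[OF s] G.M.a_ac)
    finally show "h' d a a' \<oplus>\<^bsub>B\<^esub> x (axpy A d a a') = h d a a' \<oplus>\<^bsub>B\<^esub> axpy B d (x a) (x a')"
      using * h(1) h'(1) x by (subst (asm) section_eq_iff[OF s]) auto
  qed
qed

lemma cocycle_unique:
  assumes "has_cocycle D A B S h" "has_cocycle D A B S h'"
  shows "cohomologous D A B h h'"
proof -
  obtain s s' where s: "ses_section D A B S s h" and s': "ses_section D A B S s' h'"
    using assms by (auto simp: has_cocycle_def)
  then show ?thesis unfolding cohomologous_def by (metis sections_differ)
qed

end

text \<open>That the values of h' lie in \<open>B\<close> is a separate hypothesis because the
  equation in \<open>cohomologous\<close> does not control sums formed outside the carrier.\<close>

lemma cocycle_change: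
  assumes S: "has_cocycle D A B S h" and "cohomologous D A B h h'"
    and h': "\<And>d a a'. \<lbrakk>d \<in> carrier D; a \<in> carrier A; a' \<in> carrier A\<rbrakk> \<Longrightarrow> h' d a a' \<in> carrier B"
  shows "has_cocycle D A B S h'"
proof -
  interpret S: exact_seq D A B S by unfold_locales (use S in \<open>rule has_cocycle_exact\<close>)
  obtain s where s: "ses_section D A B S s h" using S by (auto simp: has_cocycle_def)
  from assms(2) obtain x where x: "\<forall>a\<in>carrier A. x a \<in> carrier B"
    and *: "\<forall>d\<in>carrier D. \<forall>a\<in>carrier A. \<forall>a'\<in>carrier A.
      h' d a a' \<oplus>\<^bsub>B\<^esub> x (axpy A d a a') = h d a a' \<oplus>\<^bsub>B\<^esub> axpy B d (x a) (x a')"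
    by (rule cohomologousE)
  from S.section_change[OF s x[rule_format] h' *[rule_format]] S.exact show ?thesis by (rule has_cocycleI[rotated])
qed

section \<open>Morphisms of extensions in cocycle coordinates\<close>

text \<open>In coordinates the morphism is (a, b) -> (\<phi> a, \<psi> b); compatibility of the
  cocycles with \<phi> and \<psi> makes it linear. The last conclusion, that \<alpha> carries s to
  s' over \<phi>, allows cocycles composed with a section to be transported along \<alpha>.\<close>

lemma ses_map:
  assumes "short_exact D A B S" "short_exact D A' B' T"
    and s: "ses_section D A B S s h" and s': "ses_section D A' B' T s' h'"
    and \<phi>: "\<phi> \<in> mod_hom D A A'" and \<psi>: "\<psi> \<in> mod_hom D B B'"
    and eq: "\<And>d a a'. \<lbrakk>d \<in> carrier D; a \<in> carrier A; a' \<in> carrier A\<rbrakk> \<Longrightarrow>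
      h' d (\<phi> a) (\<phi> a') = \<psi> (h d a a')"
  obtains \<alpha> where "\<alpha> \<in> mod_hom D (mid S) (mid T)"
    and "\<And>b. b \<in> carrier B \<Longrightarrow> \<alpha> (inc S b) = inc T (\<psi> b)"
    and "\<And>x. x \<in> carrier (mid S) \<Longrightarrow> prj T (\<alpha> x) = \<phi> (prj S x)"
    and "\<And>a. a \<in> carrier A \<Longrightarrow> \<alpha> (s a) = s' (\<phi> a)"
proof -
  interpret S: exact_seq D A B S by unfold_locales fact
  interpret T: exact_seq D A' B' T by unfold_locales fact
  have "\<forall>x\<in>carrier (mid S). \<exists>b\<in>carrier B. x = s (prj S x) \<oplus>\<^bsub>mid S\<^esub> inc S b"
    using S.sectionE[OF s] by blast
  \<comment> \<open>\<open>r x\<close> is the B-coordinate of x with respect to the section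
    s.\<close>
  from bchoice[OF this[unfolded Bex_def]]
  obtain r where r: "\<And>x. x \<in> carrier (mid S) \<Longrightarrow> r x \<in> carrier B"
    and decomp: "\<And>x. x \<in> carrier (mid S) \<Longrightarrow> x = s (prj S x) \<oplus>\<^bsub>mid S\<^esub> inc S (r x)"
    by blast
  have r_eq: "r (s a \<oplus>\<^bsub>mid S\<^esub> inc S b) = b" if "a \<in> carrier A" "b \<in> carrier B" for a b
    using decomp[of "s a \<oplus>\<^bsub>mid S\<^esub> inc S b"] that r[of "s a \<oplus>\<^bsub>mid S\<^esub> inc S b"]
    by (simp only: S.prj_section_add[OF s] S.section_add_closed[OF s] S.section_eq_iff[OF s])
  define \<alpha> where "\<alpha> x = s' (\<phi> (prj S x)) \<oplus>\<^bsub>mid T\<^esub> inc T (\<psi> (r x))" for x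
  note [simp] = mod_hom_closed[OF \<phi>] mod_hom_closed[OF \<psi>] r ses_sectionD[OF s] ses_sectionD[OF s']
    mod_hom_axpy[OF \<phi>] mod_hom_axpy[OF \<psi>] mod_hom_zero[OF \<phi>] mod_hom_zero[OF \<psi>]
    S.A.left_module_axioms S.B.left_module_axioms T.A.left_module_axioms T.B.left_module_axioms
    ses_section_cocycle(1)[OF s] ses_section_cocycle(1)[OF s']
  have "\<alpha> \<in> mod_hom D (mid S) (mid T)"
  proof (rule mod_homI[OF S.G.left_module_axioms T.G.left_module_axioms])
    fix d x y assume *: "d \<in> carrier D" "x \<in> carrier (mid S)" "y \<in> carrier (mid S)"
    have "axpy (mid S) d x y = s (axpy A d (prj S x) (prj S y)) \<oplus>\<^bsub>mid S\<^esub>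
        inc S (h d (prj S x) (prj S y) \<oplus>\<^bsub>B\<^esub> axpy B d (r x) (r y))"
      using * by (subst decomp[OF *(2)], subst decomp[OF *(3)]) (simp only: S.axpy_section[OF s] r S.prj_closed)
    then have "r (axpy (mid S) d x y) = h d (prj S x) (prj S y) \<oplus>\<^bsub>B\<^esub> axpy B d (r x) (r y)"
      using * by (simp only:) (rule r_eq, simp_all)
    then have "\<alpha> (axpy (mid S) d x y) = s' (axpy A' d (\<phi> (prj S x)) (\<phi> (prj S y))) \<oplus>\<^bsub>mid T\<^esub>
        inc T (h' d (\<phi> (prj S x)) (\<phi> (prj S y)) \<oplus>\<^bsub>B'\<^esub> axpy B' d (\<psi> (r x)) (\<psi> (r y)))"
      using * by (simp add: \<alpha>_def mod_hom_add[OF \<psi>] eq)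
    then show "\<alpha> (axpy (mid S) d x y) = axpy (mid T) d (\<alpha> x) (\<alpha> y)"
      using * by (simp only: \<alpha>_def T.axpy_section[OF s'] S.prj_closed r mod_hom_closed[OF \<phi>] mod_hom_closed[OF \<psi>])
  qed (simp add: \<alpha>_def)
  moreover have "prj T (\<alpha> x) = \<phi> (prj S x)" if "x \<in> carrier (mid S)" for x
    using that by (simp add: \<alpha>_def T.prj_section_add[OF s'])
  moreover have s_zero: "\<alpha> (s a) = s' (\<phi> a)" if "a \<in> carrier A" for a
    using r_eq[of a "\<zero>\<^bsub>B\<^esub>"] that by (simp add: \<alpha>_def)
  moreover have "\<alpha> (inc S b) = inc T (\<psi> b)" if b: "b \<in> carrier B" for b
  proof -
    \<comment> \<open>Since s(0) = inc b0 may be nonzero, inc b has the coordinates (0, b - b0). The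
      cocycle equation for d = 1 and a = a' = 0 gives b0 = h(1, 0, 0), and likewise for s', so the
      two corrections match under \<psi>.\<close>
    obtain b0 where b0: "b0 \<in> carrier B" "s \<zero>\<^bsub>A\<^esub> = inc S b0"
      by (rule S.kernelE[of "s \<zero>\<^bsub>A\<^esub>"]) simp_all
    have "h \<one>\<^bsub>D\<^esub> \<zero>\<^bsub>A\<^esub> \<zero>\<^bsub>A\<^esub> = b0"
      using ses_section_cocycle(2)[OF s, of "\<one>\<^bsub>D\<^esub>" "\<zero>\<^bsub>A\<^esub>" "\<zero>\<^bsub>A\<^esub>"] b0 by simp
    moreover have "s' \<zero>\<^bsub>A'\<^esub> = inc T (h' \<one>\<^bsub>D\<^esub> \<zero>\<^bsub>A'\<^esub> \<zero>\<^bsub>A'\<^esub>)"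
      using ses_section_cocycle(2)[OF s', of "\<one>\<^bsub>D\<^esub>" "\<zero>\<^bsub>A'\<^esub>" "\<zero>\<^bsub>A'\<^esub>"] by simp
    ultimately have s'0: "s' \<zero>\<^bsub>A'\<^esub> = inc T (\<psi> b0)"
      using eq[of "\<one>\<^bsub>D\<^esub>" "\<zero>\<^bsub>A\<^esub>" "\<zero>\<^bsub>A\<^esub>"] by simp
    have "inc S b = s \<zero>\<^bsub>A\<^esub> \<oplus>\<^bsub>mid S\<^esub> inc S (r (inc S b))"
      using decomp[of "inc S b"] b by simp
    then have "b = b0 \<oplus>\<^bsub>B\<^esub> r (inc S b)" using b b0 by (simp flip: S.inc_add)
    then have "\<psi> b = \<psi> b0 \<oplus>\<^bsub>B'\<^esub> \<psi> (r (inc S b))"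
      using b b0(1) mod_hom_add[OF \<psi>, of b0 "r (inc S b)"] by simp
    then show ?thesis using b b0(1) by (simp add: \<alpha>_def s'0)
  qed
  ultimately show ?thesis using that by blast
qed

text \<open>The short five lemma over the identity of A. Two elements with equal image have equal
  projection, hence differ by some b with \<theta> b = \<theta> 0; for surjectivity, a lift of the
  projection is corrected by a preimage under \<theta>.\<close>

lemma five_lemma:
  assumes "short_exact D A B S" "short_exact D A B' T"
    and \<alpha>: "\<alpha> \<in> mod_hom D (mid S) (mid T)" and \<theta>: "bij_betw \<theta> (carrier B) (carrier B')"
    and inc: "\<And>b. b \<in> carrier B \<Longrightarrow> \<alpha> (inc S b) = inc T (\<theta> b)"
    and prj: "\<And>x. x \<in> carrier (mid S) \<Longrightarrow> prj T (\<alpha> x) = prj S x"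
  shows "\<alpha> \<in> mod_iso D (mid S) (mid T)"
proof -
  interpret S: exact_seq D A B S by unfold_locales fact
  interpret T: exact_seq D A B' T by unfold_locales fact
  have \<theta>_closed: "\<theta> b \<in> carrier B'" if "b \<in> carrier B" for b
    using \<theta> that by (auto simp: bij_betw_def)
  note [simp] = mod_hom_closed[OF \<alpha>] mod_hom_add[OF \<alpha>] inc prj \<theta>_closed
  have "inj_on \<alpha> (carrier (mid S))"
  proof (rule inj_onI)
    fix x y assume *: "x \<in> carrier (mid S)" "y \<in> carrier (mid S)" "\<alpha> x = \<alpha> y"
    then have "prj S x = prj S y" by (metis prj)
    then obtain b where b: "b \<in> carrier B" "x = y \<oplus>\<^bsub>mid S\<^esub> inc S b"
      using * by (auto elim: S.diffE)
    then have "inc T (\<theta> b) = \<zero>\<^bsub>mid T\<^esub>" using * by simp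
    moreover have "inc T (\<theta> \<zero>\<^bsub>B\<^esub>) = \<zero>\<^bsub>mid T\<^esub>"
      using mod_hom_zero[OF \<alpha>] inc[of "\<zero>\<^bsub>B\<^esub>"] S.G.left_module_axioms T.G.left_module_axioms by simp
    ultimately have "\<theta> b = \<theta> \<zero>\<^bsub>B\<^esub>" using b by (metis T.inc_eq_iff \<theta>_closed S.B.M.zero_closed)
    then have "b = \<zero>\<^bsub>B\<^esub>" using b \<theta> by (auto simp: bij_betw_def inj_on_eq_iff)
    then show "x = y" using b * by simp
  qed
  moreover have "\<exists>x\<in>carrier (mid S). \<alpha> x = y" if y: "y \<in> carrier (mid T)" for y
  proof -
    obtain x where x: "x \<in> carrier (mid S)" "prj S x = prj T y"
      using S.prj_surj T.prj_closed[OF y] by (metis imageE)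
    then obtain b' where b': "b' \<in> carrier B'" "y = \<alpha> x \<oplus>\<^bsub>mid T\<^esub> inc T b'"
      using y by (auto elim: T.diffE[of y "\<alpha> x"])
    then obtain b where "b \<in> carrier B" "b' = \<theta> b" using \<theta> by (auto simp: bij_betw_def)
    then show ?thesis using x b' by (intro bexI[of _ "x \<oplus>\<^bsub>mid S\<^esub> inc S b"]) simp_all
  qed
  ultimately show ?thesis using \<alpha> by (auto simp: mod_iso_def bij_betw_def)
qed

text \<open>Applying \<alpha> to the cocycle equation of s turns its B-term into the \<theta>-image.
  For \<theta> the identity this is invariance of cocycles under congruence; a general \<theta>
  covers quotients and pushouts.\<close>

lemma section_transport:
  assumes "ses_section D A B S s h" "short_exact D A B S"
    and \<alpha>: "\<alpha> \<in> mod_hom D (mid S) (mid T)"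
    and \<theta>: "\<And>b. b \<in> carrier B \<Longrightarrow> \<theta> b \<in> carrier B'"
    and inc: "\<And>b. b \<in> carrier B \<Longrightarrow> \<alpha> (inc S b) = inc T (\<theta> b)"
    and prj: "\<And>x. x \<in> carrier (mid S) \<Longrightarrow> prj T (\<alpha> x) = prj S x"
  shows "ses_section D A B' T (\<lambda>a. \<alpha> (s a)) (\<lambda>d a a'. \<theta> (h d a a'))"
proof -
  interpret S: exact_seq D A B S by unfold_locales fact
  note s = ses_sectionD[OF assms(1)] ses_section_cocycle[OF assms(1)]
  show ?thesis
    by (rule ses_sectionI)
       (simp_all add: s \<theta> prj mod_hom_closed[OF \<alpha>] S.G.left_module_axioms mod_hom_add[OF \<alpha>]
          flip: inc mod_hom_axpy[OF \<alpha>])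
qed

text \<open>A congruence transports a section without changing its cocycle. Conversely
  \<open>ses_map\<close> over two identities gives a morphism, and the short five lemma makes it an
  isomorphism.\<close>

lemma ses_cong_iff_cocycle:
  assumes S: "has_cocycle D A B S h" and T: "short_exact D A B T"
  shows "ses_cong D A B S T \<longleftrightarrow> has_cocycle D A B T h"
proof
  obtain s where s: "ses_section D A B S s h" using S by (auto simp: has_cocycle_def)
  note S_exact = has_cocycle_exact[OF S]
  interpret S: exact_seq D A B S by unfold_locales (rule S_exact)
  {
    assume "ses_cong D A B S T"
    then obtain \<alpha> where "\<alpha> \<in> mod_hom D (mid S) (mid T)"
      "\<And>b. b \<in> carrier B \<Longrightarrow> \<alpha> (inc S b) = inc T b"
      "\<And>x. x \<in> carrier (mid S) \<Longrightarrow> prj T (\<alpha> x) = prj S x"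
      by (auto simp: ses_cong_def mod_iso_def)
    then show "has_cocycle D A B T h"
      using section_transport[OF s S_exact, of \<alpha> T "\<lambda>b. b"] T by (auto intro: has_cocycleI)
  next
    assume "has_cocycle D A B T h"
    then obtain t where t: "ses_section D A B T t h" by (auto simp: has_cocycle_def)
    have id: "(\<lambda>x. x) \<in> mod_hom D A A" "(\<lambda>x. x) \<in> mod_hom D B B" by (auto simp: mod_hom_def)
    obtain \<alpha> where \<alpha>: "\<alpha> \<in> mod_hom D (mid S) (mid T)"
      "\<And>b. b \<in> carrier B \<Longrightarrow> \<alpha> (inc S b) = inc T b"
      "\<And>x. x \<in> carrier (mid S) \<Longrightarrow> prj T (\<alpha> x) = prj S x"
      by (rule ses_map[OF S_exact T s t id]) auto
    then have "\<alpha> \<in> mod_iso D (mid S) (mid T)"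
      by (intro five_lemma[OF S_exact T, of _ "\<lambda>b. b"]) (auto simp: bij_betw_def)
    then show "ses_cong D A B S T" using \<alpha> by (auto simp: ses_cong_def)
  }
qed

section \<open>Cohomology classes\<close>

text \<open>By \<open>ses_cong_iff_cocycle\<close> this is the congruence class of any extension
  with the cocycle h, so that elements of \<open>Ext1\<close> can be named by cochains.\<close>

definition cocycle_class ::
  "('d, 'z) ring_scheme \<Rightarrow> ('d, 'a) module \<Rightarrow> ('d, 'b) module \<Rightarrow> ('d \<Rightarrow> 'a \<Rightarrow> 'a \<Rightarrow> 'b)
    \<Rightarrow> ('d, 'a, 'b, 'a \<times> 'b) ses set"
  where "cocycle_class D A B h = {T. has_cocycle D A B T h}"

text \<open>Being realised by an extension stands in for the cocycle identities, so closure under an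
  operation is shown by constructing the corresponding extension.\<close>

definition cocycle ::
  "('d, 'z) ring_scheme \<Rightarrow> ('d, 'a) module \<Rightarrow> ('d, 'b) module \<Rightarrow> ('d \<Rightarrow> 'a \<Rightarrow> 'a \<Rightarrow> 'b) \<Rightarrow> bool"
  where "cocycle D A B h \<longleftrightarrow> cocycle_class D A B h \<noteq> {}"

lemma ext_class_eq: "has_cocycle D A B S h \<Longrightarrow> ext_class D A B S = cocycle_class D A B h"
  by (auto simp: ext_class_def cocycle_class_def ses_cong_iff_cocycle has_cocycle_exact)

text \<open>The middle module of S may have any type: \<open>ext_class_nonempty\<close> supplies a
  congruent extension on the product type, and that one has the same cocycle.\<close>

lemma cocycleI: "has_cocycle D A B S h \<Longrightarrow> cocycle D A B h"
  unfolding cocycle_def using ext_class_nonempty[OF has_cocycle_exact] by (metis ext_class_eq)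

lemma cocycleE:
  assumes "cocycle D A B h"
  obtains S :: "('d, 'a, 'b, 'a \<times> 'b) ses" where "has_cocycle D A B S h"
  using assms by (auto simp: cocycle_def cocycle_class_def)

lemma cocycle_closed:
  "\<lbrakk>cocycle D A B h; d \<in> carrier D; a \<in> carrier A; a' \<in> carrier A\<rbrakk> \<Longrightarrow> h d a a' \<in> carrier B"
  by (auto elim!: cocycleE simp: has_cocycle_closed)

lemma cocycle_cong:
  assumes "\<And>d a a'. \<lbrakk>d \<in> carrier D; a \<in> carrier A; a' \<in> carrier A\<rbrakk> \<Longrightarrow> h d a a' = h' d a a'"
  shows "cocycle D A B h \<longleftrightarrow> cocycle D A B h'"
  by (simp add: cocycle_def cocycle_class_def has_cocycle_cong[of D A h h', OF assms])

lemma cocycle_class_cong: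
  assumes "\<And>d a a'. \<lbrakk>d \<in> carrier D; a \<in> carrier A; a' \<in> carrier A\<rbrakk> \<Longrightarrow> h d a a' = h' d a a'"
  shows "cocycle_class D A B h = cocycle_class D A B h'"
  by (simp add: cocycle_class_def has_cocycle_cong[of D A h h', OF assms])

text \<open>If the classes agree, a common member has both functions as cocycles, which
  \<open>cocycle_unique\<close> compares. If the functions are cohomologous,
  \<open>cocycle_change\<close> gives both to one extension.\<close>

lemma cocycle_class_eq_iff:
  fixes A :: "('d, 'a) module" and B :: "('d, 'b) module"
  assumes h: "cocycle D A B h" and h': "cocycle D A B h'"
  shows "cocycle_class D A B h = cocycle_class D A B h' \<longleftrightarrow> cohomologous D A B h h'"
proof
  assume eq: "cocycle_class D A B h = cocycle_class D A B h'"
  obtain S :: "('d, 'a, 'b, 'a \<times> 'b) ses" where S: "has_cocycle D A B S h" using h by (rule cocycleE)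
  have S': "has_cocycle D A B S h'" using S eq by (auto simp: cocycle_class_def)
  interpret exact_seq D A B S by unfold_locales (use S in \<open>rule has_cocycle_exact\<close>)
  show "cohomologous D A B h h'" using S S' by (rule cocycle_unique)
next
  assume coh: "cohomologous D A B h h'"
  obtain S :: "('d, 'a, 'b, 'a \<times> 'b) ses" where S: "has_cocycle D A B S h" using h by (rule cocycleE)
  then have "has_cocycle D A B S h'"
    using coh cocycle_closed[OF h'] by (rule cocycle_change)
  then show "cocycle_class D A B h = cocycle_class D A B h'"
    using ext_class_eq S by metis
qed

lemma carrier_Ext1:
  fixes A :: "('d, 'a) module" and B :: "('d, 'b) module"
  shows "carrier (Ext1 D A B) = cocycle_class D A B ` {h. cocycle D A B h}"
proof (intro equalityI subsetI)
  fix c assume "c \<in> carrier (Ext1 D A B)"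
  then obtain S :: "('d, 'a, 'b, 'a \<times> 'b) ses" where S: "short_exact D A B S" "c = ext_class D A B S"
    by (auto simp: Ext1_def)
  interpret exact_seq D A B S by unfold_locales (rule S)
  obtain h where h: "has_cocycle D A B S h" using ex_cocycle by blast
  then show "c \<in> cocycle_class D A B ` {h. cocycle D A B h}"
    using S(2) ext_class_eq[OF h] cocycleI[OF h] by blast
next
  fix c assume "c \<in> cocycle_class D A B ` {h. cocycle D A B h}"
  then obtain h where h: "cocycle D A B h" "c = cocycle_class D A B h" by blast
  from h(1) obtain S :: "('d, 'a, 'b, 'a \<times> 'b) ses" where S: "has_cocycle D A B S h" by (rule cocycleE)
  then show "c \<in> carrier (Ext1 D A B)"
    using ext_class_eq[OF S] has_cocycle_exact[OF S] h(2) by (auto simp: Ext1_def intro!: image_eqI[of _ _ S])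
qed

section \<open>Constructions on cocycles\<close>

lemma mod_hom_id: "(\<lambda>x. x) \<in> mod_hom D A A"
  by (auto simp: mod_hom_def)

text \<open>The section a -> (a, s(\<phi> a)) of the fibre product has the cocycle h(d, \<phi> a,
  \<phi> a'), because \<phi> is linear.\<close>

lemma has_cocycle_pullback:
  assumes S: "has_cocycle D A B S h" and A': "left_module D A'" and \<phi>: "\<phi> \<in> mod_hom D A' A"
  shows "has_cocycle D A' B (pullback_ses A' \<phi> S) (\<lambda>d a a'. h d (\<phi> a) (\<phi> a'))"
proof -
  interpret S: exact_seq D A B S by unfold_locales (use S in \<open>rule has_cocycle_exact\<close>)
  interpret A': lmod D A' using A' by (rule lmodI)
  obtain s where s: "ses_section D A B S s h" using S by (auto simp: has_cocycle_def)
  note [simp] = mod_hom_closed[OF \<phi>] mod_hom_axpy[OF \<phi> A'] mod_hom_zero[OF \<phi> A'] ses_sectionD[OF s]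
    ses_section_cocycle[OF s] S.A.left_module_axioms
  let ?C = "{(a, g). a \<in> carrier A' \<and> g \<in> carrier (mid S) \<and> \<phi> a = prj S g}"
  let ?P = "prod_mod A' (mid S)\<lparr>carrier := ?C\<rparr>"
  interpret AG: lmod D "prod_mod A' (mid S)"
    by (intro lmodI left_module_prod_mod A' S.G.left_module_axioms)
  have "(\<zero>\<^bsub>A'\<^esub>, \<zero>\<^bsub>mid S\<^esub>) \<in> ?C" by simp
  then have "?C \<noteq> {}" by blast
  then have P: "left_module D ?P"
    by (intro AG.left_module_of_closed_subset) auto
  have "short_exact D A' B (pullback_ses A' \<phi> S)"
  proof (rule short_exactI)
    show "inc (pullback_ses A' \<phi> S) \<in> mod_hom D B (mid (pullback_ses A' \<phi> S))"
      using P by (intro mod_homI) (simp_all add: pullback_ses_def S.B.left_module_axioms)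
    show "prj (pullback_ses A' \<phi> S) \<in> mod_hom D (mid (pullback_ses A' \<phi> S)) A'"
      using P by (intro mod_homI) (auto simp: pullback_ses_def A')
    show "\<exists>x\<in>carrier (mid (pullback_ses A' \<phi> S)). prj (pullback_ses A' \<phi> S) x = a"
      if "a \<in> carrier A'" for a
      using that by (intro bexI[of _ "(a, s (\<phi> a))"]) (simp_all add: pullback_ses_def)
    show "\<exists>b\<in>carrier B. x = inc (pullback_ses A' \<phi> S) b"
      if "x \<in> carrier (mid (pullback_ses A' \<phi> S))" "prj (pullback_ses A' \<phi> S) x = \<zero>\<^bsub>A'\<^esub>" for x
      using that by (auto simp: pullback_ses_def elim!: S.kernelE)
  qed (use P in \<open>auto simp: pullback_ses_def A' S.B.left_module_axioms\<close>)
  moreover have "ses_section D A' B (pullback_ses A' \<phi> S) (\<lambda>a. (a, s (\<phi> a)))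
      (\<lambda>d a a'. h d (\<phi> a) (\<phi> a'))"
    by (rule ses_sectionI) (simp_all add: pullback_ses_def)
  ultimately show ?thesis by (rule has_cocycleI)
qed

text \<open>The fibre product over A, seen as an extension of A by \<open>prod_mod B C\<close> with
  cocycle (h, k). Dividing it by the antidiagonal gives the Baer sum; it also hosts the comparison
  of E, S and F in the action on \<open>ExtMod\<close>.\<close>

definition fibre_ses ::
  "('d, 'a, 'b, 'g) ses \<Rightarrow> ('d, 'a, 'c, 'h) ses \<Rightarrow> ('d, 'a, 'b \<times> 'c, 'g \<times> 'h) ses"
  where "fibre_ses S T =
    \<lparr>mid = prod_mod (mid S) (mid T)
       \<lparr>carrier := {(g, h). g \<in> carrier (mid S) \<and> h \<in> carrier (mid T) \<and> prj S g = prj T h}\<rparr>,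
     inc = (\<lambda>(b, c). (inc S b, inc T c)), prj = (\<lambda>(g, h). prj S g)\<rparr>"

lemma fibre_ses:
  assumes "short_exact D A B S" "short_exact D A C T"
    and s: "ses_section D A B S s h" and t: "ses_section D A C T t k"
  shows short_exact_fibre_ses: "short_exact D A (prod_mod B C) (fibre_ses S T)"
    and section_fibre_ses: "ses_section D A (prod_mod B C) (fibre_ses S T)
      (\<lambda>a. (s a, t a)) (\<lambda>d a a'. (h d a a', k d a a'))"
proof -
  interpret S: exact_seq D A B S by unfold_locales fact
  interpret T: exact_seq D A C T by unfold_locales fact
  note [simp] = ses_sectionD[OF s] ses_section_cocycle[OF s] ses_sectionD[OF t] ses_section_cocycle[OF t]
  interpret BC: lmod D "prod_mod B C"
    by (intro lmodI left_module_prod_mod S.B.left_module_axioms T.B.left_module_axioms)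
  interpret ST: lmod D "prod_mod (mid S) (mid T)"
    by (intro lmodI left_module_prod_mod S.G.left_module_axioms T.G.left_module_axioms)
  let ?C = "{(x, y). x \<in> carrier (mid S) \<and> y \<in> carrier (mid T) \<and> prj S x = prj T y}"
  have "(\<zero>\<^bsub>mid S\<^esub>, \<zero>\<^bsub>mid T\<^esub>) \<in> ?C" by simp
  then have "?C \<noteq> {}" by blast
  then have P: "left_module D (prod_mod (mid S) (mid T)\<lparr>carrier := ?C\<rparr>)"
    by (intro ST.left_module_of_closed_subset) auto
  show "short_exact D A (prod_mod B C) (fibre_ses S T)"
  proof (rule short_exactI)
    show "inc (fibre_ses S T) \<in> mod_hom D (prod_mod B C) (mid (fibre_ses S T))"
      using P by (intro mod_homI) (auto simp: fibre_ses_def BC.left_module_axioms)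
    show "prj (fibre_ses S T) \<in> mod_hom D (mid (fibre_ses S T)) A"
      using P by (intro mod_homI) (auto simp: fibre_ses_def S.A.left_module_axioms)
    show "\<exists>x\<in>carrier (mid (fibre_ses S T)). prj (fibre_ses S T) x = a" if "a \<in> carrier A" for a
      using that by (intro bexI[of _ "(s a, t a)"]) (simp_all add: fibre_ses_def)
    show "\<exists>b\<in>carrier (prod_mod B C). x = inc (fibre_ses S T) b"
      if x: "x \<in> carrier (mid (fibre_ses S T))" "prj (fibre_ses S T) x = \<zero>\<^bsub>A\<^esub>" for x
    proof -
      obtain g g' where g: "x = (g, g')" "g \<in> carrier (mid S)" "g' \<in> carrier (mid T)"
        "prj S g = \<zero>\<^bsub>A\<^esub>" "prj T g' = \<zero>\<^bsub>A\<^esub>"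
        using x by (auto simp: fibre_ses_def)
      obtain b where "b \<in> carrier B" "g = inc S b" using g by (auto elim: S.kernelE)
      moreover obtain c where "c \<in> carrier C" "g' = inc T c" using g by (auto elim: T.kernelE)
      ultimately show ?thesis using g(1) by (intro bexI[of _ "(b, c)"]) (simp_all add: fibre_ses_def)
    qed
  qed (use P in \<open>auto simp: fibre_ses_def BC.left_module_axioms S.A.left_module_axioms\<close>)
  show "ses_section D A (prod_mod B C) (fibre_ses S T)
      (\<lambda>a. (s a, t a)) (\<lambda>d a a'. (h d a a', k d a a'))"
    by (rule ses_sectionI) (simp_all add: fibre_ses_def)
qed

text \<open>
  Dividing the middle module by the image of the kernel of \<open>\<psi>\<close>: this covers the Baer sum, the
  pushout and the passage from \<open>E\<close> to \<open>E/E2\<close>.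
\<close>

lemma quot_ses:
  assumes "short_exact D A B S" and B': "left_module D B'"
    and \<psi>: "\<psi> \<in> mod_hom D B B'"
    and H: "H = inc S ` {b \<in> carrier B. \<psi> b = \<zero>\<^bsub>B'\<^esub>}"
    and T_mid: "mid T = quot_mod (mid S) H"
    and T_inc': "\<And>b'. b' \<in> carrier B' \<Longrightarrow>
      \<exists>b\<in>carrier B. \<psi> b = b' \<and> inc T b' = H +>\<^bsub>mid S\<^esub> inc S b"
    and T_prj: "\<And>x. x \<in> carrier (mid S) \<Longrightarrow> prj T (H +>\<^bsub>mid S\<^esub> x) = prj S x"
  shows short_exact_quot_ses: "short_exact D A B' T"
    and cocycle_quot_ses: "has_cocycle D A B S h \<Longrightarrow> has_cocycle D A B' T (\<lambda>d a a'. \<psi> (h d a a'))"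
proof -
  interpret S: exact_seq D A B S by unfold_locales fact
  interpret B': lmod D B' using B' by (rule lmodI)
  note [simp] = mod_hom_closed[OF \<psi>] mod_hom_axpy[OF \<psi> S.B.left_module_axioms] mod_hom_add[OF \<psi>]
    mod_hom_zero[OF \<psi> S.B.left_module_axioms B']
  have H_sub: "submodule H D (mid S)"
  proof (rule S.G.submodule_of_closed_subset)
    fix d x y assume "d \<in> carrier D" "x \<in> H" "y \<in> H"
    then obtain b b' where "b \<in> carrier B" "b' \<in> carrier B" "x = inc S b" "y = inc S b'"
      "\<psi> b = \<zero>\<^bsub>B'\<^esub>" "\<psi> b' = \<zero>\<^bsub>B'\<^esub>" unfolding H by blast
    then show "axpy (mid S) d x y \<in> H"
      using \<open>d \<in> carrier D\<close> unfolding H by (intro image_eqI[of _ _ "axpy B d b b'"]) simp_all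
  qed (auto simp: H intro!: exI[of _ "\<zero>\<^bsub>B\<^esub>"])
  interpret Q: quotient_module D "mid S" H
    by (intro quotient_module.intro quotient_module_axioms.intro S.G.lmod_axioms H_sub)
  have eq_iff: "H +>\<^bsub>mid S\<^esub> x = H +>\<^bsub>mid S\<^esub> y \<longleftrightarrow>
      (\<exists>b\<in>carrier B. \<psi> b = \<zero>\<^bsub>B'\<^esub> \<and> x = inc S b \<oplus>\<^bsub>mid S\<^esub> y)"
    if "x \<in> carrier (mid S)" "y \<in> carrier (mid S)" for x y
  proof -
    have "x \<ominus>\<^bsub>mid S\<^esub> y \<in> H \<longleftrightarrow> (\<exists>z\<in>H. x = z \<oplus>\<^bsub>mid S\<^esub> y)"
    proof
      assume "x \<ominus>\<^bsub>mid S\<^esub> y \<in> H"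
      moreover have "x = (x \<ominus>\<^bsub>mid S\<^esub> y) \<oplus>\<^bsub>mid S\<^esub> y"
        using that by (simp add: a_minus_def S.G.M.a_assoc S.G.M.l_neg)
      ultimately show "\<exists>z\<in>H. x = z \<oplus>\<^bsub>mid S\<^esub> y" by blast
    next
      assume "\<exists>z\<in>H. x = z \<oplus>\<^bsub>mid S\<^esub> y"
      then obtain z where z: "z \<in> H" "x = z \<oplus>\<^bsub>mid S\<^esub> y" by blast
      moreover have "z \<in> carrier (mid S)" using z(1) by (rule Q.a_Hcarr)
      ultimately show "x \<ominus>\<^bsub>mid S\<^esub> y \<in> H"
        using that by (simp add: a_minus_def S.G.M.a_assoc S.G.M.r_neg)
    qed
    then show ?thesis unfolding Q.coset_eq_iff[OF that] unfolding H by blast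
  qed
  have carrier_T: "carrier (mid T) = (\<lambda>x. H +>\<^bsub>mid S\<^esub> x) ` carrier (mid S)"
    by (simp add: T_mid Q.carrier_quot)
  have B'E: "\<exists>c\<in>carrier B. \<psi> c = b" if "b \<in> carrier B'" for b
    using T_inc'[OF that] by blast
  \<comment> \<open>The hypothesis provides the formula for only one preimage of each b'. Two
    preimages differ by some e with \<psi> e = 0, and inc S e lies in H, so the coset does not
    depend on the preimage.\<close>
  have T_inc: "inc T (\<psi> b) = H +>\<^bsub>mid S\<^esub> inc S b" if b: "b \<in> carrier B" for b
  proof -
    obtain c where c: "c \<in> carrier B" "\<psi> c = \<psi> b" "inc T (\<psi> b) = H +>\<^bsub>mid S\<^esub> inc S c"
      using T_inc'[of "\<psi> b"] b by auto
    let ?e = "c \<oplus>\<^bsub>B\<^esub> \<ominus>\<^bsub>B\<^esub> b"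
    have "\<psi> c = \<psi> ?e \<oplus>\<^bsub>B'\<^esub> \<psi> b" using b c(1) mod_hom_add[OF \<psi>, of ?e b]
      by (simp add: S.B.M.a_assoc S.B.M.l_neg del: mod_hom_add[OF \<psi>])
    then have "\<psi> ?e = \<zero>\<^bsub>B'\<^esub>" using b c(1,2) by (simp del: mod_hom_add[OF \<psi>])
    moreover have "inc S c = inc S ?e \<oplus>\<^bsub>mid S\<^esub> inc S b"
      using b c(1) by (simp add: S.B.M.a_assoc S.B.M.l_neg flip: S.inc_add)
    moreover have "?e \<in> carrier B" using b c(1) by simp
    ultimately have "\<exists>e\<in>carrier B. \<psi> e = \<zero>\<^bsub>B'\<^esub> \<and> inc S c = inc S e \<oplus>\<^bsub>mid S\<^esub> inc S b"
      by blast
    then have "H +>\<^bsub>mid S\<^esub> inc S c = H +>\<^bsub>mid S\<^esub> inc S b"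
      using b c(1) by (subst eq_iff) simp_all
    then show ?thesis using c(3) by simp
  qed
  have cls: "(\<lambda>x. H +>\<^bsub>mid S\<^esub> x) \<in> mod_hom D (mid S) (mid T)"
    using Q.left_module_quot S.G.left_module_axioms
    by (intro mod_homI) (auto simp: T_mid Q.carrier_quot Q.axpy_quot)
  have T: "left_module D (mid T)" using Q.left_module_quot by (simp add: T_mid)
  show T_exact: "short_exact D A B' T"
  proof (rule short_exactI)
    show "inc T \<in> mod_hom D B' (mid T)"
    proof (rule mod_homI[OF B' T])
      show "inc T x \<in> carrier (mid T)" if "x \<in> carrier B'" for x
        using B'E[OF that] by (auto simp: T_inc carrier_T)
      fix d x y assume d: "d \<in> carrier D" and "x \<in> carrier B'" "y \<in> carrier B'"
      then obtain b c where bc: "b \<in> carrier B" "c \<in> carrier B" "x = \<psi> b" "y = \<psi> c"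
        using B'E by metis
      then have "axpy B' d x y = \<psi> (axpy B d b c)" using d by simp
      then show "inc T (axpy B' d x y) = axpy (mid T) d (inc T x) (inc T y)"
        using bc d by (simp add: T_inc Q.axpy_quot T_mid del: mod_hom_axpy[OF \<psi> S.B.left_module_axioms])
    qed
    show "prj T \<in> mod_hom D (mid T) A"
      using T by (intro mod_homI) (auto simp: T_mid Q.carrier_quot Q.axpy_quot T_prj S.A.left_module_axioms)
    show "b = b'" if b: "b \<in> carrier B'" "b' \<in> carrier B'" "inc T b = inc T b'" for b b'
    proof -
      obtain c c' where c: "c \<in> carrier B" "c' \<in> carrier B" "b = \<psi> c" "b' = \<psi> c'"
        using B'E b by metis
      then obtain e where e: "e \<in> carrier B" "\<psi> e = \<zero>\<^bsub>B'\<^esub>" "inc S c = inc S e \<oplus>\<^bsub>mid S\<^esub> inc S c'"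
        using b(3) eq_iff[of "inc S c" "inc S c'"] by (auto simp: T_inc)
      then have "c = e \<oplus>\<^bsub>B\<^esub> c'" using c by (simp flip: S.inc_add)
      then show ?thesis using c e by simp
    qed
    show "\<exists>x\<in>carrier (mid T). prj T x = a" if "a \<in> carrier A" for a
      using that unfolding S.prj_surj[symmetric] by (auto simp: carrier_T T_prj)
    show "prj T (inc T b) = \<zero>\<^bsub>A\<^esub>" if "b \<in> carrier B'" for b
      using B'E[OF that] by (auto simp: T_inc T_prj)
    show "\<exists>b\<in>carrier B'. x = inc T b" if x: "x \<in> carrier (mid T)" "prj T x = \<zero>\<^bsub>A\<^esub>" for x
    proof -
      obtain g where g: "x = H +>\<^bsub>mid S\<^esub> g" "g \<in> carrier (mid S)"
        using x(1) unfolding carrier_T by (rule imageE)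
      then have "prj S g = \<zero>\<^bsub>A\<^esub>" using x(2) T_prj[of g] by simp
      with g(2) obtain b where "b \<in> carrier B" "g = inc S b" by (rule S.kernelE)
      then show ?thesis using g by (intro bexI[of _ "\<psi> b"]) (simp_all add: T_inc)
    qed
  qed (use T B' S.A.left_module_axioms in simp_all)
  assume "has_cocycle D A B S h"
  then obtain s where "ses_section D A B S s h" by (auto simp: has_cocycle_def)
  then have "ses_section D A B' T (\<lambda>a. H +>\<^bsub>mid S\<^esub> s a) (\<lambda>d a a'. \<psi> (h d a a'))"
    using S.exact cls by (rule section_transport) (simp_all add: T_inc T_prj)
  with T_exact show "has_cocycle D A B' T (\<lambda>d a a'. \<psi> (h d a a'))" by (rule has_cocycleI)
qed

text \<open>Projections out of quotients are defined by \<open>the_elem\<close> of an image. The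
  image is a singleton as soon as f is constant on the coset, and h0 ensures that the coset is
  nonempty.\<close>

lemma the_elem_image_coset:
  assumes "h0 \<in> H" "\<And>h. h \<in> H \<Longrightarrow> f (h \<oplus>\<^bsub>G\<^esub> x) = c"
  shows "the_elem (f ` (H +>\<^bsub>G\<^esub> x)) = c"
proof -
  have "f ` (H +>\<^bsub>G\<^esub> x) = {c}"
    using assms by (auto simp: mem_a_r_coset intro!: image_eqI[of _ _ "h0 \<oplus>\<^bsub>G\<^esub> x"])
  then show ?thesis by simp
qed

text \<open>The antidiagonal copy of B is the image of the kernel of addition B x B -> B. Dividing
  the fibre product, whose cocycle is (h, k), by it therefore applies addition to the
  cocycle.\<close>

lemma has_cocycle_baer_sum:
  assumes S: "has_cocycle D A B S h" and T: "has_cocycle D A B T k"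
  shows "has_cocycle D A B (baer_sum B S T) (\<lambda>d a a'. h d a a' \<oplus>\<^bsub>B\<^esub> k d a a')"
proof -
  interpret S: exact_seq D A B S by unfold_locales (use S in \<open>rule has_cocycle_exact\<close>)
  interpret T: exact_seq D A B T by unfold_locales (use T in \<open>rule has_cocycle_exact\<close>)
  obtain s t where s: "ses_section D A B S s h" and t: "ses_section D A B T t k"
    using S T by (auto simp: has_cocycle_def)
  let ?F = "fibre_ses S T" and ?\<psi> = "\<lambda>(b, b'). b \<oplus>\<^bsub>B\<^esub> b'"
  note F = fibre_ses[OF S.exact T.exact s t]
  interpret F: exact_seq D A "prod_mod B B" ?F by unfold_locales (rule F)
  let ?H = "(\<lambda>b. (inc S b, \<ominus>\<^bsub>mid T\<^esub> inc T b)) ` carrier B"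
  have T_minus: "\<ominus>\<^bsub>mid T\<^esub> inc T b = inc T (\<ominus>\<^bsub>B\<^esub> b)" if "b \<in> carrier B" for b
    using that by (simp add: S.B.minus_axpy T.G.minus_axpy)
  have \<psi>: "?\<psi> \<in> mod_hom D (prod_mod B B) B"
    by (rule mod_homI) (auto simp: F.B.left_module_axioms S.B.left_module_axioms S.B.axpy_add)
  have "?H = inc ?F ` {b \<in> carrier (prod_mod B B). ?\<psi> b = \<zero>\<^bsub>B\<^esub>}"
  proof -
    have "{b \<in> carrier (prod_mod B B). ?\<psi> b = \<zero>\<^bsub>B\<^esub>} = (\<lambda>b. (b, \<ominus>\<^bsub>B\<^esub> b)) ` carrier B"
      by (auto simp: image_iff S.B.M.r_neg intro: S.B.M.minus_equality[symmetric])
    then show ?thesis by (simp add: image_image fibre_ses_def T_minus cong: image_cong_simp)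
  qed
  moreover have "mid (baer_sum B S T) = quot_mod (mid ?F) ?H"
    by (simp add: baer_sum_def fibre_ses_def Let_def)
  moreover have "\<exists>b\<in>carrier (prod_mod B B). ?\<psi> b = b' \<and>
      inc (baer_sum B S T) b' = ?H +>\<^bsub>mid ?F\<^esub> inc ?F b" if "b' \<in> carrier B" for b'
    using that by (intro bexI[of _ "(b', \<zero>\<^bsub>B\<^esub>)"]) (simp_all add: baer_sum_def fibre_ses_def Let_def)
  moreover have "prj (baer_sum B S T) (?H +>\<^bsub>mid ?F\<^esub> x) = prj ?F x"
    if "x \<in> carrier (mid ?F)" for x
    using that S.B.M.zero_closed
    by (auto simp: baer_sum_def fibre_ses_def Let_def intro!: the_elem_image_coset)
  ultimately show ?thesis
    using cocycle_quot_ses[OF F(1) S.B.left_module_axioms \<psi>, of ?H "baer_sum B S T" "\<lambda>d a a'. (h d a a', k d a a')"]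
      F by (auto intro: has_cocycleI)
qed

text \<open>B' x mid S is an extension of A by B' x B with cocycle (0, h), and the submodule divided
  out is the image of the kernel of (b', b) -> b' + \<psi> b. So \<open>quot_ses\<close> yields the
  cocycle 0 + \<psi> h.\<close>

lemma has_cocycle_pushout:
  assumes S: "has_cocycle D A B S h" and B': "left_module D B'" and \<psi>: "\<psi> \<in> mod_hom D B B'"
  shows "has_cocycle D A B' (pushout_ses B B' \<psi> S) (\<lambda>d a a'. \<psi> (h d a a'))"
proof -
  interpret S: exact_seq D A B S by unfold_locales (use S in \<open>rule has_cocycle_exact\<close>)
  interpret B': lmod D B' using B' by (rule lmodI)
  obtain s where s: "ses_section D A B S s h" using S by (auto simp: has_cocycle_def)
  note [simp] = mod_hom_closed[OF \<psi>] mod_hom_axpy[OF \<psi> S.B.left_module_axioms]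
    ses_sectionD[OF s] ses_section_cocycle[OF s]
  let ?F = "\<lparr>mid = prod_mod B' (mid S), inc = (\<lambda>(b', b). (b', inc S b)), prj = (\<lambda>(b', g). prj S g)\<rparr>"
  let ?\<psi> = "\<lambda>(b', b). b' \<oplus>\<^bsub>B'\<^esub> \<psi> b"
  have mods: "left_module D (prod_mod B' B)" "left_module D (prod_mod B' (mid S))"
    by (intro left_module_prod_mod B' S.B.left_module_axioms S.G.left_module_axioms)+
  have F: "short_exact D A (prod_mod B' B) ?F"
  proof (rule short_exactI)
    show "inc ?F \<in> mod_hom D (prod_mod B' B) (mid ?F)"
      using mods by (intro mod_homI) auto
    show "prj ?F \<in> mod_hom D (mid ?F) A"
      using mods by (intro mod_homI) (auto simp: S.A.left_module_axioms)
    show "\<exists>x\<in>carrier (mid ?F). prj ?F x = a" if "a \<in> carrier A" for a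
      using that by (intro bexI[of _ "(\<zero>\<^bsub>B'\<^esub>, s a)"]) simp_all
    show "\<exists>b\<in>carrier (prod_mod B' B). x = inc ?F b"
      if "x \<in> carrier (mid ?F)" "prj ?F x = \<zero>\<^bsub>A\<^esub>" for x
      using that by (auto elim!: S.kernelE)
  qed (use mods in \<open>auto simp: S.A.left_module_axioms\<close>)
  have F_section: "ses_section D A (prod_mod B' B) ?F (\<lambda>a. (\<zero>\<^bsub>B'\<^esub>, s a)) (\<lambda>d a a'. (\<zero>\<^bsub>B'\<^esub>, h d a a'))"
    by (rule ses_sectionI) simp_all
  have \<psi>': "?\<psi> \<in> mod_hom D (prod_mod B' B) B'"
    by (rule mod_homI) (auto simp: mods B' B'.axpy_add)
  let ?H = "(\<lambda>b. (\<psi> b, \<ominus>\<^bsub>mid S\<^esub> inc S b)) ` carrier B"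
  have \<psi>_minus: "\<psi> (\<ominus>\<^bsub>B\<^esub> b) = \<ominus>\<^bsub>B'\<^esub> \<psi> b" if "b \<in> carrier B" for b
    using that mod_hom_zero[OF \<psi> S.B.left_module_axioms B'] by (simp add: S.B.minus_axpy B'.minus_axpy)
  have S_minus: "\<ominus>\<^bsub>mid S\<^esub> inc S b = inc S (\<ominus>\<^bsub>B\<^esub> b)" if "b \<in> carrier B" for b
    using that by (simp add: S.B.minus_axpy S.G.minus_axpy)
  have "?H = inc ?F ` {b \<in> carrier (prod_mod B' B). ?\<psi> b = \<zero>\<^bsub>B'\<^esub>}"
  proof -
    have "{b \<in> carrier (prod_mod B' B). ?\<psi> b = \<zero>\<^bsub>B'\<^esub>} = (\<lambda>b. (\<psi> b, \<ominus>\<^bsub>B\<^esub> b)) ` carrier B"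
    proof (intro equalityI subsetI)
      fix p assume "p \<in> {b \<in> carrier (prod_mod B' B). ?\<psi> b = \<zero>\<^bsub>B'\<^esub>}"
      then obtain b' b where p: "p = (b', b)" "b' \<in> carrier B'" "b \<in> carrier B" "b' \<oplus>\<^bsub>B'\<^esub> \<psi> b = \<zero>\<^bsub>B'\<^esub>"
        by auto
      then have "b' = \<psi> (\<ominus>\<^bsub>B\<^esub> b)" by (simp add: \<psi>_minus B'.M.minus_equality)
      then show "p \<in> (\<lambda>b. (\<psi> b, \<ominus>\<^bsub>B\<^esub> b)) ` carrier B"
        using p by (intro image_eqI[of _ _ "\<ominus>\<^bsub>B\<^esub> b"]) simp_all
    qed (auto simp: \<psi>_minus B'.M.r_neg)
    then show ?thesis by (simp add: image_image S_minus cong: image_cong_simp)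
  qed
  moreover have "mid (pushout_ses B B' \<psi> S) = quot_mod (mid ?F) ?H"
    by (simp add: pushout_ses_def Let_def)
  moreover have "\<exists>b\<in>carrier (prod_mod B' B). ?\<psi> b = b' \<and>
      inc (pushout_ses B B' \<psi> S) b' = ?H +>\<^bsub>mid ?F\<^esub> inc ?F b" if "b' \<in> carrier B'" for b'
    using that mod_hom_zero[OF \<psi> S.B.left_module_axioms B']
    by (intro bexI[of _ "(b', \<zero>\<^bsub>B\<^esub>)"]) (simp_all add: pushout_ses_def Let_def)
  moreover have "prj (pushout_ses B B' \<psi> S) (?H +>\<^bsub>mid ?F\<^esub> x) = prj ?F x"
    if "x \<in> carrier (mid ?F)" for x
    using that S.B.M.zero_closed
    by (auto simp: pushout_ses_def Let_def S_minus intro!: the_elem_image_coset)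
  ultimately have "has_cocycle D A B' (pushout_ses B B' \<psi> S) (\<lambda>d a a'. ?\<psi> (\<zero>\<^bsub>B'\<^esub>, h d a a'))"
    using cocycle_quot_ses[OF F B' \<psi>', of ?H "pushout_ses B B' \<psi> S" "\<lambda>d a a'. (\<zero>\<^bsub>B'\<^esub>, h d a a')"]
      has_cocycleI[OF F F_section] by simp
  then show ?thesis by (subst has_cocycle_cong) simp_all
qed

lemma has_cocycle_split:
  assumes A: "left_module D A" and B: "left_module D B"
  shows "has_cocycle D A B (split_ses A B) (\<lambda>_ _ _. \<zero>\<^bsub>B\<^esub>)"
proof -
  interpret A: lmod D A using A by (rule lmodI)
  interpret B: lmod D B using B by (rule lmodI)
  note AB = left_module_prod_mod[OF A B]
  have "short_exact D A B (split_ses A B)"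
  proof (rule short_exactI)
    show "inc (split_ses A B) \<in> mod_hom D B (mid (split_ses A B))"
      using A B AB by (intro mod_homI) (auto simp: split_ses_def)
    show "prj (split_ses A B) \<in> mod_hom D (mid (split_ses A B)) A"
      using A B AB by (intro mod_homI) (auto simp: split_ses_def)
    show "\<exists>x\<in>carrier (mid (split_ses A B)). prj (split_ses A B) x = a" if "a \<in> carrier A" for a
      using that by (intro bexI[of _ "(a, \<zero>\<^bsub>B\<^esub>)"]) (simp_all add: split_ses_def)
  qed (use A B AB in \<open>auto simp: split_ses_def\<close>)
  moreover have "ses_section D A B (split_ses A B) (\<lambda>a. (a, \<zero>\<^bsub>B\<^esub>)) (\<lambda>_ _ _. \<zero>\<^bsub>B\<^esub>)"
    by (rule ses_sectionI) (simp_all add: split_ses_def)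
  ultimately show ?thesis by (rule has_cocycleI)
qed

section \<open>The group \<open>Ext1\<close> and its functoriality in terms of cocycles\<close>

lemma cocycle_pullback:
  assumes "cocycle D A B h" "left_module D A'" "\<phi> \<in> mod_hom D A' A"
  shows "cocycle D A' B (\<lambda>d a a'. h d (\<phi> a) (\<phi> a'))"
  using assms by (auto elim!: cocycleE intro: cocycleI has_cocycle_pullback)

lemma cocycle_pushout:
  assumes "cocycle D A B h" "left_module D B'" "\<psi> \<in> mod_hom D B B'"
  shows "cocycle D A B' (\<lambda>d a a'. \<psi> (h d a a'))"
  using assms by (auto elim!: cocycleE intro: cocycleI has_cocycle_pushout)

lemma cocycle_add:
  assumes "cocycle D A B h" "cocycle D A B k"
  shows "cocycle D A B (\<lambda>d a a'. h d a a' \<oplus>\<^bsub>B\<^esub> k d a a')"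
  using assms by (auto elim!: cocycleE intro: cocycleI has_cocycle_baer_sum)

lemma cocycle_zero:
  assumes "left_module D A" "left_module D B"
  shows "cocycle D A B (\<lambda>_ _ _. \<zero>\<^bsub>B\<^esub>)"
  using has_cocycle_split[OF assms] by (rule cocycleI)

text \<open>The negative of an extension is its pushout along b -> -b.\<close>

lemma cocycle_minus:
  assumes "cocycle D A B h" "left_module D B"
  shows "cocycle D A B (\<lambda>d a a'. \<ominus>\<^bsub>B\<^esub> h d a a')"
  using cocycle_pushout[OF assms(1,2) mod_hom_minus[OF mod_hom_id assms(2,2)]] .

text \<open>\<open>ext_pullback\<close> is a union over all representatives. Each of them has the
  cocycle h and contributes the same class, and there is at least one. Pushout and product are
  handled alike.\<close>

lemma ext_pullback_class:
  fixes A :: "('d, 'a) module" and B :: "('d, 'b) module"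
  assumes h: "cocycle D A B h" and "left_module D A'" "\<phi> \<in> mod_hom D A' A"
  shows "ext_pullback D A' B \<phi> (cocycle_class D A B h) =
    cocycle_class D A' B (\<lambda>d a a'. h d (\<phi> a) (\<phi> a'))"
proof -
  have "ext_class D A' B (pullback_ses A' \<phi> S) = cocycle_class D A' B (\<lambda>d a a'. h d (\<phi> a) (\<phi> a'))"
    if "S \<in> cocycle_class D A B h" for S
    using that assms(2,3) by (intro ext_class_eq has_cocycle_pullback) (simp_all add: cocycle_class_def)
  then show ?thesis using h by (auto simp: ext_pullback_def cocycle_def)
qed

lemma ext_pushout_class:
  fixes A :: "('d, 'a) module" and B :: "('d, 'b) module"
  assumes h: "cocycle D A B h" and "left_module D B'" "\<psi> \<in> mod_hom D B B'"
  shows "ext_pushout D A B B' \<psi> (cocycle_class D A B h) =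
    cocycle_class D A B' (\<lambda>d a a'. \<psi> (h d a a'))"
proof -
  have "ext_class D A B' (pushout_ses B B' \<psi> S) = cocycle_class D A B' (\<lambda>d a a'. \<psi> (h d a a'))"
    if "S \<in> cocycle_class D A B h" for S
    using that assms(2,3) by (intro ext_class_eq has_cocycle_pushout) (simp_all add: cocycle_class_def)
  then show ?thesis using h by (auto simp: ext_pushout_def cocycle_def)
qed

lemma mult_Ext1_class:
  fixes A :: "('d, 'a) module" and B :: "('d, 'b) module"
  assumes h: "cocycle D A B h" and k: "cocycle D A B k"
  shows "cocycle_class D A B h \<otimes>\<^bsub>Ext1 D A B\<^esub> cocycle_class D A B k =
    cocycle_class D A B (\<lambda>d a a'. h d a a' \<oplus>\<^bsub>B\<^esub> k d a a')"
proof -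
  have "ext_class D A B (baer_sum B S T) = cocycle_class D A B (\<lambda>d a a'. h d a a' \<oplus>\<^bsub>B\<^esub> k d a a')"
    if "S \<in> cocycle_class D A B h" "T \<in> cocycle_class D A B k" for S T
    using that by (intro ext_class_eq has_cocycle_baer_sum) (simp_all add: cocycle_class_def)
  then show ?thesis using h k by (auto simp: Ext1_def cocycle_def)
qed

lemma one_Ext1_class:
  assumes "left_module D A" "left_module D B"
  shows "\<one>\<^bsub>Ext1 D A B\<^esub> = cocycle_class D A B (\<lambda>_ _ _. \<zero>\<^bsub>B\<^esub>)"
  using ext_class_eq[OF has_cocycle_split[OF assms]] by (simp add: Ext1_def)

lemma Ext1_E:
  assumes "c \<in> carrier (Ext1 D A B)"
  obtains h where "cocycle D A B h" "c = cocycle_class D A B h"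
  using assms by (auto simp: carrier_Ext1)

lemma cocycle_class_in_Ext1 [simp]: "cocycle D A B h \<Longrightarrow> cocycle_class D A B h \<in> carrier (Ext1 D A B)"
  by (simp add: carrier_Ext1)

text \<open>Every law holds pointwise in B, already for cochains, so no coboundary has to be
  exhibited.\<close>

lemma comm_group_Ext1:
  assumes A: "left_module D A" and B: "left_module D B"
  shows "comm_group (Ext1 D A B)"
proof (rule comm_groupI)
  interpret B: lmod D B using B by (rule lmodI)
  note one = one_Ext1_class[OF A B]
  show "\<one>\<^bsub>Ext1 D A B\<^esub> \<in> carrier (Ext1 D A B)" using cocycle_zero[OF A B] by (simp add: one)
  show "x \<otimes>\<^bsub>Ext1 D A B\<^esub> y \<in> carrier (Ext1 D A B)"
    if "x \<in> carrier (Ext1 D A B)" "y \<in> carrier (Ext1 D A B)" for x y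
    using that by (auto elim!: Ext1_E simp: mult_Ext1_class cocycle_add)
  show "x \<otimes>\<^bsub>Ext1 D A B\<^esub> y \<otimes>\<^bsub>Ext1 D A B\<^esub> z = x \<otimes>\<^bsub>Ext1 D A B\<^esub> (y \<otimes>\<^bsub>Ext1 D A B\<^esub> z)"
    if "x \<in> carrier (Ext1 D A B)" "y \<in> carrier (Ext1 D A B)" "z \<in> carrier (Ext1 D A B)" for x y z
    using that by (elim Ext1_E, simp add: mult_Ext1_class cocycle_add)
      (rule cocycle_class_cong, simp add: cocycle_closed B.M.a_assoc)
  show "x \<otimes>\<^bsub>Ext1 D A B\<^esub> y = y \<otimes>\<^bsub>Ext1 D A B\<^esub> x"
    if "x \<in> carrier (Ext1 D A B)" "y \<in> carrier (Ext1 D A B)" for x y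
    using that by (elim Ext1_E, simp add: mult_Ext1_class)
      (rule cocycle_class_cong, simp add: cocycle_closed B.M.a_comm)
  show "\<one>\<^bsub>Ext1 D A B\<^esub> \<otimes>\<^bsub>Ext1 D A B\<^esub> x = x" if "x \<in> carrier (Ext1 D A B)" for x
    using that cocycle_zero[OF A B]
    by (elim Ext1_E, simp add: one mult_Ext1_class) (rule cocycle_class_cong, simp add: cocycle_closed)
  show "\<exists>y\<in>carrier (Ext1 D A B). y \<otimes>\<^bsub>Ext1 D A B\<^esub> x = \<one>\<^bsub>Ext1 D A B\<^esub>"
    if x: "x \<in> carrier (Ext1 D A B)" for x
  proof -
    obtain h where h: "cocycle D A B h" "x = cocycle_class D A B h" using x by (rule Ext1_E)
    then show ?thesis
      using cocycle_minus[OF h(1) B]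
      by (intro bexI[of _ "cocycle_class D A B (\<lambda>d a a'. \<ominus>\<^bsub>B\<^esub> h d a a')"])
         (auto simp: mult_Ext1_class one cocycle_closed B.M.l_neg intro!: cocycle_class_cong)
  qed
qed

section \<open>Exactness of the long exact sequences at the first extension groups\<close>

text \<open>The cochain x in L that relates the projection of \<kappa> to \<beta> is lifted to mid
  S1 through t. Correcting \<kappa> by the coboundary of the lift makes its L-component equal to
  \<beta> on the nose, and \<eta> is the N-component that remains.\<close>

lemma has_cocycle_push_adjust:
  assumes S1: "short_exact D L N S1" and t: "ses_section D L N S1 t \<gamma>"
    and T: "has_cocycle D M (mid S1) T \<kappa>"
    and coh: "cohomologous D M L (\<lambda>d a a'. prj S1 (\<kappa> d a a')) \<beta>"
    and \<beta>: "\<And>d a a'. \<lbrakk>d \<in> carrier D; a \<in> carrier M; a' \<in> carrier M\<rbrakk> \<Longrightarrow> \<beta> d a a' \<in> carrier L"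
  obtains \<eta> where "has_cocycle D M (mid S1) T (\<lambda>d a a'. t (\<beta> d a a') \<oplus>\<^bsub>mid S1\<^esub> inc S1 (\<eta> d a a'))"
    and "\<forall>d\<in>carrier D. \<forall>a\<in>carrier M. \<forall>a'\<in>carrier M. \<eta> d a a' \<in> carrier N"
proof -
  interpret S1: exact_seq D L N S1 by unfold_locales fact
  interpret T: exact_seq D M "mid S1" T by unfold_locales (use T in \<open>rule has_cocycle_exact\<close>)
  note [simp] = ses_sectionD[OF t] ses_section_cocycle(1)[OF t] has_cocycle_closed[OF T] \<beta>
  from coh obtain x where x: "\<forall>a\<in>carrier M. x a \<in> carrier L"
    and xeq: "\<forall>d\<in>carrier D. \<forall>a\<in>carrier M. \<forall>a'\<in>carrier M.
      \<beta> d a a' \<oplus>\<^bsub>L\<^esub> x (axpy M d a a') = prj S1 (\<kappa> d a a') \<oplus>\<^bsub>L\<^esub> axpy L d (x a) (x a')"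
    by (rule cohomologousE)
  \<comment> \<open>Both sides project to the same element of L, which is what \<open>xeq\<close>
    says.\<close>
  have "\<exists>n\<in>carrier N. \<kappa> d a a' \<oplus>\<^bsub>mid S1\<^esub> axpy (mid S1) d (t (x a)) (t (x a')) =
      (t (\<beta> d a a') \<oplus>\<^bsub>mid S1\<^esub> t (x (axpy M d a a'))) \<oplus>\<^bsub>mid S1\<^esub> inc S1 n"
    if "d \<in> carrier D" "a \<in> carrier M" "a' \<in> carrier M" for d a a'
    using that x xeq by (intro S1.diff_ex) simp_all
  then obtain \<eta> where \<eta>: "\<eta> d a a' \<in> carrier N \<and>
      \<kappa> d a a' \<oplus>\<^bsub>mid S1\<^esub> axpy (mid S1) d (t (x a)) (t (x a')) =
      (t (\<beta> d a a') \<oplus>\<^bsub>mid S1\<^esub> t (x (axpy M d a a'))) \<oplus>\<^bsub>mid S1\<^esub> inc S1 (\<eta> d a a')"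
    if "d \<in> carrier D" "a \<in> carrier M" "a' \<in> carrier M" for d a a'
    by metis
  have "cohomologous D M (mid S1) \<kappa> (\<lambda>d a a'. t (\<beta> d a a') \<oplus>\<^bsub>mid S1\<^esub> inc S1 (\<eta> d a a'))"
    using x \<eta> by (intro cohomologousI[where x = "\<lambda>a. t (x a)"]) (simp_all add: S1.G.M.a_ac)
  with T have "has_cocycle D M (mid S1) T (\<lambda>d a a'. t (\<beta> d a a') \<oplus>\<^bsub>mid S1\<^esub> inc S1 (\<eta> d a a'))"
    by (rule cocycle_change) (simp add: \<eta>)
  then show ?thesis using \<eta> that by blast
qed

text \<open>The extension of M by N is cut out of T: as the cocycle of T has values in N, the
  elements s(m) + n form a submodule with section s. This is a statement on cochains; on classes the
  map from Ext1(M, N) to Ext1(M, G1) need not be injective.\<close>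

lemma cocycle_of_inc_cocycle:
  assumes S1: "short_exact D L N S1" and T: "has_cocycle D M (mid S1) T (\<lambda>d a a'. inc S1 (\<sigma> d a a'))"
    and \<sigma>: "\<And>d a a'. \<lbrakk>d \<in> carrier D; a \<in> carrier M; a' \<in> carrier M\<rbrakk> \<Longrightarrow> \<sigma> d a a' \<in> carrier N"
  shows "cocycle D M N \<sigma>"
proof -
  interpret S1: exact_seq D L N S1 by unfold_locales fact
  interpret T: exact_seq D M "mid S1" T by unfold_locales (use T in \<open>rule has_cocycle_exact\<close>)
  obtain s where s: "ses_section D M (mid S1) T s (\<lambda>d a a'. inc S1 (\<sigma> d a a'))"
    using T by (auto simp: has_cocycle_def)
  define C where "C = (\<lambda>(m, n). s m \<oplus>\<^bsub>mid T\<^esub> inc T (inc S1 n)) ` (carrier M \<times> carrier N)"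
  note [simp] = ses_sectionD[OF s] \<sigma>
  have C: "s m \<oplus>\<^bsub>mid T\<^esub> inc T (inc S1 n) \<in> C" if "m \<in> carrier M" "n \<in> carrier N" for m n
    using that by (auto simp: C_def)
  have s0: "s \<zero>\<^bsub>M\<^esub> = inc T (inc S1 (\<sigma> \<one>\<^bsub>D\<^esub> \<zero>\<^bsub>M\<^esub> \<zero>\<^bsub>M\<^esub>))"
    using ses_section_cocycle(2)[OF s, of "\<one>\<^bsub>D\<^esub>" "\<zero>\<^bsub>M\<^esub>" "\<zero>\<^bsub>M\<^esub>"] by simp
  \<comment> \<open>As s(0), the image of \<sigma>(1, 0, 0), may be nonzero, n is written as s(0)
    plus a corrected element of N.\<close>
  have inc_C: "inc T (inc S1 n) \<in> C" if n: "n \<in> carrier N" for n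
  proof -
    let ?n = "\<ominus>\<^bsub>N\<^esub> \<sigma> \<one>\<^bsub>D\<^esub> \<zero>\<^bsub>M\<^esub> \<zero>\<^bsub>M\<^esub> \<oplus>\<^bsub>N\<^esub> n"
    have "s \<zero>\<^bsub>M\<^esub> \<oplus>\<^bsub>mid T\<^esub> inc T (inc S1 ?n) = inc T (inc S1 n)"
      using n unfolding s0 by (simp add: S1.B.M.r_neg2 flip: T.inc_add S1.inc_add)
    then show ?thesis using C[of "\<zero>\<^bsub>M\<^esub>" ?n] n by simp
  qed
  have s_C: "s m \<in> C" if "m \<in> carrier M" for m
    using C[of m "\<zero>\<^bsub>N\<^esub>"] that by simp
  have "left_module D (mid T\<lparr>carrier := C\<rparr>)"
  proof (rule T.G.left_module_of_closed_subset)
    show "C \<subseteq> carrier (mid T)" by (auto simp: C_def)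
    show "C \<noteq> {}" using s_C[of "\<zero>\<^bsub>M\<^esub>"] by auto
    fix d x y assume d: "d \<in> carrier D" and "x \<in> C" "y \<in> C"
    then obtain m n m' n' where mn: "m \<in> carrier M" "n \<in> carrier N" "m' \<in> carrier M" "n' \<in> carrier N"
      and xy: "x = s m \<oplus>\<^bsub>mid T\<^esub> inc T (inc S1 n)" "y = s m' \<oplus>\<^bsub>mid T\<^esub> inc T (inc S1 n')"
      by (auto simp: C_def)
    have "axpy (mid T) d x y = s (axpy M d m m') \<oplus>\<^bsub>mid T\<^esub> inc T (inc S1 (\<sigma> d m m' \<oplus>\<^bsub>N\<^esub> axpy N d n n'))"
      using mn d unfolding xy by (subst T.axpy_section[OF s]) simp_all
    then show "axpy (mid T) d x y \<in> C" using mn d by (simp only:) (rule C, simp_all)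
  qed
  let ?S = "\<lparr>mid = mid T\<lparr>carrier := C\<rparr>, inc = (\<lambda>n. inc T (inc S1 n)), prj = prj T\<rparr>"
  have C_sub: "x \<in> carrier (mid T)" if "x \<in> C" for x using that by (auto simp: C_def)
  have "short_exact D M N ?S"
  proof (rule short_exactI)
    show lm: "left_module D (mid ?S)" using \<open>left_module D (mid T\<lparr>carrier := C\<rparr>)\<close> by simp
    show "inc ?S \<in> mod_hom D N (mid ?S)"
      using lm by (intro mod_homI) (simp_all add: S1.B.left_module_axioms inc_C)
    show "prj ?S \<in> mod_hom D (mid ?S) M"
      using lm by (intro mod_homI) (simp_all add: T.A.left_module_axioms C_sub)
    show "\<exists>x\<in>carrier (mid ?S). prj ?S x = a" if "a \<in> carrier M" for a
      using that by (intro bexI[of _ "s a"]) (simp_all add: s_C)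
    show "\<exists>b\<in>carrier N. x = inc ?S b" if x: "x \<in> carrier (mid ?S)" "prj ?S x = \<zero>\<^bsub>M\<^esub>" for x
    proof -
      obtain m n where mn: "m \<in> carrier M" "n \<in> carrier N" "x = s m \<oplus>\<^bsub>mid T\<^esub> inc T (inc S1 n)"
        using x(1) by (auto simp: C_def)
      then have "m = \<zero>\<^bsub>M\<^esub>" using x(2) by simp
      then show ?thesis using mn
        by (intro bexI[of _ "\<sigma> \<one>\<^bsub>D\<^esub> \<zero>\<^bsub>M\<^esub> \<zero>\<^bsub>M\<^esub> \<oplus>\<^bsub>N\<^esub> n"]) (simp_all add: s0)
    qed
  qed (simp_all add: T.A.left_module_axioms S1.B.left_module_axioms)
  moreover have "ses_section D M N ?S s \<sigma>"
    by (rule ses_sectionI) (simp_all add: s_C ses_section_cocycle[OF s])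
  ultimately show ?thesis by (intro cocycleI has_cocycleI)
qed

text \<open>Exactness of Hom(M, L) -> Ext1(M, N) -> Ext1(M, G1). A cochain x in G1 that trivialises
  \<sigma> becomes linear after projection to L, because \<sigma> has values in N; this is \<phi>.
  The N-component of x relative to t(\<phi> a) is then the cochain relating \<sigma> to the pullback
  of \<gamma> along \<phi>.\<close>

lemma push_trivial_iff:
  assumes S1: "short_exact D L N S1" and t: "ses_section D L N S1 t \<gamma>" and M: "left_module D M"
    and \<sigma>: "\<And>d a a'. \<lbrakk>d \<in> carrier D; a \<in> carrier M; a' \<in> carrier M\<rbrakk> \<Longrightarrow> \<sigma> d a a' \<in> carrier N"
  shows "cohomologous D M (mid S1) (\<lambda>_ _ _. \<zero>\<^bsub>mid S1\<^esub>) (\<lambda>d a a'. inc S1 (\<sigma> d a a')) \<longleftrightarrow>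
    (\<exists>\<phi>\<in>mod_hom D M L. cohomologous D M N (\<lambda>d a a'. \<gamma> d (\<phi> a) (\<phi> a')) \<sigma>)"
proof -
  interpret S1: exact_seq D L N S1 by unfold_locales fact
  interpret M: lmod D M using M by (rule lmodI)
  note [simp] = ses_sectionD[OF t] ses_section_cocycle(1)[OF t] \<sigma>
  show ?thesis
  proof
    assume "cohomologous D M (mid S1) (\<lambda>_ _ _. \<zero>\<^bsub>mid S1\<^esub>) (\<lambda>d a a'. inc S1 (\<sigma> d a a'))"
    then obtain x where x: "\<forall>a\<in>carrier M. x a \<in> carrier (mid S1)"
      and "\<forall>d\<in>carrier D. \<forall>a\<in>carrier M. \<forall>a'\<in>carrier M. inc S1 (\<sigma> d a a') \<oplus>\<^bsub>mid S1\<^esub> x (axpy M d a a') =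
        \<zero>\<^bsub>mid S1\<^esub> \<oplus>\<^bsub>mid S1\<^esub> axpy (mid S1) d (x a) (x a')"
      by (rule cohomologousE)
    then have xeq: "inc S1 (\<sigma> d a a') \<oplus>\<^bsub>mid S1\<^esub> x (axpy M d a a') = axpy (mid S1) d (x a) (x a')"
      if "d \<in> carrier D" "a \<in> carrier M" "a' \<in> carrier M" for d a a' using that by simp
    define \<phi> where "\<phi> a = prj S1 (x a)" for a
    have \<phi>_closed: "\<phi> a \<in> carrier L" if "a \<in> carrier M" for a using that x by (simp add: \<phi>_def)
    have \<phi>_axpy: "\<phi> (axpy M d a a') = axpy L d (\<phi> a) (\<phi> a')"
      if "d \<in> carrier D" "a \<in> carrier M" "a' \<in> carrier M" for d a a'
      using that x arg_cong[OF xeq[OF that], of "prj S1"] by (simp add: \<phi>_def)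
    then have \<phi>: "\<phi> \<in> mod_hom D M L"
      using M S1.A.left_module_axioms \<phi>_closed by (intro mod_homI) auto
    have "\<forall>a\<in>carrier M. \<exists>n\<in>carrier N. x a = t (\<phi> a) \<oplus>\<^bsub>mid S1\<^esub> inc S1 n"
      using x by (intro ballI S1.diff_ex) (simp_all add: \<phi>_def)
    then obtain y where y: "\<forall>a\<in>carrier M. y a \<in> carrier N"
      and xy: "\<forall>a\<in>carrier M. x a = t (\<phi> a) \<oplus>\<^bsub>mid S1\<^esub> inc S1 (y a)" by metis
    have "cohomologous D M N (\<lambda>d a a'. \<gamma> d (\<phi> a) (\<phi> a')) \<sigma>"
    proof (rule cohomologousI[where x = y])
      fix d a a' assume *: "d \<in> carrier D" "a \<in> carrier M" "a' \<in> carrier M"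
      have "t (axpy L d (\<phi> a) (\<phi> a')) \<oplus>\<^bsub>mid S1\<^esub> inc S1 (\<sigma> d a a' \<oplus>\<^bsub>N\<^esub> y (axpy M d a a')) =
          inc S1 (\<sigma> d a a') \<oplus>\<^bsub>mid S1\<^esub> x (axpy M d a a')"
        using * xy y by (simp add: \<phi>_closed \<phi>_axpy S1.G.M.a_ac)
      also have "\<dots> = t (axpy L d (\<phi> a) (\<phi> a')) \<oplus>\<^bsub>mid S1\<^esub>
          inc S1 (\<gamma> d (\<phi> a) (\<phi> a') \<oplus>\<^bsub>N\<^esub> axpy N d (y a) (y a'))"
        using * y by (simp only: xeq xy) (simp only: S1.axpy_section[OF t] \<phi>_closed)
      finally show "\<sigma> d a a' \<oplus>\<^bsub>N\<^esub> y (axpy M d a a') = \<gamma> d (\<phi> a) (\<phi> a') \<oplus>\<^bsub>N\<^esub> axpy N d (y a) (y a')"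
        using * y by (subst (asm) S1.section_eq_iff[OF t]) (simp_all add: \<phi>_closed)
    qed (simp add: y)
    then show "\<exists>\<phi>\<in>mod_hom D M L. cohomologous D M N (\<lambda>d a a'. \<gamma> d (\<phi> a) (\<phi> a')) \<sigma>"
      using \<phi> by blast
  next
    assume "\<exists>\<phi>\<in>mod_hom D M L. cohomologous D M N (\<lambda>d a a'. \<gamma> d (\<phi> a) (\<phi> a')) \<sigma>"
    then obtain \<phi> where \<phi>: "\<phi> \<in> mod_hom D M L"
      and "cohomologous D M N (\<lambda>d a a'. \<gamma> d (\<phi> a) (\<phi> a')) \<sigma>" by blast
    from this(2) obtain y where y: "\<forall>a\<in>carrier M. y a \<in> carrier N"
      and yeq: "\<forall>d\<in>carrier D. \<forall>a\<in>carrier M. \<forall>a'\<in>carrier M. \<sigma> d a a' \<oplus>\<^bsub>N\<^esub> y (axpy M d a a') =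
        \<gamma> d (\<phi> a) (\<phi> a') \<oplus>\<^bsub>N\<^esub> axpy N d (y a) (y a')"
      by (rule cohomologousE)
    note [simp] = mod_hom_closed[OF \<phi>] mod_hom_axpy[OF \<phi> M]
    show "cohomologous D M (mid S1) (\<lambda>_ _ _. \<zero>\<^bsub>mid S1\<^esub>) (\<lambda>d a a'. inc S1 (\<sigma> d a a'))"
    proof (rule cohomologousI[where x = "\<lambda>a. t (\<phi> a) \<oplus>\<^bsub>mid S1\<^esub> inc S1 (y a)"])
      fix d a a' assume *: "d \<in> carrier D" "a \<in> carrier M" "a' \<in> carrier M"
      have "axpy (mid S1) d (t (\<phi> a) \<oplus>\<^bsub>mid S1\<^esub> inc S1 (y a)) (t (\<phi> a') \<oplus>\<^bsub>mid S1\<^esub> inc S1 (y a')) =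
          t (axpy L d (\<phi> a) (\<phi> a')) \<oplus>\<^bsub>mid S1\<^esub> inc S1 (\<sigma> d a a' \<oplus>\<^bsub>N\<^esub> y (axpy M d a a'))"
        using * y yeq by (simp only: S1.axpy_section[OF t] mod_hom_closed[OF \<phi>])
      then show "inc S1 (\<sigma> d a a') \<oplus>\<^bsub>mid S1\<^esub>
          (t (\<phi> (axpy M d a a')) \<oplus>\<^bsub>mid S1\<^esub> inc S1 (y (axpy M d a a'))) =
          \<zero>\<^bsub>mid S1\<^esub> \<oplus>\<^bsub>mid S1\<^esub> axpy (mid S1) d (t (\<phi> a) \<oplus>\<^bsub>mid S1\<^esub> inc S1 (y a))
            (t (\<phi> a') \<oplus>\<^bsub>mid S1\<^esub> inc S1 (y a'))"
        using * y by (simp add: S1.G.M.a_ac)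
    qed (simp add: y)
  qed
qed

text \<open>Exactness of Hom(L, N) -> Ext1(M, N) -> Ext1(G0, N). The trivialising cochain x on G0
  restricts to L as a homomorphism \<mu> plus a constant; evaluating x along the section s exhibits
  \<sigma> as the pushout of \<beta> along -\<mu>, up to a coboundary.\<close>

lemma pull_trivial_iff:
  assumes S0: "short_exact D M L S0" and s: "ses_section D M L S0 s \<beta>" and N: "left_module D N"
    and \<sigma>: "\<And>d a a'. \<lbrakk>d \<in> carrier D; a \<in> carrier M; a' \<in> carrier M\<rbrakk> \<Longrightarrow> \<sigma> d a a' \<in> carrier N"
  shows "cohomologous D (mid S0) N (\<lambda>_ _ _. \<zero>\<^bsub>N\<^esub>) (\<lambda>d g g'. \<sigma> d (prj S0 g) (prj S0 g')) \<longleftrightarrow>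
    (\<exists>\<psi>\<in>mod_hom D L N. cohomologous D M N (\<lambda>d a a'. \<psi> (\<beta> d a a')) \<sigma>)"
proof -
  interpret S0: exact_seq D M L S0 by unfold_locales fact
  interpret N: lmod D N using N by (rule lmodI)
  note [simp] = ses_sectionD[OF s] ses_section_cocycle(1)[OF s] \<sigma>
  show ?thesis
  proof
    assume "cohomologous D (mid S0) N (\<lambda>_ _ _. \<zero>\<^bsub>N\<^esub>) (\<lambda>d g g'. \<sigma> d (prj S0 g) (prj S0 g'))"
    then obtain x where x [rule_format, simp]: "\<forall>g\<in>carrier (mid S0). x g \<in> carrier N"
      and "\<forall>d\<in>carrier D. \<forall>g\<in>carrier (mid S0). \<forall>g'\<in>carrier (mid S0).
        \<sigma> d (prj S0 g) (prj S0 g') \<oplus>\<^bsub>N\<^esub> x (axpy (mid S0) d g g') = \<zero>\<^bsub>N\<^esub> \<oplus>\<^bsub>N\<^esub> axpy N d (x g) (x g')"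
      by (rule cohomologousE)
    then have xeq: "\<sigma> d (prj S0 g) (prj S0 g') \<oplus>\<^bsub>N\<^esub> x (axpy (mid S0) d g g') = axpy N d (x g) (x g')"
      if "d \<in> carrier D" "g \<in> carrier (mid S0)" "g' \<in> carrier (mid S0)" for d g g' using that by simp
    \<comment> \<open>x need not vanish at zero; subtracting x(0) is what makes its restriction to L
      linear.\<close>
    let ?x0 = "x \<zero>\<^bsub>mid S0\<^esub>"
    define \<mu> where "\<mu> l = x (inc S0 l) \<oplus>\<^bsub>N\<^esub> \<ominus>\<^bsub>N\<^esub> ?x0" for l
    have \<mu>_closed [simp]: "\<mu> l \<in> carrier N" if "l \<in> carrier L" for l
      using that by (simp add: \<mu>_def)
    have x_inc: "x (inc S0 l) = \<mu> l \<oplus>\<^bsub>N\<^esub> ?x0" if "l \<in> carrier L" for l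
      using that by (simp add: \<mu>_def N.M.a_assoc N.M.l_neg)
    have "\<mu> (axpy L d l l') = axpy N d (\<mu> l) (\<mu> l')"
      if *: "d \<in> carrier D" "l \<in> carrier L" "l' \<in> carrier L" for d l l'
    proof -
      let ?c = "\<sigma> d \<zero>\<^bsub>M\<^esub> \<zero>\<^bsub>M\<^esub>"
      have "?c \<oplus>\<^bsub>N\<^esub> ?x0 \<oplus>\<^bsub>N\<^esub> \<mu> (axpy L d l l') = ?c \<oplus>\<^bsub>N\<^esub> x (axpy (mid S0) d (inc S0 l) (inc S0 l'))"
        using * x_inc[of "axpy L d l l'"] by (simp add: N.M.a_ac)
      also have "\<dots> = axpy N d (\<mu> l \<oplus>\<^bsub>N\<^esub> ?x0) (\<mu> l' \<oplus>\<^bsub>N\<^esub> ?x0)"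
        using xeq[of d "inc S0 l" "inc S0 l'"] * by (simp add: x_inc)
      also have "\<dots> = axpy N d (\<mu> l) (\<mu> l') \<oplus>\<^bsub>N\<^esub> axpy N d ?x0 ?x0"
        using * by (simp add: N.axpy_add)
      also have "axpy N d ?x0 ?x0 = ?c \<oplus>\<^bsub>N\<^esub> ?x0"
        using xeq[of d "\<zero>\<^bsub>mid S0\<^esub>" "\<zero>\<^bsub>mid S0\<^esub>"] * by simp
      finally show ?thesis using * by (simp add: N.M.a_comm[of "axpy N d (\<mu> l) (\<mu> l')"])
    qed
    then have \<mu>: "\<mu> \<in> mod_hom D L N"
      using N S0.B.left_module_axioms by (intro mod_homI) auto
    \<comment> \<open>The equation for x with d = 1 gives additivity up to \<sigma>(1, 0, m), and
      this defect equals x(0).\<close>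
    have x_add: "x (s m \<oplus>\<^bsub>mid S0\<^esub> inc S0 l) = \<mu> l \<oplus>\<^bsub>N\<^esub> x (s m)"
      if *: "m \<in> carrier M" "l \<in> carrier L" for m l
    proof -
      have 1: "\<sigma> \<one>\<^bsub>D\<^esub> \<zero>\<^bsub>M\<^esub> m = ?x0"
        using xeq[of "\<one>\<^bsub>D\<^esub>" "\<zero>\<^bsub>mid S0\<^esub>" "s m"] * by simp
      have "?x0 \<oplus>\<^bsub>N\<^esub> x (inc S0 l \<oplus>\<^bsub>mid S0\<^esub> s m) = ?x0 \<oplus>\<^bsub>N\<^esub> (\<mu> l \<oplus>\<^bsub>N\<^esub> x (s m))"
        using xeq[of "\<one>\<^bsub>D\<^esub>" "inc S0 l" "s m"] * 1 by (simp add: x_inc N.M.a_ac)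
      then show ?thesis using * by (simp add: S0.G.M.a_comm)
    qed
    have "cohomologous D M N (\<lambda>d a a'. \<ominus>\<^bsub>N\<^esub> \<mu> (\<beta> d a a')) \<sigma>"
    proof (rule cohomologousI[where x = "\<lambda>a. x (s a)"])
      fix d a a' assume *: "d \<in> carrier D" "a \<in> carrier M" "a' \<in> carrier M"
      have "\<mu> (\<beta> d a a') \<oplus>\<^bsub>N\<^esub> (\<sigma> d a a' \<oplus>\<^bsub>N\<^esub> x (s (axpy M d a a'))) = axpy N d (x (s a)) (x (s a'))"
        using xeq[of d "s a" "s a'"] * by (simp add: ses_section_cocycle(2)[OF s] x_add N.M.a_ac)
      then show "\<sigma> d a a' \<oplus>\<^bsub>N\<^esub> x (s (axpy M d a a')) =
          \<ominus>\<^bsub>N\<^esub> \<mu> (\<beta> d a a') \<oplus>\<^bsub>N\<^esub> axpy N d (x (s a)) (x (s a'))"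
        using * by (simp add: N.M.r_neg1 flip: \<open>\<mu> (\<beta> d a a') \<oplus>\<^bsub>N\<^esub> _ = _\<close>)
    qed simp
    moreover have "(\<lambda>l. \<ominus>\<^bsub>N\<^esub> \<mu> l) \<in> mod_hom D L N"
      using \<mu> S0.B.left_module_axioms N by (rule mod_hom_minus)
    ultimately show "\<exists>\<psi>\<in>mod_hom D L N. cohomologous D M N (\<lambda>d a a'. \<psi> (\<beta> d a a')) \<sigma>"
      by (intro bexI[of _ "\<lambda>l. \<ominus>\<^bsub>N\<^esub> \<mu> l"])
  next
    assume "\<exists>\<psi>\<in>mod_hom D L N. cohomologous D M N (\<lambda>d a a'. \<psi> (\<beta> d a a')) \<sigma>"
    then obtain \<psi> where \<psi>: "\<psi> \<in> mod_hom D L N" and "cohomologous D M N (\<lambda>d a a'. \<psi> (\<beta> d a a')) \<sigma>"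
      by blast
    from this(2) obtain y where y [rule_format, simp]: "\<forall>a\<in>carrier M. y a \<in> carrier N"
      and yeq: "\<forall>d\<in>carrier D. \<forall>a\<in>carrier M. \<forall>a'\<in>carrier M. \<sigma> d a a' \<oplus>\<^bsub>N\<^esub> y (axpy M d a a') =
        \<psi> (\<beta> d a a') \<oplus>\<^bsub>N\<^esub> axpy N d (y a) (y a')"
      by (rule cohomologousE)
    define \<mu> where "\<mu> l = \<ominus>\<^bsub>N\<^esub> \<psi> l" for l
    have \<mu>: "\<mu> \<in> mod_hom D L N"
      unfolding \<mu>_def using \<psi> S0.B.left_module_axioms N by (rule mod_hom_minus)
    note [simp] = mod_hom_closed[OF \<mu>] mod_hom_closed[OF \<psi>] mod_hom_add[OF \<mu>]
      mod_hom_axpy[OF \<mu> S0.B.left_module_axioms]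
    have yeq': "\<mu> (\<beta> d a a') \<oplus>\<^bsub>N\<^esub> (\<sigma> d a a' \<oplus>\<^bsub>N\<^esub> y (axpy M d a a')) = axpy N d (y a) (y a')"
      if "d \<in> carrier D" "a \<in> carrier M" "a' \<in> carrier M" for d a a'
      using that yeq by (simp add: \<mu>_def N.M.r_neg1)
    have "\<forall>g\<in>carrier (mid S0). \<exists>l\<in>carrier L. g = s (prj S0 g) \<oplus>\<^bsub>mid S0\<^esub> inc S0 l"
      by (intro ballI S0.diff_ex) simp_all
    from bchoice[OF this[unfolded Bex_def]] obtain r
      where r [simp]: "\<And>g. g \<in> carrier (mid S0) \<Longrightarrow> r g \<in> carrier L"
      and dec: "\<And>g. g \<in> carrier (mid S0) \<Longrightarrow> g = s (prj S0 g) \<oplus>\<^bsub>mid S0\<^esub> inc S0 (r g)"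
      by blast
    \<comment> \<open>In the coordinates prj g and r(g) of g, the trivialising cochain is y on the
      M-part plus \<mu> = -\<psi> on the L-part.\<close>
    show "cohomologous D (mid S0) N (\<lambda>_ _ _. \<zero>\<^bsub>N\<^esub>) (\<lambda>d g g'. \<sigma> d (prj S0 g) (prj S0 g'))"
    proof (rule cohomologousI[where x = "\<lambda>g. y (prj S0 g) \<oplus>\<^bsub>N\<^esub> \<mu> (r g)"])
      fix d g g' assume *: "d \<in> carrier D" "g \<in> carrier (mid S0)" "g' \<in> carrier (mid S0)"
      let ?m = "prj S0 g" and ?m' = "prj S0 g'" and ?a = "axpy (mid S0) d g g'"
      have "s (prj S0 ?a) \<oplus>\<^bsub>mid S0\<^esub> inc S0 (r ?a) =
          axpy (mid S0) d (s ?m \<oplus>\<^bsub>mid S0\<^esub> inc S0 (r g)) (s ?m' \<oplus>\<^bsub>mid S0\<^esub> inc S0 (r g'))"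
        using * by (simp only: dec[symmetric] S0.G.axpy_closed)
      also have "\<dots> = s (axpy M d ?m ?m') \<oplus>\<^bsub>mid S0\<^esub> inc S0 (\<beta> d ?m ?m' \<oplus>\<^bsub>L\<^esub> axpy L d (r g) (r g'))"
        using * by (simp only: S0.axpy_section[OF s] S0.prj_closed r)
      finally have "r ?a = \<beta> d ?m ?m' \<oplus>\<^bsub>L\<^esub> axpy L d (r g) (r g')"
        using * by (subst (asm) S0.section_eq_iff[OF s]) simp_all
      then have "\<sigma> d ?m ?m' \<oplus>\<^bsub>N\<^esub> (y (prj S0 ?a) \<oplus>\<^bsub>N\<^esub> \<mu> (r ?a)) =
          \<mu> (\<beta> d ?m ?m') \<oplus>\<^bsub>N\<^esub> (\<sigma> d ?m ?m' \<oplus>\<^bsub>N\<^esub> y (axpy M d ?m ?m')) \<oplus>\<^bsub>N\<^esub> axpy N d (\<mu> (r g)) (\<mu> (r g'))"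
        using * by (simp add: N.M.a_ac)
      then show "\<sigma> d ?m ?m' \<oplus>\<^bsub>N\<^esub> (y (prj S0 ?a) \<oplus>\<^bsub>N\<^esub> \<mu> (r ?a)) =
          \<zero>\<^bsub>N\<^esub> \<oplus>\<^bsub>N\<^esub> axpy N d (y ?m \<oplus>\<^bsub>N\<^esub> \<mu> (r g)) (y ?m' \<oplus>\<^bsub>N\<^esub> \<mu> (r g'))"
        using * by (simp only: yeq' S0.prj_closed N.axpy_add) (simp add: N.axpy_add)
    qed simp
  qed
qed

text \<open>Exactness of Ext1(M, N) -> Ext1(G0, N) -> Ext1(L, N). A splitting over L embeds L into
  mid T, and mid T modulo this copy of L is the required extension of M by N.\<close>

lemma pull_trivial_imp_pullback:
  assumes S0: "short_exact D M L S0" and T: "has_cocycle D (mid S0) N T h"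
    and coh: "cohomologous D L N (\<lambda>_ _ _. \<zero>\<^bsub>N\<^esub>) (\<lambda>d l l'. h d (inc S0 l) (inc S0 l'))"
  obtains \<sigma> where "cocycle D M N \<sigma>"
    and "cohomologous D (mid S0) N (\<lambda>d g g'. \<sigma> d (prj S0 g) (prj S0 g')) h"
proof -
  interpret S0: exact_seq D M L S0 by unfold_locales fact
  interpret T: exact_seq D "mid S0" N T by unfold_locales (use T in \<open>rule has_cocycle_exact\<close>)
  obtain u where u: "ses_section D (mid S0) N T u h" using T by (auto simp: has_cocycle_def)
  note [simp] = ses_sectionD[OF u] ses_section_cocycle(1)[OF u]
  from coh obtain x where x [rule_format, simp]: "\<forall>l\<in>carrier L. x l \<in> carrier N"
    and xeq: "\<forall>d\<in>carrier D. \<forall>l\<in>carrier L. \<forall>l'\<in>carrier L. h d (inc S0 l) (inc S0 l') \<oplus>\<^bsub>N\<^esub> x (axpy L d l l') =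
        \<zero>\<^bsub>N\<^esub> \<oplus>\<^bsub>N\<^esub> axpy N d (x l) (x l')"
    by (rule cohomologousE)
  \<comment> \<open>Subtracting the trivialising cochain x turns the section u over L into a linear
    lift.\<close>
  define \<rho> where "\<rho> l = u (inc S0 l) \<oplus>\<^bsub>mid T\<^esub> inc T (\<ominus>\<^bsub>N\<^esub> x l)" for l
  have \<rho>_closed [simp]: "\<rho> l \<in> carrier (mid T)" and prj_\<rho> [simp]: "prj T (\<rho> l) = inc S0 l"
    if "l \<in> carrier L" for l
    using that by (simp_all add: \<rho>_def)
  have \<rho>_axpy [simp]: "\<rho> (axpy L d l l') = axpy (mid T) d (\<rho> l) (\<rho> l')"
    if *: "d \<in> carrier D" "l \<in> carrier L" "l' \<in> carrier L" for d l l'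
  proof -
    let ?h = "h d (inc S0 l) (inc S0 l')"
    have "?h \<oplus>\<^bsub>N\<^esub> axpy N d (\<ominus>\<^bsub>N\<^esub> x l) (\<ominus>\<^bsub>N\<^esub> x l') = ?h \<oplus>\<^bsub>N\<^esub> \<ominus>\<^bsub>N\<^esub> (?h \<oplus>\<^bsub>N\<^esub> x (axpy L d l l'))"
      using * xeq by (simp add: T.B.axpy_minus)
    also have "\<dots> = \<ominus>\<^bsub>N\<^esub> x (axpy L d l l')"
      using * by (simp add: T.B.M.minus_add T.B.M.r_neg2)
    finally show ?thesis
      using * unfolding \<rho>_def by (subst T.axpy_section[OF u]) simp_all
  qed
  \<comment> \<open>The module mid T as an extension of M by L x N; its cocycle has an L-component b
    and an N-component \<sigma>.\<close>
  let ?F = "\<lparr>mid = mid T, inc = (\<lambda>(l, n). \<rho> l \<oplus>\<^bsub>mid T\<^esub> inc T n), prj = (\<lambda>x. prj S0 (prj T x))\<rparr>"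
  have LN: "left_module D (prod_mod L N)"
    by (intro left_module_prod_mod S0.B.left_module_axioms T.B.left_module_axioms)
  have F: "short_exact D M (prod_mod L N) ?F"
  proof (rule short_exactI)
    show "inc ?F \<in> mod_hom D (prod_mod L N) (mid ?F)"
      using LN by (intro mod_homI) (auto simp: T.G.left_module_axioms T.G.axpy_add)
    show "prj ?F \<in> mod_hom D (mid ?F) M"
      by (intro mod_homI) (auto simp: T.G.left_module_axioms S0.A.left_module_axioms)
    show "\<exists>x\<in>carrier (mid ?F). prj ?F x = a" if a: "a \<in> carrier M" for a
    proof -
      obtain g where "a = prj S0 g" "g \<in> carrier (mid S0)"
        using a unfolding S0.prj_surj[symmetric] by (rule imageE)
      then show ?thesis by (intro bexI[of _ "u g"]) simp_all
    qed
    show "\<exists>b\<in>carrier (prod_mod L N). x = inc ?F b" if x: "x \<in> carrier (mid ?F)" "prj ?F x = \<zero>\<^bsub>M\<^esub>" for x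
    proof -
      obtain l where l: "l \<in> carrier L" "prj T x = inc S0 l"
        using x S0.kernelE[of "prj T x"] by auto
      then obtain n where "n \<in> carrier N" "x = \<rho> l \<oplus>\<^bsub>mid T\<^esub> inc T n"
        using x T.diff_ex[of x "\<rho> l"] by auto
      then show ?thesis using l by (intro bexI[of _ "(l, n)"]) simp_all
    qed
    show "b = b'" if b: "b \<in> carrier (prod_mod L N)" "b' \<in> carrier (prod_mod L N)" "inc ?F b = inc ?F b'" for b b'
    proof -
      obtain l n l' n' where bb: "b = (l, n)" "b' = (l', n')" by fastforce
      have "prj T (\<rho> l \<oplus>\<^bsub>mid T\<^esub> inc T n) = prj T (\<rho> l' \<oplus>\<^bsub>mid T\<^esub> inc T n')"
        using b by (simp add: bb)
      then have "l = l'" using b(1,2) by (simp add: bb)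
      then show ?thesis using b by (simp add: bb)
    qed
  qed (use LN in \<open>auto simp: S0.A.left_module_axioms T.G.left_module_axioms\<close>)
  interpret F: exact_seq D M "prod_mod L N" ?F by unfold_locales (rule F)
  obtain w hw where w: "ses_section D M (prod_mod L N) ?F w hw" using F.ex_section by blast
  define b where "b d a a' = fst (hw d a a')" for d a a'
  define \<sigma> where "\<sigma> d a a' = snd (hw d a a')" for d a a'
  have hw: "hw d a a' = (b d a a', \<sigma> d a a')" for d a a' by (simp add: b_def \<sigma>_def)
  have [simp]: "b d a a' \<in> carrier L" "\<sigma> d a a' \<in> carrier N"
    if "d \<in> carrier D" "a \<in> carrier M" "a' \<in> carrier M" for d a a'
    using ses_section_cocycle(1)[OF w that] by (simp_all add: hw)
  have w_closed [simp]: "w a \<in> carrier (mid T)" and w_prj [simp]: "prj S0 (prj T (w a)) = a"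
    if "a \<in> carrier M" for a
    using ses_sectionD[OF w that] by simp_all
  have w_axpy: "axpy (mid T) d (w a) (w a') =
      w (axpy M d a a') \<oplus>\<^bsub>mid T\<^esub> (\<rho> (b d a a') \<oplus>\<^bsub>mid T\<^esub> inc T (\<sigma> d a a'))"
    if "d \<in> carrier D" "a \<in> carrier M" "a' \<in> carrier M" for d a a'
    using ses_section_cocycle(2)[OF w that] by (simp add: hw)
  have "cocycle D M N \<sigma>"
  proof -
    \<comment> \<open>This is \<rho>(L), the image of the kernel of \<open>snd\<close>, so
      \<open>quot_ses\<close> retains just the component \<sigma>.\<close>
    let ?H = "inc ?F ` {p \<in> carrier (prod_mod L N). snd p = \<zero>\<^bsub>N\<^esub>}"
    let ?Q = "\<lparr>mid = quot_mod (mid T) ?H, inc = (\<lambda>n. ?H +>\<^bsub>mid T\<^esub> inc T n),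
      prj = (\<lambda>C. the_elem ((\<lambda>x. prj S0 (prj T x)) ` C))\<rparr>"
    have snd: "snd \<in> mod_hom D (prod_mod L N) N"
      using LN by (intro mod_homI) (auto simp: T.B.left_module_axioms)
    have \<rho>_zero: "\<rho> \<zero>\<^bsub>L\<^esub> = \<zero>\<^bsub>mid T\<^esub>"
      using F.inc_zero by simp
    have "has_cocycle D M N ?Q (\<lambda>d a a'. snd (hw d a a'))"
    proof (rule cocycle_quot_ses[OF F T.B.left_module_axioms snd, where H = ?H])
      show "\<exists>b\<in>carrier (prod_mod L N). snd b = b' \<and> inc ?Q b' = ?H +>\<^bsub>mid ?F\<^esub> inc ?F b"
        if "b' \<in> carrier N" for b'
        using that by (intro bexI[of _ "(\<zero>\<^bsub>L\<^esub>, b')"]) (simp_all add: \<rho>_zero)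
      show "prj ?Q (?H +>\<^bsub>mid ?F\<^esub> x) = prj ?F x" if x: "x \<in> carrier (mid ?F)" for x
      proof -
        have "inc ?F \<zero>\<^bsub>prod_mod L N\<^esub> \<in> ?H" by (rule imageI) simp
        moreover have "prj S0 (prj T (h \<oplus>\<^bsub>mid T\<^esub> x)) = prj S0 (prj T x)" if "h \<in> ?H" for h
          using that x by auto
        ultimately show ?thesis by (simp del: F.inc_zero) (rule the_elem_image_coset)
      qed
    qed (use has_cocycleI[OF F w] in simp_all)
    then show ?thesis unfolding \<sigma>_def by (rule cocycleI)
  qed
  moreover have "has_cocycle D (mid S0) N T (\<lambda>d g g'. \<sigma> d (prj S0 g) (prj S0 g'))"
  proof -
    have s: "ses_section D M L S0 (\<lambda>m. prj T (w m)) b"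
    proof (rule ses_sectionI)
      fix d a a' assume *: "d \<in> carrier D" "a \<in> carrier M" "a' \<in> carrier M"
      then show "axpy (mid S0) d (prj T (w a)) (prj T (w a')) =
          prj T (w (axpy M d a a')) \<oplus>\<^bsub>mid S0\<^esub> inc S0 (b d a a')"
        using arg_cong[OF w_axpy[OF *], of "prj T"] by simp
    qed simp_all
    have "\<forall>g\<in>carrier (mid S0). \<exists>l\<in>carrier L. g = prj T (w (prj S0 g)) \<oplus>\<^bsub>mid S0\<^esub> inc S0 l"
      by (intro ballI S0.diff_ex) simp_all
    from bchoice[OF this[unfolded Bex_def]] obtain r
      where r [simp]: "\<And>g. g \<in> carrier (mid S0) \<Longrightarrow> r g \<in> carrier L"
      and dec: "\<And>g. g \<in> carrier (mid S0) \<Longrightarrow> g = prj T (w (prj S0 g)) \<oplus>\<^bsub>mid S0\<^esub> inc S0 (r g)"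
      by blast
    \<comment> \<open>A section over mid S0 adapted to \<rho>: lifting the L-part of g linearly
      absorbs the component b and leaves \<sigma> composed with the projection.\<close>
    have "ses_section D (mid S0) N T (\<lambda>g. w (prj S0 g) \<oplus>\<^bsub>mid T\<^esub> \<rho> (r g))
        (\<lambda>d g g'. \<sigma> d (prj S0 g) (prj S0 g'))"
    proof (rule ses_sectionI)
      fix d g g' assume *: "d \<in> carrier D" "g \<in> carrier (mid S0)" "g' \<in> carrier (mid S0)"
      let ?m = "prj S0 g" and ?m' = "prj S0 g'" and ?a = "axpy (mid S0) d g g'"
      have "prj T (w (prj S0 ?a)) \<oplus>\<^bsub>mid S0\<^esub> inc S0 (r ?a) =
          axpy (mid S0) d (prj T (w ?m) \<oplus>\<^bsub>mid S0\<^esub> inc S0 (r g)) (prj T (w ?m') \<oplus>\<^bsub>mid S0\<^esub> inc S0 (r g'))"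
        using * by (simp only: dec[symmetric] S0.G.axpy_closed)
      also have "\<dots> = prj T (w (axpy M d ?m ?m')) \<oplus>\<^bsub>mid S0\<^esub> inc S0 (b d ?m ?m' \<oplus>\<^bsub>L\<^esub> axpy L d (r g) (r g'))"
        using * by (simp only: S0.axpy_section[OF s] S0.prj_closed r)
      finally have "r ?a = b d ?m ?m' \<oplus>\<^bsub>L\<^esub> axpy L d (r g) (r g')"
        using * by (subst (asm) S0.section_eq_iff[OF s]) simp_all
      moreover have "\<rho> (l \<oplus>\<^bsub>L\<^esub> l') = \<rho> l \<oplus>\<^bsub>mid T\<^esub> \<rho> l'" if "l \<in> carrier L" "l' \<in> carrier L" for l l'
        using \<rho>_axpy[of "\<one>\<^bsub>D\<^esub>" l l'] that by simp
      ultimately show "axpy (mid T) d (w ?m \<oplus>\<^bsub>mid T\<^esub> \<rho> (r g)) (w ?m' \<oplus>\<^bsub>mid T\<^esub> \<rho> (r g')) =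
          w (prj S0 ?a) \<oplus>\<^bsub>mid T\<^esub> \<rho> (r ?a) \<oplus>\<^bsub>mid T\<^esub> inc T (\<sigma> d ?m ?m')"
        using * by (simp add: T.G.axpy_add w_axpy T.G.M.a_ac)
    qed (simp_all flip: dec)
    then show ?thesis by (rule has_cocycleI[OF T.exact])
  qed
  ultimately show ?thesis using that T.cocycle_unique[OF _ T] by blast
qed

section \<open>Cocycles of 2-extension modules\<close>

text \<open>The common summand k cancels pointwise and may be any cochain. Comparisons of two
  cochains are thus reduced to comparisons with zero.\<close>

lemma cohomologous_add_iff:
  assumes "left_module D A" "left_module D B"
    and [simp]: "\<And>d a a'. \<lbrakk>d \<in> carrier D; a \<in> carrier A; a' \<in> carrier A\<rbrakk> \<Longrightarrow> k d a a' \<in> carrier B"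
      "\<And>d a a'. \<lbrakk>d \<in> carrier D; a \<in> carrier A; a' \<in> carrier A\<rbrakk> \<Longrightarrow> h d a a' \<in> carrier B"
      "\<And>d a a'. \<lbrakk>d \<in> carrier D; a \<in> carrier A; a' \<in> carrier A\<rbrakk> \<Longrightarrow> h' d a a' \<in> carrier B"
  shows "cohomologous D A B (\<lambda>d a a'. k d a a' \<oplus>\<^bsub>B\<^esub> h d a a') (\<lambda>d a a'. k d a a' \<oplus>\<^bsub>B\<^esub> h' d a a')
    \<longleftrightarrow> cohomologous D A B h h'"
proof -
  interpret A: lmod D A using assms(1) by (rule lmodI)
  interpret B: lmod D B using assms(2) by (rule lmodI)
  have "k d a a' \<oplus>\<^bsub>B\<^esub> h' d a a' \<oplus>\<^bsub>B\<^esub> x (axpy A d a a') =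
      k d a a' \<oplus>\<^bsub>B\<^esub> h d a a' \<oplus>\<^bsub>B\<^esub> axpy B d (x a) (x a') \<longleftrightarrow>
      h' d a a' \<oplus>\<^bsub>B\<^esub> x (axpy A d a a') = h d a a' \<oplus>\<^bsub>B\<^esub> axpy B d (x a) (x a')"
    if "\<forall>a\<in>carrier A. x a \<in> carrier B" "d \<in> carrier D" "a \<in> carrier A" "a' \<in> carrier A" for x d a a'
    using that by (simp add: B.M.a_assoc)
  then show ?thesis by (simp add: cohomologous_def cong: conj_cong)
qed

text \<open>Subtracting the first cochain reduces this to \<open>push_trivial_iff\<close> for
  \<sigma> = \<eta>' - \<eta>; adding \<eta> back on the side of N gives the stated form.\<close>

lemma push_cohomologous_iff:
  assumes S1: "short_exact D L N S1" and t: "ses_section D L N S1 t \<gamma>" and M: "left_module D M"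
    and [simp]: "\<And>d a a'. \<lbrakk>d \<in> carrier D; a \<in> carrier M; a' \<in> carrier M\<rbrakk> \<Longrightarrow> \<beta> d a a' \<in> carrier L"
      "\<And>d a a'. \<lbrakk>d \<in> carrier D; a \<in> carrier M; a' \<in> carrier M\<rbrakk> \<Longrightarrow> \<eta> d a a' \<in> carrier N"
      "\<And>d a a'. \<lbrakk>d \<in> carrier D; a \<in> carrier M; a' \<in> carrier M\<rbrakk> \<Longrightarrow> \<eta>' d a a' \<in> carrier N"
  shows "cohomologous D M (mid S1)
      (\<lambda>d a a'. t (\<beta> d a a') \<oplus>\<^bsub>mid S1\<^esub> inc S1 (\<eta> d a a')) (\<lambda>d a a'. t (\<beta> d a a') \<oplus>\<^bsub>mid S1\<^esub> inc S1 (\<eta>' d a a'))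
    \<longleftrightarrow> (\<exists>\<phi>\<in>mod_hom D M L. cohomologous D M N (\<lambda>d a a'. \<eta> d a a' \<oplus>\<^bsub>N\<^esub> \<gamma> d (\<phi> a) (\<phi> a')) \<eta>')"
    (is "?lhs \<longleftrightarrow> ?rhs")
proof -
  interpret S1: exact_seq D L N S1 by unfold_locales fact
  interpret M: lmod D M using M by (rule lmodI)
  note [simp] = ses_sectionD[OF t] ses_section_cocycle(1)[OF t]
  define \<sigma> where "\<sigma> d a a' = \<ominus>\<^bsub>N\<^esub> \<eta> d a a' \<oplus>\<^bsub>N\<^esub> \<eta>' d a a'" for d a a'
  have \<sigma> [simp]: "\<sigma> d a a' \<in> carrier N" and \<eta>': "\<eta>' d a a' = \<eta> d a a' \<oplus>\<^bsub>N\<^esub> \<sigma> d a a'"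
    if "d \<in> carrier D" "a \<in> carrier M" "a' \<in> carrier M" for d a a'
    using that by (simp_all add: \<sigma>_def S1.B.M.r_neg2)
  let ?\<kappa> = "\<lambda>d a a'. t (\<beta> d a a') \<oplus>\<^bsub>mid S1\<^esub> inc S1 (\<eta> d a a')"
  have "?lhs \<longleftrightarrow> cohomologous D M (mid S1) (\<lambda>d a a'. ?\<kappa> d a a' \<oplus>\<^bsub>mid S1\<^esub> \<zero>\<^bsub>mid S1\<^esub>)
      (\<lambda>d a a'. ?\<kappa> d a a' \<oplus>\<^bsub>mid S1\<^esub> inc S1 (\<sigma> d a a'))"
    by (intro cohomologous_cong) (simp_all add: \<eta>' S1.G.M.a_assoc)
  also have "\<dots> \<longleftrightarrow> cohomologous D M (mid S1) (\<lambda>_ _ _. \<zero>\<^bsub>mid S1\<^esub>) (\<lambda>d a a'. inc S1 (\<sigma> d a a'))"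
    by (rule cohomologous_add_iff) (simp_all add: M S1.G.left_module_axioms)
  also have "\<dots> \<longleftrightarrow> (\<exists>\<phi>\<in>mod_hom D M L. cohomologous D M N (\<lambda>d a a'. \<gamma> d (\<phi> a) (\<phi> a')) \<sigma>)"
    using S1 t M by (rule push_trivial_iff) simp
  also have "\<dots> \<longleftrightarrow> ?rhs"
  proof (rule bex_cong[OF refl])
    fix \<phi> assume \<phi>: "\<phi> \<in> mod_hom D M L"
    have "cohomologous D M N (\<lambda>d a a'. \<eta> d a a' \<oplus>\<^bsub>N\<^esub> \<gamma> d (\<phi> a) (\<phi> a')) (\<lambda>d a a'. \<eta> d a a' \<oplus>\<^bsub>N\<^esub> \<sigma> d a a') \<longleftrightarrow>
        cohomologous D M N (\<lambda>d a a'. \<gamma> d (\<phi> a) (\<phi> a')) \<sigma>"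
      by (rule cohomologous_add_iff) (simp_all add: M S1.B.left_module_axioms mod_hom_closed[OF \<phi>])
    then show "cohomologous D M N (\<lambda>d a a'. \<gamma> d (\<phi> a) (\<phi> a')) \<sigma> \<longleftrightarrow>
        cohomologous D M N (\<lambda>d a a'. \<eta> d a a' \<oplus>\<^bsub>N\<^esub> \<gamma> d (\<phi> a) (\<phi> a')) \<eta>'"
      using \<eta>' by (simp cong: cohomologous_cong)
  qed
  finally show ?thesis .
qed

text \<open>The sequence \<open>M \<leftarrow> E \<leftarrow> E1\<close>; its kernel \<open>E1\<close> is the middle module of \<open>lower_ses E\<close>.\<close>

definition filtration_ses :: "('d, 'm, 'l, 'n, 'e) ext2 \<Rightarrow> ('d, 'm, 'e, 'e) ses"
  where "filtration_ses E =
    \<lparr>mid = E0 E, inc = (\<lambda>x. x), prj = (\<lambda>e. isoM E (E1 E +>\<^bsub>E0 E\<^esub> e))\<rparr>"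

lemma filtration_ses_simps [simp]:
  "mid (filtration_ses E) = E0 E" "inc (filtration_ses E) = (\<lambda>x. x)"
  by (simp_all add: filtration_ses_def)

lemma lower_ses_mid:
  "carrier (mid (lower_ses E)) = E1 E" "add (mid (lower_ses E)) = add (E0 E)"
  "axpy (mid (lower_ses E)) = axpy (E0 E)" "zero (mid (lower_ses E)) = zero (E0 E)"
  by (simp_all add: lower_ses_def)

section \<open>The exact sequences attached to a 2-extension module\<close>

context quotient_module
begin

lemma coset_hom: "(\<lambda>x. H +>\<^bsub>A\<^esub> x) \<in> mod_hom D A (quot_mod A H)"
  using left_module_axioms left_module_quot by (intro mod_homI) (auto simp: carrier_quot axpy_quot)

lemma coset_zero_iff: "x \<in> carrier A \<Longrightarrow> H +>\<^bsub>A\<^esub> x = \<zero>\<^bsub>quot_mod A H\<^esub> \<longleftrightarrow> x \<in> H"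
proof -
  have "\<ominus>\<^bsub>A\<^esub> \<zero>\<^bsub>A\<^esub> = \<zero>\<^bsub>A\<^esub>" by (rule M.minus_equality) simp_all
  then show "x \<in> carrier A \<Longrightarrow> ?thesis"
    by (simp only: zero_quot coset_eq_iff a_minus_def M.zero_closed M.r_zero)
qed

text \<open>Composed with the coset map, an identification of A/H with B is a surjection A -> B with
  kernel H, the shape in which \<open>isoM\<close> and \<open>isoL\<close> enter short exact
  sequences.\<close>

lemma quot_iso:
  assumes f: "f \<in> mod_iso D (quot_mod A H) B" and B: "left_module D B"
  shows quot_iso_hom: "(\<lambda>x. f (H +>\<^bsub>A\<^esub> x)) \<in> mod_hom D A B"
    and quot_iso_surj: "\<And>b. b \<in> carrier B \<Longrightarrow> \<exists>x\<in>carrier A. f (H +>\<^bsub>A\<^esub> x) = b"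
    and quot_iso_zero_iff: "\<And>x. x \<in> carrier A \<Longrightarrow> f (H +>\<^bsub>A\<^esub> x) = \<zero>\<^bsub>B\<^esub> \<longleftrightarrow> x \<in> H"
proof -
  have hom: "f \<in> mod_hom D (quot_mod A H) B" and bij: "bij_betw f (carrier (quot_mod A H)) (carrier B)"
    using f by (simp_all add: mod_iso_def)
  show "(\<lambda>x. f (H +>\<^bsub>A\<^esub> x)) \<in> mod_hom D A B" using coset_hom hom by (rule mod_hom_compose)
  show "\<exists>x\<in>carrier A. f (H +>\<^bsub>A\<^esub> x) = b" if "b \<in> carrier B" for b
  proof -
    have "b \<in> f ` (\<lambda>x. H +>\<^bsub>A\<^esub> x) ` carrier A"
      using bij that by (simp add: bij_betw_def carrier_quot)
    then show ?thesis by blast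
  qed
  show "f (H +>\<^bsub>A\<^esub> x) = \<zero>\<^bsub>B\<^esub> \<longleftrightarrow> x \<in> H" if x: "x \<in> carrier A" for x
  proof -
    have "f (H +>\<^bsub>A\<^esub> x) = f \<zero>\<^bsub>quot_mod A H\<^esub> \<longleftrightarrow> H +>\<^bsub>A\<^esub> x = \<zero>\<^bsub>quot_mod A H\<^esub>"
      using bij x by (intro inj_on_eq_iff) (auto simp: bij_betw_def carrier_quot zero_quot)
    then show ?thesis using mod_hom_zero[OF hom left_module_quot B] coset_zero_iff[OF x] by simp
  qed
qed

end

text \<open>The passage converse to \<open>quot_iso\<close>. It supplies \<open>isoM\<close> and
  \<open>isoL\<close> when a 2-extension module is built from a given extension.\<close>

lemma first_isomorphism:
  assumes f: "f \<in> mod_hom D A B" and A: "left_module D A" and B: "left_module D B"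
    and surj: "\<forall>b\<in>carrier B. \<exists>x\<in>carrier A. f x = b"
    and H: "H = {x \<in> carrier A. f x = \<zero>\<^bsub>B\<^esub>}"
  shows submodule_kernel: "submodule H D A"
    and the_elem_image_kernel_coset: "\<And>x. x \<in> carrier A \<Longrightarrow> the_elem (f ` (H +>\<^bsub>A\<^esub> x)) = f x"
    and first_isomorphism_iso: "(\<lambda>C. the_elem (f ` C)) \<in> mod_iso D (quot_mod A H) B"
proof -
  interpret A: lmod D A using A by (rule lmodI)
  interpret B: lmod D B using B by (rule lmodI)
  note [simp] = mod_hom_closed[OF f] mod_hom_axpy[OF f A] mod_hom_add[OF f] mod_hom_zero[OF f A B]
  show sub: "submodule H D A"
  proof (rule A.submodule_of_closed_subset)
    have "\<zero>\<^bsub>A\<^esub> \<in> H" by (simp add: H)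
    then show "H \<noteq> {}" by blast
  qed (auto simp: H)
  have zero_H: "\<zero>\<^bsub>A\<^esub> \<in> H" by (simp add: H)
  have H_D: "h \<in> carrier A" "f h = \<zero>\<^bsub>B\<^esub>" if "h \<in> H" for h using that by (simp_all add: H)
  have H_I: "x \<in> H" if "x \<in> carrier A" "f x = \<zero>\<^bsub>B\<^esub>" for x using that by (simp add: H)
  interpret Q: quotient_module D A H
    by (intro quotient_module.intro quotient_module_axioms.intro A.lmod_axioms sub)
  show val: "the_elem (f ` (H +>\<^bsub>A\<^esub> x)) = f x" if x: "x \<in> carrier A" for x
  proof (rule the_elem_image_coset)
    show "\<zero>\<^bsub>A\<^esub> \<in> H" by (rule zero_H)
    show "f (h \<oplus>\<^bsub>A\<^esub> x) = f x" if "h \<in> H" for h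
      using H_D[OF that] x by simp
  qed
  let ?g = "\<lambda>C. the_elem (f ` C)"
  have hom: "?g \<in> mod_hom D (quot_mod A H) B"
    by (rule mod_homI[OF Q.left_module_quot B]) (auto simp: Q.carrier_quot Q.axpy_quot val)
  moreover have "inj_on ?g (carrier (quot_mod A H))"
  proof (rule inj_onI)
    fix C C' assume "C \<in> carrier (quot_mod A H)" "C' \<in> carrier (quot_mod A H)" and eq: "?g C = ?g C'"
    then obtain x y where xy: "x \<in> carrier A" "y \<in> carrier A" "C = H +>\<^bsub>A\<^esub> x" "C' = H +>\<^bsub>A\<^esub> y"
      unfolding Q.carrier_quot by blast
    then have "f x = f y" using eq by (simp add: val)
    moreover have "f x = f (x \<ominus>\<^bsub>A\<^esub> y) \<oplus>\<^bsub>B\<^esub> f y"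
      using xy(1,2) mod_hom_add[OF f, of "x \<ominus>\<^bsub>A\<^esub> y" y]
      by (simp add: a_minus_def A.M.a_assoc A.M.l_neg del: mod_hom_add[OF f])
    ultimately have "f (x \<ominus>\<^bsub>A\<^esub> y) = \<zero>\<^bsub>B\<^esub>" using xy(1,2) by (simp del: mod_hom_add[OF f])
    then have "x \<ominus>\<^bsub>A\<^esub> y \<in> H" using xy(1,2) by (intro H_I) simp_all
    then show "C = C'" using xy by (simp add: Q.coset_eq_iff)
  qed
  moreover have "?g ` carrier (quot_mod A H) = carrier B"
    using surj by (auto simp: Q.carrier_quot image_image val image_iff)
  ultimately show "?g \<in> mod_iso D (quot_mod A H) B" by (simp add: mod_iso_def bij_betw_def)
qed

locale two_ext =
  fixes D :: "('d, 'z) ring_scheme" and M :: "('d, 'm) module" and L :: "('d, 'l) module"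
    and N :: "('d, 'n) module" and E :: "('d, 'm, 'l, 'n, 'e) ext2"
  assumes two_extension: "two_extension D M L N E"
begin

sublocale E: lmod D "E0 E" using two_extension by (simp add: two_extension_def lmodI)

lemma modules: "left_module D M" "left_module D L" "left_module D N"
  and E1: "submodule (E1 E) D (E0 E)" and E2: "submodule (E2 E) D (E0 E)" and E2_E1: "E2 E \<subseteq> E1 E"
  and isoM: "isoM E \<in> mod_iso D (quot_mod (E0 E) (E1 E)) M"
  and isoL: "isoL E \<in> mod_iso D (quot_mod (mid (lower_ses E)) (E2 E)) L"
  and isoN: "isoN E \<in> mod_iso D (E0 E\<lparr>carrier := E2 E\<rparr>) N"
  using two_extension by (auto simp: two_extension_def lower_ses_def)

sublocale Q1: quotient_module D "E0 E" "E1 E"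
  by (intro quotient_module.intro quotient_module_axioms.intro E.lmod_axioms E1)

sublocale Q2: quotient_module D "E0 E" "E2 E"
  by (intro quotient_module.intro quotient_module_axioms.intro E.lmod_axioms E2)

lemma E1_carrier: "x \<in> E1 E \<Longrightarrow> x \<in> carrier (E0 E)"
  using Q1.a_subset by blast

lemma zero_E2: "\<zero>\<^bsub>E0 E\<^esub> \<in> E2 E" and zero_E1: "\<zero>\<^bsub>E0 E\<^esub> \<in> E1 E"
  using Q2.sub.one_closed E2_E1 by auto

lemma left_module_E1: "left_module D (E0 E\<lparr>carrier := E1 E\<rparr>)"
  and left_module_E2: "left_module D (E0 E\<lparr>carrier := E2 E\<rparr>)"
proof -
  have "E1 E \<noteq> {}" "E2 E \<noteq> {}" using zero_E1 zero_E2 by blast+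
  then show "left_module D (E0 E\<lparr>carrier := E1 E\<rparr>)" "left_module D (E0 E\<lparr>carrier := E2 E\<rparr>)"
    using E1_carrier E2_E1 E1 E2 E.left_module_axioms
    by (auto intro!: E.left_module_of_closed_subset simp: submodule_axpy subset_iff)
qed

lemma left_module_lower_mid: "left_module D (mid (lower_ses E))"
  using left_module_E1 by (simp add: lower_ses_def)

lemma submodule_E2_E1: "submodule (E2 E) D (mid (lower_ses E))"
proof -
  interpret K: lmod D "mid (lower_ses E)" using left_module_lower_mid by (rule lmodI)
  have "E2 E \<noteq> {}" using zero_E2 by blast
  then show ?thesis
    using E2_E1 E2 E.left_module_axioms
    by (intro K.submodule_of_closed_subset) (auto simp: lower_ses_mid submodule_axpy)
qed

lemma short_exact_lower: "short_exact D L N (lower_ses E)"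
proof -
  interpret K: lmod D "mid (lower_ses E)" using left_module_lower_mid by (rule lmodI)
  interpret Q: quotient_module D "mid (lower_ses E)" "E2 E"
    by (intro quotient_module.intro quotient_module_axioms.intro K.lmod_axioms submodule_E2_E1)
  have prj: "prj (lower_ses E) = (\<lambda>x. isoL E (E2 E +>\<^bsub>mid (lower_ses E)\<^esub> x))"
    by (simp add: lower_ses_def)
  have bij: "bij_betw (isoN E) (E2 E) (carrier N)" using isoN by (simp add: mod_iso_def)
  have inc: "inc (lower_ses E) \<in> mod_iso D N (E0 E\<lparr>carrier := E2 E\<rparr>)"
    using mod_iso_inv[OF isoN left_module_E2 modules(3)] by (simp add: lower_ses_def)
  then have inc_hom: "inc (lower_ses E) \<in> mod_hom D N (E0 E\<lparr>carrier := E2 E\<rparr>)"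
    and inc_bij: "bij_betw (inc (lower_ses E)) (carrier N) (E2 E)" by (simp_all add: mod_iso_def)
  note iso = Q.quot_iso[OF isoL modules(2)]
  show ?thesis
  proof (rule short_exactI[OF modules(2,3) left_module_lower_mid])
    show "inc (lower_ses E) \<in> mod_hom D N (mid (lower_ses E))"
      using inc_hom E2_E1 by (auto simp: mod_hom_def lower_ses_def Pi_iff)
    show "prj (lower_ses E) \<in> mod_hom D (mid (lower_ses E)) L" unfolding prj by (rule iso)
    show "\<exists>x\<in>carrier (mid (lower_ses E)). prj (lower_ses E) x = a" if "a \<in> carrier L" for a
      using iso(2)[OF that] by (simp add: prj)
    have in_E2: "inc (lower_ses E) b \<in> E2 E" if "b \<in> carrier N" for b
      using inc_bij that by (auto simp: bij_betw_def)
    show "prj (lower_ses E) (inc (lower_ses E) b) = \<zero>\<^bsub>L\<^esub>" if "b \<in> carrier N" for b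
      unfolding prj using iso(3) in_E2[OF that] E2_E1 by (auto simp: lower_ses_mid)
    show "\<exists>b\<in>carrier N. x = inc (lower_ses E) b"
      if x: "x \<in> carrier (mid (lower_ses E))" "prj (lower_ses E) x = \<zero>\<^bsub>L\<^esub>" for x
    proof -
      have "x \<in> E2 E" using iso(3)[OF x(1)] x(2) by (simp add: prj)
      then show ?thesis using inc_bij by (auto simp: bij_betw_def)
    qed
    show "b = b'" if "b \<in> carrier N" "b' \<in> carrier N" "inc (lower_ses E) b = inc (lower_ses E) b'" for b b'
      using inj_onD[OF bij_betw_imp_inj_on[OF inc_bij] that(3,1,2)] .
  qed
qed

sublocale lower: exact_seq D L N "lower_ses E"
  by unfold_locales (rule short_exact_lower)

lemma short_exact_filtration: "short_exact D M (mid (lower_ses E)) (filtration_ses E)"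
proof -
  have prj: "prj (filtration_ses E) = (\<lambda>x. isoM E (E1 E +>\<^bsub>E0 E\<^esub> x))"
    by (simp add: filtration_ses_def)
  note iso = Q1.quot_iso[OF isoM modules(1)]
  show ?thesis
  proof (rule short_exactI[OF modules(1) left_module_lower_mid])
    show "inc (filtration_ses E) \<in> mod_hom D (mid (lower_ses E)) (mid (filtration_ses E))"
      using E1_carrier by (auto simp: mod_hom_def lower_ses_def)
    show "prj (filtration_ses E) \<in> mod_hom D (mid (filtration_ses E)) M"
      unfolding prj filtration_ses_simps by (rule iso)
    show "\<exists>x\<in>carrier (mid (filtration_ses E)). prj (filtration_ses E) x = a" if "a \<in> carrier M" for a
      using iso(2)[OF that] by (simp add: prj)
  qed (use iso(3) E1_carrier in \<open>auto simp: prj lower_ses_mid E.left_module_axioms\<close>)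
qed

sublocale filt: exact_seq D M "mid (lower_ses E)" "filtration_ses E"
  by unfold_locales (rule short_exact_filtration)

lemma inc_lower_image: "inc (lower_ses E) ` carrier N = E2 E"
proof -
  have bij: "bij_betw (isoN E) (E2 E) (carrier N)" using isoN by (simp add: mod_iso_def)
  from bij_betw_inv_into[OF bij] show ?thesis by (simp add: lower_ses_def bij_betw_def)
qed

lemma isoN_inc: "n \<in> carrier N \<Longrightarrow> isoN E (inc (lower_ses E) n) = n"
proof -
  have bij: "bij_betw (isoN E) (E2 E) (carrier N)" using isoN by (simp add: mod_iso_def)
  then show "n \<in> carrier N \<Longrightarrow> ?thesis" by (simp add: lower_ses_def bij_betw_inv_into_right)
qed

text \<open>\<open>upper_ses E\<close> arises from M <- E <- E1 by dividing by E2, the kernel of E1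
  -> L. So this is \<open>quot_ses\<close> with \<psi> the projection of
  \<open>lower_ses E\<close>.\<close>

lemma cocycle_upper:
  assumes "has_cocycle D M (mid (lower_ses E)) (filtration_ses E) \<kappa>"
  shows "has_cocycle D M L (upper_ses E) (\<lambda>d a a'. prj (lower_ses E) (\<kappa> d a a'))"
proof (rule cocycle_quot_ses[OF short_exact_filtration modules(2) lower.prj_hom, where H = "E2 E"])
  show "E2 E = inc (filtration_ses E) ` {b \<in> carrier (mid (lower_ses E)). prj (lower_ses E) b = \<zero>\<^bsub>L\<^esub>}"
    unfolding filtration_ses_simps image_ident by (rule trans[OF inc_lower_image[symmetric] lower.inc_image])
  show "mid (upper_ses E) = quot_mod (mid (filtration_ses E)) (E2 E)"
    by (simp add: upper_ses_def)
  have bij: "bij_betw (isoL E) (carrier (quot_mod (mid (lower_ses E)) (E2 E))) (carrier L)"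
    using isoL by (simp add: mod_iso_def)
  show "\<exists>b\<in>carrier (mid (lower_ses E)). prj (lower_ses E) b = b' \<and>
      inc (upper_ses E) b' = E2 E +>\<^bsub>mid (filtration_ses E)\<^esub> inc (filtration_ses E) b"
    if b': "b' \<in> carrier L" for b'
  proof -
    interpret Q: quotient_module D "mid (lower_ses E)" "E2 E"
      by (intro quotient_module.intro quotient_module_axioms.intro lower.G.lmod_axioms submodule_E2_E1)
    have inc: "inc (upper_ses E) = inv_into (carrier (quot_mod (mid (lower_ses E)) (E2 E))) (isoL E)"
      by (simp add: upper_ses_def lower_ses_def)
    have "inc (upper_ses E) b' \<in> carrier (quot_mod (mid (lower_ses E)) (E2 E))"
      using bij_betw_inv_into[OF bij] b' by (auto simp: inc bij_betw_def)
    then obtain x where x: "x \<in> carrier (mid (lower_ses E))" "inc (upper_ses E) b' = E2 E +>\<^bsub>mid (lower_ses E)\<^esub> x"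
      unfolding Q.carrier_quot by blast
    moreover have "isoL E (inc (upper_ses E) b') = b'"
      using bij b' by (simp add: inc bij_betw_inv_into_right)
    ultimately show ?thesis by (intro bexI[of _ x]) (simp_all add: lower_ses_def)
  qed
  show "prj (upper_ses E) (E2 E +>\<^bsub>mid (filtration_ses E)\<^esub> x) = prj (filtration_ses E) x"
    if "x \<in> carrier (mid (filtration_ses E))" for x
  proof -
    \<comment> \<open>\<open>upper_ses\<close> sends a coset C of E2 to E1 + C; because E2 is
      contained in E1, this is the coset of E1 with the same representative.\<close>
    have "E1 E <+>\<^bsub>E0 E\<^esub> (E2 E +>\<^bsub>E0 E\<^esub> x) = E1 E +>\<^bsub>E0 E\<^esub> x" (is "?A = ?B")
    proof (intro equalityI subsetI)
      fix y assume "y \<in> ?A"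
      then obtain a b where ab: "a \<in> E1 E" "b \<in> E2 E" "y = a \<oplus>\<^bsub>E0 E\<^esub> (b \<oplus>\<^bsub>E0 E\<^esub> x)"
        by (auto simp: set_add_def set_mult_def mem_a_r_coset)
      moreover have b: "b \<in> E1 E" using ab E2_E1 by blast
      ultimately have "y = (a \<oplus>\<^bsub>E0 E\<^esub> b) \<oplus>\<^bsub>E0 E\<^esub> x" "a \<oplus>\<^bsub>E0 E\<^esub> b \<in> E1 E"
        using that E1_carrier by (simp_all add: E.M.a_assoc Q1.a_closed)
      then show "y \<in> ?B" unfolding mem_a_r_coset by blast
    next
      fix y assume "y \<in> ?B"
      then obtain a where a: "a \<in> E1 E" "y = a \<oplus>\<^bsub>E0 E\<^esub> x" unfolding mem_a_r_coset by blast
      moreover have "x \<in> E2 E +>\<^bsub>E0 E\<^esub> x" using that by (intro Q2.a_rcos_self) simp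
      ultimately show "y \<in> ?A" by (auto simp: set_add_def set_mult_def)
    qed
    then show ?thesis by (simp add: upper_ses_def filtration_ses_def)
  qed
qed fact

end

lemma two_extI: "two_extension D M L N E \<Longrightarrow> two_ext D M L N E"
  by (simp add: two_ext_def)

text \<open>The short five lemma is applied twice, first to E1 as an extension of L by N, then to E
  as an extension of M by E1. Compatibility with the three subfactors thus yields bijectivity and
  the equalities of the filtration steps.\<close>

lemma ext2_equivI:
  assumes "two_extension D M L N E" "two_extension D M L N F"
    and \<alpha>: "\<alpha> \<in> mod_hom D (E0 E) (E0 F)"
    and \<alpha>M: "\<And>x. x \<in> carrier (E0 E) \<Longrightarrow> prj (filtration_ses F) (\<alpha> x) = prj (filtration_ses E) x"
    and \<alpha>L: "\<And>x. x \<in> E1 E \<Longrightarrow> prj (lower_ses F) (\<alpha> x) = prj (lower_ses E) x"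
    and \<alpha>N: "\<And>n. n \<in> carrier N \<Longrightarrow> \<alpha> (inc (lower_ses E) n) = inc (lower_ses F) n"
  shows "ext2_equiv D E F"
proof -
  interpret E: two_ext D M L N E by (rule two_extI) fact
  interpret F: two_ext D M L N F by (rule two_extI) fact
  have \<alpha>1: "\<alpha> x \<in> E1 F" if x: "x \<in> E1 E" for x
  proof -
    have "prj (filtration_ses F) (\<alpha> x) = \<zero>\<^bsub>M\<^esub>"
      using x \<alpha>M E.E1_carrier E.filt.prj_inc[of x] by (simp add: lower_ses_mid)
    moreover have "\<alpha> x \<in> carrier (E0 F)" using \<alpha> E.E1_carrier[OF x] by (rule mod_hom_closed)
    ultimately show ?thesis by (auto elim: F.filt.kernelE[simplified] simp: lower_ses_mid)
  qed
  have "\<alpha> \<in> mod_hom D (mid (lower_ses E)) (mid (lower_ses F))"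
    using \<alpha> \<alpha>1 E.E1_carrier by (auto simp: mod_hom_def lower_ses_def)
  then have iso1: "\<alpha> \<in> mod_iso D (mid (lower_ses E)) (mid (lower_ses F))"
    by (rule five_lemma[OF E.short_exact_lower F.short_exact_lower, of _ "\<lambda>x. x"])
       (simp_all add: \<alpha>N \<alpha>L lower_ses_mid bij_betw_def)
  then have bij1: "bij_betw \<alpha> (E1 E) (E1 F)" by (simp add: mod_iso_def lower_ses_mid)
  have iso: "\<alpha> \<in> mod_iso D (E0 E) (E0 F)"
    using five_lemma[OF E.short_exact_filtration F.short_exact_filtration, of \<alpha> \<alpha>] \<alpha> bij1 \<alpha>M
    by (simp add: lower_ses_mid)
  have "\<alpha> ` E2 E = E2 F"
    unfolding E.inc_lower_image[symmetric] F.inc_lower_image[symmetric] image_image using \<alpha>N by simp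
  moreover have "isoN F (\<alpha> e) = isoN E e" if "e \<in> E2 E" for e
    using that \<alpha>N by (auto simp: E.isoN_inc F.isoN_inc simp flip: E.inc_lower_image)
  moreover have "\<alpha> ` E1 E = E1 F" using bij1 by (simp add: bij_betw_def)
  ultimately show ?thesis
    using iso \<alpha>M \<alpha>L unfolding ext2_equiv_def
    by (intro bexI[of _ \<alpha>]) (simp_all add: filtration_ses_def lower_ses_def)
qed

section \<open>Triples of cochains describing a 2-extension module\<close>

text \<open>The cocycle of M <- E <- E1 has values in E1; the section t of E1 -> L splits it into
  \<beta> with values in L and \<eta> with values in N. The section t is quantified away, while its
  own cocycle \<gamma> is recorded.\<close>

definition ext2_cocycle ::
  "('d, 'z) ring_scheme \<Rightarrow> ('d, 'm) module \<Rightarrow> ('d, 'l) module \<Rightarrow> ('d, 'n) module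
    \<Rightarrow> ('d, 'm, 'l, 'n, 'e) ext2 \<Rightarrow> ('d \<Rightarrow> 'm \<Rightarrow> 'm \<Rightarrow> 'l) \<Rightarrow> ('d \<Rightarrow> 'l \<Rightarrow> 'l \<Rightarrow> 'n)
    \<Rightarrow> ('d \<Rightarrow> 'm \<Rightarrow> 'm \<Rightarrow> 'n) \<Rightarrow> bool"
  where "ext2_cocycle D M L N E \<beta> \<gamma> \<eta> \<longleftrightarrow> two_extension D M L N E \<and>
    (\<forall>d\<in>carrier D. \<forall>a\<in>carrier M. \<forall>a'\<in>carrier M. \<beta> d a a' \<in> carrier L \<and> \<eta> d a a' \<in> carrier N) \<and>
    (\<exists>t. ses_section D L N (lower_ses E) t \<gamma> \<and>
      has_cocycle D M (mid (lower_ses E)) (filtration_ses E)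
        (\<lambda>d a a'. t (\<beta> d a a') \<oplus>\<^bsub>mid (lower_ses E)\<^esub> inc (lower_ses E) (\<eta> d a a')))"

lemma ext2_cocycle_cong:
  assumes "\<And>d a a'. \<lbrakk>d \<in> carrier D; a \<in> carrier M; a' \<in> carrier M\<rbrakk> \<Longrightarrow> \<eta> d a a' = \<eta>' d a a'"
  shows "ext2_cocycle D M L N E \<beta> \<gamma> \<eta> \<longleftrightarrow> ext2_cocycle D M L N E \<beta> \<gamma> \<eta>'"
proof -
  have "has_cocycle D M (mid (lower_ses E)) (filtration_ses E)
        (\<lambda>d a a'. t (\<beta> d a a') \<oplus>\<^bsub>mid (lower_ses E)\<^esub> inc (lower_ses E) (\<eta> d a a')) \<longleftrightarrow>
      has_cocycle D M (mid (lower_ses E)) (filtration_ses E)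
        (\<lambda>d a a'. t (\<beta> d a a') \<oplus>\<^bsub>mid (lower_ses E)\<^esub> inc (lower_ses E) (\<eta>' d a a'))" for t
    using assms by (intro has_cocycle_cong) simp
  then show ?thesis using assms by (simp add: ext2_cocycle_def)
qed

lemma ext2_cocycleE:
  assumes "ext2_cocycle D M L N E \<beta> \<gamma> \<eta>"
  obtains t where "two_ext D M L N E" "ses_section D L N (lower_ses E) t \<gamma>"
    "has_cocycle D M (mid (lower_ses E)) (filtration_ses E)
        (\<lambda>d a a'. t (\<beta> d a a') \<oplus>\<^bsub>mid (lower_ses E)\<^esub> inc (lower_ses E) (\<eta> d a a'))"
    "\<forall>d\<in>carrier D. \<forall>a\<in>carrier M. \<forall>a'\<in>carrier M. \<beta> d a a' \<in> carrier L"
    "\<forall>d\<in>carrier D. \<forall>a\<in>carrier M. \<forall>a'\<in>carrier M. \<eta> d a a' \<in> carrier N"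
  using assms unfolding ext2_cocycle_def two_ext_def by blast

text \<open>The data determine E layer by layer: equal \<gamma> gives a morphism \<theta> between
  the submodules E1 that respects the sections, hence the cocycles of M <- E <- E1 correspond under
  \<theta>, which gives \<alpha> over \<theta>. Conversely an equivalence transports both
  sections.\<close>

lemma ext2_equiv_iff_cocycle:
  assumes E: "ext2_cocycle D M L N E \<beta> \<gamma> \<eta>" and F: "two_extension D M L N F"
  shows "ext2_equiv D E F \<longleftrightarrow> ext2_cocycle D M L N F \<beta> \<gamma> \<eta>"
proof
  from E obtain t where "two_ext D M L N E" and t: "ses_section D L N (lower_ses E) t \<gamma>"
    and \<kappa>: "has_cocycle D M (mid (lower_ses E)) (filtration_ses E)
        (\<lambda>d a a'. t (\<beta> d a a') \<oplus>\<^bsub>mid (lower_ses E)\<^esub> inc (lower_ses E) (\<eta> d a a'))"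
    and \<beta> [rule_format, simp]: "\<forall>d\<in>carrier D. \<forall>a\<in>carrier M. \<forall>a'\<in>carrier M. \<beta> d a a' \<in> carrier L"
    and \<eta> [rule_format, simp]: "\<forall>d\<in>carrier D. \<forall>a\<in>carrier M. \<forall>a'\<in>carrier M. \<eta> d a a' \<in> carrier N"
    by (rule ext2_cocycleE)
  interpret E: two_ext D M L N E by fact
  interpret F: two_ext D M L N F using F by (rule two_extI)
  obtain s where s: "ses_section D M (mid (lower_ses E)) (filtration_ses E) s
        (\<lambda>d a a'. t (\<beta> d a a') \<oplus>\<^bsub>mid (lower_ses E)\<^esub> inc (lower_ses E) (\<eta> d a a'))"
    using \<kappa> by (auto simp: has_cocycle_def)
  {
    assume "ext2_equiv D E F"
    then obtain \<alpha> where iso: "\<alpha> \<in> mod_iso D (E0 E) (E0 F)" and \<alpha>1: "\<alpha> ` E1 E = E1 F" and \<alpha>2: "\<alpha> ` E2 E = E2 F"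
      and \<alpha>M: "\<forall>e\<in>carrier (E0 E). isoM F (E1 F +>\<^bsub>E0 F\<^esub> \<alpha> e) = isoM E (E1 E +>\<^bsub>E0 E\<^esub> e)"
      and \<alpha>L: "\<forall>e\<in>E1 E. isoL F (E2 F +>\<^bsub>E0 F\<^esub> \<alpha> e) = isoL E (E2 E +>\<^bsub>E0 E\<^esub> e)"
      and \<alpha>N: "\<forall>e\<in>E2 E. isoN F (\<alpha> e) = isoN E e"
      by (auto simp: ext2_equiv_def)
    have \<alpha>: "\<alpha> \<in> mod_hom D (E0 E) (E0 F)" using iso by (simp add: mod_iso_def)
    have inc: "\<alpha> (inc (lower_ses E) n) = inc (lower_ses F) n" if n: "n \<in> carrier N" for n
    proof -
      have e: "inc (lower_ses E) n \<in> E2 E" using n E.inc_lower_image by blast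
      then have "\<alpha> (inc (lower_ses E) n) \<in> inc (lower_ses F) ` carrier N"
        using \<alpha>2 F.inc_lower_image by blast
      then obtain n' where "n' \<in> carrier N" "\<alpha> (inc (lower_ses E) n) = inc (lower_ses F) n'" by blast
      then show ?thesis using \<alpha>N e n E.isoN_inc F.isoN_inc by metis
    qed
    have \<alpha>K: "\<alpha> \<in> mod_hom D (mid (lower_ses E)) (mid (lower_ses F))"
      using \<alpha> \<alpha>1 E.E1_carrier by (auto simp: mod_hom_def lower_ses_def)
    have t': "ses_section D L N (lower_ses F) (\<lambda>l. \<alpha> (t l)) \<gamma>"
      using section_transport[OF t E.short_exact_lower \<alpha>K, of "\<lambda>n. n"] \<alpha>L inc
      by (simp add: lower_ses_mid) (simp add: lower_ses_def)
    have "ses_section D M (mid (lower_ses F)) (filtration_ses F) (\<lambda>a. \<alpha> (s a))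
        (\<lambda>d a a'. \<alpha> (t (\<beta> d a a') \<oplus>\<^bsub>mid (lower_ses E)\<^esub> inc (lower_ses E) (\<eta> d a a')))"
      using \<alpha> \<alpha>1 \<alpha>M by (intro section_transport[OF s E.short_exact_filtration])
        (auto simp: lower_ses_mid filtration_ses_def)
    then have "has_cocycle D M (mid (lower_ses F)) (filtration_ses F)
        (\<lambda>d a a'. \<alpha> (t (\<beta> d a a') \<oplus>\<^bsub>mid (lower_ses E)\<^esub> inc (lower_ses E) (\<eta> d a a')))"
      by (rule has_cocycleI[OF F.short_exact_filtration])
    then have "has_cocycle D M (mid (lower_ses F)) (filtration_ses F)
        (\<lambda>d a a'. \<alpha> (t (\<beta> d a a')) \<oplus>\<^bsub>mid (lower_ses F)\<^esub> inc (lower_ses F) (\<eta> d a a'))"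
      by (subst (asm) has_cocycle_cong) (simp_all add: mod_hom_add[OF \<alpha>K] ses_sectionD[OF t] inc)
    then show "ext2_cocycle D M L N F \<beta> \<gamma> \<eta>"
      using F t' \<beta> \<eta> unfolding ext2_cocycle_def by blast
  next
    assume "ext2_cocycle D M L N F \<beta> \<gamma> \<eta>"
    then obtain t' where t': "ses_section D L N (lower_ses F) t' \<gamma>"
      and \<kappa>': "has_cocycle D M (mid (lower_ses F)) (filtration_ses F)
          (\<lambda>d a a'. t' (\<beta> d a a') \<oplus>\<^bsub>mid (lower_ses F)\<^esub> inc (lower_ses F) (\<eta> d a a'))"
      by (rule ext2_cocycleE)
    obtain s' where s': "ses_section D M (mid (lower_ses F)) (filtration_ses F) s'
          (\<lambda>d a a'. t' (\<beta> d a a') \<oplus>\<^bsub>mid (lower_ses F)\<^esub> inc (lower_ses F) (\<eta> d a a'))"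
      using \<kappa>' by (auto simp: has_cocycle_def)
    obtain \<theta> where \<theta>: "\<theta> \<in> mod_hom D (mid (lower_ses E)) (mid (lower_ses F))"
      and \<theta>N: "\<And>n. n \<in> carrier N \<Longrightarrow> \<theta> (inc (lower_ses E) n) = inc (lower_ses F) n"
      and \<theta>L: "\<And>x. x \<in> carrier (mid (lower_ses E)) \<Longrightarrow> prj (lower_ses F) (\<theta> x) = prj (lower_ses E) x"
      and \<theta>t: "\<And>l. l \<in> carrier L \<Longrightarrow> \<theta> (t l) = t' l"
      by (rule ses_map[OF E.short_exact_lower F.short_exact_lower t t' mod_hom_id mod_hom_id]) auto
    obtain \<alpha> where \<alpha>: "\<alpha> \<in> mod_hom D (mid (filtration_ses E)) (mid (filtration_ses F))"
      and \<alpha>K: "\<And>k. k \<in> carrier (mid (lower_ses E)) \<Longrightarrow> \<alpha> (inc (filtration_ses E) k) = inc (filtration_ses F) (\<theta> k)"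
      and \<alpha>M: "\<And>x. x \<in> carrier (mid (filtration_ses E)) \<Longrightarrow> prj (filtration_ses F) (\<alpha> x) = prj (filtration_ses E) x"
      by (rule ses_map[OF E.short_exact_filtration F.short_exact_filtration s s' mod_hom_id \<theta>])
         (auto simp: mod_hom_add[OF \<theta>] ses_sectionD[OF t] \<theta>N \<theta>t)
    show "ext2_equiv D E F"
      using E.two_extension F
    proof (rule ext2_equivI)
      show "\<alpha> \<in> mod_hom D (E0 E) (E0 F)" using \<alpha> by simp
      show "prj (filtration_ses F) (\<alpha> x) = prj (filtration_ses E) x" if "x \<in> carrier (E0 E)" for x
        using \<alpha>M that by simp
      show "prj (lower_ses F) (\<alpha> x) = prj (lower_ses E) x" if "x \<in> E1 E" for x
        using \<alpha>K[of x] \<theta>L[of x] that by (simp add: lower_ses_mid)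
      show "\<alpha> (inc (lower_ses E) n) = inc (lower_ses F) n" if "n \<in> carrier N" for n
        using \<alpha>K[of "inc (lower_ses E) n"] \<theta>N[OF that] that by simp
    qed
  }
qed

lemma ext_class_eq_iff:
  fixes A :: "('d, 'a) module" and B :: "('d, 'b) module"
  assumes S: "short_exact D A B S" and h: "cocycle D A B h"
  shows "ext_class D A B S = cocycle_class D A B h \<longleftrightarrow> has_cocycle D A B S h"
proof
  assume eq: "ext_class D A B S = cocycle_class D A B h"
  interpret exact_seq D A B S by unfold_locales (rule S)
  obtain k where k: "has_cocycle D A B S k" using ex_cocycle by blast
  then have "cohomologous D A B k h"
    using eq ext_class_eq[OF k] cocycle_class_eq_iff[OF cocycleI[OF k] h] by simp
  then show "has_cocycle D A B S h" using k cocycle_closed[OF h] by (blast intro: cocycle_change)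
qed (rule ext_class_eq)

lemma ext2_cocycle_upper:
  assumes "ext2_cocycle D M L N E \<beta> \<gamma> \<eta>"
  shows "has_cocycle D M L (upper_ses E) \<beta>"
  using assms
proof (rule ext2_cocycleE)
  fix t
  assume E: "two_ext D M L N E" and t: "ses_section D L N (lower_ses E) t \<gamma>"
    and \<kappa>: "has_cocycle D M (mid (lower_ses E)) (filtration_ses E)
        (\<lambda>d a a'. t (\<beta> d a a') \<oplus>\<^bsub>mid (lower_ses E)\<^esub> inc (lower_ses E) (\<eta> d a a'))"
    and cl: "\<forall>d\<in>carrier D. \<forall>a\<in>carrier M. \<forall>a'\<in>carrier M. \<beta> d a a' \<in> carrier L"
    "\<forall>d\<in>carrier D. \<forall>a\<in>carrier M. \<forall>a'\<in>carrier M. \<eta> d a a' \<in> carrier N"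
  interpret two_ext D M L N E by (rule E)
  show ?thesis
    using cocycle_upper[OF \<kappa>] cl by (subst (asm) has_cocycle_cong) (simp_all add: ses_sectionD[OF t])
qed

lemma ext2_cocycle_lower:
  assumes "ext2_cocycle D M L N E \<beta> \<gamma> \<eta>"
  shows "has_cocycle D L N (lower_ses E) \<gamma>"
  using assms
proof (rule ext2_cocycleE)
  fix t
  assume E: "two_ext D M L N E" and t: "ses_section D L N (lower_ses E) t \<gamma>"
  interpret two_ext D M L N E by (rule E)
  show ?thesis using short_exact_lower t by (rule has_cocycleI)
qed

text \<open>A section t with cocycle \<gamma> is given by hypothesis, and
  \<open>has_cocycle_push_adjust\<close> changes the cocycle of M <- E <- E1 until its L-component
  is the prescribed \<beta>; only \<eta> is left to be found.\<close>

lemma ex_ext2_cocycle: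
  assumes E: "two_extension D M L N E"
    and \<beta>: "has_cocycle D M L (upper_ses E) \<beta>" and \<gamma>: "has_cocycle D L N (lower_ses E) \<gamma>"
  shows "\<exists>\<eta>. ext2_cocycle D M L N E \<beta> \<gamma> \<eta>"
proof -
  interpret two_ext D M L N E using E by (rule two_extI)
  interpret upper: exact_seq D M L "upper_ses E"
    by unfold_locales (use \<beta> in \<open>rule has_cocycle_exact\<close>)
  obtain t where t: "ses_section D L N (lower_ses E) t \<gamma>" using \<gamma> by (auto simp: has_cocycle_def)
  obtain \<kappa> where \<kappa>: "has_cocycle D M (mid (lower_ses E)) (filtration_ses E) \<kappa>"
    using filt.ex_cocycle by blast
  have "cohomologous D M L (\<lambda>d a a'. prj (lower_ses E) (\<kappa> d a a')) \<beta>"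
    using cocycle_upper[OF \<kappa>] \<beta> by (rule upper.cocycle_unique)
  then obtain \<eta> where "has_cocycle D M (mid (lower_ses E)) (filtration_ses E)
        (\<lambda>d a a'. t (\<beta> d a a') \<oplus>\<^bsub>mid (lower_ses E)\<^esub> inc (lower_ses E) (\<eta> d a a'))"
    and "\<forall>d\<in>carrier D. \<forall>a\<in>carrier M. \<forall>a'\<in>carrier M. \<eta> d a a' \<in> carrier N"
    by (rule has_cocycle_push_adjust[OF short_exact_lower t \<kappa>]) (simp add: has_cocycle_closed[OF \<beta>])
  then show ?thesis
    using E t has_cocycle_closed[OF \<beta>] unfolding ext2_cocycle_def by blast
qed

text \<open>The middle module of T is filtered by the images of mid S1 and of N, and the first
  isomorphism theorem supplies the identifications of E/E1 and E1/E2.\<close>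

lemma ext2_of_ses:
  fixes T :: "('d, 'm, 'g, 'e) ses" and L :: "('d, 'l) module" and N :: "('d, 'n) module"
  assumes S1: "short_exact D L N S1" and t: "ses_section D L N S1 t \<gamma>"
    and T: "has_cocycle D M (mid S1) T (\<lambda>d a a'. t (\<beta> d a a') \<oplus>\<^bsub>mid S1\<^esub> inc S1 (\<eta> d a a'))"
    and [simp]: "\<And>d a a'. \<lbrakk>d \<in> carrier D; a \<in> carrier M; a' \<in> carrier M\<rbrakk> \<Longrightarrow> \<beta> d a a' \<in> carrier L"
      "\<And>d a a'. \<lbrakk>d \<in> carrier D; a \<in> carrier M; a' \<in> carrier M\<rbrakk> \<Longrightarrow> \<eta> d a a' \<in> carrier N"
  shows "\<exists>E :: ('d, 'm, 'l, 'n, 'e) ext2. ext2_cocycle D M L N E \<beta> \<gamma> \<eta>"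
proof -
  interpret S1: exact_seq D L N S1 by unfold_locales fact
  interpret T: exact_seq D M "mid S1" T by unfold_locales (use T in \<open>rule has_cocycle_exact\<close>)
  note [simp] = ses_sectionD[OF t]
  \<comment> \<open>\<open>j\<close> takes the image of mid S1 in mid T back to mid S1; followed by
    \<open>prj S1\<close> it is the surjection of E1 onto L.\<close>
  define j where "j = inv_into (carrier (mid S1)) (inc T)"
  let ?E1 = "inc T ` carrier (mid S1)" and ?E2 = "(\<lambda>n. inc T (inc S1 n)) ` carrier N"
  let ?K = "mid T\<lparr>carrier := ?E1\<rparr>"
  let ?f = "\<lambda>x. prj S1 (j x)"
  define E :: "('d, 'm, 'l, 'n, 'e) ext2" where
    "E = \<lparr>E0 = mid T, E1 = ?E1, E2 = ?E2, isoM = (\<lambda>C. the_elem (prj T ` C)),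
      isoL = (\<lambda>C. the_elem (?f ` C)), isoN = inv_into (carrier N) (\<lambda>n. inc T (inc S1 n))\<rparr>"
  have j [simp]: "j (inc T g) = g" if "g \<in> carrier (mid S1)" for g
    using that by (simp add: j_def inv_into_f_eq inj_on_def)
  have inc_T_axpy: "axpy (mid T) d (inc T g) (inc T g') = inc T (axpy (mid S1) d g g')"
    if "d \<in> carrier D" "g \<in> carrier (mid S1)" "g' \<in> carrier (mid S1)" for d g g'
    using that by simp
  have ne: "?E1 \<noteq> {}" "?E2 \<noteq> {}" using S1.G.M.zero_closed S1.B.M.zero_closed by blast+
  have K: "left_module D ?K"
    using ne(1) by (intro T.G.left_module_of_closed_subset) (auto simp: inc_T_axpy simp del: T.inc_axpy)
  have inc2: "inc T (inc S1 (axpy N d n n')) = axpy (mid T) d (inc T (inc S1 n)) (inc T (inc S1 n'))"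
    if "d \<in> carrier D" "n \<in> carrier N" "n' \<in> carrier N" for d n n'
    using that by simp
  have closed2: "axpy (mid T) d x y \<in> ?E2" if d: "d \<in> carrier D" and "x \<in> ?E2" "y \<in> ?E2" for d x y
  proof -
    from \<open>x \<in> ?E2\<close> \<open>y \<in> ?E2\<close> obtain n n' where "n \<in> carrier N" "n' \<in> carrier N"
      "x = inc T (inc S1 n)" "y = inc T (inc S1 n')" by (elim imageE)
    then show ?thesis using inc2[OF d] d by (intro image_eqI[of _ _ "axpy N d n n'"]) simp_all
  qed
  have E2: "submodule ?E2 D (mid T)" "left_module D (mid T\<lparr>carrier := ?E2\<rparr>)"
    using ne(2) closed2
    by (intro T.G.submodule_of_closed_subset T.G.left_module_of_closed_subset; auto)+
  have E1_eq: "?E1 = {x \<in> carrier (mid T). prj T x = \<zero>\<^bsub>M\<^esub>}" by (rule T.inc_image)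
  have prj_surj: "\<forall>b\<in>carrier M. \<exists>x\<in>carrier (mid T). prj T x = b"
    unfolding T.prj_surj[symmetric] by blast
  note iso1 = first_isomorphism[OF T.prj_hom T.G.left_module_axioms T.A.left_module_axioms prj_surj E1_eq]
  have f: "?f \<in> mod_hom D ?K L"
    using K S1.A.left_module_axioms by (intro mod_homI) (auto simp: inc_T_axpy simp del: T.inc_axpy)
  have f_surj: "\<forall>b\<in>carrier L. \<exists>x\<in>carrier ?K. ?f x = b"
  proof
    fix b assume "b \<in> carrier L"
    then show "\<exists>x\<in>carrier ?K. ?f x = b" by (intro bexI[of _ "inc T (t b)"]) simp_all
  qed
  have E2_eq: "?E2 = {x \<in> carrier ?K. ?f x = \<zero>\<^bsub>L\<^esub>}"
  proof (intro equalityI subsetI)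
    fix x assume "x \<in> {x \<in> carrier ?K. ?f x = \<zero>\<^bsub>L\<^esub>}"
    then obtain g where g: "g \<in> carrier (mid S1)" "x = inc T g" "prj S1 g = \<zero>\<^bsub>L\<^esub>" by auto
    from g(1,3) obtain n where "n \<in> carrier N" "g = inc S1 n" by (rule S1.kernelE)
    then show "x \<in> ?E2" using g(2) by blast
  qed auto
  note iso2 = first_isomorphism[OF f K S1.A.left_module_axioms f_surj E2_eq]
  have "(\<lambda>n. inc T (inc S1 n)) \<in> mod_hom D N (mid T\<lparr>carrier := ?E2\<rparr>)"
    using E2(2) S1.B.left_module_axioms by (intro mod_homI) auto
  then have inc_iso: "(\<lambda>n. inc T (inc S1 n)) \<in> mod_iso D N (mid T\<lparr>carrier := ?E2\<rparr>)"
    by (auto simp: mod_iso_def bij_betw_def inj_on_def)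
  have isoN: "isoN E \<in> mod_iso D (E0 E\<lparr>carrier := E2 E\<rparr>) N"
    using mod_iso_inv[OF inc_iso S1.B.left_module_axioms E2(2)] by (simp add: E_def)
  have E0: "E0 E = mid T" by (simp add: E_def)
  have "two_extension D M L N E"
    unfolding two_extension_def
    using T.A.left_module_axioms S1.A.left_module_axioms S1.B.left_module_axioms T.G.left_module_axioms
      iso1 iso2 E2(1) isoN
    by (auto simp: E_def)
  then interpret E: two_ext D M L N E by (rule two_extI)
  have inc_lower: "inc (lower_ses E) n = inc T (inc S1 n)" if n: "n \<in> carrier N" for n
  proof -
    have bij: "bij_betw (\<lambda>n. inc T (inc S1 n)) (carrier N) ?E2"
      using inc_iso by (simp add: mod_iso_def)
    then have "isoN E (inc T (inc S1 n)) = n"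
      using n bij_betw_inv_into_left[OF bij n] by (simp add: E_def)
    moreover have "inj_on (isoN E) ?E2"
      using bij_betw_inv_into[OF bij] by (simp add: E_def bij_betw_def)
    ultimately show ?thesis
      using n by (auto simp: lower_ses_def E_def intro!: inv_into_f_eq)
  qed
  have prj_lower: "prj (lower_ses E) (inc T g) = prj S1 g" if "g \<in> carrier (mid S1)" for g
    using iso2(2)[of "inc T g"] that by (simp add: lower_ses_def E_def)
  have "ses_section D L N (lower_ses E) (\<lambda>l. inc T (t l)) (\<lambda>d l l'. \<gamma> d l l')"
  proof (rule section_transport[OF t S1])
    show "inc T \<in> mod_hom D (mid S1) (mid (lower_ses E))"
      using T.inc_hom by (auto simp: mod_hom_def lower_ses_def E_def)
  qed (simp_all add: inc_lower prj_lower)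
  then have t': "ses_section D L N (lower_ses E) (\<lambda>l. inc T (t l)) \<gamma>" by simp
  obtain s where s: "ses_section D M (mid S1) T s (\<lambda>d a a'. t (\<beta> d a a') \<oplus>\<^bsub>mid S1\<^esub> inc S1 (\<eta> d a a'))"
    using T by (auto simp: has_cocycle_def)
  have "ses_section D M (mid (lower_ses E)) (filtration_ses E) (\<lambda>a. s a)
      (\<lambda>d a a'. inc T (t (\<beta> d a a') \<oplus>\<^bsub>mid S1\<^esub> inc S1 (\<eta> d a a')))"
  proof (rule section_transport[OF s T.exact])
    show "(\<lambda>x. x) \<in> mod_hom D (mid T) (mid (filtration_ses E))"
      by (simp add: E_def mod_hom_id)
    show "prj (filtration_ses E) x = prj T x" if "x \<in> carrier (mid T)" for x
      using iso1(2)[OF that] by (simp add: filtration_ses_def E_def)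
  qed (simp_all add: lower_ses_mid E_def)
  then have "has_cocycle D M (mid (lower_ses E)) (filtration_ses E)
      (\<lambda>d a a'. inc T (t (\<beta> d a a') \<oplus>\<^bsub>mid S1\<^esub> inc S1 (\<eta> d a a')))"
    by (rule has_cocycleI[OF E.short_exact_filtration])
  then have "has_cocycle D M (mid (lower_ses E)) (filtration_ses E)
      (\<lambda>d a a'. inc T (t (\<beta> d a a')) \<oplus>\<^bsub>mid (lower_ses E)\<^esub> inc (lower_ses E) (\<eta> d a a'))"
    using E0 by (subst (asm) has_cocycle_cong) (simp_all add: inc_lower lower_ses_mid)
  then show ?thesis
    using E.two_extension t' by (intro exI[of _ E]) (auto simp: ext2_cocycle_def)
qed

text \<open>A comparison of E1 with mid S1 that respects the sections shows that 2-extension modules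
  and extensions of M by mid S1 admit the same \<eta>. This common index set links
  \<open>ExtMod\<close> to the fibre over \<eta>ML.\<close>

lemma ex_ext2_iff_cocycle:
  fixes M :: "('d, 'm) module" and L :: "('d, 'l) module" and N :: "('d, 'n) module"
  assumes S1: "short_exact D L N S1" and t: "ses_section D L N S1 t \<gamma>"
    and \<beta> [simp]: "\<And>d a a'. \<lbrakk>d \<in> carrier D; a \<in> carrier M; a' \<in> carrier M\<rbrakk> \<Longrightarrow> \<beta> d a a' \<in> carrier L"
  shows "(\<exists>E :: ('d, 'm, 'l, 'n, 'm \<times> 'l \<times> 'n) ext2. ext2_cocycle D M L N E \<beta> \<gamma> \<eta>) \<longleftrightarrow>
    cocycle D M (mid S1) (\<lambda>d a a'. t (\<beta> d a a') \<oplus>\<^bsub>mid S1\<^esub> inc S1 (\<eta> d a a')) \<and>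
    (\<forall>d\<in>carrier D. \<forall>a\<in>carrier M. \<forall>a'\<in>carrier M. \<eta> d a a' \<in> carrier N)"
proof
  interpret S1: exact_seq D L N S1 by unfold_locales fact
  note [simp] = ses_sectionD[OF t]
  {
    assume "\<exists>E :: ('d, 'm, 'l, 'n, 'm \<times> 'l \<times> 'n) ext2. ext2_cocycle D M L N E \<beta> \<gamma> \<eta>"
    then obtain E :: "('d, 'm, 'l, 'n, 'm \<times> 'l \<times> 'n) ext2" where "ext2_cocycle D M L N E \<beta> \<gamma> \<eta>" ..
    then obtain t' where E: "two_ext D M L N E" and t': "ses_section D L N (lower_ses E) t' \<gamma>"
      and \<kappa>: "has_cocycle D M (mid (lower_ses E)) (filtration_ses E)
        (\<lambda>d a a'. t' (\<beta> d a a') \<oplus>\<^bsub>mid (lower_ses E)\<^esub> inc (lower_ses E) (\<eta> d a a'))"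
      and \<eta>: "\<forall>d\<in>carrier D. \<forall>a\<in>carrier M. \<forall>a'\<in>carrier M. \<eta> d a a' \<in> carrier N"
      by (rule ext2_cocycleE)
    interpret E: two_ext D M L N E by (rule E)
    obtain \<theta> where \<theta>: "\<theta> \<in> mod_hom D (mid (lower_ses E)) (mid S1)"
      and \<theta>N: "\<And>n. n \<in> carrier N \<Longrightarrow> \<theta> (inc (lower_ses E) n) = inc S1 n"
      and \<theta>t: "\<And>l. l \<in> carrier L \<Longrightarrow> \<theta> (t' l) = t l"
      by (rule ses_map[OF E.short_exact_lower S1 t' t mod_hom_id mod_hom_id]) auto
    have "cocycle D M (mid S1) (\<lambda>d a a'. \<theta> (t' (\<beta> d a a') \<oplus>\<^bsub>mid (lower_ses E)\<^esub> inc (lower_ses E) (\<eta> d a a')))"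
      using cocycleI[OF \<kappa>] S1.G.left_module_axioms \<theta> by (rule cocycle_pushout)
    then have "cocycle D M (mid S1) (\<lambda>d a a'. t (\<beta> d a a') \<oplus>\<^bsub>mid S1\<^esub> inc S1 (\<eta> d a a'))"
      using \<eta> by (subst (asm) cocycle_cong) (simp_all add: mod_hom_add[OF \<theta>] ses_sectionD[OF t'] \<theta>N \<theta>t)
    then show "cocycle D M (mid S1) (\<lambda>d a a'. t (\<beta> d a a') \<oplus>\<^bsub>mid S1\<^esub> inc S1 (\<eta> d a a')) \<and>
        (\<forall>d\<in>carrier D. \<forall>a\<in>carrier M. \<forall>a'\<in>carrier M. \<eta> d a a' \<in> carrier N)" using \<eta> ..
  next
    assume "cocycle D M (mid S1) (\<lambda>d a a'. t (\<beta> d a a') \<oplus>\<^bsub>mid S1\<^esub> inc S1 (\<eta> d a a')) \<and>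
        (\<forall>d\<in>carrier D. \<forall>a\<in>carrier M. \<forall>a'\<in>carrier M. \<eta> d a a' \<in> carrier N)"
    then have c: "cocycle D M (mid S1) (\<lambda>d a a'. t (\<beta> d a a') \<oplus>\<^bsub>mid S1\<^esub> inc S1 (\<eta> d a a'))"
      and \<eta> [rule_format, simp]: "\<forall>d\<in>carrier D. \<forall>a\<in>carrier M. \<forall>a'\<in>carrier M. \<eta> d a a' \<in> carrier N"
      by blast+
    \<comment> \<open>Replacing \<open>S1\<close> by a congruent sequence on \<open>'l \<times> 'n\<close> puts the 2-extension on \<open>'m \<times> 'l \<times> 'n\<close>.\<close>
    from cocycleI[OF has_cocycleI[OF S1 t]]
    obtain S1' :: "('d, 'l, 'n, 'l \<times> 'n) ses" where S1': "has_cocycle D L N S1' \<gamma>" by (rule cocycleE)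
    interpret S1': exact_seq D L N S1' by unfold_locales (use S1' in \<open>rule has_cocycle_exact\<close>)
    obtain t' where t': "ses_section D L N S1' t' \<gamma>" using S1' by (auto simp: has_cocycle_def)
    obtain \<theta> where \<theta>: "\<theta> \<in> mod_hom D (mid S1) (mid S1')"
      and \<theta>N: "\<And>n. n \<in> carrier N \<Longrightarrow> \<theta> (inc S1 n) = inc S1' n"
      and \<theta>t: "\<And>l. l \<in> carrier L \<Longrightarrow> \<theta> (t l) = t' l"
      by (rule ses_map[OF S1 S1'.exact t t' mod_hom_id mod_hom_id]) auto
    have "cocycle D M (mid S1') (\<lambda>d a a'. \<theta> (t (\<beta> d a a') \<oplus>\<^bsub>mid S1\<^esub> inc S1 (\<eta> d a a')))"
      using c S1'.G.left_module_axioms \<theta> by (rule cocycle_pushout)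
    then have "cocycle D M (mid S1') (\<lambda>d a a'. t' (\<beta> d a a') \<oplus>\<^bsub>mid S1'\<^esub> inc S1' (\<eta> d a a'))"
      by (subst (asm) cocycle_cong) (simp_all add: mod_hom_add[OF \<theta>] \<theta>N \<theta>t)
    then obtain T :: "('d, 'm, 'l \<times> 'n, 'm \<times> 'l \<times> 'n) ses"
      where "has_cocycle D M (mid S1') T (\<lambda>d a a'. t' (\<beta> d a a') \<oplus>\<^bsub>mid S1'\<^esub> inc S1' (\<eta> d a a'))"
      by (rule cocycleE)
    then show "\<exists>E :: ('d, 'm, 'l, 'n, 'm \<times> 'l \<times> 'n) ext2. ext2_cocycle D M L N E \<beta> \<gamma> \<eta>"
      by (rule ext2_of_ses[OF S1'.exact t']) simp_all
  }
qed

text \<open>Two choices remain once \<beta> and \<gamma> are fixed. Sections of E1 -> L with the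
  same \<gamma> differ by a homomorphism L -> N, which produces \<psi>; for a fixed t,
  \<open>push_cohomologous_iff\<close> describes the freedom in the section of E -> M and produces
  \<phi>.\<close>

lemma ext2_cocycle_change:
  fixes E :: "('d, 'm, 'l, 'n, 'e) ext2"
  assumes E: "ext2_cocycle D M L N E \<beta> \<gamma> \<eta>"
    and \<eta>': "\<And>d a a'. \<lbrakk>d \<in> carrier D; a \<in> carrier M; a' \<in> carrier M\<rbrakk> \<Longrightarrow> \<eta>' d a a' \<in> carrier N"
  shows "ext2_cocycle D M L N E \<beta> \<gamma> \<eta>' \<longleftrightarrow> (\<exists>\<phi>\<in>mod_hom D M L. \<exists>\<psi>\<in>mod_hom D L N.
    cohomologous D M N (\<lambda>d a a'. \<eta> d a a' \<oplus>\<^bsub>N\<^esub> (\<gamma> d (\<phi> a) (\<phi> a') \<oplus>\<^bsub>N\<^esub> \<psi> (\<beta> d a a'))) \<eta>')"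
proof -
  from E obtain t where "two_ext D M L N E" and t: "ses_section D L N (lower_ses E) t \<gamma>"
    and \<kappa>: "has_cocycle D M (mid (lower_ses E)) (filtration_ses E)
        (\<lambda>d a a'. t (\<beta> d a a') \<oplus>\<^bsub>mid (lower_ses E)\<^esub> inc (lower_ses E) (\<eta> d a a'))"
    and \<beta> [rule_format, simp]: "\<forall>d\<in>carrier D. \<forall>a\<in>carrier M. \<forall>a'\<in>carrier M. \<beta> d a a' \<in> carrier L"
    and \<eta> [rule_format, simp]: "\<forall>d\<in>carrier D. \<forall>a\<in>carrier M. \<forall>a'\<in>carrier M. \<eta> d a a' \<in> carrier N"
    by (rule ext2_cocycleE)
  interpret E: two_ext D M L N E by fact
  note [simp] = ses_sectionD[OF t] \<eta>' ses_section_cocycle(1)[OF t]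
  let ?i = "inc (lower_ses E)" and ?G = "mid (lower_ses E)"
  show ?thesis
  proof
    assume "ext2_cocycle D M L N E \<beta> \<gamma> \<eta>'"
    then obtain t' where t': "ses_section D L N (lower_ses E) t' \<gamma>"
      and \<kappa>': "has_cocycle D M ?G (filtration_ses E) (\<lambda>d a a'. t' (\<beta> d a a') \<oplus>\<^bsub>?G\<^esub> ?i (\<eta>' d a a'))"
      by (rule ext2_cocycleE)
    from t t' obtain x where x [rule_format, simp]: "\<forall>l\<in>carrier L. x l \<in> carrier N"
      and tt': "\<forall>l\<in>carrier L. t' l = t l \<oplus>\<^bsub>?G\<^esub> ?i (x l)"
      and xeq: "\<forall>d\<in>carrier D. \<forall>l\<in>carrier L. \<forall>l'\<in>carrier L.
        \<gamma> d l l' \<oplus>\<^bsub>N\<^esub> x (axpy L d l l') = \<gamma> d l l' \<oplus>\<^bsub>N\<^esub> axpy N d (x l) (x l')"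
      by (rule E.lower.sections_differ)
    \<comment> \<open>Both sections have the cocycle \<gamma>, so their difference x has zero
      coboundary, that is, it is linear. The required \<psi> is -x.\<close>
    have x_hom: "x \<in> mod_hom D L N"
      using E.modules(2,3) xeq by (intro mod_homI) simp_all
    have "has_cocycle D M ?G (filtration_ses E)
        (\<lambda>d a a'. t (\<beta> d a a') \<oplus>\<^bsub>?G\<^esub> ?i (x (\<beta> d a a') \<oplus>\<^bsub>N\<^esub> \<eta>' d a a'))"
      using \<kappa>' tt' by (subst (asm) has_cocycle_cong) (simp_all add: E.lower.G.M.a_assoc)
    with \<kappa> have "cohomologous D M ?G (\<lambda>d a a'. t (\<beta> d a a') \<oplus>\<^bsub>?G\<^esub> ?i (\<eta> d a a'))
        (\<lambda>d a a'. t (\<beta> d a a') \<oplus>\<^bsub>?G\<^esub> ?i (x (\<beta> d a a') \<oplus>\<^bsub>N\<^esub> \<eta>' d a a'))"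
      by (rule E.filt.cocycle_unique)
    then obtain \<phi> where \<phi>: "\<phi> \<in> mod_hom D M L"
      and coh: "cohomologous D M N (\<lambda>d a a'. \<eta> d a a' \<oplus>\<^bsub>N\<^esub> \<gamma> d (\<phi> a) (\<phi> a'))
        (\<lambda>d a a'. x (\<beta> d a a') \<oplus>\<^bsub>N\<^esub> \<eta>' d a a')"
      by (subst (asm) push_cohomologous_iff[OF E.short_exact_lower t]) (auto simp: E.modules)
    note [simp] = mod_hom_closed[OF \<phi>]
    have "cohomologous D M N
        (\<lambda>d a a'. \<ominus>\<^bsub>N\<^esub> x (\<beta> d a a') \<oplus>\<^bsub>N\<^esub> (\<eta> d a a' \<oplus>\<^bsub>N\<^esub> \<gamma> d (\<phi> a) (\<phi> a')))
        (\<lambda>d a a'. \<ominus>\<^bsub>N\<^esub> x (\<beta> d a a') \<oplus>\<^bsub>N\<^esub> (x (\<beta> d a a') \<oplus>\<^bsub>N\<^esub> \<eta>' d a a'))"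
      using coh by (subst cohomologous_add_iff) (simp_all add: E.modules)
    then have "cohomologous D M N
        (\<lambda>d a a'. \<eta> d a a' \<oplus>\<^bsub>N\<^esub> (\<gamma> d (\<phi> a) (\<phi> a') \<oplus>\<^bsub>N\<^esub> \<ominus>\<^bsub>N\<^esub> x (\<beta> d a a'))) \<eta>'"
      by (subst (asm) cohomologous_cong) (simp_all add: E.lower.B.M.a_ac E.lower.B.M.r_neg1 E.lower.B.M.r_neg)
    then show "\<exists>\<phi>\<in>mod_hom D M L. \<exists>\<psi>\<in>mod_hom D L N.
        cohomologous D M N (\<lambda>d a a'. \<eta> d a a' \<oplus>\<^bsub>N\<^esub> (\<gamma> d (\<phi> a) (\<phi> a') \<oplus>\<^bsub>N\<^esub> \<psi> (\<beta> d a a'))) \<eta>'"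
      using \<phi> mod_hom_minus[OF x_hom E.modules(2,3)] by (intro bexI[of _ \<phi>] bexI[of _ "\<lambda>l. \<ominus>\<^bsub>N\<^esub> x l"])
  next
    assume "\<exists>\<phi>\<in>mod_hom D M L. \<exists>\<psi>\<in>mod_hom D L N.
        cohomologous D M N (\<lambda>d a a'. \<eta> d a a' \<oplus>\<^bsub>N\<^esub> (\<gamma> d (\<phi> a) (\<phi> a') \<oplus>\<^bsub>N\<^esub> \<psi> (\<beta> d a a'))) \<eta>'"
    then obtain \<phi> \<psi> where \<phi>: "\<phi> \<in> mod_hom D M L" and \<psi>: "\<psi> \<in> mod_hom D L N"
      and coh: "cohomologous D M N (\<lambda>d a a'. \<eta> d a a' \<oplus>\<^bsub>N\<^esub> (\<gamma> d (\<phi> a) (\<phi> a') \<oplus>\<^bsub>N\<^esub> \<psi> (\<beta> d a a'))) \<eta>'"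
      by blast
    note [simp] = mod_hom_closed[OF \<phi>] mod_hom_closed[OF \<psi>]
    \<comment> \<open>Shifting t by -\<psi> keeps \<gamma> because \<psi> is linear; writing
      t(\<beta>) as t'(\<beta>) + \<psi>(\<beta>) then adds \<psi>(\<beta>) to \<eta>.\<close>
    define t' where "t' l = t l \<oplus>\<^bsub>?G\<^esub> ?i (\<ominus>\<^bsub>N\<^esub> \<psi> l)" for l
    have t': "ses_section D L N (lower_ses E) t' \<gamma>"
      unfolding t'_def using t
      by (rule E.lower.section_change)
         (simp_all add: E.lower.B.axpy_minus mod_hom_axpy[OF \<psi> E.modules(2)])
    have eq: "t (\<beta> d a a') \<oplus>\<^bsub>?G\<^esub> ?i (\<eta> d a a') =
        t' (\<beta> d a a') \<oplus>\<^bsub>?G\<^esub> ?i (\<psi> (\<beta> d a a') \<oplus>\<^bsub>N\<^esub> \<eta> d a a')"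
      if "d \<in> carrier D" "a \<in> carrier M" "a' \<in> carrier M" for d a a'
      using that
      by (simp add: t'_def E.lower.G.M.a_assoc E.lower.B.M.r_neg1 del: E.lower.inc_add flip: E.lower.inc_add)
    have \<kappa>': "has_cocycle D M ?G (filtration_ses E)
        (\<lambda>d a a'. t' (\<beta> d a a') \<oplus>\<^bsub>?G\<^esub> ?i (\<psi> (\<beta> d a a') \<oplus>\<^bsub>N\<^esub> \<eta> d a a'))"
      using \<kappa> by (subst (asm) has_cocycle_cong[OF eq])
    have "cohomologous D M N (\<lambda>d a a'. (\<psi> (\<beta> d a a') \<oplus>\<^bsub>N\<^esub> \<eta> d a a') \<oplus>\<^bsub>N\<^esub> \<gamma> d (\<phi> a) (\<phi> a')) \<eta>'"
      using coh by (subst (asm) cohomologous_cong) (simp_all add: E.lower.B.M.a_ac)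
    then have "cohomologous D M ?G
        (\<lambda>d a a'. t' (\<beta> d a a') \<oplus>\<^bsub>?G\<^esub> ?i (\<psi> (\<beta> d a a') \<oplus>\<^bsub>N\<^esub> \<eta> d a a'))
        (\<lambda>d a a'. t' (\<beta> d a a') \<oplus>\<^bsub>?G\<^esub> ?i (\<eta>' d a a'))"
      using \<phi> by (subst push_cohomologous_iff[OF E.short_exact_lower t']) (auto simp: E.modules)
    with \<kappa>' have "has_cocycle D M ?G (filtration_ses E) (\<lambda>d a a'. t' (\<beta> d a a') \<oplus>\<^bsub>?G\<^esub> ?i (\<eta>' d a a'))"
      by (rule cocycle_change) (simp add: ses_sectionD[OF t'])
    then show "ext2_cocycle D M L N E \<beta> \<gamma> \<eta>'"
      using E.two_extension t' by (auto simp: ext2_cocycle_def)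
  qed
qed

definition ext2_cocycle_class ::
  "('d, 'z) ring_scheme \<Rightarrow> ('d, 'm) module \<Rightarrow> ('d, 'l) module \<Rightarrow> ('d, 'n) module
    \<Rightarrow> ('d \<Rightarrow> 'm \<Rightarrow> 'm \<Rightarrow> 'l) \<Rightarrow> ('d \<Rightarrow> 'l \<Rightarrow> 'l \<Rightarrow> 'n) \<Rightarrow> ('d \<Rightarrow> 'm \<Rightarrow> 'm \<Rightarrow> 'n)
    \<Rightarrow> ('d, 'm, 'l, 'n, 'm \<times> 'l \<times> 'n) ext2 set"
  where "ext2_cocycle_class D M L N \<beta> \<gamma> \<eta> = {E. ext2_cocycle D M L N E \<beta> \<gamma> \<eta>}"

text \<open>By \<open>ex_ext2_cocycle\<close> every member of a class has a description with the
  fixed \<beta> and \<gamma>. The map from \<eta> to classes is onto, but different \<eta> may give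
  the same class.\<close>

lemma ExtMod_eq:
  fixes M :: "('d, 'm) module" and L :: "('d, 'l) module" and N :: "('d, 'n) module"
  assumes \<beta>: "cocycle D M L \<beta>" and \<gamma>: "cocycle D L N \<gamma>"
  shows "ExtMod D M L N (cocycle_class D M L \<beta>) (cocycle_class D L N \<gamma>) =
    ext2_cocycle_class D M L N \<beta> \<gamma> ` {\<eta>. ext2_cocycle_class D M L N \<beta> \<gamma> \<eta> \<noteq> {}}"
proof -
  have cls: "ext2_class D M L N E = ext2_cocycle_class D M L N \<beta> \<gamma> \<eta>"
    if "ext2_cocycle D M L N E \<beta> \<gamma> \<eta>" for E :: "('d, 'm, 'l, 'n, 'm \<times> 'l \<times> 'n) ext2" and \<eta>
    using ext2_equiv_iff_cocycle[OF that]
    by (auto simp: ext2_class_def ext2_cocycle_class_def ext2_cocycle_def)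
  have iff: "ext_class D M L (upper_ses E) = cocycle_class D M L \<beta> \<and>
      ext_class D L N (lower_ses E) = cocycle_class D L N \<gamma> \<longleftrightarrow> (\<exists>\<eta>. ext2_cocycle D M L N E \<beta> \<gamma> \<eta>)"
    if E: "two_extension D M L N E" for E :: "('d, 'm, 'l, 'n, 'm \<times> 'l \<times> 'n) ext2"
  proof -
    interpret E: two_ext D M L N E using E by (rule two_extI)
    obtain \<kappa> where "has_cocycle D M (mid (lower_ses E)) (filtration_ses E) \<kappa>"
      using E.filt.ex_cocycle by blast
    then have upper: "short_exact D M L (upper_ses E)"
      by (intro has_cocycle_exact[OF E.cocycle_upper])
    show ?thesis
      unfolding ext_class_eq_iff[OF upper \<beta>] ext_class_eq_iff[OF E.short_exact_lower \<gamma>]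
      using ex_ext2_cocycle[OF E] ext2_cocycle_upper ext2_cocycle_lower by blast
  qed
  show ?thesis
  proof (intro equalityI subsetI)
    fix c assume "c \<in> ExtMod D M L N (cocycle_class D M L \<beta>) (cocycle_class D L N \<gamma>)"
    then obtain E :: "('d, 'm, 'l, 'n, 'm \<times> 'l \<times> 'n) ext2"
      where E: "two_extension D M L N E" "c = ext2_class D M L N E"
      "ext_class D M L (upper_ses E) = cocycle_class D M L \<beta>"
      "ext_class D L N (lower_ses E) = cocycle_class D L N \<gamma>"
      unfolding ExtMod_def by blast
    then obtain \<eta> where \<eta>: "ext2_cocycle D M L N E \<beta> \<gamma> \<eta>" using iff by blast
    moreover have "ext2_cocycle_class D M L N \<beta> \<gamma> \<eta> \<noteq> {}" using \<eta> by (auto simp: ext2_cocycle_class_def)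
    ultimately show "c \<in> ext2_cocycle_class D M L N \<beta> \<gamma> ` {\<eta>. ext2_cocycle_class D M L N \<beta> \<gamma> \<eta> \<noteq> {}}"
      using E(2) cls by blast
  next
    fix c assume "c \<in> ext2_cocycle_class D M L N \<beta> \<gamma> ` {\<eta>. ext2_cocycle_class D M L N \<beta> \<gamma> \<eta> \<noteq> {}}"
    then obtain \<eta> E where c: "c = ext2_cocycle_class D M L N \<beta> \<gamma> \<eta>" and E: "ext2_cocycle D M L N E \<beta> \<gamma> \<eta>"
      and "E \<in> ext2_cocycle_class D M L N \<beta> \<gamma> \<eta>"
      by (auto simp: ext2_cocycle_class_def)
    moreover have "two_extension D M L N E" using E by (simp add: ext2_cocycle_def)
    ultimately show "c \<in> ExtMod D M L N (cocycle_class D M L \<beta>) (cocycle_class D L N \<gamma>)"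
      unfolding ExtMod_def using iff cls by blast
  qed
qed

section \<open>Presentations by relation matrices\<close>

lemma row_vectorsD: "a \<in> row_vectors D X \<Longrightarrow> x \<in> X \<Longrightarrow> a x \<in> carrier D"
  by (auto simp: row_vectors_def)

lemma finite_support: "a \<in> row_vectors D X \<Longrightarrow> finite {x \<in> X. a x \<noteq> \<zero>\<^bsub>D\<^esub>}"
  by (auto simp: row_vectors_def)

lemma row_vectors_cong:
  "(\<And>x. x \<in> X \<Longrightarrow> a x = b x) \<Longrightarrow> a \<in> row_vectors D X \<longleftrightarrow> b \<in> row_vectors D X"
  by (auto simp: row_vectors_def Pi_iff cong: conj_cong)

lemma row_vectors_Plus:
  "a \<in> row_vectors D (X <+> Y) \<longleftrightarrow> (\<lambda>x. a (Inl x)) \<in> row_vectors D X \<and> (\<lambda>y. a (Inr y)) \<in> row_vectors D Y"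
proof -
  have "{z \<in> X <+> Y. a z \<noteq> \<zero>\<^bsub>D\<^esub>} = {x \<in> X. a (Inl x) \<noteq> \<zero>\<^bsub>D\<^esub>} <+> {y \<in> Y. a (Inr y) \<noteq> \<zero>\<^bsub>D\<^esub>}"
    by auto
  then show ?thesis by (auto simp: row_vectors_def Pi_iff finite_Plus_iff)
qed

context lmod
begin

lemma zero_row: "(\<lambda>_. \<zero>\<^bsub>D\<^esub>) \<in> row_vectors D X"
  by (simp add: row_vectors_def)

lemma row_vectors_axpy:
  assumes "a \<in> row_vectors D X" "b \<in> row_vectors D X" "d \<in> carrier D"
  shows "(\<lambda>x. d \<otimes>\<^bsub>D\<^esub> a x \<oplus>\<^bsub>D\<^esub> b x) \<in> row_vectors D X"
proof -
  have "{x \<in> X. d \<otimes>\<^bsub>D\<^esub> a x \<oplus>\<^bsub>D\<^esub> b x \<noteq> \<zero>\<^bsub>D\<^esub>} \<subseteq> {x \<in> X. a x \<noteq> \<zero>\<^bsub>D\<^esub>} \<union> {x \<in> X. b x \<noteq> \<zero>\<^bsub>D\<^esub>}"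
    using assms(3) by auto
  then have "finite {x \<in> X. d \<otimes>\<^bsub>D\<^esub> a x \<oplus>\<^bsub>D\<^esub> b x \<noteq> \<zero>\<^bsub>D\<^esub>}"
    by (rule finite_subset) (simp add: assms finite_support)
  then show ?thesis using assms by (auto simp: row_vectors_def)
qed

lemma row_vectors_add:
  assumes "a \<in> row_vectors D X" "b \<in> row_vectors D X"
  shows "(\<lambda>x. a x \<oplus>\<^bsub>D\<^esub> b x) \<in> row_vectors D X"
proof -
  have "(\<lambda>x. \<one>\<^bsub>D\<^esub> \<otimes>\<^bsub>D\<^esub> a x \<oplus>\<^bsub>D\<^esub> b x) \<in> row_vectors D X"
    using assms by (intro row_vectors_axpy) simp_all
  then show ?thesis
    using assms by (subst (asm) row_vectors_cong) (simp_all add: row_vectorsD)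
qed

text \<open>\<open>lincomb\<close> sums over the support of a, which changes with a. Enlarging it to
  a common finite set F makes sums with different coefficient vectors comparable.\<close>

lemma lincomb_finsum:
  assumes "finite F" "F \<subseteq> X" "{x \<in> X. a x \<noteq> \<zero>\<^bsub>D\<^esub>} \<subseteq> F"
    and "\<And>x. x \<in> X \<Longrightarrow> a x \<in> carrier D" "\<And>x. x \<in> X \<Longrightarrow> g x \<in> carrier A"
  shows "lincomb D A X a g = (\<Oplus>\<^bsub>A\<^esub>x\<in>F. a x \<odot>\<^bsub>A\<^esub> g x)"
  unfolding lincomb_def using assms
  by (intro M.add.finprod_mono_neutral_cong) (auto intro: finite_subset)

lemma lincomb_closed [simp]:
  assumes "a \<in> row_vectors D X" "\<And>x. x \<in> X \<Longrightarrow> g x \<in> carrier A"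
  shows "lincomb D A X a g \<in> carrier A"
  unfolding lincomb_def using assms by (intro M.finsum_closed) (auto simp: row_vectorsD)

lemma lincomb_cong:
  assumes "\<And>x. x \<in> X \<Longrightarrow> a x = b x" "\<And>x. x \<in> X \<Longrightarrow> g x = h x"
    and "a \<in> row_vectors D X" "\<And>x. x \<in> X \<Longrightarrow> g x \<in> carrier A"
  shows "lincomb D A X a g = lincomb D A X b h"
proof -
  have "b x \<in> carrier D" "h x \<in> carrier A" if "x \<in> X" for x
    using that assms(1,2,4) row_vectorsD[OF assms(3)] by metis+
  then show ?thesis
    unfolding lincomb_def using assms(1,2) by (intro M.finsum_cong') auto
qed

lemma lincomb_axpy:
  assumes a: "a \<in> row_vectors D X" and b: "b \<in> row_vectors D X" and d: "d \<in> carrier D"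
    and g: "\<And>x. x \<in> X \<Longrightarrow> g x \<in> carrier A"
  shows "lincomb D A X (\<lambda>x. d \<otimes>\<^bsub>D\<^esub> a x \<oplus>\<^bsub>D\<^esub> b x) g = axpy A d (lincomb D A X a g) (lincomb D A X b g)"
proof -
  let ?F = "{x \<in> X. a x \<noteq> \<zero>\<^bsub>D\<^esub>} \<union> {x \<in> X. b x \<noteq> \<zero>\<^bsub>D\<^esub>}"
  have F: "finite ?F" "?F \<subseteq> X" using a b by (auto simp: finite_support)
  have ax: "a x \<in> carrier D" "b x \<in> carrier D" if "x \<in> X" for x using that a b by (simp_all add: row_vectorsD)
  have smult_sum: "d \<odot>\<^bsub>A\<^esub> (\<Oplus>\<^bsub>A\<^esub>x\<in>F. a x \<odot>\<^bsub>A\<^esub> g x) = (\<Oplus>\<^bsub>A\<^esub>x\<in>F. d \<odot>\<^bsub>A\<^esub> (a x \<odot>\<^bsub>A\<^esub> g x))"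
    if "finite F" "F \<subseteq> X" for F
    using that
  proof (induction F rule: finite_induct)
    case (insert x F)
    then show ?case using ax g d by (simp add: M.finsum_insert smult_r_distr Pi_iff subset_iff)
  qed (simp add: d)
  have "lincomb D A X (\<lambda>x. d \<otimes>\<^bsub>D\<^esub> a x \<oplus>\<^bsub>D\<^esub> b x) g =
      (\<Oplus>\<^bsub>A\<^esub>x\<in>?F. (d \<otimes>\<^bsub>D\<^esub> a x \<oplus>\<^bsub>D\<^esub> b x) \<odot>\<^bsub>A\<^esub> g x)"
    using F ax g d by (intro lincomb_finsum) auto
  also have "\<dots> = (\<Oplus>\<^bsub>A\<^esub>x\<in>?F. d \<odot>\<^bsub>A\<^esub> (a x \<odot>\<^bsub>A\<^esub> g x) \<oplus>\<^bsub>A\<^esub> b x \<odot>\<^bsub>A\<^esub> g x)"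
    using ax g d by (intro M.finsum_cong') (auto simp: smult_l_distr smult_assoc1)
  also have "\<dots> = (\<Oplus>\<^bsub>A\<^esub>x\<in>?F. d \<odot>\<^bsub>A\<^esub> (a x \<odot>\<^bsub>A\<^esub> g x)) \<oplus>\<^bsub>A\<^esub> (\<Oplus>\<^bsub>A\<^esub>x\<in>?F. b x \<odot>\<^bsub>A\<^esub> g x)"
    using ax g d by (intro M.finsum_addf) auto
  also have "\<dots> = d \<odot>\<^bsub>A\<^esub> (\<Oplus>\<^bsub>A\<^esub>x\<in>?F. a x \<odot>\<^bsub>A\<^esub> g x) \<oplus>\<^bsub>A\<^esub> (\<Oplus>\<^bsub>A\<^esub>x\<in>?F. b x \<odot>\<^bsub>A\<^esub> g x)"
    using smult_sum[OF F] by simp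
  also have "(\<Oplus>\<^bsub>A\<^esub>x\<in>?F. a x \<odot>\<^bsub>A\<^esub> g x) = lincomb D A X a g"
    using F ax g by (intro lincomb_finsum[symmetric]) auto
  also have "(\<Oplus>\<^bsub>A\<^esub>x\<in>?F. b x \<odot>\<^bsub>A\<^esub> g x) = lincomb D A X b g"
    using F ax g by (intro lincomb_finsum[symmetric]) auto
  finally show ?thesis by (simp add: axpy_def)
qed

lemma lincomb_add:
  assumes a: "a \<in> row_vectors D X" and b: "b \<in> row_vectors D X"
    and g: "\<And>x. x \<in> X \<Longrightarrow> g x \<in> carrier A"
  shows "lincomb D A X (\<lambda>x. a x \<oplus>\<^bsub>D\<^esub> b x) g = lincomb D A X a g \<oplus>\<^bsub>A\<^esub> lincomb D A X b g"
proof -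
  have "lincomb D A X (\<lambda>x. a x \<oplus>\<^bsub>D\<^esub> b x) g = lincomb D A X (\<lambda>x. \<one>\<^bsub>D\<^esub> \<otimes>\<^bsub>D\<^esub> a x \<oplus>\<^bsub>D\<^esub> b x) g"
    using a b g by (intro lincomb_cong row_vectors_add) (simp_all add: row_vectorsD)
  also have "\<dots> = axpy A \<one>\<^bsub>D\<^esub> (lincomb D A X a g) (lincomb D A X b g)"
    using a b g by (intro lincomb_axpy) simp_all
  finally show ?thesis using a g by simp
qed

lemma lincomb_zero [simp]: "lincomb D A X (\<lambda>_. \<zero>\<^bsub>D\<^esub>) g = \<zero>\<^bsub>A\<^esub>"
  by (simp add: lincomb_def)

lemma lincomb_Plus:
  assumes a: "a \<in> row_vectors D (X <+> Y)" and g: "\<And>z. z \<in> X <+> Y \<Longrightarrow> g z \<in> carrier A"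
  shows "lincomb D A (X <+> Y) a g =
    lincomb D A X (\<lambda>x. a (Inl x)) (\<lambda>x. g (Inl x)) \<oplus>\<^bsub>A\<^esub> lincomb D A Y (\<lambda>y. a (Inr y)) (\<lambda>y. g (Inr y))"
proof -
  let ?X = "{x \<in> X. a (Inl x) \<noteq> \<zero>\<^bsub>D\<^esub>}" and ?Y = "{y \<in> Y. a (Inr y) \<noteq> \<zero>\<^bsub>D\<^esub>}"
  have supp: "{z \<in> X <+> Y. a z \<noteq> \<zero>\<^bsub>D\<^esub>} = Inl ` ?X \<union> Inr ` ?Y" by auto
  have fin: "finite ?X" "finite ?Y" using a by (simp_all add: row_vectors_Plus finite_support)
  have cl: "a z \<odot>\<^bsub>A\<^esub> g z \<in> carrier A" if "z \<in> X <+> Y" for z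
    using that a g by (simp add: row_vectorsD)
  have "lincomb D A (X <+> Y) a g =
      (\<Oplus>\<^bsub>A\<^esub>z\<in>Inl ` ?X. a z \<odot>\<^bsub>A\<^esub> g z) \<oplus>\<^bsub>A\<^esub> (\<Oplus>\<^bsub>A\<^esub>z\<in>Inr ` ?Y. a z \<odot>\<^bsub>A\<^esub> g z)"
    unfolding lincomb_def supp using fin cl by (intro M.finsum_Un_disjoint) auto
  also have "(\<Oplus>\<^bsub>A\<^esub>z\<in>Inl ` ?X. a z \<odot>\<^bsub>A\<^esub> g z) = lincomb D A X (\<lambda>x. a (Inl x)) (\<lambda>x. g (Inl x))"
    unfolding lincomb_def using cl by (intro M.finsum_reindex) auto
  also have "(\<Oplus>\<^bsub>A\<^esub>z\<in>Inr ` ?Y. a z \<odot>\<^bsub>A\<^esub> g z) = lincomb D A Y (\<lambda>y. a (Inr y)) (\<lambda>y. g (Inr y))"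
    unfolding lincomb_def using cl by (intro M.finsum_reindex) auto
  finally show ?thesis .
qed

lemma row_times_matrix_finsum:
  assumes "finite F" "F \<subseteq> R" "{r \<in> R. c r \<noteq> \<zero>\<^bsub>D\<^esub>} \<subseteq> F"
    and "\<And>r. r \<in> R \<Longrightarrow> c r \<in> carrier D" "\<And>r. r \<in> R \<Longrightarrow> B r x \<in> carrier D"
  shows "row_times_matrix D R c B x = (\<Oplus>\<^bsub>D\<^esub>r\<in>F. c r \<otimes>\<^bsub>D\<^esub> B r x)"
  unfolding row_times_matrix_def using assms
  by (intro R.add.finprod_mono_neutral_cong) (auto intro: finite_subset)

text \<open>Associativity (c B) g = c (B g), by induction on the finite support of c. The same
  induction shows that c B is again a vector of finite support.\<close>

lemma lincomb_row_times_matrix: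
  assumes c: "c \<in> row_vectors D R" and B: "\<And>r. r \<in> R \<Longrightarrow> B r \<in> row_vectors D X"
    and g: "\<And>x. x \<in> X \<Longrightarrow> g x \<in> carrier A"
  shows row_times_matrix_row_vectors: "row_times_matrix D R c B \<in> row_vectors D X"
    and lincomb_row_times_matrix_eq: "lincomb D A X (row_times_matrix D R c B) g =
      lincomb D A R c (\<lambda>r. lincomb D A X (B r) g)"
proof -
  let ?v = "\<lambda>F x. \<Oplus>\<^bsub>D\<^esub>r\<in>F. c r \<otimes>\<^bsub>D\<^esub> B r x"
  have *: "?v F \<in> row_vectors D X \<and>
      lincomb D A X (?v F) g = (\<Oplus>\<^bsub>A\<^esub>r\<in>F. c r \<odot>\<^bsub>A\<^esub> lincomb D A X (B r) g)"
    if "finite F" "F \<subseteq> R" for F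
    using that
  proof (induction F rule: finite_induct)
    case empty
    then show ?case by (simp add: zero_row)
  next
    case (insert r F)
    have r: "r \<in> R" "c r \<in> carrier D" and F: "F \<subseteq> R" using insert.prems c by (auto simp: row_vectorsD)
    have IH: "?v F \<in> row_vectors D X" "lincomb D A X (?v F) g = (\<Oplus>\<^bsub>A\<^esub>r\<in>F. c r \<odot>\<^bsub>A\<^esub> lincomb D A X (B r) g)"
      using insert.IH F by auto
    have cB: "c r \<in> carrier D" "B r x \<in> carrier D" if "r \<in> R" "x \<in> X" for r x
      using that c B by (auto intro: row_vectorsD)
    have eq: "?v (insert r F) x = c r \<otimes>\<^bsub>D\<^esub> B r x \<oplus>\<^bsub>D\<^esub> ?v F x" if "x \<in> X" for x
      using insert.hyps r(1) F that cB by (intro R.finsum_insert) auto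
    have v: "?v (insert r F) \<in> row_vectors D X"
      using row_vectors_axpy[OF B[OF r(1)] IH(1) r(2)] by (subst row_vectors_cong[OF eq])
    have "lincomb D A X (?v (insert r F)) g = lincomb D A X (\<lambda>x. c r \<otimes>\<^bsub>D\<^esub> B r x \<oplus>\<^bsub>D\<^esub> ?v F x) g"
      using v g eq by (intro lincomb_cong) simp_all
    also have "\<dots> = c r \<odot>\<^bsub>A\<^esub> lincomb D A X (B r) g \<oplus>\<^bsub>A\<^esub> (\<Oplus>\<^bsub>A\<^esub>r\<in>F. c r \<odot>\<^bsub>A\<^esub> lincomb D A X (B r) g)"
      using B r IH g by (subst lincomb_axpy) (simp_all add: axpy_def)
    also have "\<dots> = (\<Oplus>\<^bsub>A\<^esub>r\<in>insert r F. c r \<odot>\<^bsub>A\<^esub> lincomb D A X (B r) g)"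
      using insert.hyps r F c B g by (intro M.finsum_insert[symmetric]) (auto simp: row_vectorsD subset_iff)
    finally show ?case using v by blast
  qed
  have fin: "finite {r \<in> R. c r \<noteq> \<zero>\<^bsub>D\<^esub>}" using c by (rule finite_support)
  have eq: "row_times_matrix D R c B = ?v {r \<in> R. c r \<noteq> \<zero>\<^bsub>D\<^esub>}"
    by (simp add: row_times_matrix_def fun_eq_iff)
  show "row_times_matrix D R c B \<in> row_vectors D X" unfolding eq using *[OF fin] by blast
  show "lincomb D A X (row_times_matrix D R c B) g = lincomb D A R c (\<lambda>r. lincomb D A X (B r) g)"
    unfolding eq using *[OF fin] by (auto simp: lincomb_def)
qed

end

lemma lincomb_hom:
  assumes f: "f \<in> mod_hom D A B" and A: "left_module D A" and B: "left_module D B"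
    and a: "a \<in> row_vectors D X" and g: "\<And>x. x \<in> X \<Longrightarrow> g x \<in> carrier A"
  shows "f (lincomb D A X a g) = lincomb D B X a (\<lambda>x. f (g x))"
proof -
  interpret A: lmod D A using A by (rule lmodI)
  interpret B: lmod D B using B by (rule lmodI)
  have "f (\<Oplus>\<^bsub>A\<^esub>x\<in>F. a x \<odot>\<^bsub>A\<^esub> g x) = (\<Oplus>\<^bsub>B\<^esub>x\<in>F. a x \<odot>\<^bsub>B\<^esub> f (g x))" if "finite F" "F \<subseteq> X" for F
    using that
  proof (induction F rule: finite_induct)
    case empty
    then show ?case using mod_hom_zero[OF f A B] by simp
  next
    case (insert x F)
    then show ?case
      using a g by (simp add: A.M.finsum_insert B.M.finsum_insert mod_hom_add[OF f] mod_hom_smult[OF f]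
          mod_hom_closed[OF f] row_vectorsD subset_iff Pi_iff A.M.finsum_closed)
  qed
  from this[OF finite_support[OF a]] show ?thesis by (auto simp: lincomb_def)
qed

section \<open>Homomorphisms out of a presented module\<close>

lemma presentsD:
  assumes "presents D M P"
  shows "x \<in> cols P \<Longrightarrow> gen P x \<in> carrier M"
    and "r \<in> rows P \<Longrightarrow> ent P r \<in> row_vectors D (cols P)"
    and "m \<in> carrier M \<Longrightarrow> \<exists>a\<in>row_vectors D (cols P). lincomb D M (cols P) a (gen P) = m"
    and "a \<in> row_vectors D (cols P) \<Longrightarrow> lincomb D M (cols P) a (gen P) = \<zero>\<^bsub>M\<^esub> \<longleftrightarrow>
      (\<exists>c\<in>row_vectors D (rows P). \<forall>x\<in>cols P. a x = row_times_matrix D (rows P) c (ent P) x)"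
  using assms by (auto simp: presents_def Pi_iff)

text \<open>The unit vector at r exhibits the row itself as a combination of rows.\<close>

lemma presents_row:
  assumes P: "presents D M P" and M: "left_module D M" and r: "r \<in> rows P"
  shows "lincomb D M (cols P) (ent P r) (gen P) = \<zero>\<^bsub>M\<^esub>"
proof -
  interpret M: lmod D M using M by (rule lmodI)
  let ?c = "\<lambda>r'. if r' = r then \<one>\<^bsub>D\<^esub> else \<zero>\<^bsub>D\<^esub>"
  have c: "?c \<in> row_vectors D (rows P)"
    by (auto simp: row_vectors_def intro!: finite_subset[of _ "{r}"])
  have "ent P r x = row_times_matrix D (rows P) ?c (ent P) x" if x: "x \<in> cols P" for x
  proof -
    have cl: "ent P r' x \<in> carrier D" if "r' \<in> rows P" for r'
      using presentsD(2)[OF P that] x by (rule row_vectorsD)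
    have "row_times_matrix D (rows P) ?c (ent P) x = (\<Oplus>\<^bsub>D\<^esub>r'\<in>{r}. ?c r' \<otimes>\<^bsub>D\<^esub> ent P r' x)"
      using r cl by (intro M.row_times_matrix_finsum) auto
    also have "\<dots> = ent P r x" using cl[OF r] by (simp add: M.R.finsum_insert)
    finally show ?thesis by simp
  qed
  then show ?thesis using presentsD(2,4)[OF P] r c by blast
qed

lemma presents_hom_eq:
  assumes P: "presents D X P" and X: "left_module D X" and Y: "left_module D Y"
    and f: "f \<in> mod_hom D X Y" and g: "g \<in> mod_hom D X Y"
    and eq: "\<And>x. x \<in> cols P \<Longrightarrow> f (gen P x) = g (gen P x)" and m: "m \<in> carrier X"
  shows "f m = g m"
proof -
  interpret Y: lmod D Y using Y by (rule lmodI)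
  obtain a where a: "a \<in> row_vectors D (cols P)" "lincomb D X (cols P) a (gen P) = m"
    using presentsD(3)[OF P m] by blast
  have "f m = lincomb D Y (cols P) a (\<lambda>x. f (gen P x))"
    unfolding a(2)[symmetric] using f X Y a(1) presentsD(1)[OF P] by (rule lincomb_hom)
  also have "\<dots> = lincomb D Y (cols P) a (\<lambda>x. g (gen P x))"
    using a(1) eq presentsD(1)[OF P] by (intro Y.lincomb_cong) (simp_all add: mod_hom_closed[OF g])
  also have "\<dots> = g m"
    unfolding a(2)[symmetric] using g X Y a(1) presentsD(1)[OF P] by (rule lincomb_hom[symmetric])
  finally show ?thesis .
qed

text \<open>The universal property of a cokernel. A coefficient vector \<open>w m\<close> is chosen
  for each m; the image does not depend on the choice, because a vector representing zero is a
  combination of rows, and every row is sent to zero.\<close>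

lemma presents_universal:
  assumes P: "presents D X P" and X: "left_module D X" and Y: "left_module D Y"
    and y: "\<And>x. x \<in> cols P \<Longrightarrow> y x \<in> carrier Y"
    and rel: "\<And>r. r \<in> rows P \<Longrightarrow> lincomb D Y (cols P) (ent P r) y = \<zero>\<^bsub>Y\<^esub>"
  obtains f where "f \<in> mod_hom D X Y" "\<And>x. x \<in> cols P \<Longrightarrow> f (gen P x) = y x"
proof -
  interpret X: lmod D X using X by (rule lmodI)
  interpret Y: lmod D Y using Y by (rule lmodI)
  let ?V = "row_vectors D (cols P)" and ?x = "\<lambda>a. lincomb D X (cols P) a (gen P)"
    and ?y = "\<lambda>a. lincomb D Y (cols P) a y"
  note gen = presentsD(1)[OF P]
  have zero: "?y a = \<zero>\<^bsub>Y\<^esub>" if a: "a \<in> ?V" "?x a = \<zero>\<^bsub>X\<^esub>" for a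
  proof -
    obtain c where c: "c \<in> row_vectors D (rows P)"
      and eq: "\<forall>x\<in>cols P. a x = row_times_matrix D (rows P) c (ent P) x"
      using presentsD(4)[OF P a(1)] a(2) by blast
    have "?y a = ?y (row_times_matrix D (rows P) c (ent P))"
      using a(1) eq y by (intro Y.lincomb_cong) simp_all
    also have "\<dots> = lincomb D Y (rows P) c (\<lambda>r. ?y (ent P r))"
      using c presentsD(2)[OF P] y by (rule Y.lincomb_row_times_matrix_eq)
    also have "\<dots> = lincomb D Y (rows P) c (\<lambda>r. \<zero>\<^bsub>Y\<^esub>)"
      using c rel by (intro Y.lincomb_cong) simp_all
    also have "\<dots> = \<zero>\<^bsub>Y\<^esub>"
      using c by (auto simp: lincomb_def row_vectorsD intro!: Y.M.add.finprod_one_eqI)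
    finally show ?thesis .
  qed
  have eq: "?y a = ?y b" if ab: "a \<in> ?V" "b \<in> ?V" "?x a = ?x b" for a b
  proof -
    let ?m = "\<ominus>\<^bsub>D\<^esub> \<one>\<^bsub>D\<^esub>"
    have "?x (\<lambda>x. ?m \<otimes>\<^bsub>D\<^esub> a x \<oplus>\<^bsub>D\<^esub> b x) = axpy X ?m (?x a) (?x b)"
      using ab gen by (intro X.lincomb_axpy) simp_all
    also have "\<dots> = \<zero>\<^bsub>X\<^esub>" using ab gen by (simp add: axpy_def X.M.l_neg)
    finally have "?y (\<lambda>x. ?m \<otimes>\<^bsub>D\<^esub> a x \<oplus>\<^bsub>D\<^esub> b x) = \<zero>\<^bsub>Y\<^esub>"
      using ab by (intro zero X.row_vectors_axpy) simp_all
    moreover have "?y (\<lambda>x. ?m \<otimes>\<^bsub>D\<^esub> a x \<oplus>\<^bsub>D\<^esub> b x) = axpy Y ?m (?y a) (?y b)"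
      using ab y by (intro Y.lincomb_axpy) simp_all
    ultimately have "\<ominus>\<^bsub>Y\<^esub> ?y a \<oplus>\<^bsub>Y\<^esub> ?y b = \<zero>\<^bsub>Y\<^esub>" using ab y by (simp add: axpy_def)
    moreover have "?y a \<in> carrier Y" "?y b \<in> carrier Y" using ab y by simp_all
    ultimately show ?thesis by (metis Y.M.a_inv_closed Y.M.minus_equality Y.M.minus_minus)
  qed
  have "\<forall>m\<in>carrier X. \<exists>a. a \<in> ?V \<and> ?x a = m"
    using presentsD(3)[OF P] by blast
  from bchoice[OF this] obtain w where w: "\<And>m. m \<in> carrier X \<Longrightarrow> w m \<in> ?V \<and> ?x (w m) = m"
    by blast
  have f: "(\<lambda>m. ?y (w m)) \<in> mod_hom D X Y"
  proof (rule mod_homI[OF X Y])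
    show "?y (w m) \<in> carrier Y" if "m \<in> carrier X" for m using w[OF that] y by simp
    fix d m m' assume *: "d \<in> carrier D" "m \<in> carrier X" "m' \<in> carrier X"
    note w' = w[OF *(2)] w[OF *(3)]
    have "?y (w (axpy X d m m')) = ?y (\<lambda>x. d \<otimes>\<^bsub>D\<^esub> w m x \<oplus>\<^bsub>D\<^esub> w m' x)"
      using * w w' gen by (intro eq) (simp_all add: X.row_vectors_axpy X.lincomb_axpy)
    also have "\<dots> = axpy Y d (?y (w m)) (?y (w m'))"
      using * w' y by (intro Y.lincomb_axpy) simp_all
    finally show "?y (w (axpy X d m m')) = axpy Y d (?y (w m)) (?y (w m'))" .
  qed
  moreover have "?y (w (gen P x)) = y x" if x: "x \<in> cols P" for x
  proof -
    let ?u = "\<lambda>x'. if x' = x then \<one>\<^bsub>D\<^esub> else \<zero>\<^bsub>D\<^esub>"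
    have u: "?u \<in> ?V" by (auto simp: row_vectors_def intro!: finite_subset[of _ "{x}"])
    have "?x ?u = (\<Oplus>\<^bsub>X\<^esub>x'\<in>{x}. ?u x' \<odot>\<^bsub>X\<^esub> gen P x')"
      using x gen by (intro X.lincomb_finsum) auto
    then have "?x ?u = gen P x" using gen[OF x] by (simp add: X.M.finsum_insert)
    moreover have "?y ?u = (\<Oplus>\<^bsub>Y\<^esub>x'\<in>{x}. ?u x' \<odot>\<^bsub>Y\<^esub> y x')"
      using x y by (intro Y.lincomb_finsum) auto
    then have "?y ?u = y x" using y[OF x] by (simp add: Y.M.finsum_insert)
    ultimately show ?thesis using eq[of "w (gen P x)" ?u] w[OF gen[OF x]] u by simp
  qed
  ultimately show ?thesis using that by blast
qed

context lmod
begin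

lemma lincomb_eq_zero:
  assumes "c \<in> row_vectors D R" "\<And>r. r \<in> R \<Longrightarrow> f r = \<zero>\<^bsub>A\<^esub>"
  shows "lincomb D A R c f = \<zero>\<^bsub>A\<^esub>"
  using assms by (auto simp: lincomb_def row_vectorsD intro!: M.add.finprod_one_eqI)

lemma row_times_matrix_Plus:
  assumes c: "c \<in> row_vectors D (R <+> S)" and B: "\<And>r. r \<in> R <+> S \<Longrightarrow> B r x \<in> carrier D"
  shows "row_times_matrix D (R <+> S) c B x =
    row_times_matrix D R (\<lambda>r. c (Inl r)) (\<lambda>r. B (Inl r)) x \<oplus>\<^bsub>D\<^esub>
    row_times_matrix D S (\<lambda>s. c (Inr s)) (\<lambda>s. B (Inr s)) x"
proof -
  let ?R = "{r \<in> R. c (Inl r) \<noteq> \<zero>\<^bsub>D\<^esub>}" and ?S = "{s \<in> S. c (Inr s) \<noteq> \<zero>\<^bsub>D\<^esub>}"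
  have supp: "{z \<in> R <+> S. c z \<noteq> \<zero>\<^bsub>D\<^esub>} = Inl ` ?R \<union> Inr ` ?S" by auto
  have fin: "finite ?R" "finite ?S" using c by (simp_all add: row_vectors_Plus finite_support)
  have cl: "c z \<otimes>\<^bsub>D\<^esub> B z x \<in> carrier D" if "z \<in> R <+> S" for z
    using B[OF that] row_vectorsD[OF c that] by simp
  have "row_times_matrix D (R <+> S) c B x =
      (\<Oplus>\<^bsub>D\<^esub>z\<in>Inl ` ?R. c z \<otimes>\<^bsub>D\<^esub> B z x) \<oplus>\<^bsub>D\<^esub> (\<Oplus>\<^bsub>D\<^esub>z\<in>Inr ` ?S. c z \<otimes>\<^bsub>D\<^esub> B z x)"
    unfolding row_times_matrix_def supp using fin cl by (intro R.finsum_Un_disjoint) auto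
  also have "(\<Oplus>\<^bsub>D\<^esub>z\<in>Inl ` ?R. c z \<otimes>\<^bsub>D\<^esub> B z x) = row_times_matrix D R (\<lambda>r. c (Inl r)) (\<lambda>r. B (Inl r)) x"
    unfolding row_times_matrix_def using cl by (intro R.finsum_reindex) auto
  also have "(\<Oplus>\<^bsub>D\<^esub>z\<in>Inr ` ?S. c z \<otimes>\<^bsub>D\<^esub> B z x) = row_times_matrix D S (\<lambda>s. c (Inr s)) (\<lambda>s. B (Inr s)) x"
    unfolding row_times_matrix_def using cl by (intro R.finsum_reindex) auto
  finally show ?thesis .
qed

lemma row_times_zero_matrix:
  assumes "c \<in> row_vectors D R"
  shows "row_times_matrix D R c (\<lambda>_ _. \<zero>\<^bsub>D\<^esub>) x = \<zero>\<^bsub>D\<^esub>"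
  using assms by (auto simp: row_times_matrix_def row_vectorsD intro!: R.add.finprod_one_eqI)

end

section \<open>Block matrices and extensions\<close>

text \<open>This is the record occurring in \<open>ses_presented\<close>. With \<open>PB\<close> a
  block presentation itself it becomes the three-block matrix of \<open>ext2_presented\<close>, so
  both cases rest on one lemma.\<close>

definition block_presentation ::
  "('d, 'z) ring_scheme \<Rightarrow> ('d, 'm, 'x, 'r) presentation \<Rightarrow> ('d, 'n, 'y, 's) presentation
    \<Rightarrow> ('r \<Rightarrow> 'y \<Rightarrow> 'd) \<Rightarrow> ('x + 'y \<Rightarrow> 'g) \<Rightarrow> ('d, 'g, 'x + 'y, 'r + 's) presentation"
  where "block_presentation D PA PB \<zeta> e =
    \<lparr>cols = cols PA <+> cols PB, rows = rows PA <+> rows PB,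
     ent = block_upper D (ent PA) \<zeta> (ent PB), gen = e\<rparr>"

text \<open>
  \<open>e\<close> lifts the generators of \<open>A\<close> to the middle module, and the rows of \<open>\<zeta>\<close> express what their
  relations become there.
\<close>

definition ses_lift ::
  "('d, 'z) ring_scheme \<Rightarrow> ('d, 'b) module \<Rightarrow> ('d, 'a, 'x, 'r) presentation \<Rightarrow> ('d, 'b, 'y, 's) presentation
    \<Rightarrow> ('d, 'a, 'b, 'g) ses \<Rightarrow> ('r \<Rightarrow> 'y \<Rightarrow> 'd) \<Rightarrow> ('x \<Rightarrow> 'g) \<Rightarrow> bool"
  where "ses_lift D B PA PB S \<zeta> e \<longleftrightarrow>
    (\<forall>x\<in>cols PA. e x \<in> carrier (mid S) \<and> prj S (e x) = gen PA x) \<and>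
    (\<forall>r\<in>rows PA. \<zeta> r \<in> row_vectors D (cols PB) \<and>
      lincomb D (mid S) (cols PA) (ent PA r) e \<oplus>\<^bsub>mid S\<^esub> inc S (lincomb D B (cols PB) (\<zeta> r) (gen PB)) = \<zero>\<^bsub>mid S\<^esub>)"

lemma ses_liftD:
  assumes "ses_lift D B PA PB S \<zeta> e"
  shows "x \<in> cols PA \<Longrightarrow> e x \<in> carrier (mid S)" and "x \<in> cols PA \<Longrightarrow> prj S (e x) = gen PA x"
    and "r \<in> rows PA \<Longrightarrow> \<zeta> r \<in> row_vectors D (cols PB)"
    and "r \<in> rows PA \<Longrightarrow> lincomb D (mid S) (cols PA) (ent PA r) e \<oplus>\<^bsub>mid S\<^esub>
      inc S (lincomb D B (cols PB) (\<zeta> r) (gen PB)) = \<zero>\<^bsub>mid S\<^esub>"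
  using assms by (auto simp: ses_lift_def)

context exact_seq
begin

lemma lincomb_block:
  assumes PB: "presents D B PB"
    and eA: "\<And>x. x \<in> X \<Longrightarrow> e (Inl x) \<in> carrier (mid S)"
    and eB: "\<And>z. z \<in> cols PB \<Longrightarrow> e (Inr z) = inc S (gen PB z)"
    and v: "v \<in> row_vectors D (X <+> cols PB)"
  shows "lincomb D (mid S) (X <+> cols PB) v e =
    lincomb D (mid S) X (\<lambda>x. v (Inl x)) (\<lambda>x. e (Inl x)) \<oplus>\<^bsub>mid S\<^esub>
    inc S (lincomb D B (cols PB) (\<lambda>z. v (Inr z)) (gen PB))"
proof -
  have v': "(\<lambda>z. v (Inr z)) \<in> row_vectors D (cols PB)" using v by (simp add: row_vectors_Plus)
  have "lincomb D (mid S) (X <+> cols PB) v e =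
      lincomb D (mid S) X (\<lambda>x. v (Inl x)) (\<lambda>x. e (Inl x)) \<oplus>\<^bsub>mid S\<^esub>
      lincomb D (mid S) (cols PB) (\<lambda>z. v (Inr z)) (\<lambda>z. e (Inr z))"
    using v eA eB presentsD(1)[OF PB] by (intro G.lincomb_Plus) auto
  also have "lincomb D (mid S) (cols PB) (\<lambda>z. v (Inr z)) (\<lambda>z. e (Inr z)) =
      lincomb D (mid S) (cols PB) (\<lambda>z. v (Inr z)) (\<lambda>z. inc S (gen PB z))"
    using v' eB presentsD(1)[OF PB] by (intro G.lincomb_cong) simp_all
  also have "\<dots> = inc S (lincomb D B (cols PB) (\<lambda>z. v (Inr z)) (gen PB))"
    using inc_hom B.left_module_axioms G.left_module_axioms v' presentsD(1)[OF PB]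
    by (rule lincomb_hom[symmetric])
  finally show ?thesis .
qed

text \<open>Once the upper rows are relations for the lifted generators, exactness ensures that
  there are no further ones: the A-part of a relation is a combination of rows of PA, and after
  subtracting these rows a relation of B remains, because \<open>inc S\<close> is injective.\<close>

lemma block_presents_iff:
  assumes PA: "presents D A PA" and PB: "presents D B PB"
    and eB: "\<And>z. z \<in> cols PB \<Longrightarrow> e (Inr z) = inc S (gen PB z)"
  shows "presents D (mid S) (block_presentation D PA PB \<zeta> e) \<and> (\<forall>x\<in>cols PA. prj S (e (Inl x)) = gen PA x)
    \<longleftrightarrow> ses_lift D B PA PB S \<zeta> (\<lambda>x. e (Inl x))"
proof (intro iffI conjI)
  assume "presents D (mid S) (block_presentation D PA PB \<zeta> e) \<and> (\<forall>x\<in>cols PA. prj S (e (Inl x)) = gen PA x)"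
  then have P: "presents D (mid S) (block_presentation D PA PB \<zeta> e)"
    and prj: "\<forall>x\<in>cols PA. prj S (e (Inl x)) = gen PA x" by blast+
  have eA: "e (Inl x) \<in> carrier (mid S)" if "x \<in> cols PA" for x
    using presentsD(1)[OF P, of "Inl x"] that by (simp add: block_presentation_def InlI)
  have "\<zeta> r \<in> row_vectors D (cols PB) \<and>
      lincomb D (mid S) (cols PA) (ent PA r) (\<lambda>x. e (Inl x)) \<oplus>\<^bsub>mid S\<^esub>
      inc S (lincomb D B (cols PB) (\<zeta> r) (gen PB)) = \<zero>\<^bsub>mid S\<^esub>" if r: "r \<in> rows PA" for r
  proof -
    let ?v = "case_sum (ent PA r) (\<zeta> r)"
    have v: "?v \<in> row_vectors D (cols PA <+> cols PB)"
      using presentsD(2)[OF P, of "Inl r"] r by (simp add: block_presentation_def block_upper_def InlI)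
    have "lincomb D (mid S) (cols PA <+> cols PB) ?v e = \<zero>\<^bsub>mid S\<^esub>"
      using presents_row[OF P G.left_module_axioms, of "Inl r"] r
      by (simp add: block_presentation_def block_upper_def InlI)
    then show ?thesis using v by (simp add: lincomb_block[OF PB eA eB] row_vectors_Plus)
  qed
  then show "ses_lift D B PA PB S \<zeta> (\<lambda>x. e (Inl x))" using eA prj by (simp add: ses_lift_def)
next
  assume lift: "ses_lift D B PA PB S \<zeta> (\<lambda>x. e (Inl x))"
  note [simp] = InlI InrI
  note eA = ses_liftD(1)[OF lift] and prj_eA = ses_liftD(2)[OF lift]
    and \<zeta> = ses_liftD(3)[OF lift] and rel = ses_liftD(4)[OF lift]
  show "\<forall>x\<in>cols PA. prj S (e (Inl x)) = gen PA x" using prj_eA by blast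
  let ?cols = "cols PA <+> cols PB" and ?rows = "rows PA <+> rows PB"
    and ?ent = "block_upper D (ent PA) \<zeta> (ent PB)"
  have e: "e z \<in> carrier (mid S)" if "z \<in> ?cols" for z
    using that eA eB presentsD(1)[OF PB] by auto
  have ent: "?ent r \<in> row_vectors D ?cols" if "r \<in> ?rows" for r
    using that presentsD(2)[OF PA] presentsD(2)[OF PB] \<zeta>
    by (auto simp: row_vectors_Plus block_upper_def A.zero_row)
  have rel_ent: "lincomb D (mid S) ?cols (?ent r) e = \<zero>\<^bsub>mid S\<^esub>" if r: "r \<in> ?rows" for r
    using r rel presents_row[OF PB B.left_module_axioms]
    by (subst lincomb_block[OF PB eA eB ent]) (auto simp: block_upper_def)
  have cl: "?ent r y \<in> carrier D" if "r \<in> ?rows" "y \<in> ?cols" for r y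
    using ent[OF that(1)] that(2) by (rule row_vectorsD)
  have rowtimes_Inl: "row_times_matrix D ?rows c ?ent (Inl x) =
      row_times_matrix D (rows PA) (\<lambda>r. c (Inl r)) (ent PA) x"
    if c: "c \<in> row_vectors D ?rows" and x: "x \<in> cols PA" for c x
  proof -
    have c': "(\<lambda>r. c (Inl r)) \<in> row_vectors D (rows PA)" "(\<lambda>s. c (Inr s)) \<in> row_vectors D (rows PB)"
      using c by (simp_all add: row_vectors_Plus)
    have "row_times_matrix D ?rows c ?ent (Inl x) =
        row_times_matrix D (rows PA) (\<lambda>r. c (Inl r)) (\<lambda>r. ?ent (Inl r)) (Inl x) \<oplus>\<^bsub>D\<^esub>
        row_times_matrix D (rows PB) (\<lambda>s. c (Inr s)) (\<lambda>s. ?ent (Inr s)) (Inl x)"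
      using c cl x by (intro A.row_times_matrix_Plus) auto
    also have "row_times_matrix D (rows PA) (\<lambda>r. c (Inl r)) (\<lambda>r. ?ent (Inl r)) (Inl x) =
        row_times_matrix D (rows PA) (\<lambda>r. c (Inl r)) (ent PA) x"
      by (simp add: row_times_matrix_def block_upper_def)
    also have "row_times_matrix D (rows PB) (\<lambda>s. c (Inr s)) (\<lambda>s. ?ent (Inr s)) (Inl x) =
        row_times_matrix D (rows PB) (\<lambda>s. c (Inr s)) (\<lambda>_ _. \<zero>\<^bsub>D\<^esub>) x"
      by (simp add: row_times_matrix_def block_upper_def)
    also have "\<dots> = \<zero>\<^bsub>D\<^esub>" using c'(2) by (rule A.row_times_zero_matrix)
    finally show ?thesis
      using row_vectorsD[OF A.row_times_matrix_row_vectors[OF c'(1) presentsD(2)[OF PA] presentsD(1)[OF PA]] x]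
      by simp
  qed
  have rowtimes_Inr: "row_times_matrix D ?rows c ?ent (Inr z) =
      row_times_matrix D (rows PA) (\<lambda>r. c (Inl r)) \<zeta> z \<oplus>\<^bsub>D\<^esub>
      row_times_matrix D (rows PB) (\<lambda>s. c (Inr s)) (ent PB) z"
    if c: "c \<in> row_vectors D ?rows" and z: "z \<in> cols PB" for c z
  proof -
    have "row_times_matrix D ?rows c ?ent (Inr z) =
        row_times_matrix D (rows PA) (\<lambda>r. c (Inl r)) (\<lambda>r. ?ent (Inl r)) (Inr z) \<oplus>\<^bsub>D\<^esub>
        row_times_matrix D (rows PB) (\<lambda>s. c (Inr s)) (\<lambda>s. ?ent (Inr s)) (Inr z)"
      using c cl z by (intro A.row_times_matrix_Plus) auto
    then show ?thesis by (simp add: row_times_matrix_def block_upper_def)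
  qed
  have "\<exists>a\<in>row_vectors D ?cols. lincomb D (mid S) ?cols a e = m" if m: "m \<in> carrier (mid S)" for m
  proof -
    obtain a where a: "a \<in> row_vectors D (cols PA)" "lincomb D A (cols PA) a (gen PA) = prj S m"
      using presentsD(3)[OF PA prj_closed[OF m]] by blast
    let ?l = "lincomb D (mid S) (cols PA) a (\<lambda>x. e (Inl x))"
    have "prj S ?l = lincomb D A (cols PA) a (\<lambda>x. prj S (e (Inl x)))"
      using prj_hom G.left_module_axioms A.left_module_axioms a(1) eA by (rule lincomb_hom)
    also have "\<dots> = prj S m"
      unfolding a(2)[symmetric] using a(1) prj_eA presentsD(1)[OF PA] by (intro A.lincomb_cong) simp_all
    finally obtain b where b: "b \<in> carrier B" "m = ?l \<oplus>\<^bsub>mid S\<^esub> inc S b"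
      using diff_ex[of m ?l] m a(1) eA by auto
    obtain c where c: "c \<in> row_vectors D (cols PB)" "lincomb D B (cols PB) c (gen PB) = b"
      using presentsD(3)[OF PB b(1)] by blast
    have "case_sum a c \<in> row_vectors D ?cols" using a c by (simp add: row_vectors_Plus)
    moreover from this have "lincomb D (mid S) ?cols (case_sum a c) e = m"
      using b(2) c(2) by (simp add: lincomb_block[OF PB eA eB])
    ultimately show ?thesis by blast
  qed
  moreover have "lincomb D (mid S) ?cols v e = \<zero>\<^bsub>mid S\<^esub> \<longleftrightarrow>
      (\<exists>c\<in>row_vectors D ?rows. \<forall>x\<in>?cols. v x = row_times_matrix D ?rows c ?ent x)"
    if v: "v \<in> row_vectors D ?cols" for v
  proof
    assume "\<exists>c\<in>row_vectors D ?rows. \<forall>x\<in>?cols. v x = row_times_matrix D ?rows c ?ent x"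
    then obtain c where c: "c \<in> row_vectors D ?rows"
      and eq: "\<forall>x\<in>?cols. v x = row_times_matrix D ?rows c ?ent x" by blast
    have "lincomb D (mid S) ?cols v e = lincomb D (mid S) ?cols (row_times_matrix D ?rows c ?ent) e"
      using v e eq by (intro G.lincomb_cong) simp_all
    also have "\<dots> = lincomb D (mid S) ?rows c (\<lambda>r. lincomb D (mid S) ?cols (?ent r) e)"
      using c ent e by (rule G.lincomb_row_times_matrix_eq)
    also have "\<dots> = \<zero>\<^bsub>mid S\<^esub>" using c rel_ent by (rule G.lincomb_eq_zero)
    finally show "lincomb D (mid S) ?cols v e = \<zero>\<^bsub>mid S\<^esub>" .
  next
    assume zero: "lincomb D (mid S) ?cols v e = \<zero>\<^bsub>mid S\<^esub>"
    let ?vA = "\<lambda>x. v (Inl x)" and ?vB = "\<lambda>z. v (Inr z)"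
    have vAB: "?vA \<in> row_vectors D (cols PA)" "?vB \<in> row_vectors D (cols PB)"
      using v by (simp_all add: row_vectors_Plus)
    let ?l = "lincomb D (mid S) (cols PA) ?vA (\<lambda>x. e (Inl x))"
    have "prj S (?l \<oplus>\<^bsub>mid S\<^esub> inc S (lincomb D B (cols PB) ?vB (gen PB))) = \<zero>\<^bsub>A\<^esub>"
      using zero by (simp add: lincomb_block[OF PB eA eB v])
    then have "prj S ?l = \<zero>\<^bsub>A\<^esub>" using vAB eA presentsD(1)[OF PB] by simp
    moreover have "prj S ?l = lincomb D A (cols PA) ?vA (\<lambda>x. prj S (e (Inl x)))"
      using prj_hom G.left_module_axioms A.left_module_axioms vAB(1) eA by (rule lincomb_hom)
    moreover have "\<dots> = lincomb D A (cols PA) ?vA (gen PA)"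
      using vAB(1) prj_eA eA presentsD(1)[OF PA] by (intro A.lincomb_cong) simp_all
    ultimately have "lincomb D A (cols PA) ?vA (gen PA) = \<zero>\<^bsub>A\<^esub>" by simp
    then obtain c where c: "c \<in> row_vectors D (rows PA)"
      and c_eq: "\<forall>x\<in>cols PA. v (Inl x) = row_times_matrix D (rows PA) c (ent PA) x"
      using presentsD(4)[OF PA vAB(1)] by blast
    \<comment> \<open>The upper rows are taken with the coefficients c and the lower ones with zero,
      so that \<open>?w\<close> agrees with v on the columns of PA.\<close>
    let ?c = "case_sum c (\<lambda>_. \<zero>\<^bsub>D\<^esub>)"
    have c': "?c \<in> row_vectors D ?rows" using c by (simp add: row_vectors_Plus A.zero_row)
    let ?w = "row_times_matrix D ?rows ?c ?ent"
    have w: "?w \<in> row_vectors D ?cols" "lincomb D (mid S) ?cols ?w e = \<zero>\<^bsub>mid S\<^esub>"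
      using G.row_times_matrix_row_vectors[OF c' ent e] G.lincomb_row_times_matrix_eq[OF c' ent e]
        G.lincomb_eq_zero[OF c' rel_ent] by simp_all
    \<comment> \<open>The remaining relation v - w vanishes on the columns of PA.\<close>
    let ?u = "\<lambda>x. (\<ominus>\<^bsub>D\<^esub> \<one>\<^bsub>D\<^esub>) \<otimes>\<^bsub>D\<^esub> ?w x \<oplus>\<^bsub>D\<^esub> v x"
    have u: "?u \<in> row_vectors D ?cols" using w v by (intro A.row_vectors_axpy) simp_all
    have "lincomb D (mid S) ?cols ?u e = axpy (mid S) (\<ominus>\<^bsub>D\<^esub> \<one>\<^bsub>D\<^esub>)
        (lincomb D (mid S) ?cols ?w e) (lincomb D (mid S) ?cols v e)"
      using w(1) v _ e by (rule G.lincomb_axpy) simp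
    then have u0: "lincomb D (mid S) ?cols ?u e = \<zero>\<^bsub>mid S\<^esub>" using w zero by simp
    have v_cl: "v x \<in> carrier D" "?w x \<in> carrier D" if "x \<in> ?cols" for x
      using row_vectorsD[OF v that] row_vectorsD[OF w(1) that] by simp_all
    have u_eq: "?u x = v x \<oplus>\<^bsub>D\<^esub> \<ominus>\<^bsub>D\<^esub> ?w x" if "x \<in> ?cols" for x
      using v_cl[OF that] by (simp add: A.R.l_minus A.R.a_comm)
    have uA: "?u (Inl x) = \<zero>\<^bsub>D\<^esub>" if x: "x \<in> cols PA" for x
    proof -
      have "?w (Inl x) = v (Inl x)"
        using rowtimes_Inl[OF c' x] c_eq x by simp
      then show ?thesis using u_eq[of "Inl x"] x v_cl[of "Inl x"] by (simp add: A.R.r_neg)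
    qed
    let ?uB = "\<lambda>z. ?u (Inr z)"
    have uB: "?uB \<in> row_vectors D (cols PB)" using u by (simp add: row_vectors_Plus)
    have "lincomb D (mid S) (cols PA) (\<lambda>x. ?u (Inl x)) (\<lambda>x. e (Inl x)) =
        lincomb D (mid S) (cols PA) (\<lambda>_. \<zero>\<^bsub>D\<^esub>) (\<lambda>x. e (Inl x))"
      using uA eA u by (intro G.lincomb_cong) (simp_all add: row_vectors_Plus)
    then have "inc S (lincomb D B (cols PB) ?uB (gen PB)) = inc S \<zero>\<^bsub>B\<^esub>"
      using u0 uB presentsD(1)[OF PB] by (simp add: lincomb_block[OF PB eA eB u])
    then have "lincomb D B (cols PB) ?uB (gen PB) = \<zero>\<^bsub>B\<^esub>"
      using uB presentsD(1)[OF PB] by (subst (asm) inc_eq_iff) simp_all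
    then obtain d where d: "d \<in> row_vectors D (rows PB)"
      and d_eq: "\<forall>z\<in>cols PB. ?uB z = row_times_matrix D (rows PB) d (ent PB) z"
      using presentsD(4)[OF PB uB] by blast
    let ?cd = "case_sum c d"
    have cd: "?cd \<in> row_vectors D ?rows" using c d by (simp add: row_vectors_Plus)
    have "v x = row_times_matrix D ?rows ?cd ?ent x" if x: "x \<in> ?cols" for x
      using x
    proof (elim PlusE)
      fix y assume y: "x = Inl y" "y \<in> cols PA"
      then show ?thesis using rowtimes_Inl[OF cd y(2)] c_eq by simp
    next
      fix z assume z: "x = Inr z" "z \<in> cols PB"
      have "row_times_matrix D (rows PA) c \<zeta> z \<in> carrier D"
        using B.row_times_matrix_row_vectors[OF c \<zeta> presentsD(1)[OF PB]] z(2) by (rule row_vectorsD)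
      then have w_eq: "?w (Inr z) = row_times_matrix D (rows PA) c \<zeta> z"
        using rowtimes_Inr[OF c' z(2)] by (simp add: row_times_matrix_def)
      have "row_times_matrix D ?rows ?cd ?ent x = ?w x \<oplus>\<^bsub>D\<^esub> ?u x"
        by (simp only: z(1) rowtimes_Inr[OF cd z(2)] sum.case w_eq[symmetric] bspec[OF d_eq z(2), symmetric])
      also have "\<dots> = v x"
        unfolding u_eq[OF x] using v_cl[OF x] by (simp add: A.R.a_lcomm A.R.r_neg)
      finally show ?thesis by simp
    qed
    with cd show "\<exists>c\<in>row_vectors D ?rows. \<forall>x\<in>?cols. v x = row_times_matrix D ?rows c ?ent x"
      by blast
  qed
  ultimately show "presents D (mid S) (block_presentation D PA PB \<zeta> e)"
    using e ent by (simp add: presents_def block_presentation_def)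
qed

text \<open>The generators of A are lifted arbitrarily. A row of PA evaluated at the lifts projects
  to zero, so it is the image of some b in B, and \<zeta> expands -b in the generators of B.\<close>

lemma ex_ses_lift:
  assumes PA: "presents D A PA" and PB: "presents D B PB"
  shows "\<exists>\<zeta> eA. ses_lift D B PA PB S \<zeta> eA"
proof -
  have "\<forall>x\<in>cols PA. \<exists>y. y \<in> carrier (mid S) \<and> prj S y = gen PA x"
    using presentsD(1)[OF PA] unfolding prj_surj[symmetric] by (metis imageE)
  from bchoice[OF this] obtain e
    where e: "\<And>x. x \<in> cols PA \<Longrightarrow> e x \<in> carrier (mid S)" "\<And>x. x \<in> cols PA \<Longrightarrow> prj S (e x) = gen PA x"
    by blast
  have "\<exists>z. z \<in> row_vectors D (cols PB) \<and> lincomb D (mid S) (cols PA) (ent PA r) e \<oplus>\<^bsub>mid S\<^esub>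
      inc S (lincomb D B (cols PB) z (gen PB)) = \<zero>\<^bsub>mid S\<^esub>" if r: "r \<in> rows PA" for r
  proof -
    note row = presentsD(2)[OF PA r]
    let ?l = "lincomb D (mid S) (cols PA) (ent PA r) e"
    have "prj S ?l = lincomb D A (cols PA) (ent PA r) (\<lambda>x. prj S (e x))"
      using prj_hom G.left_module_axioms A.left_module_axioms row e(1) by (rule lincomb_hom)
    also have "\<dots> = lincomb D A (cols PA) (ent PA r) (gen PA)"
      using row e presentsD(1)[OF PA] by (intro A.lincomb_cong) simp_all
    also have "\<dots> = \<zero>\<^bsub>A\<^esub>" using PA A.left_module_axioms r by (rule presents_row)
    finally have "prj S ?l = \<zero>\<^bsub>A\<^esub>" .
    moreover have "?l \<in> carrier (mid S)" using row e(1) by simp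
    ultimately obtain b where b: "b \<in> carrier B" "?l = inc S b" by (auto elim: kernelE)
    obtain z where z: "z \<in> row_vectors D (cols PB)" "lincomb D B (cols PB) z (gen PB) = \<ominus>\<^bsub>B\<^esub> b"
      using presentsD(3)[OF PB, of "\<ominus>\<^bsub>B\<^esub> b"] b(1) by auto
    have "?l \<oplus>\<^bsub>mid S\<^esub> inc S (lincomb D B (cols PB) z (gen PB)) = inc S (b \<oplus>\<^bsub>B\<^esub> \<ominus>\<^bsub>B\<^esub> b)"
      unfolding z(2) b(2) using b(1) by (intro inc_add[symmetric]) simp_all
    then show ?thesis using z(1) b(1) by (auto simp: B.M.r_neg simp del: inc_add)
  qed
  then have "\<forall>r\<in>rows PA. \<exists>z. z \<in> row_vectors D (cols PB) \<and> lincomb D (mid S) (cols PA) (ent PA r) e \<oplus>\<^bsub>mid S\<^esub>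
      inc S (lincomb D B (cols PB) z (gen PB)) = \<zero>\<^bsub>mid S\<^esub>" by blast
  from bchoice[OF this] obtain \<zeta> where "\<forall>r\<in>rows PA. \<zeta> r \<in> row_vectors D (cols PB) \<and>
      lincomb D (mid S) (cols PA) (ent PA r) e \<oplus>\<^bsub>mid S\<^esub>
      inc S (lincomb D B (cols PB) (\<zeta> r) (gen PB)) = \<zero>\<^bsub>mid S\<^esub>" by blast
  then have "ses_lift D B PA PB S \<zeta> e" using e by (simp add: ses_lift_def)
  then show ?thesis by blast
qed

end

lemma ses_presented_iff:
  assumes S: "short_exact D M N S" and PM: "presents D M PM" and PN: "presents D N PN"
  shows "ses_presented D PM PN S \<eta> \<longleftrightarrow> (\<exists>e. ses_lift D N PM PN S \<eta> e)"
proof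
  interpret S: exact_seq D M N S by unfold_locales (rule S)
  {
    assume "ses_presented D PM PN S \<eta>"
    then obtain e where "presents D (mid S) (block_presentation D PM PN \<eta> e)"
      "\<forall>x\<in>cols PM. prj S (e (Inl x)) = gen PM x" "\<forall>z\<in>cols PN. e (Inr z) = inc S (gen PN z)"
      by (auto simp: ses_presented_def block_presentation_def)
    then show "\<exists>e. ses_lift D N PM PN S \<eta> e"
      using S.block_presents_iff[OF PM PN, of e \<eta>] by blast
  next
    assume "\<exists>e. ses_lift D N PM PN S \<eta> e"
    then obtain e where e: "ses_lift D N PM PN S \<eta> e" ..
    let ?e = "case_sum e (\<lambda>z. inc S (gen PN z))"
    have "presents D (mid S) (block_presentation D PM PN \<eta> ?e) \<and> (\<forall>x\<in>cols PM. prj S (?e (Inl x)) = gen PM x)"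
      using e by (subst S.block_presents_iff[OF PM PN]) simp_all
    then show "ses_presented D PM PN S \<eta>"
      unfolding ses_presented_def block_presentation_def by (intro exI[of _ ?e]) simp
  }
qed

definition lower_presentation ::
  "('d, 'z) ring_scheme \<Rightarrow> ('d, 'l, 'x, 'r) presentation \<Rightarrow> ('d, 'n, 'y, 's) presentation
    \<Rightarrow> ('d, 'm, 'l, 'n, 'e) ext2 \<Rightarrow> ('r \<Rightarrow> 'y \<Rightarrow> 'd) \<Rightarrow> ('x \<Rightarrow> 'e) \<Rightarrow> ('d, 'e, 'x + 'y, 'r + 's) presentation"
  where "lower_presentation D PL PN E \<gamma> eL =
    block_presentation D PL PN \<gamma> (case_sum eL (\<lambda>z. inc (lower_ses E) (gen PN z)))"

text \<open>The three-block matrix is read as two nested two-block ones: \<gamma> belongs to E1 as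
  an extension of L by N, and the row (\<beta>, \<eta>) to E as an extension of M by E1 with
  \<open>lower_presentation\<close> for E1.\<close>

definition ext2_lift ::
  "('d, 'z) ring_scheme \<Rightarrow> ('d, 'n) module \<Rightarrow> ('d, 'm, 'xm, 'rm) presentation
    \<Rightarrow> ('d, 'l, 'xl, 'rl) presentation \<Rightarrow> ('d, 'n, 'xn, 'rn) presentation \<Rightarrow> ('d, 'm, 'l, 'n, 'e) ext2
    \<Rightarrow> ('rm \<Rightarrow> 'xl \<Rightarrow> 'd) \<Rightarrow> ('rl \<Rightarrow> 'xn \<Rightarrow> 'd) \<Rightarrow> ('rm \<Rightarrow> 'xn \<Rightarrow> 'd)
    \<Rightarrow> ('xl \<Rightarrow> 'e) \<Rightarrow> ('xm \<Rightarrow> 'e) \<Rightarrow> bool"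
  where "ext2_lift D N PM PL PN E \<beta> \<gamma> \<eta> eL eM \<longleftrightarrow>
    ses_lift D N PL PN (lower_ses E) \<gamma> eL \<and>
    ses_lift D (mid (lower_ses E)) PM (lower_presentation D PL PN E \<gamma> eL) (filtration_ses E)
      (\<lambda>r. case_sum (\<beta> r) (\<eta> r)) eM"

context two_ext
begin

lemma lower_presents:
  assumes "presents D L PL" "presents D N PN" "ses_lift D N PL PN (lower_ses E) \<gamma> eL"
  shows "presents D (mid (lower_ses E)) (lower_presentation D PL PN E \<gamma> eL)"
  unfolding lower_presentation_def
  using lower.block_presents_iff[OF assms(1,2), of "case_sum eL (\<lambda>z. inc (lower_ses E) (gen PN z))" \<gamma>] assms(3)
  by simp

text \<open>Lifts give presentations by \<open>block_presents_iff\<close>, used for E1 and then for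
  E. In the other direction only a presentation of E is given, so the relations of E1 are first
  recovered from the middle rows of the matrix.\<close>

lemma ext2_presented_iff:
  assumes PM: "presents D M PM" and PL: "presents D L PL" and PN: "presents D N PN"
  shows "ext2_presented D PM PL PN E \<beta> \<gamma> \<eta> \<longleftrightarrow> (\<exists>eL eM. ext2_lift D N PM PL PN E \<beta> \<gamma> \<eta> eL eM)"
proof
  let ?K = "mid (lower_ses E)" and ?i = "inc (lower_ses E)"
  have inc_E2: "?i n \<in> E2 E" if "n \<in> carrier N" for n
    using that inc_lower_image by blast
  {
    assume "\<exists>eL eM. ext2_lift D N PM PL PN E \<beta> \<gamma> \<eta> eL eM"
    then obtain eL eM where eL: "ses_lift D N PL PN (lower_ses E) \<gamma> eL"
      and eM: "ses_lift D ?K PM (lower_presentation D PL PN E \<gamma> eL) (filtration_ses E)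
        (\<lambda>r. case_sum (\<beta> r) (\<eta> r)) eM"
      by (auto simp: ext2_lift_def)
    note PK = lower_presents[OF PL PN eL]
    let ?e = "case_sum eM (case_sum eL (\<lambda>z. ?i (gen PN z)))"
    have "presents D (mid (filtration_ses E)) (block_presentation D PM (lower_presentation D PL PN E \<gamma> eL)
        (\<lambda>r. case_sum (\<beta> r) (\<eta> r)) ?e) \<and> (\<forall>x\<in>cols PM. prj (filtration_ses E) (?e (Inl x)) = gen PM x)"
      using eM by (subst filt.block_presents_iff[OF PM PK])
        (simp_all add: lower_presentation_def block_presentation_def)
    moreover have "eL y \<in> E1 E \<and> prj (lower_ses E) (eL y) = gen PL y" if "y \<in> cols PL" for y
      using ses_liftD(1,2)[OF eL that] by (simp add: lower_ses_mid)
    moreover have "?i (gen PN z) \<in> E2 E \<and> isoN E (?i (gen PN z)) = gen PN z" if "z \<in> cols PN" for z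
      using presentsD(1)[OF PN that] by (simp add: inc_E2 isoN_inc)
    ultimately show "ext2_presented D PM PL PN E \<beta> \<gamma> \<eta>"
      unfolding ext2_presented_def
      by (intro exI[of _ ?e])
         (simp add: lower_presentation_def block_presentation_def, simp add: filtration_ses_def lower_ses_def)
  next
    assume "ext2_presented D PM PL PN E \<beta> \<gamma> \<eta>"
    then obtain e where P0: "presents D (E0 E)
           \<lparr>cols = cols PM <+> (cols PL <+> cols PN), rows = rows PM <+> (rows PL <+> rows PN),
            ent = block_upper D (ent PM) (\<lambda>r. case_sum (\<beta> r) (\<eta> r))
                    (block_upper D (ent PL) \<gamma> (ent PN)), gen = e\<rparr>"
      and eM0: "\<forall>x\<in>cols PM. isoM E (E1 E +>\<^bsub>E0 E\<^esub> e (Inl x)) = gen PM x"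
      and eL0: "\<forall>y\<in>cols PL. e (Inr (Inl y)) \<in> E1 E \<and> isoL E (E2 E +>\<^bsub>E0 E\<^esub> e (Inr (Inl y))) = gen PL y"
      and eN: "\<forall>z\<in>cols PN. e (Inr (Inr z)) \<in> E2 E \<and> isoN E (e (Inr (Inr z))) = gen PN z"
      unfolding ext2_presented_def by blast
    have P: "presents D (E0 E) (block_presentation D PM (lower_presentation D PL PN E \<gamma> eL)
        (\<lambda>r. case_sum (\<beta> r) (\<eta> r)) e)" for eL
      using P0 by (simp add: block_presentation_def lower_presentation_def)
    have eM: "\<forall>x\<in>cols PM. prj (filtration_ses E) (e (Inl x)) = gen PM x"
      using eM0 by (simp add: filtration_ses_def)
    have eL: "\<forall>y\<in>cols PL. e (Inr (Inl y)) \<in> E1 E \<and> prj (lower_ses E) (e (Inr (Inl y))) = gen PL y"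
      using eL0 by (simp add: lower_ses_def)
    have eN': "e (Inr (Inr z)) = ?i (gen PN z)" if z: "z \<in> cols PN" for z
    proof -
      have "e (Inr (Inr z)) \<in> ?i ` carrier N" using eN z by (simp add: inc_lower_image)
      then obtain n where n: "e (Inr (Inr z)) = ?i n" "n \<in> carrier N" by (rule imageE)
      moreover have "isoN E (e (Inr (Inr z))) = gen PN z" using eN z by blast
      ultimately show ?thesis using isoN_inc[of n] by simp
    qed
    let ?eL = "\<lambda>y. e (Inr (Inl y))"
    have eL_K: "?eL y \<in> carrier ?K" if "y \<in> cols PL" for y
      using eL that by (simp add: lower_ses_mid)
    have e_cl: "e z \<in> carrier (E0 E)" if "z \<in> cols PM <+> (cols PL <+> cols PN)" for z
      using presentsD(1)[OF P, of z] that by (simp add: block_presentation_def lower_presentation_def)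
    have lift_L: "ses_lift D N PL PN (lower_ses E) \<gamma> ?eL"
      unfolding ses_lift_def
    proof (intro conjI ballI)
      fix r assume r: "r \<in> rows PL"
      \<comment> \<open>A middle row: its block over PM is zero, so it is a relation among elements
        of E1, where linear combinations agree with those in E.\<close>
      let ?v = "case_sum (\<lambda>_. \<zero>\<^bsub>D\<^esub>) (case_sum (ent PL r) (\<gamma> r))"
      have v: "?v \<in> row_vectors D (cols PM <+> (cols PL <+> cols PN))"
        using presentsD(2)[OF P, of "Inr (Inl r)"] r
        by (simp add: block_presentation_def lower_presentation_def block_upper_def InlI InrI)
      then show \<gamma>: "\<gamma> r \<in> row_vectors D (cols PN)" by (simp add: row_vectors_Plus)
      have v2: "case_sum (ent PL r) (\<gamma> r) \<in> row_vectors D (cols PL <+> cols PN)"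
        using v by (simp add: row_vectors_Plus)
      have "lincomb D (E0 E) (cols PM <+> (cols PL <+> cols PN)) ?v e = \<zero>\<^bsub>E0 E\<^esub>"
        using presents_row[OF P E.left_module_axioms, of "Inr (Inl r)"] r
        by (simp add: block_presentation_def lower_presentation_def block_upper_def InlI InrI)
      then have zero: "lincomb D (E0 E) (cols PL <+> cols PN) (case_sum (ent PL r) (\<gamma> r)) (\<lambda>z. e (Inr z)) = \<zero>\<^bsub>E0 E\<^esub>"
        using e_cl v2 by (subst (asm) E.lincomb_Plus[OF v]) (simp_all add: InrI)
      let ?e' = "case_sum ?eL (\<lambda>z. ?i (gen PN z))"
      have e'_cl: "?e' z \<in> carrier ?K" if "z \<in> cols PL <+> cols PN" for z
        using that eL_K presentsD(1)[OF PN] by auto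
      have "lincomb D ?K (cols PL <+> cols PN) (case_sum (ent PL r) (\<gamma> r)) ?e' =
          lincomb D (E0 E) (cols PL <+> cols PN) (case_sum (ent PL r) (\<gamma> r)) ?e'"
        using lincomb_hom[OF filt.inc_hom lower.G.left_module_axioms filt.G.left_module_axioms v2 e'_cl] by simp
      also have "\<dots> = \<zero>\<^bsub>E0 E\<^esub>"
        unfolding zero[symmetric] using v2 e_cl eN'
        by (intro E.lincomb_cong) (auto simp: InlI InrI simp flip: eN')
      finally show "lincomb D ?K (cols PL) (ent PL r) ?eL \<oplus>\<^bsub>?K\<^esub>
          ?i (lincomb D N (cols PN) (\<gamma> r) (gen PN)) = \<zero>\<^bsub>?K\<^esub>"
        using eL_K v2 by (subst (asm) lower.lincomb_block[OF PN]) (simp_all add: lower_ses_mid)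
    qed (use eL eL_K in simp_all)
    note PK = lower_presents[OF PL PN lift_L]
    have "ses_lift D ?K PM (lower_presentation D PL PN E \<gamma> ?eL) (filtration_ses E)
        (\<lambda>r. case_sum (\<beta> r) (\<eta> r)) (\<lambda>x. e (Inl x))"
      using P eM eN' by (subst filt.block_presents_iff[OF PM PK, symmetric])
        (auto simp: lower_presentation_def block_presentation_def)
    then show "\<exists>eL eM. ext2_lift D N PM PL PN E \<beta> \<gamma> \<eta> eL eM"
      using lift_L by (auto simp: ext2_lift_def)
  }
qed

lemma ex_ext2_lift:
  assumes PM: "presents D M PM" and PL: "presents D L PL" and PN: "presents D N PN"
  shows "\<exists>\<beta> \<gamma> \<eta> eL eM. ext2_lift D N PM PL PN E \<beta> \<gamma> \<eta> eL eM"
proof -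
  obtain \<gamma> eL where eL: "ses_lift D N PL PN (lower_ses E) \<gamma> eL"
    using lower.ex_ses_lift[OF PL PN] by blast
  obtain \<zeta> eM where eM: "ses_lift D (mid (lower_ses E)) PM (lower_presentation D PL PN E \<gamma> eL) (filtration_ses E) \<zeta> eM"
    using filt.ex_ses_lift[OF PM lower_presents[OF PL PN eL]] by blast
  have "(\<lambda>r. case_sum (\<lambda>y. \<zeta> r (Inl y)) (\<lambda>z. \<zeta> r (Inr z))) = \<zeta>"
    by (auto simp: fun_eq_iff split: sum.split)
  then have "ext2_lift D N PM PL PN E (\<lambda>r y. \<zeta> r (Inl y)) \<gamma> (\<lambda>r z. \<zeta> r (Inr z)) eL eM"
    using eL eM by (simp add: ext2_lift_def)
  then show ?thesis by blast
qed

end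

section \<open>The action on 2-extension modules in terms of cocycles\<close>

text \<open>This connects addition of cocycles with addition of matrices. Pairing the lifts to E and
  to S gives lifts to the fibre product over M, where both row relations hold at once; their images
  in F are lifts with upper right block h + k, while b and c are kept.\<close>

lemma ext2_lift_sum:
  assumes E: "ext2_cocycle D M L N E \<beta> \<gamma> \<eta>" and S: "has_cocycle D M N S \<sigma>"
    and F: "ext2_cocycle D M L N F \<beta> \<gamma> (\<lambda>d a a'. \<eta> d a a' \<oplus>\<^bsub>N\<^esub> \<sigma> d a a')"
    and PM: "presents D M PM" and PL: "presents D L PL" and PN: "presents D N PN"
    and lift_E: "ext2_lift D N PM PL PN E b c h eL eM" and lift_S: "ses_lift D N PM PN S k fM"
  shows "\<exists>eL' eM'. ext2_lift D N PM PL PN F b c (\<lambda>r z. h r z \<oplus>\<^bsub>D\<^esub> k r z) eL' eM'"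
proof -
  from E obtain t where "two_ext D M L N E" and t: "ses_section D L N (lower_ses E) t \<gamma>"
    and \<kappa>: "has_cocycle D M (mid (lower_ses E)) (filtration_ses E)
        (\<lambda>d a a'. t (\<beta> d a a') \<oplus>\<^bsub>mid (lower_ses E)\<^esub> inc (lower_ses E) (\<eta> d a a'))"
    and \<beta> [rule_format, simp]: "\<forall>d\<in>carrier D. \<forall>a\<in>carrier M. \<forall>a'\<in>carrier M. \<beta> d a a' \<in> carrier L"
    and \<eta> [rule_format, simp]: "\<forall>d\<in>carrier D. \<forall>a\<in>carrier M. \<forall>a'\<in>carrier M. \<eta> d a a' \<in> carrier N"
    by (rule ext2_cocycleE)
  from F obtain t' where "two_ext D M L N F" and t': "ses_section D L N (lower_ses F) t' \<gamma>"
    and \<kappa>': "has_cocycle D M (mid (lower_ses F)) (filtration_ses F)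
        (\<lambda>d a a'. t' (\<beta> d a a') \<oplus>\<^bsub>mid (lower_ses F)\<^esub> inc (lower_ses F) (\<eta> d a a' \<oplus>\<^bsub>N\<^esub> \<sigma> d a a'))"
    by (rule ext2_cocycleE)
  interpret E: two_ext D M L N E by fact
  interpret F: two_ext D M L N F by fact
  interpret S: exact_seq D M N S by unfold_locales (use S in \<open>rule has_cocycle_exact\<close>)
  let ?KE = "mid (lower_ses E)" and ?KF = "mid (lower_ses F)"
    and ?iE = "inc (lower_ses E)" and ?iF = "inc (lower_ses F)"
  obtain sE where sE: "ses_section D M ?KE (filtration_ses E) sE (\<lambda>d a a'. t (\<beta> d a a') \<oplus>\<^bsub>?KE\<^esub> ?iE (\<eta> d a a'))"
    using \<kappa> by (auto simp: has_cocycle_def)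
  obtain sF where sF: "ses_section D M ?KF (filtration_ses F) sF
      (\<lambda>d a a'. t' (\<beta> d a a') \<oplus>\<^bsub>?KF\<^esub> ?iF (\<eta> d a a' \<oplus>\<^bsub>N\<^esub> \<sigma> d a a'))"
    using \<kappa>' by (auto simp: has_cocycle_def)
  obtain sS where sS: "ses_section D M N S sS \<sigma>" using S by (auto simp: has_cocycle_def)
  note [simp] = ses_sectionD[OF t] ses_sectionD[OF t'] has_cocycle_closed[OF S]
  \<comment> \<open>The first filtration submodules of E and F share the cocycle \<gamma>, hence a
    morphism between them over the identities of L and N.\<close>
  obtain \<theta> where \<theta>: "\<theta> \<in> mod_hom D ?KE ?KF"
    and \<theta>N: "\<And>n. n \<in> carrier N \<Longrightarrow> \<theta> (?iE n) = ?iF n"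
    and \<theta>L: "\<And>x. x \<in> carrier ?KE \<Longrightarrow> prj (lower_ses F) (\<theta> x) = prj (lower_ses E) x"
    and \<theta>t: "\<And>l. l \<in> carrier L \<Longrightarrow> \<theta> (t l) = t' l"
    by (rule ses_map[OF E.short_exact_lower F.short_exact_lower t t' mod_hom_id mod_hom_id]) auto
  note \<theta>_simps [simp] = mod_hom_closed[OF \<theta>] mod_hom_add[OF \<theta>] mod_hom_axpy[OF \<theta> E.lower.G.left_module_axioms]
  let ?F = "fibre_ses (filtration_ses E) S" and ?\<psi> = "\<lambda>(x, n). \<theta> x \<oplus>\<^bsub>?KF\<^esub> ?iF n"
  note fib = fibre_ses[OF E.short_exact_filtration S.exact sE sS]
  interpret P: exact_seq D M "prod_mod ?KE N" ?F by unfold_locales (rule fib)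
  have \<psi>: "?\<psi> \<in> mod_hom D (prod_mod ?KE N) ?KF"
    using P.B.left_module_axioms F.lower.G.left_module_axioms
    by (intro mod_homI) (auto simp: F.lower.G.axpy_add)
  \<comment> \<open>\<open>E\<close> plus \<open>S\<close> maps to \<open>F\<close>: this is the Baer sum of \<open>S\<close> with the sequence \<open>M \<leftarrow> E \<leftarrow> E1\<close>,
    pushed out along \<open>E1 \<oplus> N \<rightarrow> E1\<close>.\<close>
  obtain \<alpha> where \<alpha>: "\<alpha> \<in> mod_hom D (mid ?F) (mid (filtration_ses F))"
    and \<alpha>K: "\<And>p. p \<in> carrier (prod_mod ?KE N) \<Longrightarrow> \<alpha> (inc ?F p) = inc (filtration_ses F) (?\<psi> p)"
    and \<alpha>M: "\<And>x. x \<in> carrier (mid ?F) \<Longrightarrow> prj (filtration_ses F) (\<alpha> x) = prj ?F x"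
    by (rule ses_map[OF fib(1) F.short_exact_filtration fib(2) sF mod_hom_id \<psi>])
       (auto simp: \<theta>N \<theta>t F.lower.G.M.a_assoc)
  from lift_E have eL: "ses_lift D N PL PN (lower_ses E) c eL"
    and eM: "ses_lift D ?KE PM (lower_presentation D PL PN E c eL) (filtration_ses E) (\<lambda>r. case_sum (b r) (h r)) eM"
    by (auto simp: ext2_lift_def)
  note eL_D = ses_liftD[OF eL] and fM_D = ses_liftD[OF lift_S] and eM_D = ses_liftD[OF eM]
  define eL' where "eL' = (\<lambda>y. \<theta> (eL y))"
  define eM' where "eM' = (\<lambda>x. \<alpha> (eM x, fM x))"
  have \<theta>_lincomb: "\<theta> (lincomb D ?KE (cols PL) a eL) = lincomb D ?KF (cols PL) a eL'"
    if "a \<in> row_vectors D (cols PL)" for a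
    unfolding eL'_def using \<theta> E.lower.G.left_module_axioms F.lower.G.left_module_axioms that eL_D(1)
    by (rule lincomb_hom)
  have lift_L: "ses_lift D N PL PN (lower_ses F) c eL'"
    unfolding ses_lift_def
  proof (intro conjI ballI)
    fix r assume r: "r \<in> rows PL"
    have "lincomb D ?KF (cols PL) (ent PL r) eL' \<oplus>\<^bsub>?KF\<^esub> ?iF (lincomb D N (cols PN) (c r) (gen PN)) =
        \<theta> (lincomb D ?KE (cols PL) (ent PL r) eL \<oplus>\<^bsub>?KE\<^esub> ?iE (lincomb D N (cols PN) (c r) (gen PN)))"
      using r presentsD(2)[OF PL] presentsD(1)[OF PN] eL_D(1,3) by (simp add: \<theta>_lincomb \<theta>N)
    then show "lincomb D ?KF (cols PL) (ent PL r) eL' \<oplus>\<^bsub>?KF\<^esub> ?iF (lincomb D N (cols PN) (c r) (gen PN)) = \<zero>\<^bsub>?KF\<^esub>"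
      using eL_D(4)[OF r] mod_hom_zero[OF \<theta> E.lower.G.left_module_axioms F.lower.G.left_module_axioms] by simp
  qed (use eL_D \<theta>L in \<open>simp_all add: eL'_def\<close>)
  have P_carrier: "(x, y) \<in> carrier (mid ?F) \<longleftrightarrow> x \<in> carrier (E0 E) \<and> y \<in> carrier (mid S) \<and> prj (filtration_ses E) x = prj S y"
    for x y by (simp add: fibre_ses_def)
  have eMf: "(eM x, fM x) \<in> carrier (mid ?F)" if "x \<in> cols PM" for x
    using that eM_D(1,2) fM_D(1,2) by (simp add: P_carrier)
  have fst: "fst \<in> mod_hom D (mid ?F) (E0 E)" and snd: "snd \<in> mod_hom D (mid ?F) (mid S)"
    by (auto simp: mod_hom_def fibre_ses_def)
  let ?cols = "cols PL <+> cols PN"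
  have lift_M: "ses_lift D ?KF PM (lower_presentation D PL PN F c eL') (filtration_ses F)
      (\<lambda>r. case_sum (b r) (\<lambda>z. h r z \<oplus>\<^bsub>D\<^esub> k r z)) eM'"
    unfolding ses_lift_def
  proof (intro conjI ballI)
    fix r assume r: "r \<in> rows PM"
    have "case_sum (b r) (h r) \<in> row_vectors D ?cols"
      using eM_D(3)[OF r] by (simp add: lower_presentation_def block_presentation_def)
    then have br: "b r \<in> row_vectors D (cols PL)" and hr: "h r \<in> row_vectors D (cols PN)"
      by (simp_all add: row_vectors_Plus)
    note bh = \<open>case_sum (b r) (h r) \<in> row_vectors D ?cols\<close> and kr = fM_D(3)[OF r]
    have hk: "(\<lambda>z. h r z \<oplus>\<^bsub>D\<^esub> k r z) \<in> row_vectors D (cols PN)"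
      using hr kr by (rule E.filt.A.row_vectors_add)
    then have bhk: "case_sum (b r) (\<lambda>z. h r z \<oplus>\<^bsub>D\<^esub> k r z) \<in> row_vectors D ?cols"
      using br by (simp add: row_vectors_Plus)
    then show "case_sum (b r) (\<lambda>z. h r z \<oplus>\<^bsub>D\<^esub> k r z) \<in> row_vectors D (cols (lower_presentation D PL PN F c eL'))"
      by (simp add: lower_presentation_def block_presentation_def)
    let ?n = "\<lambda>v. lincomb D N (cols PN) v (gen PN)"
    have n_cl: "?n v \<in> carrier N" if "v \<in> row_vectors D (cols PN)" for v
      using that presentsD(1)[OF PN] by simp
    \<comment> \<open>The E1-part of the row relation in E, and its counterpart in F. The latter is
      the former carried over by \<theta>, plus the contribution of k in N.\<close>
    let ?kE = "lincomb D ?KE ?cols (case_sum (b r) (h r)) (case_sum eL (\<lambda>z. ?iE (gen PN z)))"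
    let ?kF = "lincomb D ?KF ?cols (case_sum (b r) (\<lambda>z. h r z \<oplus>\<^bsub>D\<^esub> k r z)) (case_sum eL' (\<lambda>z. ?iF (gen PN z)))"
    have kE: "?kE = lincomb D ?KE (cols PL) (b r) eL \<oplus>\<^bsub>?KE\<^esub> ?iE (?n (h r))"
      using eL_D(1) bh by (subst E.lower.lincomb_block[OF PN]) simp_all
    have l_cl: "lincomb D ?KE (cols PL) (b r) eL \<in> carrier ?KE" using br eL_D(1) by simp
    have "?kF = lincomb D ?KF (cols PL) (b r) eL' \<oplus>\<^bsub>?KF\<^esub> ?iF (?n (\<lambda>z. h r z \<oplus>\<^bsub>D\<^esub> k r z))"
      using eL_D(1) bhk by (subst F.lower.lincomb_block[OF PN]) (simp_all add: eL'_def)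
    also have "?n (\<lambda>z. h r z \<oplus>\<^bsub>D\<^esub> k r z) = ?n (h r) \<oplus>\<^bsub>N\<^esub> ?n (k r)"
      using hr kr presentsD(1)[OF PN] by (rule E.lower.B.lincomb_add)
    also have "lincomb D ?KF (cols PL) (b r) eL' = \<theta> (lincomb D ?KE (cols PL) (b r) eL)"
      using \<theta>_lincomb[OF br] by simp
    finally have kF: "?kF = ?\<psi> (?kE, ?n (k r))"
      using l_cl hr kr n_cl by (simp add: kE \<theta>N F.lower.G.M.a_assoc)
    have kE_cl: "?kE \<in> carrier ?KE" using l_cl hr n_cl by (simp add: kE)
    let ?l = "lincomb D (mid ?F) (cols PM) (ent PM r) (\<lambda>x. (eM x, fM x))"
    note row = presentsD(2)[OF PM r]
    have "fst ?l = lincomb D (E0 E) (cols PM) (ent PM r) (\<lambda>x. fst (eM x, fM x))"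
      using fst P.G.left_module_axioms E.E.left_module_axioms row eMf by (rule lincomb_hom)
    moreover have "snd ?l = lincomb D (mid S) (cols PM) (ent PM r) (\<lambda>x. snd (eM x, fM x))"
      using snd P.G.left_module_axioms S.G.left_module_axioms row eMf by (rule lincomb_hom)
    ultimately have l: "?l = (lincomb D (E0 E) (cols PM) (ent PM r) eM, lincomb D (mid S) (cols PM) (ent PM r) fM)"
      by (simp add: prod_eq_iff)
    have inc: "inc ?F (?kE, ?n (k r)) = (?kE, inc S (?n (k r)))" by (simp add: fibre_ses_def)
    have l_P: "?l \<in> carrier (mid ?F)" using row eMf by simp
    have inc_P: "inc ?F (?kE, ?n (k r)) \<in> carrier (mid ?F)" using kE_cl kr n_cl by simp
    have "lincomb D (E0 F) (cols PM) (ent PM r) eM' \<oplus>\<^bsub>E0 F\<^esub> ?kF = \<alpha> ?l \<oplus>\<^bsub>E0 F\<^esub> \<alpha> (inc ?F (?kE, ?n (k r)))"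
      using lincomb_hom[OF \<alpha> P.G.left_module_axioms F.filt.G.left_module_axioms row eMf]
        \<alpha>K[of "(?kE, ?n (k r))"] kE_cl kr n_cl by (simp add: kF eM'_def)
    also have "\<dots> = \<alpha> (?l \<oplus>\<^bsub>mid ?F\<^esub> inc ?F (?kE, ?n (k r)))"
      using mod_hom_add[OF \<alpha> l_P inc_P] by simp
    also have "?l \<oplus>\<^bsub>mid ?F\<^esub> inc ?F (?kE, ?n (k r)) = \<zero>\<^bsub>mid ?F\<^esub>"
    proof -
      have "lincomb D (E0 E) (cols PM) (ent PM r) eM \<oplus>\<^bsub>E0 E\<^esub> ?kE = \<zero>\<^bsub>E0 E\<^esub>"
        using eM_D(4)[OF r] by (simp add: lower_presentation_def block_presentation_def)
      moreover have "(p \<oplus>\<^bsub>mid ?F\<^esub> q) = (fst p \<oplus>\<^bsub>E0 E\<^esub> fst q, snd p \<oplus>\<^bsub>mid S\<^esub> snd q)" for p q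
        by (simp add: fibre_ses_def prod_mod_def)
      moreover have "\<zero>\<^bsub>mid ?F\<^esub> = (\<zero>\<^bsub>E0 E\<^esub>, \<zero>\<^bsub>mid S\<^esub>)" by (simp add: fibre_ses_def)
      ultimately show ?thesis using fM_D(4)[OF r] unfolding l inc by simp
    qed
    also have "\<alpha> \<zero>\<^bsub>mid ?F\<^esub> = \<zero>\<^bsub>E0 F\<^esub>"
      using mod_hom_zero[OF \<alpha> P.G.left_module_axioms F.filt.G.left_module_axioms] by simp
    finally show "lincomb D (mid (filtration_ses F)) (cols PM) (ent PM r) eM' \<oplus>\<^bsub>mid (filtration_ses F)\<^esub>
        inc (filtration_ses F) (lincomb D ?KF (cols (lower_presentation D PL PN F c eL'))
          (case_sum (b r) (\<lambda>z. h r z \<oplus>\<^bsub>D\<^esub> k r z)) (gen (lower_presentation D PL PN F c eL'))) =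
        \<zero>\<^bsub>mid (filtration_ses F)\<^esub>"
      by (simp add: lower_presentation_def block_presentation_def)
  next
    fix x assume x: "x \<in> cols PM"
    show "eM' x \<in> carrier (mid (filtration_ses F))"
      unfolding eM'_def using \<alpha> eMf[OF x] by (rule mod_hom_closed)
    show "prj (filtration_ses F) (eM' x) = gen PM x"
      using \<alpha>M[OF eMf[OF x]] eM_D(2)[OF x] by (simp add: eM'_def fibre_ses_def)
  qed
  from lift_L lift_M show ?thesis by (auto simp: ext2_lift_def)
qed

text \<open>Equal matrices mean that the lifted generators of F satisfy the relations of E, so the
  universal property gives a homomorphism f. Its compatibility with the subfactors is checked on
  generators, and \<open>ext2_equivI\<close> turns it into an equivalence.\<close>

lemma ext2_equiv_of_lifts:
  assumes E: "two_extension D M L N E" and F: "two_extension D M L N F"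
    and PM: "presents D M PM" and PL: "presents D L PL" and PN: "presents D N PN"
    and lift_E: "ext2_lift D N PM PL PN E b c h eL eM" and lift_F: "ext2_lift D N PM PL PN F b c h eL' eM'"
  shows "ext2_equiv D E F"
proof -
  interpret E: two_ext D M L N E using E by (rule two_extI)
  interpret F: two_ext D M L N F using F by (rule two_extI)
  let ?KE = "mid (lower_ses E)" and ?KF = "mid (lower_ses F)"
    and ?iE = "inc (lower_ses E)" and ?iF = "inc (lower_ses F)"
  let ?PE = "lower_presentation D PL PN E c eL" and ?PF = "lower_presentation D PL PN F c eL'"
  let ?\<zeta> = "\<lambda>r. case_sum (b r) (h r)"
  from lift_E have eL: "ses_lift D N PL PN (lower_ses E) c eL"
    and eM: "ses_lift D ?KE PM ?PE (filtration_ses E) ?\<zeta> eM" by (auto simp: ext2_lift_def)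
  from lift_F have eL': "ses_lift D N PL PN (lower_ses F) c eL'"
    and eM': "ses_lift D ?KF PM ?PF (filtration_ses F) ?\<zeta> eM'" by (auto simp: ext2_lift_def)
  note PE = E.lower_presents[OF PL PN eL] and PF = F.lower_presents[OF PL PN eL']
  let ?e = "case_sum eM (gen ?PE)" and ?e' = "case_sum eM' (gen ?PF)"
  have P: "presents D (E0 E) (block_presentation D PM ?PE ?\<zeta> ?e)"
    using E.filt.block_presents_iff[OF PM PE, of ?e ?\<zeta>] eM by simp
  have P': "presents D (E0 F) (block_presentation D PM ?PF ?\<zeta> ?e')"
    using F.filt.block_presents_iff[OF PM PF, of ?e' ?\<zeta>] eM' by simp
  have same: "cols (block_presentation D PM ?PF ?\<zeta> ?e') = cols (block_presentation D PM ?PE ?\<zeta> ?e)"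
    "rows (block_presentation D PM ?PF ?\<zeta> ?e') = rows (block_presentation D PM ?PE ?\<zeta> ?e)"
    "ent (block_presentation D PM ?PF ?\<zeta> ?e') = ent (block_presentation D PM ?PE ?\<zeta> ?e)"
    "gen (block_presentation D PM ?PF ?\<zeta> ?e') = ?e'" "gen (block_presentation D PM ?PE ?\<zeta> ?e) = ?e"
    "cols (block_presentation D PM ?PE ?\<zeta> ?e) = cols PM <+> (cols PL <+> cols PN)"
    by (simp_all add: block_presentation_def lower_presentation_def)
  obtain f where f: "f \<in> mod_hom D (E0 E) (E0 F)"
    and f_gen: "\<And>x. x \<in> cols PM <+> (cols PL <+> cols PN) \<Longrightarrow> f (?e x) = ?e' x"
    using presents_universal[OF P E.E.left_module_axioms F.E.left_module_axioms, of ?e']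
      presentsD(1)[OF P'] presents_row[OF P' F.E.left_module_axioms]
    by (auto simp: same)
  have PE_gen: "gen ?PE y \<in> carrier ?KE" "gen ?PF y \<in> carrier ?KF" if "y \<in> cols PL <+> cols PN" for y
    using presentsD(1)[OF PE, of y] presentsD(1)[OF PF, of y] that
    by (simp_all add: block_presentation_def lower_presentation_def)
  have fM: "prj (filtration_ses F) (f x) = prj (filtration_ses E) x" if x: "x \<in> carrier (E0 E)" for x
  proof (rule presents_hom_eq[OF P E.E.left_module_axioms E.modules(1) _ _ _ x])
    show "(\<lambda>x. prj (filtration_ses F) (f x)) \<in> mod_hom D (E0 E) M"
      using f F.filt.prj_hom[unfolded filtration_ses_simps] by (rule mod_hom_compose)
    show "prj (filtration_ses E) \<in> mod_hom D (E0 E) M" using E.filt.prj_hom by simp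
    fix z assume "z \<in> cols (block_presentation D PM ?PE ?\<zeta> ?e)"
    then have z: "z \<in> cols PM <+> (cols PL <+> cols PN)" by (simp add: same)
    have "prj (filtration_ses F) (?e' z) = prj (filtration_ses E) (?e z)"
      using z
    proof (rule PlusE)
      fix y assume "z = Inr y" "y \<in> cols PL <+> cols PN"
      then show ?thesis
        using PE_gen[of y] E.filt.prj_inc[of "gen ?PE y"] F.filt.prj_inc[of "gen ?PF y"] by simp
    qed (use ses_liftD(2)[OF eM] ses_liftD(2)[OF eM'] in simp)
    then show "prj (filtration_ses F) (f (gen (block_presentation D PM ?PE ?\<zeta> ?e) z)) =
        prj (filtration_ses E) (gen (block_presentation D PM ?PE ?\<zeta> ?e) z)"
      using f_gen[OF z] by (simp add: same)
  qed
  have f1: "f x \<in> carrier ?KF" if x: "x \<in> carrier ?KE" for x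
  proof -
    have x0: "x \<in> carrier (E0 E)" using E.filt.inc_closed[OF x] by simp
    have "prj (filtration_ses F) (f x) = \<zeta>" if "\<zeta> = \<zero>\<^bsub>M\<^esub>" for \<zeta>
      using fM[OF x0] E.filt.prj_inc[OF x] that by simp
    moreover have "f x \<in> carrier (mid (filtration_ses F))" using mod_hom_closed[OF f x0] by simp
    ultimately obtain y where "y \<in> carrier ?KF" "f x = inc (filtration_ses F) y"
      by (blast elim: F.filt.kernelE)
    then show ?thesis by simp
  qed
  have fK: "f \<in> mod_hom D ?KE ?KF"
    using f f1 E.E1_carrier by (auto simp: mod_hom_def lower_ses_def)
  have f_iE: "f (?iE n) = ?iF n" if n: "n \<in> carrier N" for n
  proof (rule presents_hom_eq[OF PN E.modules(3) F.lower.G.left_module_axioms _ F.lower.inc_hom _ n])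
    show "(\<lambda>n. f (?iE n)) \<in> mod_hom D N ?KF" using E.lower.inc_hom fK by (rule mod_hom_compose)
    show "f (?iE (gen PN z)) = ?iF (gen PN z)" if "z \<in> cols PN" for z
      using f_gen[of "Inr (Inr z)"] that by (simp add: lower_presentation_def block_presentation_def InrI)
  qed
  have fL: "prj (lower_ses F) (f x) = prj (lower_ses E) x" if x: "x \<in> carrier ?KE" for x
  proof (rule presents_hom_eq[OF PE E.lower.G.left_module_axioms E.modules(2) _ E.lower.prj_hom _ x])
    show "(\<lambda>x. prj (lower_ses F) (f x)) \<in> mod_hom D ?KE L" using fK F.lower.prj_hom by (rule mod_hom_compose)
    fix z assume "z \<in> cols ?PE"
    then have z: "z \<in> cols PL <+> cols PN" by (simp add: lower_presentation_def block_presentation_def)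
    then have "f (gen ?PE z) = gen ?PF z" using f_gen[of "Inr z"] by (simp add: InrI)
    moreover have "prj (lower_ses F) (gen ?PF z) = prj (lower_ses E) (gen ?PE z)"
      using z ses_liftD(2)[OF eL] ses_liftD(2)[OF eL'] presentsD(1)[OF PN]
      by (auto simp: lower_presentation_def block_presentation_def)
    ultimately show "prj (lower_ses F) (f (gen ?PE z)) = prj (lower_ses E) (gen ?PE z)" by simp
  qed
  show ?thesis
    using E F f fM fL f_iE by (rule ext2_equivI) (simp_all add: lower_ses_mid)
qed

text \<open>Independence of all choices in \<open>ExtMod_act\<close>: whatever matrices occur,
  \<open>ext2_lift_sum\<close> gives their sum to a fixed member F0 of the class on the right, and
  equal matrices force equivalence with F0. Conversely, matrices of E and S exist, and the same
  lemma gives their sum to F.\<close>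

lemma ExtMod_act_class:
  fixes M :: "('d, 'm) module" and L :: "('d, 'l) module" and N :: "('d, 'n) module"
  assumes PM: "presents D M PM" and PL: "presents D L PL" and PN: "presents D N PN"
    and E: "ext2_cocycle_class D M L N \<beta> \<gamma> \<eta> \<noteq> {}" and \<sigma>: "cocycle D M N \<sigma>"
    and sum: "ext2_cocycle_class D M L N \<beta> \<gamma> (\<lambda>d a a'. \<eta> d a a' \<oplus>\<^bsub>N\<^esub> \<sigma> d a a') \<noteq> {}"
  shows "ExtMod_act D M L N PM PL PN (cocycle_class D M N \<sigma>) (ext2_cocycle_class D M L N \<beta> \<gamma> \<eta>) =
    ext2_cocycle_class D M L N \<beta> \<gamma> (\<lambda>d a a'. \<eta> d a a' \<oplus>\<^bsub>N\<^esub> \<sigma> d a a')"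
proof (intro equalityI subsetI)
  let ?sum = "\<lambda>d a a'. \<eta> d a a' \<oplus>\<^bsub>N\<^esub> \<sigma> d a a'"
  fix F assume "F \<in> ExtMod_act D M L N PM PL PN (cocycle_class D M N \<sigma>) (ext2_cocycle_class D M L N \<beta> \<gamma> \<eta>)"
  then obtain E :: "('d, 'm, 'l, 'n, 'm \<times> 'l \<times> 'n) ext2" and S :: "('d, 'm, 'n, 'm \<times> 'n) ses"
    and b c h k where F: "two_extension D M L N F" and E: "ext2_cocycle D M L N E \<beta> \<gamma> \<eta>"
    and S: "has_cocycle D M N S \<sigma>" and pE: "ext2_presented D PM PL PN E b c h"
    and pS: "ses_presented D PM PN S k"
    and pF: "ext2_presented D PM PL PN F b c (\<lambda>r z. h r z \<oplus>\<^bsub>D\<^esub> k r z)"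
    unfolding ExtMod_act_def ext2_cocycle_class_def cocycle_class_def by blast
  interpret E: two_ext D M L N E using E by (auto simp: ext2_cocycle_def two_ext_def)
  interpret F: two_ext D M L N F using F by (rule two_extI)
  obtain F0 where F0: "ext2_cocycle D M L N F0 \<beta> \<gamma> ?sum" "F0 \<in> ext2_cocycle_class D M L N \<beta> \<gamma> ?sum"
    using sum by (auto simp: ext2_cocycle_class_def)
  then have F0_ext: "two_extension D M L N F0" by (simp add: ext2_cocycle_def)
  obtain eL eM where "ext2_lift D N PM PL PN E b c h eL eM" using pE E.ext2_presented_iff[OF PM PL PN] by blast
  moreover obtain fM where "ses_lift D N PM PN S k fM"
    using pS ses_presented_iff[OF has_cocycle_exact[OF S] PM PN] by blast
  ultimately obtain eL' eM' where "ext2_lift D N PM PL PN F0 b c (\<lambda>r z. h r z \<oplus>\<^bsub>D\<^esub> k r z) eL' eM'"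
    using ext2_lift_sum[OF E S F0(1) PM PL PN] by blast
  moreover obtain eL'' eM'' where "ext2_lift D N PM PL PN F b c (\<lambda>r z. h r z \<oplus>\<^bsub>D\<^esub> k r z) eL'' eM''"
    using pF F.ext2_presented_iff[OF PM PL PN] by blast
  ultimately have "ext2_equiv D F0 F" using ext2_equiv_of_lifts[OF F0_ext F PM PL PN] by blast
  then show "F \<in> ext2_cocycle_class D M L N \<beta> \<gamma> ?sum"
    using ext2_equiv_iff_cocycle[OF F0(1) F] by (simp add: ext2_cocycle_class_def)
next
  let ?sum = "\<lambda>d a a'. \<eta> d a a' \<oplus>\<^bsub>N\<^esub> \<sigma> d a a'"
  fix F assume "F \<in> ext2_cocycle_class D M L N \<beta> \<gamma> ?sum"
  then have F: "ext2_cocycle D M L N F \<beta> \<gamma> ?sum" by (simp add: ext2_cocycle_class_def)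
  obtain E where E: "E \<in> ext2_cocycle_class D M L N \<beta> \<gamma> \<eta>" using E by blast
  then have E': "ext2_cocycle D M L N E \<beta> \<gamma> \<eta>" by (simp add: ext2_cocycle_class_def)
  from \<sigma> obtain S :: "('d, 'm, 'n, 'm \<times> 'n) ses" where S: "has_cocycle D M N S \<sigma>" by (rule cocycleE)
  interpret E: two_ext D M L N E using E' by (auto simp: ext2_cocycle_def two_ext_def)
  interpret F: two_ext D M L N F using F by (auto simp: ext2_cocycle_def two_ext_def)
  interpret S: exact_seq D M N S by unfold_locales (use S in \<open>rule has_cocycle_exact\<close>)
  obtain b c h eL eM where lift_E: "ext2_lift D N PM PL PN E b c h eL eM"
    using E.ex_ext2_lift[OF PM PL PN] by blast
  obtain k fM where lift_S: "ses_lift D N PM PN S k fM" using S.ex_ses_lift[OF PM PN] by blast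
  have "ext2_presented D PM PL PN F b c (\<lambda>r z. h r z \<oplus>\<^bsub>D\<^esub> k r z)"
    using ext2_lift_sum[OF E' S F PM PL PN lift_E lift_S] F.ext2_presented_iff[OF PM PL PN] by blast
  moreover have "ext2_presented D PM PL PN E b c h" using lift_E E.ext2_presented_iff[OF PM PL PN] by blast
  moreover have "ses_presented D PM PN S k" using lift_S ses_presented_iff[OF S.exact PM PN] by blast
  moreover have "S \<in> cocycle_class D M N \<sigma>" using S by (simp add: cocycle_class_def)
  ultimately show "F \<in> ExtMod_act D M L N PM PL PN (cocycle_class D M N \<sigma>) (ext2_cocycle_class D M L N \<beta> \<gamma> \<eta>)"
    using E F.two_extension unfolding ExtMod_act_def by blast
qed

section \<open>Transitive actions with a common stabilizer\<close>

text \<open>Only values on \<open>X\<close> are constrained, since the actions concerned are not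
  extensional functions as \<open>BijGroup\<close> requires. One K serves for all points, as it must
  for a transitive action of a commutative group.\<close>

definition transitive_with_stabilizer ::
  "('g, 'z) monoid_scheme \<Rightarrow> 'x set \<Rightarrow> ('g \<Rightarrow> 'x \<Rightarrow> 'x) \<Rightarrow> 'g set \<Rightarrow> bool"
  where "transitive_with_stabilizer G X \<phi> K \<longleftrightarrow> X \<noteq> {} \<and> K \<subseteq> carrier G \<and>
    (\<forall>g\<in>carrier G. \<forall>x\<in>X. \<phi> g x \<in> X) \<and> (\<forall>x\<in>X. \<phi> \<one>\<^bsub>G\<^esub> x = x) \<and>
    (\<forall>g\<in>carrier G. \<forall>h\<in>carrier G. \<forall>x\<in>X. \<phi> (g \<otimes>\<^bsub>G\<^esub> h) x = \<phi> g (\<phi> h x)) \<and>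
    (\<forall>x\<in>X. \<forall>y\<in>X. \<exists>g\<in>carrier G. \<phi> g x = y) \<and>
    (\<forall>g\<in>carrier G. \<forall>x\<in>X. \<phi> g x = x \<longleftrightarrow> g \<in> K)"

locale transitive_set = comm_group G for G (structure) +
  fixes X :: "'x set" and \<phi> :: "'a \<Rightarrow> 'x \<Rightarrow> 'x" and K :: "'a set"
  assumes transitive: "transitive_with_stabilizer G X \<phi> K"
begin

lemma ne: "X \<noteq> {}" and K_carrier: "K \<subseteq> carrier G"
  and act_closed [simp]: "\<lbrakk>g \<in> carrier G; x \<in> X\<rbrakk> \<Longrightarrow> \<phi> g x \<in> X"
  and act_one [simp]: "x \<in> X \<Longrightarrow> \<phi> \<one> x = x"
  and act_mult: "\<lbrakk>g \<in> carrier G; h \<in> carrier G; x \<in> X\<rbrakk> \<Longrightarrow> \<phi> (g \<otimes> h) x = \<phi> g (\<phi> h x)"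
  and act_transitive: "\<lbrakk>x \<in> X; y \<in> X\<rbrakk> \<Longrightarrow> \<exists>g\<in>carrier G. \<phi> g x = y"
  and act_fixed_iff: "\<lbrakk>g \<in> carrier G; x \<in> X\<rbrakk> \<Longrightarrow> \<phi> g x = x \<longleftrightarrow> g \<in> K"
  using transitive by (auto simp: transitive_with_stabilizer_def)

lemma K_in [simp]: "g \<in> K \<Longrightarrow> g \<in> carrier G"
  using K_carrier by blast

lemma act_inv: "\<lbrakk>g \<in> carrier G; x \<in> X\<rbrakk> \<Longrightarrow> \<phi> (inv g) (\<phi> g x) = x"
  by (simp flip: act_mult)

lemma act_eq_iff:
  assumes "g \<in> carrier G" "h \<in> carrier G" "x \<in> X"
  shows "\<phi> g x = \<phi> h x \<longleftrightarrow> inv h \<otimes> g \<in> K"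
proof -
  have "\<phi> g x = \<phi> h x \<longleftrightarrow> \<phi> (inv h) (\<phi> g x) = x"
  proof
    assume "\<phi> (inv h) (\<phi> g x) = x"
    then have "\<phi> h (\<phi> (inv h) (\<phi> g x)) = \<phi> h x" by simp
    then show "\<phi> g x = \<phi> h x" using assms by (simp flip: act_mult add: m_assoc[symmetric])
  qed (use assms in \<open>simp add: act_inv\<close>)
  then show ?thesis using assms act_fixed_iff[of "inv h \<otimes> g" x] by (simp add: act_mult)
qed

text \<open>Stabilizers are subgroups. Applied to the two fibres, this gives that
  \<open>Hom_ext\<close> and \<open>ext_Hom\<close> are subgroups without a computation with Yoneda
  products.\<close>

lemma subgroup_K: "subgroup K G"
proof (rule subgroupI)
  obtain x where x: "x \<in> X" using ne by blast
  show "K \<noteq> {}" using act_fixed_iff[of \<one> x] x by auto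
  show "inv g \<in> K" if "g \<in> K" for g
    using that x act_inv[of g x] act_fixed_iff[of g x] act_fixed_iff[of "inv g" x] by simp
  show "g \<otimes> h \<in> K" if "g \<in> K" "h \<in> K" for g h
    using that x act_fixed_iff[of g x] act_fixed_iff[of h x] act_fixed_iff[of "g \<otimes> h" x] by (simp add: act_mult)
qed (rule K_carrier)

lemma principal_homogeneous: "principal_homogeneous_space (G Mod K) X (quotient_action \<phi> X)"
proof -
  interpret normal K G using subgroup_K by (rule subgroup_imp_normal)
  let ?\<psi> = "quotient_action \<phi> X"
  \<comment> \<open>K also fixes the point \<phi> g x, so all elements of the coset act on x alike
    and \<open>the_elem\<close> picks their common value.\<close>
  have coset: "?\<psi> (K #> g) x = \<phi> g x" if "g \<in> carrier G" "x \<in> X" for g x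
  proof -
    have "(\<lambda>g. \<phi> g x) ` (K #> g) = {\<phi> g x}"
      using that act_fixed_iff[of _ "\<phi> g x"] one_closed
      by (auto simp: r_coset_def act_mult image_iff)
    then show ?thesis using that by (simp add: quotient_action_def)
  qed
  have carrier: "carrier (G Mod K) = (\<lambda>g. K #> g) ` carrier G"
    by (auto simp: FactGroup_def RCOSETS_def)
  have bij: "?\<psi> (K #> g) \<in> Bij X" if g: "g \<in> carrier G" for g
  proof -
    have "bij_betw (?\<psi> (K #> g)) X X"
      using g by (intro bij_betwI[of _ _ _ "\<phi> (inv g)"]) (auto simp: coset simp flip: act_mult)
    then show ?thesis by (simp add: Bij_def quotient_action_def)
  qed
  have "group_hom (G Mod K) (BijGroup X) ?\<psi>"
  proof (intro group_hom.intro group_hom_axioms.intro homI)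
    show "group (G Mod K)" by (rule factorgroup_is_group)
    show "group (BijGroup X)" by (rule group_BijGroup)
    show "?\<psi> C \<in> carrier (BijGroup X)" if "C \<in> carrier (G Mod K)" for C
      using that bij by (auto simp: carrier BijGroup_def)
    show "?\<psi> (C \<otimes>\<^bsub>G Mod K\<^esub> C') = ?\<psi> C \<otimes>\<^bsub>BijGroup X\<^esub> ?\<psi> C'"
      if "C \<in> carrier (G Mod K)" "C' \<in> carrier (G Mod K)" for C C'
    proof -
      obtain g h where gh: "g \<in> carrier G" "h \<in> carrier G" "C = K #> g" "C' = K #> h"
        using \<open>C \<in> carrier (G Mod K)\<close> \<open>C' \<in> carrier (G Mod K)\<close> by (auto simp: carrier)
      have "?\<psi> (K #> (g \<otimes> h)) = compose X (?\<psi> (K #> g)) (?\<psi> (K #> h))"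
      proof
        fix x
        show "?\<psi> (K #> (g \<otimes> h)) x = compose X (?\<psi> (K #> g)) (?\<psi> (K #> h)) x"
          using gh by (cases "x \<in> X") (simp_all add: coset compose_def act_mult, simp add: quotient_action_def)
      qed
      then show ?thesis
        using gh bij by (simp add: BijGroup_def FactGroup_def rcos_sum)
    qed
  qed
  then have act: "group_action (G Mod K) X ?\<psi>" by (simp add: group_action_def)
  have "transitive_action (G Mod K) X ?\<psi>"
  proof (rule transitive_action.intro[OF act], unfold_locales)
    fix x y assume xy: "x \<in> X" "y \<in> X"
    then obtain g where g: "g \<in> carrier G" "\<phi> g x = y" using act_transitive by blast
    then show "\<exists>C\<in>carrier (G Mod K). ?\<psi> C x = y"
      using xy by (intro bexI[of _ "K #> g"]) (auto simp: coset carrier)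
  qed
  moreover have "stabilizer (G Mod K) ?\<psi> x = {\<one>\<^bsub>G Mod K\<^esub>}" if x: "x \<in> X" for x
  proof -
    have K_one: "K = K #> \<one>" by (simp add: coset_mult_one K_carrier)
    have "C = K" if C: "C \<in> carrier (G Mod K)" "?\<psi> C x = x" for C
    proof -
      obtain g where g: "g \<in> carrier G" "C = K #> g" using C(1) unfolding carrier by blast
      then have "g \<in> K" using C(2) coset[OF g(1) x] act_fixed_iff[OF g(1) x] by simp
      then show ?thesis using g subgroup_K by (simp add: coset_join2)
    qed
    moreover have "K \<in> carrier (G Mod K)" unfolding carrier using K_one by blast
    moreover have "?\<psi> K x = x" using coset[of \<one> x] x by (simp flip: K_one)
    ultimately show ?thesis by (auto simp: stabilizer_def one_FactGroup)
  qed
  ultimately show ?thesis using ne by (simp add: principal_homogeneous_space_def)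
qed

text \<open>Commutativity makes \<phi> g map orbits of H to orbits of H. An element g preserves the
  orbit of x if and only if \<phi> g x = \<phi> h x for some h in H, that is, if g lies in K
  h.\<close>

lemma transitive_orbits:
  assumes H: "subgroup H G"
  shows "transitive_with_stabilizer G (orbits (G\<lparr>carrier := H\<rparr>) X \<phi>) (\<lambda>g. image (\<phi> g)) (K <#> H)"
proof -
  interpret H: subgroup H G by (rule H)
  let ?O = "\<lambda>x. (\<lambda>h. \<phi> h x) ` H"
  have orbits: "orbits (G\<lparr>carrier := H\<rparr>) X \<phi> = ?O ` X"
    by (auto simp: orbits_def orbit_def)
  have img: "\<phi> g ` ?O x = ?O (\<phi> g x)" if "g \<in> carrier G" "x \<in> X" for g x
  proof -
    have "\<phi> g (\<phi> h x) = \<phi> h (\<phi> g x)" if "h \<in> H" for h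
      using that \<open>g \<in> carrier G\<close> \<open>x \<in> X\<close> by (simp add: m_comm flip: act_mult)
    then show ?thesis by (auto simp: image_image)
  qed
  have self: "x \<in> ?O x" if "x \<in> X" for x
    using that by (intro image_eqI[of _ _ \<one>]) simp_all
  have eq_iff: "?O x = ?O y \<longleftrightarrow> (\<exists>h\<in>H. x = \<phi> h y)" if xy: "x \<in> X" "y \<in> X" for x y
  proof
    assume "?O x = ?O y"
    then show "\<exists>h\<in>H. x = \<phi> h y" using self[OF xy(1)] by auto
  next
    assume "\<exists>h\<in>H. x = \<phi> h y"
    then obtain h where h: "h \<in> H" "x = \<phi> h y" by blast
    have "?O x \<subseteq> ?O y"
    proof
      fix z assume "z \<in> ?O x"
      then obtain k where "k \<in> H" "z = \<phi> k x" by blast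
      then show "z \<in> ?O y" using h xy by (intro image_eqI[of _ _ "k \<otimes> h"]) (simp_all add: act_mult)
    qed
    moreover have "?O y \<subseteq> ?O x"
    proof
      fix z assume "z \<in> ?O y"
      then obtain k where k: "k \<in> H" "z = \<phi> k y" by blast
      have "y = \<phi> (inv h) x" using h xy by (simp add: act_inv)
      then show "z \<in> ?O x" using h k xy by (intro image_eqI[of _ _ "k \<otimes> inv h"]) (simp_all add: act_mult)
    qed
    ultimately show "?O x = ?O y" by blast
  qed
  show ?thesis
    unfolding transitive_with_stabilizer_def orbits
  proof (intro conjI ballI)
    show "?O ` X \<noteq> {}" using ne by blast
    show "K <#> H \<subseteq> carrier G" by (auto simp: set_mult_def)
    show "\<phi> g ` A \<in> ?O ` X" if "g \<in> carrier G" "A \<in> ?O ` X" for g A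
      using that img by auto
    show "\<phi> \<one> ` A = A" if "A \<in> ?O ` X" for A
      using that img[OF one_closed] by auto
    show "\<phi> (g \<otimes> h) ` A = \<phi> g ` \<phi> h ` A" if "g \<in> carrier G" "h \<in> carrier G" "A \<in> ?O ` X" for g h A
    proof -
      obtain x where x: "x \<in> X" "A = ?O x" using \<open>A \<in> ?O ` X\<close> by blast
      have "\<phi> (g \<otimes> h) ` A = ?O (\<phi> g (\<phi> h x))"
        using that(1,2) x(1) unfolding x(2) by (simp only: img m_closed act_mult)
      also have "\<dots> = \<phi> g ` \<phi> h ` A"
        using that(1,2) x(1) unfolding x(2) by (simp only: img act_closed)
      finally show ?thesis .
    qed
    show "\<exists>g\<in>carrier G. \<phi> g ` A = B" if "A \<in> ?O ` X" "B \<in> ?O ` X" for A B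
    proof -
      obtain x y where xy: "x \<in> X" "A = ?O x" "y \<in> X" "B = ?O y"
        using \<open>A \<in> ?O ` X\<close> \<open>B \<in> ?O ` X\<close> by blast
      obtain g where "g \<in> carrier G" "\<phi> g x = y" using act_transitive xy by blast
      then show ?thesis using xy img by (intro bexI[of _ g]) simp_all
    qed
    show "\<phi> g ` A = A \<longleftrightarrow> g \<in> K <#> H" if g: "g \<in> carrier G" and A: "A \<in> ?O ` X" for g A
    proof -
      obtain x where x: "x \<in> X" "A = ?O x" using A by blast
      have "\<phi> g ` A = A \<longleftrightarrow> (\<exists>h\<in>H. \<phi> g x = \<phi> h x)"
        unfolding x(2) img[OF g x(1)] using g x(1) by (subst eq_iff) simp_all
      also have "\<dots> \<longleftrightarrow> (\<exists>h\<in>H. inv h \<otimes> g \<in> K)"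
        using g x(1) by (intro bex_cong refl act_eq_iff) simp_all
      also have "\<dots> \<longleftrightarrow> g \<in> K <#> H"
      proof
        assume "\<exists>h\<in>H. inv h \<otimes> g \<in> K"
        then obtain h where h: "h \<in> H" "inv h \<otimes> g \<in> K" by blast
        then have "g = (inv h \<otimes> g) \<otimes> h" using g by (simp add: m_ac m_assoc[symmetric] l_inv)
        then show "g \<in> K <#> H" using h by (auto simp: set_mult_def)
      next
        assume "g \<in> K <#> H"
        then obtain k h where kh: "k \<in> K" "h \<in> H" "g = k \<otimes> h" by (auto simp: set_mult_def)
        then have "inv h \<otimes> g = k" by (simp add: m_comm[of k h] m_assoc[symmetric])
        then show "\<exists>h\<in>H. inv h \<otimes> g \<in> K" using kh(1,2) by (intro bexI[of _ h]) simp_all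
      qed
      finally show ?thesis .
    qed
  qed
qed

end

text \<open>Both sets become G/K after a choice of base points: \<phi> g x0 is sent to \<psi> g y0,
  which is well defined and injective because the stabilizers agree. The bijection depends on the
  base points.\<close>

lemma equivariant_iso_of_stabilizer:
  assumes X: "transitive_set G X \<phi> K" and Y: "transitive_set G Y \<psi> K"
  shows "equivariant_iso G X \<phi> Y \<psi>"
proof -
  interpret X: transitive_set G X \<phi> K by (rule X)
  interpret Y: transitive_set G Y \<psi> K by (rule Y)
  obtain x0 y0 where x0: "x0 \<in> X" and y0: "y0 \<in> Y" using X.ne Y.ne by blast
  have "\<forall>x\<in>X. \<exists>g. g \<in> carrier G \<and> \<phi> g x0 = x" using X.act_transitive[OF x0] by blast
  from bchoice[OF this] obtain k where k: "\<And>x. x \<in> X \<Longrightarrow> k x \<in> carrier G \<and> \<phi> (k x) x0 = x" by blast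
  define f where "f x = \<psi> (k x) y0" for x
  have f: "f (\<phi> g x0) = \<psi> g y0" if g: "g \<in> carrier G" for g
  proof -
    have "k (\<phi> g x0) \<in> carrier G \<and> \<phi> (k (\<phi> g x0)) x0 = \<phi> g x0" using k g x0 by simp
    then show ?thesis
      using g x0 y0 X.act_eq_iff[of "k (\<phi> g x0)" g x0] Y.act_eq_iff[of "k (\<phi> g x0)" g y0]
      by (simp add: f_def)
  qed
  have f_eq: "f x = f x' \<longleftrightarrow> x = x'" if "x \<in> X" "x' \<in> X" for x x'
  proof -
    have "f x = f x' \<longleftrightarrow> \<phi> (k x) x0 = \<phi> (k x') x0"
      using k[OF that(1)] k[OF that(2)] x0 y0 X.act_eq_iff[of "k x" "k x'" x0] Y.act_eq_iff[of "k x" "k x'" y0]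
      by (simp add: f_def)
    then show ?thesis using k that by simp
  qed
  have "bij_betw f X Y"
    unfolding bij_betw_def
  proof
    show "inj_on f X" using f_eq by (simp add: inj_on_def)
    show "f ` X = Y"
    proof (intro equalityI subsetI)
      fix y assume "y \<in> Y"
      then obtain g where "g \<in> carrier G" "\<psi> g y0 = y" using Y.act_transitive[OF y0] by blast
      then show "y \<in> f ` X" using f x0 by (intro image_eqI[of _ _ "\<phi> g x0"]) simp_all
    qed (use k y0 in \<open>auto simp: f_def\<close>)
  qed
  moreover have "f (\<phi> g x) = \<psi> g (f x)" if g: "g \<in> carrier G" and x: "x \<in> X" for g x
  proof -
    have "\<phi> g x = \<phi> (g \<otimes>\<^bsub>G\<^esub> k x) x0" using g k[OF x] x0 by (simp add: X.act_mult)
    then show ?thesis using g k[OF x] y0 f[of "g \<otimes>\<^bsub>G\<^esub> k x"] by (simp add: Y.act_mult f_def)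
  qed
  ultimately show ?thesis by (auto simp: equivariant_iso_def)
qed

section \<open>The three sets of the theorem\<close>

text \<open>Up to values outside the carriers, Z is a torsor under the cocycles of M by N, and c
  forms classes in it. \<open>ExtMod\<close> and the fibre over \<eta>ML arise from the same Z and
  differ only in c and the resulting stabilizer.\<close>

lemma transitive_set_of_cochains:
  fixes c :: "('d \<Rightarrow> 'm \<Rightarrow> 'm \<Rightarrow> 'n) \<Rightarrow> 'x" and M :: "('d, 'm) module" and N :: "('d, 'n) module"
  assumes M: "left_module D M" and N: "left_module D N"
    and X: "X = c ` Z" and ne: "Z \<noteq> {}" and K: "K \<subseteq> carrier (Ext1 D M N)"
    and Z_closed: "\<And>\<eta> d a a'. \<lbrakk>\<eta> \<in> Z; d \<in> carrier D; a \<in> carrier M; a' \<in> carrier M\<rbrakk> \<Longrightarrow> \<eta> d a a' \<in> carrier N"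
    and Z_add: "\<And>\<eta> \<sigma>. \<lbrakk>\<eta> \<in> Z; cocycle D M N \<sigma>\<rbrakk> \<Longrightarrow> (\<lambda>d a a'. \<eta> d a a' \<oplus>\<^bsub>N\<^esub> \<sigma> d a a') \<in> Z"
    and Z_diff: "\<And>\<eta> \<eta>'. \<lbrakk>\<eta> \<in> Z; \<eta>' \<in> Z\<rbrakk> \<Longrightarrow> cocycle D M N (\<lambda>d a a'. \<ominus>\<^bsub>N\<^esub> \<eta> d a a' \<oplus>\<^bsub>N\<^esub> \<eta>' d a a')"
    and c_cong: "\<And>\<eta> \<eta>'. (\<And>d a a'. \<lbrakk>d \<in> carrier D; a \<in> carrier M; a' \<in> carrier M\<rbrakk> \<Longrightarrow> \<eta> d a a' = \<eta>' d a a') \<Longrightarrow>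
      c \<eta> = c \<eta>'"
    and act: "\<And>\<eta> \<sigma>. \<lbrakk>\<eta> \<in> Z; cocycle D M N \<sigma>\<rbrakk> \<Longrightarrow>
      \<phi> (cocycle_class D M N \<sigma>) (c \<eta>) = c (\<lambda>d a a'. \<eta> d a a' \<oplus>\<^bsub>N\<^esub> \<sigma> d a a')"
    and stab: "\<And>\<eta> \<sigma>. \<lbrakk>\<eta> \<in> Z; cocycle D M N \<sigma>\<rbrakk> \<Longrightarrow>
      c (\<lambda>d a a'. \<eta> d a a' \<oplus>\<^bsub>N\<^esub> \<sigma> d a a') = c \<eta> \<longleftrightarrow> cocycle_class D M N \<sigma> \<in> K"
  shows "transitive_set (Ext1 D M N) X \<phi> K"
proof -
  interpret N: lmod D N using N by (rule lmodI)
  let ?G = "Ext1 D M N"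
  have "transitive_with_stabilizer ?G X \<phi> K"
    unfolding transitive_with_stabilizer_def X
  proof (intro conjI ballI K)
    show "c ` Z \<noteq> {}" using ne by simp
    show "\<phi> g x \<in> c ` Z" if "g \<in> carrier ?G" "x \<in> c ` Z" for g x
      using that by (auto elim!: Ext1_E simp: act Z_add)
    show "\<phi> \<one>\<^bsub>?G\<^esub> x = x" if "x \<in> c ` Z" for x
      using that by (auto simp: one_Ext1_class[OF M N] act cocycle_zero[OF M N] Z_closed intro!: c_cong)
    show "\<phi> (g \<otimes>\<^bsub>?G\<^esub> h) x = \<phi> g (\<phi> h x)" if ghx: "g \<in> carrier ?G" "h \<in> carrier ?G" "x \<in> c ` Z" for g h x
    proof -
      obtain \<sigma> \<tau> \<eta> where \<sigma>: "cocycle D M N \<sigma>" "g = cocycle_class D M N \<sigma>"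
        and \<tau>: "cocycle D M N \<tau>" "h = cocycle_class D M N \<tau>" and \<eta>: "\<eta> \<in> Z" "x = c \<eta>"
        using ghx by (auto elim!: Ext1_E)
      have "\<phi> (g \<otimes>\<^bsub>?G\<^esub> h) x = c (\<lambda>d a a'. \<eta> d a a' \<oplus>\<^bsub>N\<^esub> (\<sigma> d a a' \<oplus>\<^bsub>N\<^esub> \<tau> d a a'))"
        using \<sigma> \<tau> \<eta> by (simp add: mult_Ext1_class act cocycle_add)
      also have "\<dots> = c (\<lambda>d a a'. (\<eta> d a a' \<oplus>\<^bsub>N\<^esub> \<tau> d a a') \<oplus>\<^bsub>N\<^esub> \<sigma> d a a')"
        using \<sigma> \<tau> \<eta> by (intro c_cong) (simp add: Z_closed cocycle_closed N.M.a_ac)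
      also have "\<dots> = \<phi> g (\<phi> h x)" using \<sigma> \<tau> \<eta> by (simp add: act Z_add)
      finally show ?thesis .
    qed
    show "\<exists>g\<in>carrier ?G. \<phi> g x = y" if "x \<in> c ` Z" "y \<in> c ` Z" for x y
    proof -
      obtain \<eta> \<eta>' where \<eta>: "\<eta> \<in> Z" "x = c \<eta>" "\<eta>' \<in> Z" "y = c \<eta>'"
        using \<open>x \<in> c ` Z\<close> \<open>y \<in> c ` Z\<close> by blast
      let ?\<sigma> = "\<lambda>d a a'. \<ominus>\<^bsub>N\<^esub> \<eta> d a a' \<oplus>\<^bsub>N\<^esub> \<eta>' d a a'"
      have "cocycle D M N ?\<sigma>" using \<eta> by (intro Z_diff)
      moreover from this have "\<phi> (cocycle_class D M N ?\<sigma>) x = y"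
        using \<eta> by (simp add: act) (rule c_cong, simp add: Z_closed N.M.r_neg2)
      ultimately show ?thesis by (intro bexI[of _ "cocycle_class D M N ?\<sigma>"]) simp_all
    qed
    show "\<phi> g x = x \<longleftrightarrow> g \<in> K" if "g \<in> carrier ?G" "x \<in> c ` Z" for g x
      using that by (auto elim!: Ext1_E simp: act stab)
  qed
  then show ?thesis
    using comm_group_Ext1[OF M N] by (intro transitive_set.intro transitive_set_axioms.intro)
qed

section \<open>Stabilizers as cohomology relations\<close>

lemma Hom_ext_iff:
  assumes M: "left_module D M" and \<gamma>: "cocycle D L N \<gamma>" and \<sigma>: "cocycle D M N \<sigma>"
  shows "cocycle_class D M N \<sigma> \<in> Hom_ext D M L N (cocycle_class D L N \<gamma>) \<longleftrightarrow>
    (\<exists>\<phi>\<in>mod_hom D M L. cohomologous D M N (\<lambda>d a a'. \<gamma> d (\<phi> a) (\<phi> a')) \<sigma>)"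
proof -
  have "ext_pullback D M N \<phi> (cocycle_class D L N \<gamma>) = cocycle_class D M N \<sigma> \<longleftrightarrow>
      cohomologous D M N (\<lambda>d a a'. \<gamma> d (\<phi> a) (\<phi> a')) \<sigma>" if "\<phi> \<in> mod_hom D M L" for \<phi>
    using that M \<gamma> \<sigma> by (simp add: ext_pullback_class cocycle_class_eq_iff cocycle_pullback)
  then show ?thesis by (auto simp: Hom_ext_def eq_commute[of "cocycle_class D M N \<sigma>"])
qed

lemma ext_Hom_iff:
  assumes N: "left_module D N" and \<beta>: "cocycle D M L \<beta>" and \<sigma>: "cocycle D M N \<sigma>"
  shows "cocycle_class D M N \<sigma> \<in> ext_Hom D M L N (cocycle_class D M L \<beta>) \<longleftrightarrow>
    (\<exists>\<psi>\<in>mod_hom D L N. cohomologous D M N (\<lambda>d a a'. \<psi> (\<beta> d a a')) \<sigma>)"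
proof -
  have "ext_pushout D M L N \<psi> (cocycle_class D M L \<beta>) = cocycle_class D M N \<sigma> \<longleftrightarrow>
      cohomologous D M N (\<lambda>d a a'. \<psi> (\<beta> d a a')) \<sigma>" if "\<psi> \<in> mod_hom D L N" for \<psi>
    using that N \<beta> \<sigma> by (simp add: ext_pushout_class cocycle_class_eq_iff cocycle_pushout)
  then show ?thesis by (auto simp: ext_Hom_def eq_commute[of "cocycle_class D M N \<sigma>"])
qed

lemma Hom_ext_subset:
  assumes "left_module D M" "cocycle D L N \<gamma>"
  shows "Hom_ext D M L N (cocycle_class D L N \<gamma>) \<subseteq> carrier (Ext1 D M N)"
  using assms by (auto simp: Hom_ext_def ext_pullback_class cocycle_pullback)

lemma ext_Hom_subset:
  assumes "left_module D N" "cocycle D M L \<beta>"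
  shows "ext_Hom D M L N (cocycle_class D M L \<beta>) \<subseteq> carrier (Ext1 D M N)"
  using assms by (auto simp: ext_Hom_def ext_pushout_class cocycle_pushout)

text \<open>The sum of the two Yoneda products has the cocycle \<gamma>(\<phi>, \<phi>) +
  \<psi>(\<beta>), so a single coboundary relates it to \<sigma>; this matches the form in
  \<open>ext2_cocycle_change\<close>.\<close>

lemma Hom_ext_mult_ext_Hom_iff:
  assumes M: "left_module D M" and N: "left_module D N"
    and \<beta>: "cocycle D M L \<beta>" and \<gamma>: "cocycle D L N \<gamma>" and \<sigma>: "cocycle D M N \<sigma>"
  shows "cocycle_class D M N \<sigma> \<in> Hom_ext D M L N (cocycle_class D L N \<gamma>) <#>\<^bsub>Ext1 D M N\<^esub>
      ext_Hom D M L N (cocycle_class D M L \<beta>) \<longleftrightarrow>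
    (\<exists>\<phi>\<in>mod_hom D M L. \<exists>\<psi>\<in>mod_hom D L N.
      cohomologous D M N (\<lambda>d a a'. \<gamma> d (\<phi> a) (\<phi> a') \<oplus>\<^bsub>N\<^esub> \<psi> (\<beta> d a a')) \<sigma>)"
proof -
  have "ext_pullback D M N \<phi> (cocycle_class D L N \<gamma>) \<otimes>\<^bsub>Ext1 D M N\<^esub> ext_pushout D M L N \<psi> (cocycle_class D M L \<beta>) =
      cocycle_class D M N \<sigma> \<longleftrightarrow>
      cohomologous D M N (\<lambda>d a a'. \<gamma> d (\<phi> a) (\<phi> a') \<oplus>\<^bsub>N\<^esub> \<psi> (\<beta> d a a')) \<sigma>"
    if "\<phi> \<in> mod_hom D M L" "\<psi> \<in> mod_hom D L N" for \<phi> \<psi>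
    using that M N \<beta> \<gamma> \<sigma>
    by (simp add: ext_pullback_class ext_pushout_class cocycle_class_eq_iff mult_Ext1_class
        cocycle_pullback cocycle_pushout cocycle_add)
  moreover have "cocycle_class D M N \<sigma> \<in> Hom_ext D M L N (cocycle_class D L N \<gamma>) <#>\<^bsub>Ext1 D M N\<^esub>
      ext_Hom D M L N (cocycle_class D M L \<beta>) \<longleftrightarrow>
    (\<exists>\<phi>\<in>mod_hom D M L. \<exists>\<psi>\<in>mod_hom D L N. ext_pullback D M N \<phi> (cocycle_class D L N \<gamma>) \<otimes>\<^bsub>Ext1 D M N\<^esub>
      ext_pushout D M L N \<psi> (cocycle_class D M L \<beta>) = cocycle_class D M N \<sigma>)"
    unfolding set_mult_def Hom_ext_def ext_Hom_def by blast
  ultimately show ?thesis by simp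
qed

text \<open>
  The cocycles of all sequences \<open>M \<leftarrow> X \<leftarrow> G1\<close> whose pushout to \<open>L\<close> has the cocycle \<open>\<beta>\<close>, given by
  their components in \<open>N\<close>; these are at the same time the \<open>\<eta>\<close> for which \<open>(\<beta>, \<gamma>, \<eta>)\<close> belongs to a
  2-extension module.
\<close>

definition push_cochains ::
  "('d, 'z) ring_scheme \<Rightarrow> ('d, 'm) module \<Rightarrow> ('d, 'n) module \<Rightarrow> ('d, 'l, 'n, 'g) ses \<Rightarrow> ('l \<Rightarrow> 'g)
    \<Rightarrow> ('d \<Rightarrow> 'm \<Rightarrow> 'm \<Rightarrow> 'l) \<Rightarrow> ('d \<Rightarrow> 'm \<Rightarrow> 'm \<Rightarrow> 'n) set"
  where "push_cochains D M N S1 t \<beta> =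
    {\<eta>. cocycle D M (mid S1) (\<lambda>d a a'. t (\<beta> d a a') \<oplus>\<^bsub>mid S1\<^esub> inc S1 (\<eta> d a a')) \<and>
      (\<forall>d\<in>carrier D. \<forall>a\<in>carrier M. \<forall>a'\<in>carrier M. \<eta> d a a' \<in> carrier N)}"

lemma push_cochainsD:
  assumes "\<eta> \<in> push_cochains D M N S1 t \<beta>"
  shows "cocycle D M (mid S1) (\<lambda>d a a'. t (\<beta> d a a') \<oplus>\<^bsub>mid S1\<^esub> inc S1 (\<eta> d a a'))"
    and "\<lbrakk>d \<in> carrier D; a \<in> carrier M; a' \<in> carrier M\<rbrakk> \<Longrightarrow> \<eta> d a a' \<in> carrier N"
  using assms by (simp_all add: push_cochains_def)

lemma push_cochains_add:
  assumes S1: "short_exact D L N S1" and t: "ses_section D L N S1 t \<gamma>" and \<beta>: "cocycle D M L \<beta>"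
    and \<eta>: "\<eta> \<in> push_cochains D M N S1 t \<beta>" and \<sigma>: "cocycle D M N \<sigma>"
  shows push_cochains_add_cocycle: "(\<lambda>d a a'. \<eta> d a a' \<oplus>\<^bsub>N\<^esub> \<sigma> d a a') \<in> push_cochains D M N S1 t \<beta>"
    and fibre_push_act_class: "fibre_push_act D M N S1 (cocycle_class D M N \<sigma>)
        (cocycle_class D M (mid S1) (\<lambda>d a a'. t (\<beta> d a a') \<oplus>\<^bsub>mid S1\<^esub> inc S1 (\<eta> d a a'))) =
      cocycle_class D M (mid S1) (\<lambda>d a a'. t (\<beta> d a a') \<oplus>\<^bsub>mid S1\<^esub> inc S1 (\<eta> d a a' \<oplus>\<^bsub>N\<^esub> \<sigma> d a a'))"
proof -
  interpret S1: exact_seq D L N S1 by unfold_locales (rule S1)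
  note [simp] = ses_sectionD[OF t] cocycle_closed[OF \<beta>] cocycle_closed[OF \<sigma>] push_cochainsD[OF \<eta>]
  let ?h = "\<lambda>\<eta> d a a'. t (\<beta> d a a') \<oplus>\<^bsub>mid S1\<^esub> inc S1 (\<eta> d a a')"
  have i\<sigma>: "cocycle D M (mid S1) (\<lambda>d a a'. inc S1 (\<sigma> d a a'))"
    using \<sigma> S1.G.left_module_axioms S1.inc_hom by (rule cocycle_pushout)
  have eq: "inc S1 (\<sigma> d a a') \<oplus>\<^bsub>mid S1\<^esub> ?h \<eta> d a a' = ?h (\<lambda>d a a'. \<eta> d a a' \<oplus>\<^bsub>N\<^esub> \<sigma> d a a') d a a'"
    if "d \<in> carrier D" "a \<in> carrier M" "a' \<in> carrier M" for d a a'
    using that by (simp add: S1.G.M.a_ac)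
  have c: "cocycle D M (mid S1) (\<lambda>d a a'. inc S1 (\<sigma> d a a') \<oplus>\<^bsub>mid S1\<^esub> ?h \<eta> d a a')"
    using i\<sigma> push_cochainsD(1)[OF \<eta>] by (rule cocycle_add)
  have "cocycle D M (mid S1) (?h (\<lambda>d a a'. \<eta> d a a' \<oplus>\<^bsub>N\<^esub> \<sigma> d a a'))"
    using c by (subst (asm) cocycle_cong[OF eq])
  then show "(\<lambda>d a a'. \<eta> d a a' \<oplus>\<^bsub>N\<^esub> \<sigma> d a a') \<in> push_cochains D M N S1 t \<beta>"
    by (simp add: push_cochains_def del: S1.inc_add)
  have "fibre_push_act D M N S1 (cocycle_class D M N \<sigma>) (cocycle_class D M (mid S1) (?h \<eta>)) =
      cocycle_class D M (mid S1) (\<lambda>d a a'. inc S1 (\<sigma> d a a') \<oplus>\<^bsub>mid S1\<^esub> ?h \<eta> d a a')"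
    using \<sigma> i\<sigma> S1.G.left_module_axioms S1.inc_hom
    by (simp add: fibre_push_act_def ext_pushout_class mult_Ext1_class)
  also have "\<dots> = cocycle_class D M (mid S1) (?h (\<lambda>d a a'. \<eta> d a a' \<oplus>\<^bsub>N\<^esub> \<sigma> d a a'))"
    by (rule cocycle_class_cong[OF eq])
  finally show "fibre_push_act D M N S1 (cocycle_class D M N \<sigma>) (cocycle_class D M (mid S1) (?h \<eta>)) = \<dots>" .
qed

text \<open>In the difference of the two cocycles with values in mid S1 the terms t(\<beta>) cancel,
  so it has values in N; \<open>cocycle_of_inc_cocycle\<close> then realises it by an extension of M
  by N.\<close>

lemma push_cochains_diff:
  fixes M :: "('d, 'm) module" and S1 :: "('d, 'l, 'n, 'g) ses"
  assumes S1: "short_exact D L N S1" and t: "ses_section D L N S1 t \<gamma>" and \<beta>: "cocycle D M L \<beta>"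
    and \<eta>: "\<eta> \<in> push_cochains D M N S1 t \<beta>" and \<eta>': "\<eta>' \<in> push_cochains D M N S1 t \<beta>"
  shows "cocycle D M N (\<lambda>d a a'. \<ominus>\<^bsub>N\<^esub> \<eta> d a a' \<oplus>\<^bsub>N\<^esub> \<eta>' d a a')" (is "cocycle D M N ?\<sigma>")
proof -
  interpret S1: exact_seq D L N S1 by unfold_locales (rule S1)
  note [simp] = ses_sectionD[OF t] cocycle_closed[OF \<beta>] push_cochainsD(2)[OF \<eta>] push_cochainsD(2)[OF \<eta>']
  let ?h = "\<lambda>\<eta> d a a'. t (\<beta> d a a') \<oplus>\<^bsub>mid S1\<^esub> inc S1 (\<eta> d a a')"
  have "cocycle D M (mid S1) (\<lambda>d a a'. \<ominus>\<^bsub>mid S1\<^esub> ?h \<eta> d a a' \<oplus>\<^bsub>mid S1\<^esub> ?h \<eta>' d a a')"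
    using cocycle_minus[OF push_cochainsD(1)[OF \<eta>] S1.G.left_module_axioms] push_cochainsD(1)[OF \<eta>']
    by (rule cocycle_add)
  moreover have "\<ominus>\<^bsub>mid S1\<^esub> ?h \<eta> d a a' \<oplus>\<^bsub>mid S1\<^esub> ?h \<eta>' d a a' = inc S1 (?\<sigma> d a a')"
    if *: "d \<in> carrier D" "a \<in> carrier M" "a' \<in> carrier M" for d a a'
  proof -
    have "?h \<eta> d a a' \<oplus>\<^bsub>mid S1\<^esub> inc S1 (?\<sigma> d a a') = t (\<beta> d a a') \<oplus>\<^bsub>mid S1\<^esub> inc S1 (\<eta> d a a' \<oplus>\<^bsub>N\<^esub> ?\<sigma> d a a')"
      using * by (simp add: S1.G.M.a_assoc)
    also have "\<dots> = ?h \<eta>' d a a'" using * by (simp add: S1.B.M.r_neg2 del: S1.inc_add)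
    finally have "?h \<eta>' d a a' = ?h \<eta> d a a' \<oplus>\<^bsub>mid S1\<^esub> inc S1 (?\<sigma> d a a')" by simp
    then show ?thesis using * by (simp add: S1.G.M.r_neg1 del: S1.inc_add)
  qed
  ultimately have "cocycle D M (mid S1) (\<lambda>d a a'. inc S1 (?\<sigma> d a a'))"
    by (subst (asm) cocycle_cong) simp_all
  then obtain T :: "('d, 'm, 'g, 'm \<times> 'g) ses" where "has_cocycle D M (mid S1) T (\<lambda>d a a'. inc S1 (?\<sigma> d a a'))"
    by (rule cocycleE)
  then show ?thesis by (rule cocycle_of_inc_cocycle[OF S1]) simp
qed

text \<open>\<open>has_cocycle_push_adjust\<close> brings every element of the fibre to the form
  t(\<beta>) + \<eta>, so the fibre is the image of \<open>push_cochains\<close>. The stabilizer is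
  computed by \<open>push_cohomologous_iff\<close>.\<close>

lemma transitive_set_fibre_push:
  fixes M :: "('d, 'm) module" and S1 :: "('d, 'l, 'n, 'g) ses"
  assumes S1: "short_exact D L N S1" and t: "ses_section D L N S1 t \<gamma>" and M: "left_module D M"
    and \<beta>: "cocycle D M L \<beta>" and ne: "push_cochains D M N S1 t \<beta> \<noteq> {}"
  shows "transitive_set (Ext1 D M N) (fibre_push D M L S1 (cocycle_class D M L \<beta>)) (fibre_push_act D M N S1)
    (Hom_ext D M L N (cocycle_class D L N \<gamma>))"
proof -
  interpret S1: exact_seq D L N S1 by unfold_locales (rule S1)
  note [simp] = ses_sectionD[OF t] cocycle_closed[OF \<beta>]
  have \<gamma>: "cocycle D L N \<gamma>" using has_cocycleI[OF S1 t] by (rule cocycleI)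
  let ?h = "\<lambda>\<eta> d a a'. t (\<beta> d a a') \<oplus>\<^bsub>mid S1\<^esub> inc S1 (\<eta> d a a')"
  let ?Z = "push_cochains D M N S1 t \<beta>"
  let ?c = "\<lambda>\<eta>. cocycle_class D M (mid S1) (?h \<eta>)"
  show ?thesis
  proof (rule transitive_set_of_cochains[where c = ?c and Z = ?Z])
    show "fibre_push D M L S1 (cocycle_class D M L \<beta>) = ?c ` ?Z"
    proof (intro equalityI subsetI)
      fix x assume "x \<in> fibre_push D M L S1 (cocycle_class D M L \<beta>)"
      then have x: "x \<in> carrier (Ext1 D M (mid S1))"
        "ext_pushout D M (mid S1) L (prj S1) x = cocycle_class D M L \<beta>"
        by (simp_all add: fibre_push_def)
      obtain h where h: "cocycle D M (mid S1) h" "x = cocycle_class D M (mid S1) h" using x(1) by (rule Ext1_E)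
      note prj = S1.A.left_module_axioms S1.prj_hom
      have "cohomologous D M L (\<lambda>d a a'. prj S1 (h d a a')) \<beta>"
        using x(2) h ext_pushout_class[OF h(1) prj] cocycle_class_eq_iff[OF cocycle_pushout[OF h(1) prj] \<beta>] by simp
      moreover obtain T :: "('d, 'm, 'g, 'm \<times> 'g) ses" where T: "has_cocycle D M (mid S1) T h"
        using h(1) by (rule cocycleE)
      ultimately obtain \<eta> where \<eta>: "has_cocycle D M (mid S1) T (?h \<eta>)"
        "\<forall>d\<in>carrier D. \<forall>a\<in>carrier M. \<forall>a'\<in>carrier M. \<eta> d a a' \<in> carrier N"
        by (elim has_cocycle_push_adjust[OF S1 t T]) simp_all
      then have "x = ?c \<eta>" using ext_class_eq[OF T] ext_class_eq[OF \<eta>(1)] h(2) by simp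
      moreover have "\<eta> \<in> ?Z" using \<eta>(2) cocycleI[OF \<eta>(1)] by (simp add: push_cochains_def)
      ultimately show "x \<in> ?c ` ?Z" by blast
    next
      fix x assume "x \<in> ?c ` ?Z"
      then obtain \<eta> where \<eta>: "\<eta> \<in> ?Z" "x = ?c \<eta>" by blast
      note [simp] = push_cochainsD[OF \<eta>(1)]
      have "ext_pushout D M (mid S1) L (prj S1) x = cocycle_class D M L (\<lambda>d a a'. prj S1 (?h \<eta> d a a'))"
        using \<eta> by (simp add: ext_pushout_class S1.A.left_module_axioms S1.prj_hom del: S1.prj_add)
      also have "\<dots> = cocycle_class D M L \<beta>"
        by (intro cocycle_class_cong) simp
      finally show "x \<in> fibre_push D M L S1 (cocycle_class D M L \<beta>)"
        using \<eta> by (simp add: fibre_push_def)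
    qed
    show "?Z \<noteq> {}" by (rule ne)
    show "Hom_ext D M L N (cocycle_class D L N \<gamma>) \<subseteq> carrier (Ext1 D M N)"
      using M \<gamma> by (rule Hom_ext_subset)
    show "\<eta> d a a' \<in> carrier N" if "\<eta> \<in> ?Z" "d \<in> carrier D" "a \<in> carrier M" "a' \<in> carrier M" for \<eta> d a a'
      using that by (rule push_cochainsD(2))
    show "?c \<eta> = ?c \<eta>'" if "\<And>d a a'. \<lbrakk>d \<in> carrier D; a \<in> carrier M; a' \<in> carrier M\<rbrakk> \<Longrightarrow> \<eta> d a a' = \<eta>' d a a'" for \<eta> \<eta>'
      using that by (intro cocycle_class_cong) simp
    show "?c (\<lambda>d a a'. \<eta> d a a' \<oplus>\<^bsub>N\<^esub> \<sigma> d a a') = ?c \<eta> \<longleftrightarrow>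
        cocycle_class D M N \<sigma> \<in> Hom_ext D M L N (cocycle_class D L N \<gamma>)"
      if \<eta>: "\<eta> \<in> ?Z" and \<sigma>: "cocycle D M N \<sigma>" for \<eta> \<sigma>
    proof -
      note [simp] = push_cochainsD[OF \<eta>] cocycle_closed[OF \<sigma>] cocycle_closed[OF \<gamma>]
      have "?c (\<lambda>d a a'. \<eta> d a a' \<oplus>\<^bsub>N\<^esub> \<sigma> d a a') = ?c \<eta> \<longleftrightarrow>
          cohomologous D M (mid S1) (?h \<eta>) (?h (\<lambda>d a a'. \<eta> d a a' \<oplus>\<^bsub>N\<^esub> \<sigma> d a a'))"
        using push_cochainsD(1)[OF push_cochains_add_cocycle[OF S1 t \<beta> \<eta> \<sigma>]] push_cochainsD(1)[OF \<eta>]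
          cocycle_class_eq_iff[of D M "mid S1" "?h \<eta>" "?h (\<lambda>d a a'. \<eta> d a a' \<oplus>\<^bsub>N\<^esub> \<sigma> d a a')"]
        by (simp add: eq_commute[of "?c (\<lambda>d a a'. \<eta> d a a' \<oplus>\<^bsub>N\<^esub> \<sigma> d a a')"])
      also have "\<dots> \<longleftrightarrow> (\<exists>\<phi>\<in>mod_hom D M L. cohomologous D M N
          (\<lambda>d a a'. \<eta> d a a' \<oplus>\<^bsub>N\<^esub> \<gamma> d (\<phi> a) (\<phi> a')) (\<lambda>d a a'. \<eta> d a a' \<oplus>\<^bsub>N\<^esub> \<sigma> d a a'))"
        by (intro push_cohomologous_iff[OF S1 t M]) simp_all
      also have "\<dots> \<longleftrightarrow> (\<exists>\<phi>\<in>mod_hom D M L. cohomologous D M N (\<lambda>d a a'. \<gamma> d (\<phi> a) (\<phi> a')) \<sigma>)"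
        by (intro bex_cong[OF refl] cohomologous_add_iff M S1.B.left_module_axioms) (simp_all add: mod_hom_closed)
      finally show ?thesis by (simp add: Hom_ext_iff[OF M \<gamma> \<sigma>])
    qed
  qed (rule M S1.B.left_module_axioms push_cochains_add[OF S1 t \<beta>] push_cochains_diff[OF S1 t \<beta>]; assumption)+
qed

text \<open>The cochains are those of the fibre, but the classes may be coarser: besides the section
  over M, the section of E1 over L may change, which adds \<open>ext_Hom\<close> to the stabilizer
  through \<open>ext2_cocycle_change\<close>.\<close>

lemma transitive_set_ExtMod:
  fixes M :: "('d, 'm) module" and S1 :: "('d, 'l, 'n, 'g) ses"
  assumes S1: "short_exact D L N S1" and t: "ses_section D L N S1 t \<gamma>" and M: "left_module D M"
    and PM: "presents D M PM" and PL: "presents D L PL" and PN: "presents D N PN"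
    and \<beta>: "cocycle D M L \<beta>" and ne: "push_cochains D M N S1 t \<beta> \<noteq> {}"
  shows "transitive_set (Ext1 D M N) (ExtMod D M L N (cocycle_class D M L \<beta>) (cocycle_class D L N \<gamma>))
    (ExtMod_act D M L N PM PL PN)
    (Hom_ext D M L N (cocycle_class D L N \<gamma>) <#>\<^bsub>Ext1 D M N\<^esub> ext_Hom D M L N (cocycle_class D M L \<beta>))"
    (is "transitive_set _ _ _ ?K")
proof -
  interpret S1: exact_seq D L N S1 by unfold_locales (rule S1)
  have \<gamma>: "cocycle D L N \<gamma>" using has_cocycleI[OF S1 t] by (rule cocycleI)
  note N = S1.B.left_module_axioms
  interpret Ext: comm_group "Ext1 D M N" using M N by (rule comm_group_Ext1)
  let ?c = "ext2_cocycle_class D M L N \<beta> \<gamma>"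
  let ?Z = "push_cochains D M N S1 t \<beta>"
  have Z: "?c \<eta> \<noteq> {} \<longleftrightarrow> \<eta> \<in> ?Z" for \<eta>
    using ex_ext2_iff_cocycle[OF S1 t, of M \<beta> \<eta>] cocycle_closed[OF \<beta>]
    by (simp add: ext2_cocycle_class_def push_cochains_def)
  show ?thesis
  proof (rule transitive_set_of_cochains[where c = ?c and Z = ?Z])
    show "ExtMod D M L N (cocycle_class D M L \<beta>) (cocycle_class D L N \<gamma>) = ?c ` ?Z"
      unfolding ExtMod_eq[OF \<beta> \<gamma>] Z by simp
    show "?K \<subseteq> carrier (Ext1 D M N)"
      using Hom_ext_subset[OF M \<gamma>] ext_Hom_subset[OF N \<beta>] by (rule Ext.set_mult_closed)
    show "\<eta> d a a' \<in> carrier N" if "\<eta> \<in> ?Z" "d \<in> carrier D" "a \<in> carrier M" "a' \<in> carrier M" for \<eta> d a a'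
      using that by (rule push_cochainsD(2))
    show "?c \<eta> = ?c \<eta>'" if "\<And>d a a'. \<lbrakk>d \<in> carrier D; a \<in> carrier M; a' \<in> carrier M\<rbrakk> \<Longrightarrow> \<eta> d a a' = \<eta>' d a a'" for \<eta> \<eta>'
      unfolding ext2_cocycle_class_def using that by (intro Collect_cong ext2_cocycle_cong)
    show "ExtMod_act D M L N PM PL PN (cocycle_class D M N \<sigma>) (?c \<eta>) = ?c (\<lambda>d a a'. \<eta> d a a' \<oplus>\<^bsub>N\<^esub> \<sigma> d a a')"
      if "\<eta> \<in> ?Z" "cocycle D M N \<sigma>" for \<eta> \<sigma>
      using that push_cochains_add_cocycle[OF S1 t \<beta> that]
      by (intro ExtMod_act_class[OF PM PL PN]) (simp_all only: Z)
    show "?c (\<lambda>d a a'. \<eta> d a a' \<oplus>\<^bsub>N\<^esub> \<sigma> d a a') = ?c \<eta> \<longleftrightarrow> cocycle_class D M N \<sigma> \<in> ?K"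
      if \<eta>: "\<eta> \<in> ?Z" and \<sigma>: "cocycle D M N \<sigma>" for \<eta> \<sigma>
    proof -
      let ?\<eta>\<sigma> = "\<lambda>d a a'. \<eta> d a a' \<oplus>\<^bsub>N\<^esub> \<sigma> d a a'"
      note [simp] = push_cochainsD(2)[OF \<eta>] cocycle_closed[OF \<sigma>] cocycle_closed[OF \<beta>] cocycle_closed[OF \<gamma>]
      obtain E where E: "ext2_cocycle D M L N E \<beta> \<gamma> \<eta>" and E_c: "E \<in> ?c \<eta>"
        using \<eta> unfolding Z[symmetric] by (auto simp: ext2_cocycle_class_def)
      have "?c ?\<eta>\<sigma> = ?c \<eta> \<longleftrightarrow> ext2_cocycle D M L N E \<beta> \<gamma> ?\<eta>\<sigma>"
      proof
        assume E': "ext2_cocycle D M L N E \<beta> \<gamma> ?\<eta>\<sigma>"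
        have "ext2_cocycle D M L N F \<beta> \<gamma> ?\<eta>\<sigma> \<longleftrightarrow> ext2_cocycle D M L N F \<beta> \<gamma> \<eta>"
          for F :: "('d, 'm, 'l, 'n, 'm \<times> 'l \<times> 'n) ext2"
        proof (cases "two_extension D M L N F")
          case True
          then show ?thesis
            using ext2_equiv_iff_cocycle[OF E True] ext2_equiv_iff_cocycle[OF E' True] by blast
        next
          case False
          then show ?thesis by (simp add: ext2_cocycle_def)
        qed
        then show "?c ?\<eta>\<sigma> = ?c \<eta>" by (simp only: ext2_cocycle_class_def)
      qed (use E_c in \<open>auto simp: ext2_cocycle_class_def\<close>)
      also have "\<dots> \<longleftrightarrow> (\<exists>\<phi>\<in>mod_hom D M L. \<exists>\<psi>\<in>mod_hom D L N. cohomologous D M N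
          (\<lambda>d a a'. \<eta> d a a' \<oplus>\<^bsub>N\<^esub> (\<gamma> d (\<phi> a) (\<phi> a') \<oplus>\<^bsub>N\<^esub> \<psi> (\<beta> d a a'))) ?\<eta>\<sigma>)"
        using E by (rule ext2_cocycle_change) simp
      also have "\<dots> \<longleftrightarrow> (\<exists>\<phi>\<in>mod_hom D M L. \<exists>\<psi>\<in>mod_hom D L N. cohomologous D M N
          (\<lambda>d a a'. \<gamma> d (\<phi> a) (\<phi> a') \<oplus>\<^bsub>N\<^esub> \<psi> (\<beta> d a a')) \<sigma>)"
        by (intro bex_cong[OF refl] cohomologous_add_iff M N) (simp_all add: mod_hom_closed)
      finally show ?thesis by (simp add: Hom_ext_mult_ext_Hom_iff[OF M N \<beta> \<gamma> \<sigma>])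
    qed
  qed (rule M N ne push_cochains_add_cocycle[OF S1 t \<beta>] push_cochains_diff[OF S1 t \<beta>]; assumption)+
qed

section \<open>The fibre over the class in Ext1(L, N)\<close>

text \<open>The pullback of \<sigma> along the zero map L -> M splits, but its cocycle \<sigma>(d,
  0, 0) need not vanish. It is the coboundary of the constant n with s(0) = inc n.\<close>

lemma cocycle_at_zero:
  fixes M :: "('d, 'm) module" and N :: "('d, 'n) module"
  assumes M: "left_module D M" and L: "left_module D L" and \<sigma>: "cocycle D M N \<sigma>"
  shows "cohomologous D L N (\<lambda>_ _ _. \<zero>\<^bsub>N\<^esub>) (\<lambda>d _ _. \<sigma> d \<zero>\<^bsub>M\<^esub> \<zero>\<^bsub>M\<^esub>)"
proof -
  from \<sigma> obtain S :: "('d, 'm, 'n, 'm \<times> 'n) ses" where S: "has_cocycle D M N S \<sigma>" by (rule cocycleE)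
  interpret S: exact_seq D M N S by unfold_locales (use S in \<open>rule has_cocycle_exact\<close>)
  obtain s where s: "ses_section D M N S s \<sigma>" using S by (auto simp: has_cocycle_def)
  obtain n where n: "n \<in> carrier N" "s \<zero>\<^bsub>M\<^esub> = inc S n"
    by (rule S.kernelE[of "s \<zero>\<^bsub>M\<^esub>"]) (simp_all add: ses_sectionD[OF s])
  show ?thesis
  proof (rule cohomologousI[where x = "\<lambda>_. n"])
    fix d l l' assume "d \<in> carrier D" "l \<in> carrier L" "l' \<in> carrier L"
    then have "inc S (n \<oplus>\<^bsub>N\<^esub> \<sigma> d \<zero>\<^bsub>M\<^esub> \<zero>\<^bsub>M\<^esub>) = inc S (axpy N d n n)"
      using ses_section_cocycle[OF s, of d "\<zero>\<^bsub>M\<^esub>" "\<zero>\<^bsub>M\<^esub>"] n by simp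
    then show "\<sigma> d \<zero>\<^bsub>M\<^esub> \<zero>\<^bsub>M\<^esub> \<oplus>\<^bsub>N\<^esub> n = \<zero>\<^bsub>N\<^esub> \<oplus>\<^bsub>N\<^esub> axpy N d n n"
      using \<open>d \<in> carrier D\<close> n cocycle_closed[OF \<sigma>, of d "\<zero>\<^bsub>M\<^esub>" "\<zero>\<^bsub>M\<^esub>"]
      by (subst (asm) S.inc_eq_iff) (simp_all add: S.B.M.a_comm)
  qed (rule n)
qed

text \<open>Cocycles on mid S0 are not functions on M, so \<open>transitive_set_of_cochains\<close>
  does not fit and the laws are verified on h directly. Transitivity is
  \<open>pull_trivial_imp_pullback\<close> for a difference, and the stabilizer comes from
  \<open>pull_trivial_iff\<close>.\<close>

lemma transitive_set_fibre_pull: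
  fixes S0 :: "('d, 'm, 'l, 'g) ses" and N :: "('d, 'n) module"
  assumes S0: "short_exact D M L S0" and s: "ses_section D M L S0 s \<beta>" and N: "left_module D N"
    and \<gamma>: "cocycle D L N \<gamma>"
    and h0: "cocycle D (mid S0) N h0" "cohomologous D L N (\<lambda>d l l'. h0 d (inc S0 l) (inc S0 l')) \<gamma>"
  shows "transitive_set (Ext1 D M N) (fibre_pull D L N S0 (cocycle_class D L N \<gamma>)) (fibre_pull_act D N S0)
    (ext_Hom D M L N (cocycle_class D M L \<beta>))"
proof -
  interpret S0: exact_seq D M L S0 by unfold_locales (rule S0)
  interpret N: lmod D N using N by (rule lmodI)
  note mods = S0.A.left_module_axioms S0.B.left_module_axioms S0.G.left_module_axioms N
  have \<beta>: "cocycle D M L \<beta>" using has_cocycleI[OF S0 s] by (rule cocycleI)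
  let ?i = "inc S0" and ?p = "prj S0" and ?G = "Ext1 D M N"
  let ?X = "fibre_pull D L N S0 (cocycle_class D L N \<gamma>)" and ?act = "fibre_pull_act D N S0"
  let ?cls = "cocycle_class D (mid S0) N"
  have p\<sigma>: "cocycle D (mid S0) N (\<lambda>d g g'. \<sigma> d (?p g) (?p g'))" if "cocycle D M N \<sigma>" for \<sigma>
    using that mods(3) S0.prj_hom by (rule cocycle_pullback)
  have ih: "cocycle D L N (\<lambda>d l l'. h d (?i l) (?i l'))" if "cocycle D (mid S0) N h" for h
    using that mods(2) S0.inc_hom by (rule cocycle_pullback)
  have act: "?act (cocycle_class D M N \<sigma>) (?cls h) = ?cls (\<lambda>d g g'. h d g g' \<oplus>\<^bsub>N\<^esub> \<sigma> d (?p g) (?p g'))"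
    if \<sigma>: "cocycle D M N \<sigma>" and h: "cocycle D (mid S0) N h" for \<sigma> h
  proof -
    have "?act (cocycle_class D M N \<sigma>) (?cls h) = ?cls (\<lambda>d g g'. \<sigma> d (?p g) (?p g') \<oplus>\<^bsub>N\<^esub> h d g g')"
      using \<sigma> h p\<sigma>[OF \<sigma>] by (simp add: fibre_pull_act_def ext_pullback_class mods S0.prj_hom mult_Ext1_class)
    also have "\<dots> = ?cls (\<lambda>d g g'. h d g g' \<oplus>\<^bsub>N\<^esub> \<sigma> d (?p g) (?p g'))"
      by (rule cocycle_class_cong) (simp add: cocycle_closed[OF \<sigma>] cocycle_closed[OF h] N.M.a_comm)
    finally show ?thesis .
  qed
  have add: "cocycle D (mid S0) N (\<lambda>d g g'. h d g g' \<oplus>\<^bsub>N\<^esub> \<sigma> d (?p g) (?p g'))"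
    if "cocycle D M N \<sigma>" "cocycle D (mid S0) N h" for \<sigma> h
    using that(2) p\<sigma>[OF that(1)] by (rule cocycle_add)
  have X_iff: "?cls h \<in> ?X \<longleftrightarrow>
      cocycle_class D L N (\<lambda>d l l'. h d (?i l) (?i l')) = cocycle_class D L N \<gamma>"
    if "cocycle D (mid S0) N h" for h
    using that by (simp add: fibre_pull_def ext_pullback_class mods S0.inc_hom)
  have X_E: "\<exists>h. cocycle D (mid S0) N h \<and> x = ?cls h" if "x \<in> ?X" for x
    using that by (auto simp: fibre_pull_def elim: Ext1_E)
  have add_X: "?cls (\<lambda>d g g'. h d g g' \<oplus>\<^bsub>N\<^esub> \<sigma> d (?p g) (?p g')) \<in> ?X"
    if \<sigma>: "cocycle D M N \<sigma>" and h: "cocycle D (mid S0) N h" and hX: "?cls h \<in> ?X" for \<sigma> h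
  proof -
    \<comment> \<open>Restricted to L, the added term is \<sigma>(d, 0, 0), a coboundary by
      \<open>cocycle_at_zero\<close>, so the sum stays in the fibre.\<close>
    let ?hi = "\<lambda>d l l'. h d (?i l) (?i l')" and ?\<sigma>0 = "\<lambda>d _ _. \<sigma> d \<zero>\<^bsub>M\<^esub> \<zero>\<^bsub>M\<^esub>"
    have "cohomologous D L N (\<lambda>d l l'. ?hi d l l' \<oplus>\<^bsub>N\<^esub> \<zero>\<^bsub>N\<^esub>) (\<lambda>d l l'. ?hi d l l' \<oplus>\<^bsub>N\<^esub> ?\<sigma>0 d l l')"
      using cocycle_at_zero[OF mods(1,2) \<sigma>] mods
      by (subst cohomologous_add_iff) (simp_all add: cocycle_closed[OF h] cocycle_closed[OF \<sigma>])
    then have coh: "cohomologous D L N ?hi (\<lambda>d l l'. ?hi d l l' \<oplus>\<^bsub>N\<^esub> \<sigma> d (?p (?i l)) (?p (?i l')))"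
      by (subst (asm) cohomologous_cong) (simp_all add: cocycle_closed[OF h])
    have "cocycle_class D L N ?hi = cocycle_class D L N (\<lambda>d l l'. ?hi d l l' \<oplus>\<^bsub>N\<^esub> \<sigma> d (?p (?i l)) (?p (?i l')))"
      using coh by (subst cocycle_class_eq_iff) (use ih[OF h] ih[OF add[OF \<sigma> h]] in simp_all)
    then show ?thesis using hX unfolding X_iff[OF h] X_iff[OF add[OF \<sigma> h]] by simp
  qed
  have "transitive_with_stabilizer ?G ?X ?act (ext_Hom D M L N (cocycle_class D M L \<beta>))"
    unfolding transitive_with_stabilizer_def
  proof (intro conjI ballI)
    have "?cls h0 \<in> ?X"
      unfolding X_iff[OF h0(1)] using h0(2) cocycle_class_eq_iff[OF ih[OF h0(1)] \<gamma>] by simp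
    then show "?X \<noteq> {}" by blast
    show "ext_Hom D M L N (cocycle_class D M L \<beta>) \<subseteq> carrier ?G" using N \<beta> by (rule ext_Hom_subset)
    show "?act g x \<in> ?X" if gx: "g \<in> carrier ?G" "x \<in> ?X" for g x
    proof -
      obtain \<sigma> h where "cocycle D M N \<sigma>" "g = cocycle_class D M N \<sigma>" "cocycle D (mid S0) N h" "x = ?cls h"
        using X_E[OF gx(2)] gx(1) by (metis Ext1_E)
      then show ?thesis using gx(2) by (simp add: act add_X)
    qed
    show "?act \<one>\<^bsub>?G\<^esub> x = x" if x: "x \<in> ?X" for x
    proof -
      obtain h where "cocycle D (mid S0) N h" "x = ?cls h" using X_E[OF x] by blast
      then show ?thesis
        by (simp add: one_Ext1_class mods act cocycle_zero) (rule cocycle_class_cong, simp add: cocycle_closed)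
    qed
    show "?act (g \<otimes>\<^bsub>?G\<^esub> g') x = ?act g (?act g' x)"
      if ggx: "g \<in> carrier ?G" "g' \<in> carrier ?G" "x \<in> ?X" for g g' x
    proof -
      obtain h where h: "cocycle D (mid S0) N h" "x = ?cls h" using X_E[OF ggx(3)] by blast
      obtain \<sigma> where \<sigma>: "cocycle D M N \<sigma>" "g = cocycle_class D M N \<sigma>" using ggx(1) by (rule Ext1_E)
      obtain \<tau> where \<tau>: "cocycle D M N \<tau>" "g' = cocycle_class D M N \<tau>" using ggx(2) by (rule Ext1_E)
      show ?thesis
        using h \<sigma> \<tau> by (simp add: mult_Ext1_class act cocycle_add add)
          (rule cocycle_class_cong, simp add: cocycle_closed N.M.a_ac)
    qed
    show "\<exists>g\<in>carrier ?G. ?act g x = y" if xy: "x \<in> ?X" "y \<in> ?X" for x y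
    proof -
      obtain h where h: "cocycle D (mid S0) N h" "x = ?cls h" using X_E[OF xy(1)] by blast
      obtain k where k: "cocycle D (mid S0) N k" "y = ?cls k" using X_E[OF xy(2)] by blast
      note [simp] = cocycle_closed[OF h(1)] cocycle_closed[OF k(1)]
      \<comment> \<open>As both points lie in the fibre, the difference k - h restricts to a
        coboundary on L, hence it comes from M.\<close>
      let ?u = "\<lambda>d g g'. \<ominus>\<^bsub>N\<^esub> h d g g' \<oplus>\<^bsub>N\<^esub> k d g g'"
      have u: "cocycle D (mid S0) N ?u" using cocycle_minus[OF h(1) N] k(1) by (rule cocycle_add)
      have "cohomologous D L N (\<lambda>d l l'. h d (?i l) (?i l')) (\<lambda>d l l'. k d (?i l) (?i l'))"
        using xy h k X_iff cocycle_class_eq_iff[OF ih[OF h(1)] ih[OF k(1)]] by simp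
      then have "cohomologous D L N (\<lambda>d l l'. \<ominus>\<^bsub>N\<^esub> h d (?i l) (?i l') \<oplus>\<^bsub>N\<^esub> h d (?i l) (?i l'))
          (\<lambda>d l l'. ?u d (?i l) (?i l'))"
        using mods by (subst cohomologous_add_iff) simp_all
      then have u0: "cohomologous D L N (\<lambda>_ _ _. \<zero>\<^bsub>N\<^esub>) (\<lambda>d l l'. ?u d (?i l) (?i l'))"
        by (subst (asm) cohomologous_cong) (simp_all add: N.M.l_neg)
      from u obtain T :: "('d, 'g, 'n, 'g \<times> 'n) ses" where T: "has_cocycle D (mid S0) N T ?u" by (rule cocycleE)
      obtain \<sigma> where \<sigma>: "cocycle D M N \<sigma>" and "cohomologous D (mid S0) N (\<lambda>d g g'. \<sigma> d (?p g) (?p g')) ?u"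
        using S0 T u0 by (rule pull_trivial_imp_pullback)
      then have "cohomologous D (mid S0) N (\<lambda>d g g'. h d g g' \<oplus>\<^bsub>N\<^esub> \<sigma> d (?p g) (?p g'))
          (\<lambda>d g g'. h d g g' \<oplus>\<^bsub>N\<^esub> ?u d g g')"
        using mods by (subst cohomologous_add_iff) (simp_all add: cocycle_closed[OF \<sigma>])
      then have "cohomologous D (mid S0) N (\<lambda>d g g'. h d g g' \<oplus>\<^bsub>N\<^esub> \<sigma> d (?p g) (?p g')) k"
        by (subst (asm) cohomologous_cong) (simp_all add: N.M.r_neg2)
      then have "?act (cocycle_class D M N \<sigma>) x = y"
        using h k \<sigma> by (simp add: act cocycle_class_eq_iff add)
      then show ?thesis using \<sigma> by (intro bexI[of _ "cocycle_class D M N \<sigma>"]) simp_all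
    qed
    show "?act g x = x \<longleftrightarrow> g \<in> ext_Hom D M L N (cocycle_class D M L \<beta>)"
      if gx: "g \<in> carrier ?G" "x \<in> ?X" for g x
    proof -
      obtain h where h: "cocycle D (mid S0) N h" "x = ?cls h" using X_E[OF gx(2)] by blast
      obtain \<sigma> where \<sigma>: "cocycle D M N \<sigma>" "g = cocycle_class D M N \<sigma>" using gx(1) by (rule Ext1_E)
      note [simp] = cocycle_closed[OF h(1)] cocycle_closed[OF \<sigma>(1)]
      have "?act g x = x \<longleftrightarrow> cohomologous D (mid S0) N h (\<lambda>d g g'. h d g g' \<oplus>\<^bsub>N\<^esub> \<sigma> d (?p g) (?p g'))"
        using h \<sigma> cocycle_class_eq_iff[OF h(1) add[OF \<sigma>(1) h(1)]] by (auto simp: act)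
      also have "\<dots> \<longleftrightarrow> cohomologous D (mid S0) N (\<lambda>d g g'. h d g g' \<oplus>\<^bsub>N\<^esub> \<zero>\<^bsub>N\<^esub>)
          (\<lambda>d g g'. h d g g' \<oplus>\<^bsub>N\<^esub> \<sigma> d (?p g) (?p g'))"
        by (intro cohomologous_cong) simp_all
      also have "\<dots> \<longleftrightarrow> cohomologous D (mid S0) N (\<lambda>_ _ _. \<zero>\<^bsub>N\<^esub>) (\<lambda>d g g'. \<sigma> d (?p g) (?p g'))"
        using mods by (intro cohomologous_add_iff) simp_all
      also have "\<dots> \<longleftrightarrow> (\<exists>\<psi>\<in>mod_hom D L N. cohomologous D M N (\<lambda>d a a'. \<psi> (\<beta> d a a')) \<sigma>)"
        using S0 s N by (rule pull_trivial_iff) simp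
      finally show ?thesis using \<sigma> by (simp add: ext_Hom_iff[OF N \<beta> \<sigma>(1)])
    qed
  qed
  then show ?thesis
    using comm_group_Ext1[OF mods(1) N] by (intro transitive_set.intro transitive_set_axioms.intro)
qed

text \<open>
  \<open>E\<close> is also an extension of \<open>E/E2\<close>, which is isomorphic to \<open>mid S0\<close>, by \<open>N\<close>; \<open>h\<close> is a cocycle of it.
\<close>

lemma ext2_pull_cocycle:
  assumes S0: "short_exact D M L S0" and s: "ses_section D M L S0 s \<beta>"
    and E: "ext2_cocycle D M L N E \<beta> \<gamma> \<eta>"
  shows "\<exists>h. cocycle D (mid S0) N h \<and> cohomologous D L N (\<lambda>d l l'. h d (inc S0 l) (inc S0 l')) \<gamma>"
proof -
  from E obtain t where "two_ext D M L N E" and t: "ses_section D L N (lower_ses E) t \<gamma>"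
    and \<kappa>: "has_cocycle D M (mid (lower_ses E)) (filtration_ses E)
        (\<lambda>d a a'. t (\<beta> d a a') \<oplus>\<^bsub>mid (lower_ses E)\<^esub> inc (lower_ses E) (\<eta> d a a'))"
    and \<beta> [rule_format, simp]: "\<forall>d\<in>carrier D. \<forall>a\<in>carrier M. \<forall>a'\<in>carrier M. \<beta> d a a' \<in> carrier L"
    and \<eta> [rule_format, simp]: "\<forall>d\<in>carrier D. \<forall>a\<in>carrier M. \<forall>a'\<in>carrier M. \<eta> d a a' \<in> carrier N"
    by (rule ext2_cocycleE)
  interpret E: two_ext D M L N E by fact
  interpret S0: exact_seq D M L S0 by unfold_locales (rule S0)
  note [simp] = ses_sectionD[OF t] ses_section_cocycle[OF t]
  let ?K = "mid (lower_ses E)" and ?i = "inc (lower_ses E)"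
  obtain sE where sE: "ses_section D M ?K (filtration_ses E) sE (\<lambda>d a a'. t (\<beta> d a a') \<oplus>\<^bsub>?K\<^esub> ?i (\<eta> d a a'))"
    using \<kappa> by (auto simp: has_cocycle_def)
  \<comment> \<open>The map of E onto mid S0 with kernel N. It exists because the projection of E1
    to L sends the cocycle t(\<beta>) + \<eta> to \<beta>.\<close>
  obtain \<pi> where \<pi>: "\<pi> \<in> mod_hom D (mid (filtration_ses E)) (mid S0)"
    and \<pi>K: "\<And>k. k \<in> carrier ?K \<Longrightarrow> \<pi> (inc (filtration_ses E) k) = inc S0 (prj (lower_ses E) k)"
    and \<pi>M: "\<And>x. x \<in> carrier (mid (filtration_ses E)) \<Longrightarrow> prj S0 (\<pi> x) = prj (filtration_ses E) x"
    by (rule ses_map[OF E.short_exact_filtration S0 sE s mod_hom_id E.lower.prj_hom]) auto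
  have \<pi>': "\<pi> \<in> mod_hom D (E0 E) (mid S0)" using \<pi> by simp
  have K_E: "x \<in> carrier (E0 E)" if "x \<in> carrier ?K" for x
    using E.filt.inc_closed[OF that] by simp
  note \<pi>_simps [simp] = mod_hom_closed[OF \<pi>'] mod_hom_add[OF \<pi>'] \<pi>K[simplified] \<pi>M[simplified]
  let ?T = "\<lparr>mid = E0 E, inc = ?i, prj = \<pi>\<rparr>"
  have T: "short_exact D (mid S0) N ?T"
  proof (rule short_exactI)
    show "inc ?T \<in> mod_hom D N (mid ?T)"
      using mod_hom_compose[OF E.lower.inc_hom E.filt.inc_hom] by simp
    show "prj ?T \<in> mod_hom D (mid ?T) (mid S0)" using \<pi>' by simp
    show "b = b'" if "b \<in> carrier N" "b' \<in> carrier N" "inc ?T b = inc ?T b'" for b b'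
      using that by simp
    show "\<exists>x\<in>carrier (mid ?T). prj ?T x = g" if g: "g \<in> carrier (mid S0)" for g
    proof -
      let ?x = "sE (prj S0 g)"
      have x: "?x \<in> carrier (E0 E)" "prj (filtration_ses E) ?x = prj S0 g"
        using ses_sectionD[OF sE, of "prj S0 g"] g by simp_all
      then obtain l where l: "l \<in> carrier L" "g = \<pi> ?x \<oplus>\<^bsub>mid S0\<^esub> inc S0 l"
        using S0.diff_ex[of g "\<pi> ?x"] g by auto
      then show ?thesis using x K_E by (intro bexI[of _ "?x \<oplus>\<^bsub>E0 E\<^esub> t l"]) simp_all
    qed
    show "prj ?T (inc ?T b) = \<zero>\<^bsub>mid S0\<^esub>" if "b \<in> carrier N" for b
      using that by simp
    show "\<exists>b\<in>carrier N. x = inc ?T b" if x: "x \<in> carrier (mid ?T)" "prj ?T x = \<zero>\<^bsub>mid S0\<^esub>" for x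
    proof -
      have "prj (filtration_ses E) x = \<zero>\<^bsub>M\<^esub>" using x \<pi>M[of x] by (simp del: \<pi>_simps)
      then have xK: "x \<in> carrier ?K" using x(1) E.filt.kernelE[of x] by auto
      then have "inc S0 (prj (lower_ses E) x) = inc S0 \<zero>\<^bsub>L\<^esub>" using x(2) \<pi>K[of x] by simp
      then have "prj (lower_ses E) x = \<zero>\<^bsub>L\<^esub>" using xK by (subst (asm) S0.inc_eq_iff) simp_all
      then show ?thesis using xK by (auto elim: E.lower.kernelE)
    qed
  qed (simp_all add: S0.G.left_module_axioms E.modules E.E.left_module_axioms)
  interpret T: exact_seq D "mid S0" N ?T by unfold_locales (rule T)
  obtain h where h: "has_cocycle D (mid S0) N ?T h" using T.ex_cocycle by blast
  let ?P = "pullback_ses L (inc S0) ?T"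
  have P: "has_cocycle D L N ?P (\<lambda>d l l'. h d (inc S0 l) (inc S0 l'))"
    using h E.modules(2) S0.inc_hom by (rule has_cocycle_pullback)
  interpret P: exact_seq D L N ?P by unfold_locales (use P in \<open>rule has_cocycle_exact\<close>)
  \<comment> \<open>The pullback along \<open>inc S0\<close> is a copy of E1, so t gives it the
    cocycle \<gamma>. It also has the restriction of h, and the two are compared by
    uniqueness.\<close>
  have "ses_section D L N ?P (\<lambda>l. (l, t l)) \<gamma>"
  proof (rule ses_sectionI)
    fix d l l' assume *: "d \<in> carrier D" "l \<in> carrier L" "l' \<in> carrier L"
    have "axpy (E0 E) d (t l) (t l') = t (axpy L d l l') \<oplus>\<^bsub>E0 E\<^esub> ?i (\<gamma> d l l')"
      using ses_section_cocycle(2)[OF t *] by (simp only: lower_ses_mid)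
    then show "axpy (mid ?P) d (l, t l) (l', t l') =
        (axpy L d l l', t (axpy L d l l')) \<oplus>\<^bsub>mid ?P\<^esub> inc ?P (\<gamma> d l l')"
      using * by (simp add: pullback_ses_def del: ses_section_cocycle)
  qed (simp_all add: pullback_ses_def K_E)
  then have "has_cocycle D L N ?P \<gamma>" by (rule has_cocycleI[OF P.exact])
  with P have "cohomologous D L N (\<lambda>d l l'. h d (inc S0 l) (inc S0 l')) \<gamma>" by (rule P.cocycle_unique)
  with cocycleI[OF h] show ?thesis by blast
qed

text \<open>Passing to H2-orbits enlarges the stabilizer H1 of Y to H1 H2, and passing to H1-orbits
  that of Z to H2 H1; by commutativity both equal the stabilizer of X. That H1 and H2 are subgroups
  is read off from Y and Z.\<close>

lemma transitive_sets_isomorphic: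
  assumes X: "transitive_set G X \<phi> (H1 <#>\<^bsub>G\<^esub> H2)"
    and Y: "transitive_set G Y \<psi> H1" and Z: "transitive_set G Z \<chi> H2"
  shows "comm_group (G Mod (H1 <#>\<^bsub>G\<^esub> H2)) \<and>
    principal_homogeneous_space (G Mod (H1 <#>\<^bsub>G\<^esub> H2)) X (quotient_action \<phi> X) \<and>
    equivariant_iso G X \<phi> (orbits (G\<lparr>carrier := H2\<rparr>) Y \<psi>) (\<lambda>g. image (\<psi> g)) \<and>
    equivariant_iso G (orbits (G\<lparr>carrier := H2\<rparr>) Y \<psi>) (\<lambda>g. image (\<psi> g))
      (orbits (G\<lparr>carrier := H1\<rparr>) Z \<chi>) (\<lambda>g. image (\<chi> g))"
proof -
  interpret X: transitive_set G X \<phi> "H1 <#>\<^bsub>G\<^esub> H2" by (rule X)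
  interpret Y: transitive_set G Y \<psi> H1 by (rule Y)
  interpret Z: transitive_set G Z \<chi> H2 by (rule Z)
  note G = X.comm_group_axioms
  have Y_orbits: "transitive_set G (orbits (G\<lparr>carrier := H2\<rparr>) Y \<psi>) (\<lambda>g. image (\<psi> g)) (H1 <#>\<^bsub>G\<^esub> H2)"
    using Y.transitive_orbits[OF Z.subgroup_K] G
    by (intro transitive_set.intro transitive_set_axioms.intro)
  have "g \<otimes>\<^bsub>G\<^esub> h = h \<otimes>\<^bsub>G\<^esub> g" if "g \<in> H2" "h \<in> H1" for g h
    using that by (intro X.m_comm) simp_all
  then have "H2 <#>\<^bsub>G\<^esub> H1 = H1 <#>\<^bsub>G\<^esub> H2" by (force simp: set_mult_def)
  then have Z_orbits: "transitive_set G (orbits (G\<lparr>carrier := H1\<rparr>) Z \<chi>) (\<lambda>g. image (\<chi> g)) (H1 <#>\<^bsub>G\<^esub> H2)"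
    using Z.transitive_orbits[OF Y.subgroup_K] G
    by (intro transitive_set.intro transitive_set_axioms.intro) simp_all
  show ?thesis
    using X.abelian_FactGroup[OF X.subgroup_K] X.principal_homogeneous
      equivariant_iso_of_stabilizer[OF X Y_orbits] equivariant_iso_of_stabilizer[OF Y_orbits Z_orbits]
    by blast
qed

theorem mainTheorem2:
  fixes D :: "('d, 'z) ring_scheme"
    and M :: "('d, 'm) module" and L :: "('d, 'l) module" and N :: "('d, 'n) module"
    and PM :: "('d, 'm, 'xm, 'rm) presentation"
    and PL :: "('d, 'l, 'xl, 'rl) presentation"
    and PN :: "('d, 'n, 'xn, 'rn) presentation"
    and S0 :: "('d, 'm, 'l, 'g0) ses" and S1 :: "('d, 'l, 'n, 'g1) ses"
  assumes "ring D" "left_module D M" "left_module D L" "left_module D N"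
    and "presents D M PM" "presents D L PL" "presents D N PN"
    and "\<eta>ML \<in> carrier (Ext1 D M L)" "\<eta>LN \<in> carrier (Ext1 D L N)"
    and "short_exact D M L S0" "ext_class D M L S0 = \<eta>ML"
    and "short_exact D L N S1" "ext_class D L N S1 = \<eta>LN"
    and "ExtMod D M L N \<eta>ML \<eta>LN \<noteq> {}"
  shows "comm_group (Ext1_cocycles D M L N \<eta>ML \<eta>LN) \<and>
    principal_homogeneous_space (Ext1_cocycles D M L N \<eta>ML \<eta>LN) (ExtMod D M L N \<eta>ML \<eta>LN)
           (quotient_action (ExtMod_act D M L N PM PL PN) (ExtMod D M L N \<eta>ML \<eta>LN)) \<and>
    equivariant_iso (Ext1 D M N)
           (ExtMod D M L N \<eta>ML \<eta>LN)
           (ExtMod_act D M L N PM PL PN)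
           (orbits (Ext1 D M N\<lparr>carrier := ext_Hom D M L N \<eta>ML\<rparr>)
              (fibre_push D M L S1 \<eta>ML) (fibre_push_act D M N S1))
           (\<lambda>\<xi>. image (fibre_push_act D M N S1 \<xi>)) \<and>
    equivariant_iso (Ext1 D M N)
           (orbits (Ext1 D M N\<lparr>carrier := ext_Hom D M L N \<eta>ML\<rparr>)
              (fibre_push D M L S1 \<eta>ML) (fibre_push_act D M N S1))
           (\<lambda>\<xi>. image (fibre_push_act D M N S1 \<xi>))
           (orbits (Ext1 D M N\<lparr>carrier := Hom_ext D M L N \<eta>LN\<rparr>)
              (fibre_pull D L N S0 \<eta>LN) (fibre_pull_act D N S0))
           (\<lambda>\<xi>. image (fibre_pull_act D N S0 \<xi>))"
proof -
  note M = \<open>left_module D M\<close> and N = \<open>left_module D N\<close>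
    and S0 = \<open>short_exact D M L S0\<close> and S1 = \<open>short_exact D L N S1\<close>
  interpret S0: exact_seq D M L S0 by unfold_locales (rule S0)
  interpret S1: exact_seq D L N S1 by unfold_locales (rule S1)
  \<comment> \<open>\<beta> and \<gamma> are read off from the given sequences S0 and S1, so that
    the same cochains describe \<open>ExtMod\<close> and both fibres.\<close>
  obtain s \<beta> where s: "ses_section D M L S0 s \<beta>" using S0.ex_section by blast
  obtain t \<gamma> where t: "ses_section D L N S1 t \<gamma>" using S1.ex_section by blast
  have \<beta>: "cocycle D M L \<beta>" and eta_ML: "\<eta>ML = cocycle_class D M L \<beta>"
    using cocycleI[OF has_cocycleI[OF S0 s]] ext_class_eq[OF has_cocycleI[OF S0 s]]
      \<open>ext_class D M L S0 = \<eta>ML\<close> by simp_all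
  have \<gamma>: "cocycle D L N \<gamma>" and eta_LN: "\<eta>LN = cocycle_class D L N \<gamma>"
    using cocycleI[OF has_cocycleI[OF S1 t]] ext_class_eq[OF has_cocycleI[OF S1 t]]
      \<open>ext_class D L N S1 = \<eta>LN\<close> by simp_all
  \<comment> \<open>One 2-extension module shows that both fibres are nonempty: its \<eta> lies in
    \<open>push_cochains\<close>, and viewed as an extension of mid S0 by N it gives h.\<close>
  obtain \<eta> and E :: "('d, 'm, 'l, 'n, 'm \<times> 'l \<times> 'n) ext2" where E: "ext2_cocycle D M L N E \<beta> \<gamma> \<eta>"
    using \<open>ExtMod D M L N \<eta>ML \<eta>LN \<noteq> {}\<close> unfolding eta_ML eta_LN ExtMod_eq[OF \<beta> \<gamma>]
    by (auto simp: ext2_cocycle_class_def)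
  then have ne: "push_cochains D M N S1 t \<beta> \<noteq> {}"
    using ex_ext2_iff_cocycle[OF S1 t, of M \<beta> \<eta>] cocycle_closed[OF \<beta>]
    by (auto simp: push_cochains_def)
  obtain h where h: "cocycle D (mid S0) N h"
    "cohomologous D L N (\<lambda>d l l'. h d (inc S0 l) (inc S0 l')) \<gamma>"
    using ext2_pull_cocycle[OF S0 s E] by blast
  let ?G = "Ext1 D M N" and ?H1 = "Hom_ext D M L N \<eta>LN" and ?H2 = "ext_Hom D M L N \<eta>ML"
  have X: "transitive_set ?G (ExtMod D M L N \<eta>ML \<eta>LN) (ExtMod_act D M L N PM PL PN) (?H1 <#>\<^bsub>?G\<^esub> ?H2)"
    unfolding eta_ML eta_LN
    by (rule transitive_set_ExtMod[OF S1 t M \<open>presents D M PM\<close> \<open>presents D L PL\<close> \<open>presents D N PN\<close> \<beta> ne])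
  have push: "transitive_set ?G (fibre_push D M L S1 \<eta>ML) (fibre_push_act D M N S1) ?H1"
    unfolding eta_ML eta_LN by (rule transitive_set_fibre_push[OF S1 t M \<beta> ne])
  have pull: "transitive_set ?G (fibre_pull D L N S0 \<eta>LN) (fibre_pull_act D N S0) ?H2"
    unfolding eta_ML eta_LN by (rule transitive_set_fibre_pull[OF S0 s N \<gamma> h])
  show ?thesis
    unfolding Ext1_cocycles_def using transitive_sets_isomorphic[OF X push pull] by blast
qed

end
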